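(* Let $\mathcal G$ be a finite connected graph and let $n\ge1$ be an integer. Let $\mathcal G^{\amalg n}$ be the disjoint union of $n$ copies of $\mathcal G$. Then there is an isomorphism of Woronowicz algebras (that is, a $*$-isomorphism commuting with the coproducts) $$A_{aut}(\mathcal G^{\amalg n})\;\cong\;A_{aut}(\mathcal G)*_{\rm w}A_{aut}(X_n).$$
   Context: A finite graph $\mathcal G=(V,E)$ consists of a finite set $V$ of vertices (nonempty) and a set $E\subset V\times V$ of edges; $s,t:E\to V$ are the restrictions of the first and second projections. $\mathcal G$ is connected if for all $(i,j)\in V\times V$ there is a finite sequence of edges $\gamma_1,\dots,\gamma_r$ such that $i\in\{s(\gamma_1),t(\gamma_1)\}$, $j\in\{s(\gamma_r),t(\gamma_r)\}$ and, for $1\le k\le r-1$, $\{s(\gamma_k),t(\gamma_k)\}\cap\{s(\gamma_{k+1}),t(\gamma_{k+1})\}\neq\emptyset$. The disjoint union of $(V_1,E_1)$ and $(V_2,E_2)$ is $(V_1\amalg V_2,E_1\amalg E_2)$. For a finite graph $\mathcal G=(V,E)$, the quantum automorphism group $A_{aut}(\mathcal G)$ is the universal $C^*$-algebra with generators $(X_{ij})_{i,j\in V}$ and relations: (R1) $X_{ij}^*=X_{ij}$, $X_{ij}X_{ik}=\delta_{jk}X_{ij}$, $X_{ji}X_{ki}=\delta_{jk}X_{ji}$, $\sum_{l\in V}X_{il}=1=\sum_{l\in V}X_{li}$, for $i,j,k\in V$; (R2) $X_{s(\gamma)i}X_{t(\gamma)k}=X_{t(\gamma)k}X_{s(\gamma)i}=0$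 and $X_{is(\gamma)}X_{kt(\gamma)}=X_{kt(\gamma)}X_{is(\gamma)}=0$ for $\gamma\in E$, $(i,k)\in (V\times V)\setminus E$; (R3) $X_{s(\gamma)s(\gamma')}X_{t(\gamma)t(\gamma')}=X_{t(\gamma)t(\gamma')}X_{s(\gamma)s(\gamma')}$ for $\gamma,\gamma'\in E$; (R4) $\sum_{\gamma'\in E}X_{s(\gamma')s(\gamma)}X_{t(\gamma')t(\gamma)}=1=\sum_{\gamma'\in E}X_{s(\gamma)s(\gamma')}X_{t(\gamma)t(\gamma')}$ for $\gamma\in E$. It is a Woronowicz algebra (compact quantum group) with coproduct $\Delta(X_{ij})=\sum_{k\in V}X_{ik}\otimes X_{kj}$ ($\otimes$ is the minimal $C^*$-tensor product). $A_{aut}(X_n)$ is the universal $C^*$-algebra with generators $(x_{ij})_{1\le i,j\le n}$ and relations $x_{ij}^*=x_{ij}$, $x_{ij}x_{ik}=\delta_{jk}x_{ij}$, $x_{ji}x_{ki}=\delta_{jk}x_{ji}$, $\sum_{l}x_{il}=1=\sum_{l}x_{li}$. For a Woronowicz algebra $A$ with coproduct $\Delta_A$, let $A^{*n}$ be the $n$-fold free product (coproduct in unital $C^*$-algebras) of $A$, with canonical $*$-homomorphisms $\nu_i:A\to A^{*n}$, $1\le i\le n$. The free wreath product $A*_{\rm w}A_{aut}(X_n)$ is the quotient of the free product $C^*$-algebra $A^{*n}*A_{aut}(X_n)$ by the closed two-sided ideal generated by $\nu_k(a)x_{ki}-x_{ki}\nu_k(a)$, $1\le i,k\le n$, $a\in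 A$. It is a Woronowicz algebra with coproduct determined by $\Delta(x_{ij})=\sum_k x_{ik}\otimes x_{kj}$ and $\Delta(\nu_i(a))=\sum_{k=1}^n(\nu_i\otimes\nu_k)(\Delta_A(a))(x_{ik}\otimes1)$. *)

theory Defs
  imports
    Complex_Main
    "HOL-Library.FuncSet"
    "HOL-Library.Poly_Mapping"
    "HOL-Algebra.QuotRing"
    "HOL-Algebra.Module"
    "Graph_Theory.Pair_Digraph"
begin

section \<open>Graphs\<close>

text \<open>
  A finite graph is a \<open>pair_pre_digraph\<close> satisfying \<open>pair_fin_digraph\<close> with at least one vertex:
  the edges are pairs of vertices, loops are allowed, and source and target are
  \<^const>\<open>fst\<close> and \<^const>\<open>snd\<close>.
\<close>

definition finite_graph :: "'v pair_pre_digraph \<Rightarrow> bool" where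
  "finite_graph G \<longleftrightarrow> pair_fin_digraph G \<and> pverts G \<noteq> {}"

text \<open>
  Connectedness ignores the orientation of the edges.  The sequence of edges consists of at least
  one edge, also for \<open>i = j\<close>, so that the graph with one vertex and no edge is not connected.
\<close>

definition edge_connected :: "'v pair_pre_digraph \<Rightarrow> bool" where
  "edge_connected G \<longleftrightarrow>
     (\<forall>i\<in>pverts G. \<forall>j\<in>pverts G. \<exists>es. es \<noteq> [] \<and> set es \<subseteq> parcs G
        \<and> i \<in> {fst (hd es), snd (hd es)} \<and> j \<in> {fst (last es), snd (last es)}
        \<and> (\<forall>k. Suc k < length es \<longrightarrow>
              {fst (es ! k), snd (es ! k)} \<inter> {fst (es ! Suc k), snd (es ! Suc k)} \<noteq> {}))"

definition disjoint_copies :: "nat \<Rightarrow> 'v pair_pre_digraph \<Rightarrow> (nat \<times> 'v) pair_pre_digraph" where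
  "disjoint_copies n G =
     \<lparr> pverts = {1..n} \<times> pverts G,
       parcs = {((k, i), (k, j)) | k i j. k \<in> {1..n} \<and> (i, j) \<in> parcs G} \<rparr>"


section \<open>Star-algebras, C*-seminorms and Hausdorff completions\<close>

text \<open>
  A complex unital star-algebra is a ring record with a scalar multiplication by complex numbers
  and an involution; a unital C*-algebra moreover carries its norm.
\<close>

record 'a star_alg = "(complex, 'a) module" +
  invol :: "'a \<Rightarrow> 'a"

record 'a cstar_alg = "'a star_alg" +
  cnorm :: "'a \<Rightarrow> real"

definition star_hom ::
    "('a, 'x) star_alg_scheme \<Rightarrow> ('b, 'y) star_alg_scheme \<Rightarrow> ('a \<Rightarrow> 'b) \<Rightarrow> bool" where
  "star_hom A B h \<longleftrightarrow> h \<in> ring_hom A B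
     \<and> (\<forall>c. \<forall>x\<in>carrier A. h (c \<odot>\<^bsub>A\<^esub> x) = c \<odot>\<^bsub>B\<^esub> h x)
     \<and> (\<forall>x\<in>carrier A. h (invol A x) = invol B (h x))"

text \<open>
  \<^const>\<open>ring_hom\<close> includes preservation of the unit, so all homomorphisms are unital.
  The homomorphism determined by a property \<open>P\<close> (the values on generators, for instance)
  is made unique as a total function by requiring the value \<^const>\<open>undefined\<close> off the carrier.
\<close>

definition the_star_hom ::
    "('a, 'x) star_alg_scheme \<Rightarrow> ('b, 'y) star_alg_scheme \<Rightarrow> (('a \<Rightarrow> 'b) \<Rightarrow> bool) \<Rightarrow> 'a \<Rightarrow> 'b" where
  "the_star_hom A B P = (THE h. h \<in> extensional (carrier A) \<and> star_hom A B h \<and> P h)"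

definition cstar_seminorm :: "('a, 'x) star_alg_scheme \<Rightarrow> ('a \<Rightarrow> real) \<Rightarrow> bool" where
  "cstar_seminorm S p \<longleftrightarrow>
     (\<forall>x\<in>carrier S. 0 \<le> p x)
   \<and> (\<forall>x\<in>carrier S. \<forall>y\<in>carrier S. p (x \<oplus>\<^bsub>S\<^esub> y) \<le> p x + p y)
   \<and> (\<forall>c. \<forall>x\<in>carrier S. p (c \<odot>\<^bsub>S\<^esub> x) = cmod c * p x)
   \<and> (\<forall>x\<in>carrier S. \<forall>y\<in>carrier S. p (x \<otimes>\<^bsub>S\<^esub> y) \<le> p x * p y)
   \<and> (\<forall>x\<in>carrier S. p (invol S x \<otimes>\<^bsub>S\<^esub> x) = (p x)\<^sup>2)"

text \<open>
  The Hausdorff completion of a star-algebra \<open>S\<close> with respect to a seminorm \<open>p\<close>: Cauchy sequences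
  modulo sequences converging to zero.  It divides out the null space of \<open>p\<close> as well, and it is a
  C*-algebra whenever \<open>p\<close> is a C*-seminorm.
\<close>

definition cauchy_rel ::
    "('a, 'x) star_alg_scheme \<Rightarrow> ('a \<Rightarrow> real) \<Rightarrow> ((nat \<Rightarrow> 'a) \<times> (nat \<Rightarrow> 'a)) set" where
  "cauchy_rel S p =
     (let C = {s. range s \<subseteq> carrier S
                  \<and> (\<forall>\<epsilon>>0. \<exists>N. \<forall>k\<ge>N. \<forall>l\<ge>N. p (s k \<ominus>\<^bsub>S\<^esub> s l) < \<epsilon>)}
      in {(s, t). s \<in> C \<and> t \<in> C \<and> (\<lambda>k. p (s k \<ominus>\<^bsub>S\<^esub> t k)) \<longlonglongrightarrow> 0})"

definition completion ::
    "('a, 'x) star_alg_scheme \<Rightarrow> ('a \<Rightarrow> real) \<Rightarrow> (nat \<Rightarrow> 'a) set cstar_alg" where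
  "completion S p =
     (let cls = (\<lambda>s. cauchy_rel S p `` {s}) in
      \<lparr> carrier = Domain (cauchy_rel S p) // cauchy_rel S p,
        monoid.mult = (\<lambda>X Y. \<Union>s\<in>X. \<Union>t\<in>Y. cls (\<lambda>k. s k \<otimes>\<^bsub>S\<^esub> t k)),
        one = cls (\<lambda>k. \<one>\<^bsub>S\<^esub>),
        zero = cls (\<lambda>k. \<zero>\<^bsub>S\<^esub>),
        add = (\<lambda>X Y. \<Union>s\<in>X. \<Union>t\<in>Y. cls (\<lambda>k. s k \<oplus>\<^bsub>S\<^esub> t k)),
        smult = (\<lambda>c X. \<Union>s\<in>X. cls (\<lambda>k. c \<odot>\<^bsub>S\<^esub> s k)),
        invol = (\<lambda>X. \<Union>s\<in>X. cls (\<lambda>k. invol S (s k))),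
        cnorm = (\<lambda>X. THE r. \<forall>s\<in>X. (\<lambda>k. p (s k)) \<longlonglongrightarrow> r) \<rparr>)"

definition to_completion ::
    "('a, 'x) star_alg_scheme \<Rightarrow> ('a \<Rightarrow> real) \<Rightarrow> 'a \<Rightarrow> (nat \<Rightarrow> 'a) set" where
  "to_completion S p x = cauchy_rel S p `` {\<lambda>k. x}"

text \<open>
  The star-algebra \<open>\<complex>[M]\<close> of formal linear combinations of elements of a monoid \<open>M\<close>, with the
  convolution product and the conjugate-linear extension of an anti-multiplicative involution
  of \<open>M\<close>.
\<close>

definition monoid_star_alg ::
    "('m, 'x) monoid_scheme \<Rightarrow> ('m \<Rightarrow> 'm) \<Rightarrow> ('m \<Rightarrow>\<^sub>0 complex) star_alg" where
  "monoid_star_alg M \<tau> =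
     \<lparr> carrier = {x. Poly_Mapping.keys x \<subseteq> carrier M},
       monoid.mult = (\<lambda>x y. \<Sum>u\<in>Poly_Mapping.keys x. \<Sum>v\<in>Poly_Mapping.keys y.
                 Poly_Mapping.single (u \<otimes>\<^bsub>M\<^esub> v) (Poly_Mapping.lookup x u * Poly_Mapping.lookup y v)),
       one = Poly_Mapping.single \<one>\<^bsub>M\<^esub> 1,
       zero = 0,
       add = (+),
       smult = (\<lambda>c x. \<Sum>u\<in>Poly_Mapping.keys x. Poly_Mapping.single u (c * Poly_Mapping.lookup x u)),
       invol = (\<lambda>x. \<Sum>u\<in>Poly_Mapping.keys x.
                 Poly_Mapping.single (\<tau> u) (cnj (Poly_Mapping.lookup x u))) \<rparr>"


section \<open>Universal C*-algebras\<close>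

text \<open>
  Star-polynomials in the noncommuting generators \<open>Gs\<close> are combinations of words in the letters
  \<open>(g, False)\<close>, standing for \<open>g\<close>, and \<open>(g, True)\<close>, standing for its adjoint.
\<close>

type_synonym 'g star_poly = "('g \<times> bool) list \<Rightarrow>\<^sub>0 complex"

definition free_star_alg :: "'g set \<Rightarrow> 'g star_poly star_alg" where
  "free_star_alg Gs =
     monoid_star_alg \<lparr> carrier = lists (Gs \<times> UNIV), monoid.mult = (@), one = [] \<rparr>
       (\<lambda>w. rev (map (\<lambda>(g, b). (g, \<not> b)) w))"

definition gen :: "'g \<Rightarrow> 'g star_poly" where
  "gen g = Poly_Mapping.single [(g, False)] 1"

text \<open>
  A relation \<open>l = r\<close> is given as the pair \<open>(l, r)\<close>.  The universal C*-algebra is the completion of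
  the star-polynomials for the largest C*-seminorm for which the relations hold.  The supremum is
  finite when the relations bound the norms of all generators, as those used below do.
\<close>

definition univ_seminorm :: "'g set \<Rightarrow> ('g star_poly \<times> 'g star_poly) set \<Rightarrow> 'g star_poly \<Rightarrow> real" where
  "univ_seminorm Gs R x =
     Sup {p x | p. cstar_seminorm (free_star_alg Gs) p
                   \<and> (\<forall>(l, r)\<in>R. p (l \<ominus>\<^bsub>free_star_alg Gs\<^esub> r) = 0)}"

type_synonym 'g univ_elem = "(nat \<Rightarrow> 'g star_poly) set"

definition univ_cstar :: "'g set \<Rightarrow> ('g star_poly \<times> 'g star_poly) set \<Rightarrow> 'g univ_elem cstar_alg" where
  "univ_cstar Gs R = completion (free_star_alg Gs) (univ_seminorm Gs R)"

definition univ_gen :: "'g set \<Rightarrow> ('g star_poly \<times> 'g star_poly) set \<Rightarrow> 'g \<Rightarrow> 'g univ_elem" where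
  "univ_gen Gs R g = to_completion (free_star_alg Gs) (univ_seminorm Gs R) (gen g)"


section \<open>The minimal tensor product\<close>

text \<open>
  Elements of the algebraic tensor product are represented by formal combinations of pairs
  \<open>(a, b)\<close>, standing for elementary tensors.  The bilinearity relations need not be divided out
  beforehand: both sides have the same image under every functional below, hence are identified
  in the completion.
\<close>

definition formal_tensor ::
    "('a, 'x) cstar_alg_scheme \<Rightarrow> ('b, 'y) cstar_alg_scheme \<Rightarrow> ('a \<times> 'b \<Rightarrow>\<^sub>0 complex) star_alg" where
  "formal_tensor A B = monoid_star_alg (A \<times>\<times> B) (map_prod (invol A) (invol B))"

definition state :: "('a, 'x) cstar_alg_scheme \<Rightarrow> ('a \<Rightarrow> complex) \<Rightarrow> bool" where
  "state A \<phi> \<longleftrightarrow>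
     (\<forall>x\<in>carrier A. \<forall>y\<in>carrier A. \<phi> (x \<oplus>\<^bsub>A\<^esub> y) = \<phi> x + \<phi> y)
   \<and> (\<forall>c. \<forall>x\<in>carrier A. \<phi> (c \<odot>\<^bsub>A\<^esub> x) = c * \<phi> x)
   \<and> (\<forall>x\<in>carrier A. Im (\<phi> (invol A x \<otimes>\<^bsub>A\<^esub> x)) = 0 \<and> 0 \<le> Re (\<phi> (invol A x \<otimes>\<^bsub>A\<^esub> x)))
   \<and> \<phi> \<one>\<^bsub>A\<^esub> = 1"

definition tensor_functional ::
    "('a \<Rightarrow> complex) \<Rightarrow> ('b \<Rightarrow> complex) \<Rightarrow> ('a \<times> 'b \<Rightarrow>\<^sub>0 complex) \<Rightarrow> complex" where
  "tensor_functional \<phi> \<psi> x = (\<Sum>(a, b)\<in>Poly_Mapping.keys x. Poly_Mapping.lookup x (a, b) * (\<phi> a * \<psi> b))"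

text \<open>
  The minimal (spatial) norm is the operator norm in the tensor product of the universal
  representations of \<open>A\<close> and \<open>B\<close>, i.e. the supremum over all states \<open>\<phi>\<close> and \<open>\<psi>\<close> of the operator
  norm of \<open>x\<close> in the tensor product of the GNS representations of \<open>\<phi>\<close> and \<open>\<psi>\<close>.  The vectors of
  the latter coming from the algebraic tensor product are dense, and the inner product of (the
  vectors of) \<open>y\<close> and \<open>z\<close> is \<open>(\<phi> \<otimes> \<psi>)(z* y)\<close>.  The number \<open>0\<close> is inserted only for the sake of
  the zero algebra, which has no states.
\<close>

definition min_seminorm ::
    "('a, 'x) cstar_alg_scheme \<Rightarrow> ('b, 'y) cstar_alg_scheme \<Rightarrow> ('a \<times> 'b \<Rightarrow>\<^sub>0 complex) \<Rightarrow> real" where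
  "min_seminorm A B x =
     (let S = formal_tensor A B;
          sq = (\<lambda>\<phi> \<psi> z. Re (tensor_functional \<phi> \<psi> (invol S z \<otimes>\<^bsub>S\<^esub> z)))
      in Sup (insert 0 {sqrt (sq \<phi> \<psi> (x \<otimes>\<^bsub>S\<^esub> y)) | \<phi> \<psi> y.
            state A \<phi> \<and> state B \<psi> \<and> y \<in> carrier S \<and> sq \<phi> \<psi> y \<le> 1}))"

type_synonym ('a, 'b) tensor_elem = "(nat \<Rightarrow> ('a \<times> 'b \<Rightarrow>\<^sub>0 complex)) set"

definition min_tensor ::
    "('a, 'x) cstar_alg_scheme \<Rightarrow> ('b, 'y) cstar_alg_scheme \<Rightarrow> ('a, 'b) tensor_elem cstar_alg" where
  "min_tensor A B = completion (formal_tensor A B) (min_seminorm A B)"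

definition elem_tensor ::
    "('a, 'x) cstar_alg_scheme \<Rightarrow> ('b, 'y) cstar_alg_scheme \<Rightarrow> 'a \<Rightarrow> 'b \<Rightarrow> ('a, 'b) tensor_elem" where
  "elem_tensor A B a b =
     to_completion (formal_tensor A B) (min_seminorm A B) (Poly_Mapping.single (a, b) 1)"

definition tensor_map ::
    "('a, 'x) cstar_alg_scheme \<Rightarrow> ('b, 'y) cstar_alg_scheme \<Rightarrow>
     ('c, 'z) cstar_alg_scheme \<Rightarrow> ('d, 'w) cstar_alg_scheme \<Rightarrow>
     ('a \<Rightarrow> 'c) \<Rightarrow> ('b \<Rightarrow> 'd) \<Rightarrow> ('a, 'b) tensor_elem \<Rightarrow> ('c, 'd) tensor_elem" where
  "tensor_map A B C D f g =
     the_star_hom (min_tensor A B) (min_tensor C D)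
       (\<lambda>h. \<forall>a\<in>carrier A. \<forall>b\<in>carrier B. h (elem_tensor A B a b) = elem_tensor C D (f a) (g b))"


section \<open>Woronowicz algebras\<close>

record 'a woronowicz = "'a cstar_alg" +
  comult :: "'a \<Rightarrow> ('a, 'a) tensor_elem"

definition add_comult :: "'a cstar_alg \<Rightarrow> ('a \<Rightarrow> ('a, 'a) tensor_elem) \<Rightarrow> 'a woronowicz" where
  "add_comult A \<Delta> = cstar_alg.extend A (woronowicz.fields \<Delta>)"

definition woronowicz_iso :: "'a woronowicz \<Rightarrow> 'b woronowicz \<Rightarrow> ('a \<Rightarrow> 'b) \<Rightarrow> bool" where
  "woronowicz_iso A B \<Phi> \<longleftrightarrow>
     star_hom A B \<Phi> \<and> bij_betw \<Phi> (carrier A) (carrier B)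
   \<and> (\<forall>a\<in>carrier A. comult B (\<Phi> a) = tensor_map A A B B \<Phi> \<Phi> (comult A a))"


section \<open>Quantum automorphism groups of finite graphs\<close>

definition magic_relations :: "'v set \<Rightarrow> (('v \<times> 'v) star_poly \<times> ('v \<times> 'v) star_poly) set" where
  "magic_relations V =
     (let F = free_star_alg (V \<times> V); X = (\<lambda>i j. gen (i, j)) in
        {(invol F (X i j), X i j) | i j. i \<in> V \<and> j \<in> V}
      \<union> {(X i j \<otimes>\<^bsub>F\<^esub> X i k, if j = k then X i j else \<zero>\<^bsub>F\<^esub>) | i j k. i \<in> V \<and> j \<in> V \<and> k \<in> V}
      \<union> {(X j i \<otimes>\<^bsub>F\<^esub> X k i, if j = k then X j i else \<zero>\<^bsub>F\<^esub>) | i j k. i \<in> V \<and> j \<in> V \<and> k \<in> V}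
      \<union> {(\<Oplus>\<^bsub>F\<^esub>l\<in>V. X i l, \<one>\<^bsub>F\<^esub>) | i. i \<in> V}
      \<union> {(\<Oplus>\<^bsub>F\<^esub>l\<in>V. X l i, \<one>\<^bsub>F\<^esub>) | i. i \<in> V})"

definition graph_relations ::
    "'v pair_pre_digraph \<Rightarrow> (('v \<times> 'v) star_poly \<times> ('v \<times> 'v) star_poly) set" where
  "graph_relations G =
     (let V = pverts G; E = parcs G; F = free_star_alg (V \<times> V); X = (\<lambda>i j. gen (i, j)) in
        magic_relations V
      \<union> {(X (fst e) i \<otimes>\<^bsub>F\<^esub> X (snd e) k, \<zero>\<^bsub>F\<^esub>) | e i k. e \<in> E \<and> (i, k) \<in> V \<times> V - E}
      \<union> {(X (snd e) k \<otimes>\<^bsub>F\<^esub> X (fst e) i, \<zero>\<^bsub>F\<^esub>) | e i k. e \<in> E \<and> (i, k) \<in> V \<times> V - E}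
      \<union> {(X i (fst e) \<otimes>\<^bsub>F\<^esub> X k (snd e), \<zero>\<^bsub>F\<^esub>) | e i k. e \<in> E \<and> (i, k) \<in> V \<times> V - E}
      \<union> {(X k (snd e) \<otimes>\<^bsub>F\<^esub> X i (fst e), \<zero>\<^bsub>F\<^esub>) | e i k. e \<in> E \<and> (i, k) \<in> V \<times> V - E}
      \<union> {(X (fst e) (fst e') \<otimes>\<^bsub>F\<^esub> X (snd e) (snd e'),
          X (snd e) (snd e') \<otimes>\<^bsub>F\<^esub> X (fst e) (fst e')) | e e'. e \<in> E \<and> e' \<in> E}
      \<union> {(\<Oplus>\<^bsub>F\<^esub>e'\<in>E. X (fst e') (fst e) \<otimes>\<^bsub>F\<^esub> X (snd e') (snd e), \<one>\<^bsub>F\<^esub>) | e. e \<in> E}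
      \<union> {(\<Oplus>\<^bsub>F\<^esub>e'\<in>E. X (fst e) (fst e') \<otimes>\<^bsub>F\<^esub> X (snd e) (snd e'), \<one>\<^bsub>F\<^esub>) | e. e \<in> E})"

definition graph_cstar :: "'v pair_pre_digraph \<Rightarrow> ('v \<times> 'v) univ_elem cstar_alg" where
  "graph_cstar G = univ_cstar (pverts G \<times> pverts G) (graph_relations G)"

definition graph_gen :: "'v pair_pre_digraph \<Rightarrow> 'v \<Rightarrow> 'v \<Rightarrow> ('v \<times> 'v) univ_elem" where
  "graph_gen G i j = univ_gen (pverts G \<times> pverts G) (graph_relations G) (i, j)"

definition A_aut :: "'v pair_pre_digraph \<Rightarrow> ('v \<times> 'v) univ_elem woronowicz" where
  "A_aut G =
     (let A = graph_cstar G; AA = min_tensor A A in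
      add_comult A
        (the_star_hom A AA (\<lambda>\<Delta>. \<forall>i\<in>pverts G. \<forall>j\<in>pverts G.
           \<Delta> (graph_gen G i j)
             = (\<Oplus>\<^bsub>AA\<^esub>k\<in>pverts G. elem_tensor A A (graph_gen G i k) (graph_gen G k j)))))"

definition A_aut_X :: "nat \<Rightarrow> (nat \<times> nat) univ_elem cstar_alg" where
  "A_aut_X n = univ_cstar ({1..n} \<times> {1..n}) (magic_relations {1..n})"

definition X_gen :: "nat \<Rightarrow> nat \<Rightarrow> nat \<Rightarrow> (nat \<times> nat) univ_elem" where
  "X_gen n i j = univ_gen ({1..n} \<times> {1..n}) (magic_relations {1..n}) (i, j)"


section \<open>Free products and quotients\<close>

text \<open>
  The relations in the star-polynomials over \<open>Gs\<close> expressing that \<open>a \<mapsto> gen (\<iota> a)\<close> is a unital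
  star-homomorphism on \<open>A\<close>.  Free products (coproducts of unital C*-algebras) are universal for
  such families of homomorphisms.
\<close>

definition hom_relations ::
    "'g set \<Rightarrow> ('a, 'x) cstar_alg_scheme \<Rightarrow> ('a \<Rightarrow> 'g) \<Rightarrow> ('g star_poly \<times> 'g star_poly) set" where
  "hom_relations Gs A \<iota> =
     (let F = free_star_alg Gs in
        {(gen (\<iota> (a \<oplus>\<^bsub>A\<^esub> b)), gen (\<iota> a) \<oplus>\<^bsub>F\<^esub> gen (\<iota> b)) | a b. a \<in> carrier A \<and> b \<in> carrier A}
      \<union> {(gen (\<iota> (a \<otimes>\<^bsub>A\<^esub> b)), gen (\<iota> a) \<otimes>\<^bsub>F\<^esub> gen (\<iota> b)) | a b. a \<in> carrier A \<and> b \<in> carrier A}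
      \<union> {(gen (\<iota> (c \<odot>\<^bsub>A\<^esub> a)), c \<odot>\<^bsub>F\<^esub> gen (\<iota> a)) | c a. a \<in> carrier A}
      \<union> {(gen (\<iota> (invol A a)), invol F (gen (\<iota> a))) | a. a \<in> carrier A}
      \<union> {(gen (\<iota> \<one>\<^bsub>A\<^esub>), \<one>\<^bsub>F\<^esub>)})"

definition free_power ::
    "('a, 'x) cstar_alg_scheme \<Rightarrow> nat \<Rightarrow> (nat \<times> 'a) univ_elem cstar_alg" where
  "free_power A n =
     (let Gs = {1..n} \<times> carrier A in univ_cstar Gs (\<Union>i\<in>{1..n}. hom_relations Gs A (Pair i)))"

definition free_power_inj ::
    "('a, 'x) cstar_alg_scheme \<Rightarrow> nat \<Rightarrow> nat \<Rightarrow> 'a \<Rightarrow> (nat \<times> 'a) univ_elem" where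
  "free_power_inj A n i a =
     (let Gs = {1..n} \<times> carrier A
      in univ_gen Gs (\<Union>k\<in>{1..n}. hom_relations Gs A (Pair k)) (i, a))"

definition free_prod ::
    "('a, 'x) cstar_alg_scheme \<Rightarrow> ('b, 'y) cstar_alg_scheme \<Rightarrow> ('a + 'b) univ_elem cstar_alg" where
  "free_prod A B =
     (let Gs = carrier A <+> carrier B
      in univ_cstar Gs (hom_relations Gs A Inl \<union> hom_relations Gs B Inr))"

definition free_prod_inj ::
    "('a, 'x) cstar_alg_scheme \<Rightarrow> ('b, 'y) cstar_alg_scheme \<Rightarrow> 'a + 'b \<Rightarrow> ('a + 'b) univ_elem" where
  "free_prod_inj A B z =
     (let Gs = carrier A <+> carrier B
      in univ_gen Gs (hom_relations Gs A Inl \<union> hom_relations Gs B Inr) z)"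

definition norm_closed :: "('a, 'x) cstar_alg_scheme \<Rightarrow> 'a set \<Rightarrow> bool" where
  "norm_closed A I \<longleftrightarrow>
     (\<forall>s. \<forall>x\<in>carrier A. range s \<subseteq> I \<longrightarrow> (\<lambda>k. cnorm A (s k \<ominus>\<^bsub>A\<^esub> x)) \<longlonglongrightarrow> 0 \<longrightarrow> x \<in> I)"

definition closed_ideal_gen :: "('a, 'x) cstar_alg_scheme \<Rightarrow> 'a set \<Rightarrow> 'a set" where
  "closed_ideal_gen A S = \<Inter>{I. ideal I A \<and> norm_closed A I \<and> S \<subseteq> I}"

definition cstar_quot :: "('a, 'x) cstar_alg_scheme \<Rightarrow> 'a set \<Rightarrow> 'a set cstar_alg" where
  "cstar_quot A I =
     \<lparr> carrier = carrier (A Quot I), monoid.mult = monoid.mult (A Quot I), one = one (A Quot I),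
       zero = zero (A Quot I), add = add (A Quot I),
       smult = (\<lambda>c X. \<Union>x\<in>X. I +>\<^bsub>A\<^esub> (c \<odot>\<^bsub>A\<^esub> x)),
       invol = (\<lambda>X. \<Union>x\<in>X. I +>\<^bsub>A\<^esub> invol A x),
       cnorm = (\<lambda>X. INF x\<in>X. cnorm A x) \<rparr>"


section \<open>Free wreath products\<close>

type_synonym 'a wreath_elem = "((nat \<times> 'a) univ_elem + (nat \<times> nat) univ_elem) univ_elem set"

definition wreath_free ::
    "('a, 'x) cstar_alg_scheme \<Rightarrow> nat
       \<Rightarrow> ((nat \<times> 'a) univ_elem + (nat \<times> nat) univ_elem) univ_elem cstar_alg" where
  "wreath_free A n = free_prod (free_power A n) (A_aut_X n)"

definition wreath_ideal ::
    "('a, 'x) cstar_alg_scheme \<Rightarrow> nat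
       \<Rightarrow> ((nat \<times> 'a) univ_elem + (nat \<times> nat) univ_elem) univ_elem set" where
  "wreath_ideal A n =
     (let P = wreath_free A n;
          \<nu> = (\<lambda>k a. free_prod_inj (free_power A n) (A_aut_X n) (Inl (free_power_inj A n k a)));
          x = (\<lambda>k i. free_prod_inj (free_power A n) (A_aut_X n) (Inr (X_gen n k i)))
      in closed_ideal_gen P
           {\<nu> k a \<otimes>\<^bsub>P\<^esub> x k i \<ominus>\<^bsub>P\<^esub> x k i \<otimes>\<^bsub>P\<^esub> \<nu> k a | k i a.
              k \<in> {1..n} \<and> i \<in> {1..n} \<and> a \<in> carrier A})"

definition wreath_cstar :: "('a, 'x) cstar_alg_scheme \<Rightarrow> nat \<Rightarrow> 'a wreath_elem cstar_alg" where
  "wreath_cstar A n = cstar_quot (wreath_free A n) (wreath_ideal A n)"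

definition wreath_nu :: "('a, 'x) cstar_alg_scheme \<Rightarrow> nat \<Rightarrow> nat \<Rightarrow> 'a \<Rightarrow> 'a wreath_elem" where
  "wreath_nu A n k a =
     wreath_ideal A n +>\<^bsub>wreath_free A n\<^esub>
       free_prod_inj (free_power A n) (A_aut_X n) (Inl (free_power_inj A n k a))"

definition wreath_x :: "('a, 'x) cstar_alg_scheme \<Rightarrow> nat \<Rightarrow> nat \<Rightarrow> nat \<Rightarrow> 'a wreath_elem" where
  "wreath_x A n i j =
     wreath_ideal A n +>\<^bsub>wreath_free A n\<^esub>
       free_prod_inj (free_power A n) (A_aut_X n) (Inr (X_gen n i j))"

definition free_wreath :: "'a woronowicz \<Rightarrow> nat \<Rightarrow> 'a wreath_elem woronowicz" where
  "free_wreath A n =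
     (let W = wreath_cstar A n; WW = min_tensor W W; \<nu> = wreath_nu A n; x = wreath_x A n in
      add_comult W
        (the_star_hom W WW (\<lambda>\<Delta>.
           (\<forall>i\<in>{1..n}. \<forall>j\<in>{1..n}.
              \<Delta> (x i j) = (\<Oplus>\<^bsub>WW\<^esub>k\<in>{1..n}. elem_tensor W W (x i k) (x k j)))
         \<and> (\<forall>i\<in>{1..n}. \<forall>a\<in>carrier A.
              \<Delta> (\<nu> i a)
                = (\<Oplus>\<^bsub>WW\<^esub>k\<in>{1..n}. tensor_map A A W W (\<nu> i) (\<nu> k) (comult A a)
                     \<otimes>\<^bsub>WW\<^esub> elem_tensor W W (x i k) \<one>\<^bsub>W\<^esub>)))))"

end

theory Submission
  imports Defs "HOL-Library.Nonpos_Ints"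
begin

text \<open>
  Matrices \<open>Y\<close> satisfying (R1)--(R4) for \<open>n\<close> copies of a connected graph are of the form
  \<open>Y (k, i) (l, j) = N k i j \<cdot> x k l\<close>, for a magic unitary \<open>x\<close> and solutions \<open>N k\<close> of the relations
  for one copy that commute with the \<open>k\<close>-th row of \<open>x\<close>.  Conversely \<open>N k i j\<close> is the sum of
  \<open>Y (k, i) (l, j)\<close> over \<open>l\<close>, and \<open>x k l\<close> is the sum over \<open>j\<close>, which is independent of \<open>i\<close> as it
  agrees along edges by (R2).  By the universal properties this gives homomorphisms in both
  directions; they are inverse to each other and respect the coproducts, as one sees on generators.

  The universal properties and the functoriality of the minimal tensor product need some
  C*-algebra theory without spectral calculus.  A selfadjoint \<open>a\<close> of norm less than \<open>1\<close> is the real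
  part of the unitary \<open>a + i \<surd>(1 - a\<^sup>2)\<close>, whose square root is a fixed point of a contraction, so
  that every C*-seminorm is dominated by the complete C*-norm.  Quotients by closed ideals use
  resolvents \<open>(1 + h\<^sup>2)\<^sup>-\<^sup>1\<close> in place of approximate units, and the norm estimates for tensor
  products of homomorphisms follow from the Schur product theorem and the C*-identity, applied to
  high powers of \<open>x\<^sup>*x\<close>.
\<close>

text \<open>The algebras are defined through suprema of seminorms and the coproducts through
  definite descriptions, so every object needs its own proof of existence and uniqueness. The free
  products have whole C*-algebras as sets of generators; their seminorms are uniformly bounded only
  because homomorphisms out of a C*-algebra are contractive. That is why automatic contractivity
  comes before the universal constructions.

  Checking directly that the coproduct of the free wreath product respects its relations would
  repeat the work done for the graph algebra. Instead the coproduct of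
  \<open>A_aut (disjoint_copies n G)\<close> is transported along the isomorphism, and the result is
  shown to satisfy the two identities that single out the coproduct of \<open>free_wreath\<close>;
  existence and compatibility come together. The identity for \<open>\<nu>\<close> is required at
  every element of the algebra, not only at generators. Both of its sides are homomorphisms because
  commutation with a projection, known on generators, extends to the whole algebra: it is invariance
  under conjugation with a symmetry.\<close>

locale star_algebra = ring S for S :: "('a, 'x) star_alg_scheme" (structure) +
  assumes smult_closed [simp, intro]: "x \<in> carrier S \<Longrightarrow> c \<odot> x \<in> carrier S"
    and smult_add_left: "x \<in> carrier S \<Longrightarrow> (c + d) \<odot> x = c \<odot> x \<oplus> d \<odot> x"
    and smult_add_right: "x \<in> carrier S \<Longrightarrow> y \<in> carrier S \<Longrightarrow> c \<odot> (x \<oplus> y) = c \<odot> x \<oplus> c \<odot> y"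
    and smult_smult [simp]: "x \<in> carrier S \<Longrightarrow> c \<odot> (d \<odot> x) = (c * d) \<odot> x"
    and smult_one [simp]: "x \<in> carrier S \<Longrightarrow> 1 \<odot> x = x"
    and smult_mult_left [simp]:
      "x \<in> carrier S \<Longrightarrow> y \<in> carrier S \<Longrightarrow> (c \<odot> x) \<otimes> y = c \<odot> (x \<otimes> y)"
    and smult_mult_right [simp]:
      "x \<in> carrier S \<Longrightarrow> y \<in> carrier S \<Longrightarrow> x \<otimes> (c \<odot> y) = c \<odot> (x \<otimes> y)"
    and invol_closed [simp, intro]: "x \<in> carrier S \<Longrightarrow> invol S x \<in> carrier S"
    and invol_invol [simp]: "x \<in> carrier S \<Longrightarrow> invol S (invol S x) = x"
    and invol_add [simp]:
      "x \<in> carrier S \<Longrightarrow> y \<in> carrier S \<Longrightarrow> invol S (x \<oplus> y) = invol S x \<oplus> invol S y"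
    and invol_mult [simp]:
      "x \<in> carrier S \<Longrightarrow> y \<in> carrier S \<Longrightarrow> invol S (x \<otimes> y) = invol S y \<otimes> invol S x"
    and invol_smult [simp]: "x \<in> carrier S \<Longrightarrow> invol S (c \<odot> x) = cnj c \<odot> invol S x"
begin

lemma smult_zero_left [simp]: "x \<in> carrier S \<Longrightarrow> 0 \<odot> x = \<zero>"
  using smult_add_left[of x 0 0] by (metis add.l_cancel_one' add.one_closed add_0 smult_closed)

lemma smult_minus_left: "x \<in> carrier S \<Longrightarrow> (- c) \<odot> x = \<ominus> (c \<odot> x)"
  using smult_add_left[of x "- c" c] by (simp add: minus_equality)

lemma uminus_eq_smult: "x \<in> carrier S \<Longrightarrow> \<ominus> x = (- 1) \<odot> x"
  by (simp add: smult_minus_left)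

lemma smult_zero_right [simp]: "c \<odot> \<zero> = \<zero>"
  using smult_smult[of \<zero> c 0] smult_zero_left[of "\<zero>"] by simp

lemma smult_minus_right: "x \<in> carrier S \<Longrightarrow> c \<odot> (\<ominus> x) = \<ominus> (c \<odot> x)"
  by (simp add: uminus_eq_smult)

lemma minus_eq_smult: "x \<in> carrier S \<Longrightarrow> y \<in> carrier S \<Longrightarrow> x \<ominus> y = x \<oplus> (- 1) \<odot> y"
  by (simp add: a_minus_def uminus_eq_smult)

lemma smult_diff_right:
  "x \<in> carrier S \<Longrightarrow> y \<in> carrier S \<Longrightarrow> c \<odot> (x \<ominus> y) = c \<odot> x \<ominus> c \<odot> y"
  by (simp add: minus_eq_smult smult_add_right)

lemma smult_cancel:
  assumes "x \<in> carrier S" "y \<in> carrier S" "c \<odot> x = c \<odot> y" "c \<noteq> 0"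
  shows "x = y"
  using assms by (metis left_inverse smult_one smult_smult)

lemma invol_zero [simp]: "invol S \<zero> = \<zero>"
  using invol_smult[of \<zero> 0] by simp

lemma invol_one [simp]: "invol S \<one> = \<one>"
  using invol_mult[of "invol S \<one>" \<one>] by simp

lemma invol_uminus [simp]: "x \<in> carrier S \<Longrightarrow> invol S (\<ominus> x) = \<ominus> invol S x"
  by (simp add: uminus_eq_smult)

lemma invol_minus [simp]:
  "x \<in> carrier S \<Longrightarrow> y \<in> carrier S \<Longrightarrow> invol S (x \<ominus> y) = invol S x \<ominus> invol S y"
  by (simp add: minus_eq_smult)

lemma eq_if_minus_zero: "x \<in> carrier S \<Longrightarrow> y \<in> carrier S \<Longrightarrow> x \<ominus> y = \<zero> \<Longrightarrow> x = y"
  by (metis a_minus_def add.inv_closed add.inv_inv minus_equality)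

lemma minus_mult_left:
  "x \<in> carrier S \<Longrightarrow> y \<in> carrier S \<Longrightarrow> z \<in> carrier S \<Longrightarrow> (x \<ominus> y) \<otimes> z = x \<otimes> z \<ominus> y \<otimes> z"
  by (simp add: minus_eq_smult l_distr)

lemma minus_mult_right:
  "x \<in> carrier S \<Longrightarrow> y \<in> carrier S \<Longrightarrow> z \<in> carrier S \<Longrightarrow> z \<otimes> (x \<ominus> y) = z \<otimes> x \<ominus> z \<otimes> y"
  by (simp add: minus_eq_smult r_distr)

lemma finsum_smult:
  "f \<in> I \<rightarrow> carrier S \<Longrightarrow> c \<odot> (\<Oplus>i\<in>I. f i) = (\<Oplus>i\<in>I. c \<odot> f i)"
  by (induction I rule: infinite_finite_induct) (auto simp: smult_add_right Pi_iff)

lemma finsum_invol: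
  "f \<in> I \<rightarrow> carrier S \<Longrightarrow> invol S (\<Oplus>i\<in>I. f i) = (\<Oplus>i\<in>I. invol S (f i))"
  by (induction I rule: infinite_finite_induct) (auto simp: Pi_iff)

end

lemma star_algebraI:
  fixes S (structure)
  assumes "ring S"
    and "\<And>c x. x \<in> carrier S \<Longrightarrow> c \<odot> x \<in> carrier S"
    and "\<And>c d x. x \<in> carrier S \<Longrightarrow> (c + d) \<odot> x = c \<odot> x \<oplus> d \<odot> x"
    and "\<And>c x y. x \<in> carrier S \<Longrightarrow> y \<in> carrier S \<Longrightarrow> c \<odot> (x \<oplus> y) = c \<odot> x \<oplus> c \<odot> y"
    and "\<And>c d x. x \<in> carrier S \<Longrightarrow> c \<odot> (d \<odot> x) = (c * d) \<odot> x"
    and "\<And>x. x \<in> carrier S \<Longrightarrow> 1 \<odot> x = x"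
    and "\<And>c x y. x \<in> carrier S \<Longrightarrow> y \<in> carrier S \<Longrightarrow> (c \<odot> x) \<otimes> y = c \<odot> (x \<otimes> y)"
    and "\<And>c x y. x \<in> carrier S \<Longrightarrow> y \<in> carrier S \<Longrightarrow> x \<otimes> (c \<odot> y) = c \<odot> (x \<otimes> y)"
    and "\<And>x. x \<in> carrier S \<Longrightarrow> invol S x \<in> carrier S"
    and "\<And>x. x \<in> carrier S \<Longrightarrow> invol S (invol S x) = x"
    and "\<And>x y. x \<in> carrier S \<Longrightarrow> y \<in> carrier S \<Longrightarrow> invol S (x \<oplus> y) = invol S x \<oplus> invol S y"
    and "\<And>x y. x \<in> carrier S \<Longrightarrow> y \<in> carrier S \<Longrightarrow> invol S (x \<otimes> y) = invol S y \<otimes> invol S x"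
    and "\<And>c x. x \<in> carrier S \<Longrightarrow> invol S (c \<odot> x) = cnj c \<odot> invol S x"
  shows "star_algebra S"
  using assms by (intro star_algebra.intro star_algebra_axioms.intro) auto


section \<open>Star-homomorphisms\<close>

context
  fixes A :: "('a, 'x) star_alg_scheme" and B :: "('b, 'y) star_alg_scheme" and h :: "'a \<Rightarrow> 'b"
  assumes h: "star_hom A B h"
begin

lemma star_hom_closed: "x \<in> carrier A \<Longrightarrow> h x \<in> carrier B"
  using h by (auto simp: star_hom_def ring_hom_def)

lemma star_hom_add:
  "x \<in> carrier A \<Longrightarrow> y \<in> carrier A \<Longrightarrow> h (x \<oplus>\<^bsub>A\<^esub> y) = h x \<oplus>\<^bsub>B\<^esub> h y"
  using h by (auto simp: star_hom_def ring_hom_def)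

lemma star_hom_mult:
  "x \<in> carrier A \<Longrightarrow> y \<in> carrier A \<Longrightarrow> h (x \<otimes>\<^bsub>A\<^esub> y) = h x \<otimes>\<^bsub>B\<^esub> h y"
  using h by (auto simp: star_hom_def ring_hom_def)

lemma star_hom_one: "h \<one>\<^bsub>A\<^esub> = \<one>\<^bsub>B\<^esub>"
  using h by (auto simp: star_hom_def ring_hom_def)

lemma star_hom_smult: "x \<in> carrier A \<Longrightarrow> h (c \<odot>\<^bsub>A\<^esub> x) = c \<odot>\<^bsub>B\<^esub> h x"
  using h by (auto simp: star_hom_def)

lemma star_hom_invol: "x \<in> carrier A \<Longrightarrow> h (invol A x) = invol B (h x)"
  using h by (auto simp: star_hom_def)

context
  assumes A: "star_algebra A" and B: "star_algebra B"
begin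

interpretation A: star_algebra A by (rule A)
interpretation B: star_algebra B by (rule B)

lemma star_hom_zero: "h \<zero>\<^bsub>A\<^esub> = \<zero>\<^bsub>B\<^esub>"
  using star_hom_smult[of "\<zero>\<^bsub>A\<^esub>" 0] star_hom_closed by simp

lemma star_hom_minus:
  "x \<in> carrier A \<Longrightarrow> y \<in> carrier A \<Longrightarrow> h (x \<ominus>\<^bsub>A\<^esub> y) = h x \<ominus>\<^bsub>B\<^esub> h y"
  by (simp add: A.minus_eq_smult B.minus_eq_smult star_hom_add star_hom_smult star_hom_closed)

lemma star_hom_finsum:
  "f \<in> I \<rightarrow> carrier A \<Longrightarrow> h (\<Oplus>\<^bsub>A\<^esub>i\<in>I. f i) = (\<Oplus>\<^bsub>B\<^esub>i\<in>I. h (f i))"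
  by (induction I rule: infinite_finite_induct)
     (auto simp: star_hom_zero star_hom_add star_hom_closed Pi_iff)

end

end

lemmas star_hom_simps =
  star_hom_closed star_hom_add star_hom_mult star_hom_one star_hom_smult star_hom_invol

lemma star_homI:
  assumes "\<And>x. x \<in> carrier A \<Longrightarrow> h x \<in> carrier B"
    and "\<And>x y. x \<in> carrier A \<Longrightarrow> y \<in> carrier A \<Longrightarrow> h (x \<oplus>\<^bsub>A\<^esub> y) = h x \<oplus>\<^bsub>B\<^esub> h y"
    and "\<And>x y. x \<in> carrier A \<Longrightarrow> y \<in> carrier A \<Longrightarrow> h (x \<otimes>\<^bsub>A\<^esub> y) = h x \<otimes>\<^bsub>B\<^esub> h y"
    and "h \<one>\<^bsub>A\<^esub> = \<one>\<^bsub>B\<^esub>"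
    and "\<And>c x. x \<in> carrier A \<Longrightarrow> h (c \<odot>\<^bsub>A\<^esub> x) = c \<odot>\<^bsub>B\<^esub> h x"
    and "\<And>x. x \<in> carrier A \<Longrightarrow> h (invol A x) = invol B (h x)"
  shows "star_hom A B h"
  using assms by (auto simp: star_hom_def ring_hom_def)

lemma star_hom_comp:
  "star_hom A B g \<Longrightarrow> star_hom B C h \<Longrightarrow> star_hom A C (\<lambda>x. h (g x))"
  by (rule star_homI) (simp_all add: star_hom_simps)

lemma star_hom_restrict:
  assumes "star_algebra A" "star_hom A B h"
  shows "star_hom A B (restrict h (carrier A))"
proof -
  interpret star_algebra A by fact
  show ?thesis by (rule star_homI) (simp_all add: star_hom_simps[OF assms(2)])
qed

lemma star_hom_cong:
  assumes "star_algebra A" "star_hom A B h" "\<And>x. x \<in> carrier A \<Longrightarrow> h' x = h x"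
  shows "star_hom A B h'"
proof -
  interpret star_algebra A by fact
  show ?thesis by (rule star_homI) (simp_all add: assms(3) star_hom_simps[OF assms(2)])
qed

lemma (in star_algebra) star_hom_id: "star_hom S S (\<lambda>x. x)"
  by (rule star_homI) auto

text \<open>The bridge from the definite description to a concrete map. \<open>restrict\<close>
  provides the value \<open>undefined\<close> off the carrier, on which the definition insists, so
  \<open>P\<close> has to hold for the restricted map; uniqueness then matters only on the
  carrier.\<close>

lemma the_star_hom_eq:
  assumes "star_algebra A" and h: "star_hom A B h" and P: "P (restrict h (carrier A))"
    and unique: "\<And>h1 h2 x. star_hom A B h1 \<Longrightarrow> P h1 \<Longrightarrow> star_hom A B h2 \<Longrightarrow> P h2
      \<Longrightarrow> x \<in> carrier A \<Longrightarrow> h1 x = h2 x"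
  shows "the_star_hom A B P = restrict h (carrier A)"
  unfolding the_star_hom_def
proof (rule the_equality)
  show "restrict h (carrier A) \<in> extensional (carrier A)
      \<and> star_hom A B (restrict h (carrier A)) \<and> P (restrict h (carrier A))"
    using star_hom_restrict[OF assms(1) h] P by simp
next
  fix g assume g: "g \<in> extensional (carrier A) \<and> star_hom A B g \<and> P g"
  then show "g = restrict h (carrier A)"
    using unique[of g "restrict h (carrier A)"] star_hom_restrict[OF assms(1) h] P
    by (intro extensionalityI[of g "carrier A"]) auto
qed


section \<open>The star-algebra of a monoid with involution\<close>

locale star_monoid = monoid M for M :: "('m, 'z) monoid_scheme" (structure) +
  fixes \<tau> :: "'m \<Rightarrow> 'm"
  assumes tau_closed [simp, intro]: "u \<in> carrier M \<Longrightarrow> \<tau> u \<in> carrier M"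
    and tau_tau [simp]: "u \<in> carrier M \<Longrightarrow> \<tau> (\<tau> u) = u"
    and tau_mult [simp]: "u \<in> carrier M \<Longrightarrow> v \<in> carrier M \<Longrightarrow> \<tau> (u \<otimes> v) = \<tau> v \<otimes> \<tau> u"

lemma sum_keys_superset:
  fixes x :: "'m \<Rightarrow>\<^sub>0 complex" and f :: "'m \<Rightarrow> complex \<Rightarrow> 'b::comm_monoid_add"
  assumes "finite K" "Poly_Mapping.keys x \<subseteq> K" "\<And>u. f u 0 = 0"
  shows "(\<Sum>u\<in>Poly_Mapping.keys x. f u (Poly_Mapping.lookup x u)) = (\<Sum>u\<in>K. f u (Poly_Mapping.lookup x u))"
  using assms by (intro sum.mono_neutral_left) (auto simp: in_keys_iff)

text \<open>Cancellation can make the support of \<open>x + y\<close> smaller than the union of the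
  supports. As \<open>f u 0 = 0\<close>, all three sums may be taken over the union, where
  additivity applies termwise.\<close>

lemma sum_keys_add:
  fixes x y :: "'m \<Rightarrow>\<^sub>0 complex" and f :: "'m \<Rightarrow> complex \<Rightarrow> 'b::comm_monoid_add"
  assumes "\<And>u. f u 0 = 0" "\<And>u c d. f u (c + d) = f u c + f u d"
  shows "(\<Sum>u\<in>Poly_Mapping.keys (x + y). f u (Poly_Mapping.lookup (x + y) u))
    = (\<Sum>u\<in>Poly_Mapping.keys x. f u (Poly_Mapping.lookup x u))
      + (\<Sum>u\<in>Poly_Mapping.keys y. f u (Poly_Mapping.lookup y u))"
proof -
  let ?K = "Poly_Mapping.keys x \<union> Poly_Mapping.keys y"
  show ?thesis
    using Poly_Mapping.keys_add[of x y]
    by (subst (1 2 3) sum_keys_superset[where K = ?K])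
       (auto simp: assms sum.distrib lookup_add)
qed

lemma sum_keys_single:
  fixes f :: "'m \<Rightarrow> complex \<Rightarrow> 'b::comm_monoid_add"
  assumes "\<And>u. f u 0 = 0"
  shows "(\<Sum>u\<in>Poly_Mapping.keys (Poly_Mapping.single v c). f u (Poly_Mapping.lookup (Poly_Mapping.single v c) u))
    = f v c"
  by (subst sum_keys_superset[where K = "{v}"]) (auto simp: assms)

lemma poly_mapping_monomials:
  fixes x :: "'m \<Rightarrow>\<^sub>0 complex"
  shows "x = (\<Sum>u\<in>Poly_Mapping.keys x. Poly_Mapping.single u (Poly_Mapping.lookup x u))"
proof (rule poly_mapping_eqI)
  fix v
  show "Poly_Mapping.lookup x v = Poly_Mapping.lookup
      (\<Sum>u\<in>Poly_Mapping.keys x. Poly_Mapping.single u (Poly_Mapping.lookup x u)) v"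
    by (cases "v \<in> Poly_Mapping.keys x") (auto simp: lookup_sum lookup_single when_def in_keys_iff)
qed

lemma keys_sum_subset:
  "(\<And>i. i \<in> I \<Longrightarrow> Poly_Mapping.keys (f i) \<subseteq> K) \<Longrightarrow> Poly_Mapping.keys (\<Sum>i\<in>I. f i) \<subseteq> K"
  by (induction I rule: infinite_finite_induct) (auto dest!: subsetD[OF Poly_Mapping.keys_add])

context star_monoid
begin

abbreviation CM :: "('m \<Rightarrow>\<^sub>0 complex) star_alg" where "CM \<equiv> monoid_star_alg M \<tau>"

lemma CM_simps:
  "carrier CM = {x. Poly_Mapping.keys x \<subseteq> carrier M}"
  "\<one>\<^bsub>CM\<^esub> = Poly_Mapping.single \<one> 1" "\<zero>\<^bsub>CM\<^esub> = 0" "x \<oplus>\<^bsub>CM\<^esub> y = x + y"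
  by (simp_all add: monoid_star_alg_def)

lemma CM_single_closed: "u \<in> carrier M \<Longrightarrow> Poly_Mapping.single u c \<in> carrier CM"
  by (auto simp: CM_simps)

lemma CM_add_closed: "x \<in> carrier CM \<Longrightarrow> y \<in> carrier CM \<Longrightarrow> x + y \<in> carrier CM"
  using Poly_Mapping.keys_add[of x y] by (auto simp: CM_simps)

text \<open>Induction over finite sets of keys; membership of the partial sums in the carrier is
  carried along to make \<open>add\<close> applicable. It reduces every identity that is additive in
  each argument to monomials.\<close>

lemma CM_induct [consumes 1, case_names zero single add]:
  assumes "x \<in> carrier CM" and "P 0" and "\<And>u c. u \<in> carrier M \<Longrightarrow> P (Poly_Mapping.single u c)"
    and add: "\<And>x y. x \<in> carrier CM \<Longrightarrow> y \<in> carrier CM \<Longrightarrow> P x \<Longrightarrow> P y \<Longrightarrow> P (x + y)"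
  shows "P x"
proof -
  have "P (\<Sum>u\<in>K. Poly_Mapping.single u (Poly_Mapping.lookup x u))
      \<and> (\<Sum>u\<in>K. Poly_Mapping.single u (Poly_Mapping.lookup x u)) \<in> carrier CM"
    if "finite K" "K \<subseteq> carrier M" for K
    using that
  proof induction
    case empty then show ?case using assms(2) by (simp add: CM_simps)
  next
    case (insert u K) then show ?case
      using assms(3) by (auto intro!: add CM_add_closed CM_single_closed)
  qed
  from this[of "Poly_Mapping.keys x"] show ?thesis
    using assms(1) by (simp add: CM_simps poly_mapping_monomials[of x, symmetric])
qed

lemma CM_mult_def: "x \<otimes>\<^bsub>CM\<^esub> y = (\<Sum>u\<in>Poly_Mapping.keys x. \<Sum>v\<in>Poly_Mapping.keys y.
    Poly_Mapping.single (u \<otimes> v) (Poly_Mapping.lookup x u * Poly_Mapping.lookup y v))"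
  by (simp add: monoid_star_alg_def)

lemma CM_mult_add_left: "(x + y) \<otimes>\<^bsub>CM\<^esub> z = x \<otimes>\<^bsub>CM\<^esub> z + y \<otimes>\<^bsub>CM\<^esub> z"
  unfolding CM_mult_def
  by (rule sum_keys_add[where f = "\<lambda>u c. \<Sum>v\<in>Poly_Mapping.keys z.
        Poly_Mapping.single (u \<otimes> v) (c * Poly_Mapping.lookup z v)"])
     (simp_all add: distrib_right single_add sum.distrib)

lemma CM_mult_add_right: "z \<otimes>\<^bsub>CM\<^esub> (x + y) = z \<otimes>\<^bsub>CM\<^esub> x + z \<otimes>\<^bsub>CM\<^esub> y"
  unfolding CM_mult_def sum.distrib[symmetric]
  by (intro sum.cong refl sum_keys_add[where f = "\<lambda>v c.
        Poly_Mapping.single (_ \<otimes> v) (Poly_Mapping.lookup z _ * c)"])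
     (simp_all add: distrib_left single_add sum.distrib)

lemma CM_mult_single: "Poly_Mapping.single u c \<otimes>\<^bsub>CM\<^esub> Poly_Mapping.single v d
    = Poly_Mapping.single (u \<otimes> v) (c * d)"
  unfolding CM_mult_def
  by (subst sum_keys_single[where f = "\<lambda>u c. \<Sum>w\<in>Poly_Mapping.keys (Poly_Mapping.single v d).
        Poly_Mapping.single (u \<otimes> w) (c * Poly_Mapping.lookup (Poly_Mapping.single v d) w)"], simp)
     (subst sum_keys_single[where f = "\<lambda>w d. Poly_Mapping.single (u \<otimes> w) (c * d)"], simp_all)

lemma CM_mult_zero: "0 \<otimes>\<^bsub>CM\<^esub> x = 0" "x \<otimes>\<^bsub>CM\<^esub> 0 = 0"
  by (simp_all add: CM_mult_def)

lemma CM_smult_def: "c \<odot>\<^bsub>CM\<^esub> x =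
    (\<Sum>u\<in>Poly_Mapping.keys x. Poly_Mapping.single u (c * Poly_Mapping.lookup x u))"
  by (simp add: monoid_star_alg_def)

lemma CM_smult_add: "c \<odot>\<^bsub>CM\<^esub> (x + y) = c \<odot>\<^bsub>CM\<^esub> x + c \<odot>\<^bsub>CM\<^esub> y"
  unfolding CM_smult_def
  by (rule sum_keys_add[where f = "\<lambda>u d. Poly_Mapping.single u (c * d)"])
     (simp_all add: distrib_left single_add)

lemma CM_smult_single: "c \<odot>\<^bsub>CM\<^esub> Poly_Mapping.single u d = Poly_Mapping.single u (c * d)"
  unfolding CM_smult_def by (rule sum_keys_single) simp

lemma CM_smult_zero: "c \<odot>\<^bsub>CM\<^esub> 0 = 0"
  by (simp add: CM_smult_def)

lemma CM_invol_def: "invol CM x =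
    (\<Sum>u\<in>Poly_Mapping.keys x. Poly_Mapping.single (\<tau> u) (cnj (Poly_Mapping.lookup x u)))"
  by (simp add: monoid_star_alg_def)

lemma CM_invol_add: "invol CM (x + y) = invol CM x + invol CM y"
  unfolding CM_invol_def
  by (rule sum_keys_add[where f = "\<lambda>u d. Poly_Mapping.single (\<tau> u) (cnj d)"])
     (simp_all add: single_add)

lemma CM_invol_single: "invol CM (Poly_Mapping.single u d) = Poly_Mapping.single (\<tau> u) (cnj d)"
  unfolding CM_invol_def by (rule sum_keys_single) simp

lemma CM_invol_zero: "invol CM 0 = 0"
  by (simp add: CM_invol_def)

lemmas CM_linear = CM_mult_add_left CM_mult_add_right CM_mult_zero CM_smult_add CM_smult_zero
  CM_invol_add CM_invol_zero
lemmas CM_single = CM_mult_single CM_smult_single CM_invol_single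

lemma CM_mult_closed: "x \<in> carrier CM \<Longrightarrow> y \<in> carrier CM \<Longrightarrow> x \<otimes>\<^bsub>CM\<^esub> y \<in> carrier CM"
  unfolding CM_mult_def CM_simps mem_Collect_eq
  by (intro keys_sum_subset) (simp add: subset_iff)

lemma tau_one [simp]: "\<tau> \<one> = \<one>"
  by (metis l_one one_closed r_one tau_closed tau_mult tau_tau)

theorem star_algebra_CM: "star_algebra CM"
proof (rule star_algebraI)
  show "ring CM"
  proof (rule ringI)
    show "abelian_group CM"
    proof (rule abelian_groupI)
      fix x assume "x \<in> carrier CM"
      then show "\<exists>y\<in>carrier CM. y \<oplus>\<^bsub>CM\<^esub> x = \<zero>\<^bsub>CM\<^esub>"
        by (intro bexI[of _ "- x"]) (auto simp: CM_simps in_keys_iff subset_iff)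
    qed (auto simp: CM_simps add_ac dest!: subsetD[OF Poly_Mapping.keys_add])
    show "Group.monoid CM"
    proof (rule monoidI)
      fix x y z assume "x \<in> carrier CM" "y \<in> carrier CM" "z \<in> carrier CM"
      then show "x \<otimes>\<^bsub>CM\<^esub> y \<otimes>\<^bsub>CM\<^esub> z = x \<otimes>\<^bsub>CM\<^esub> (y \<otimes>\<^bsub>CM\<^esub> z)"
      proof (induction x rule: CM_induct)
        case (single u c)
        from single(2,3,1) show ?case
        proof (induction y rule: CM_induct)
          case (single v d)
          from single(2,1,3) show ?case
            by (induction z rule: CM_induct) (simp_all add: CM_linear CM_single m_assoc mult.assoc)
        qed (simp_all add: CM_linear)
      qed (simp_all add: CM_linear)
    next
      show "\<one>\<^bsub>CM\<^esub> \<in> carrier CM" by (simp add: CM_simps)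
    next
      fix x assume "x \<in> carrier CM"
      then show "\<one>\<^bsub>CM\<^esub> \<otimes>\<^bsub>CM\<^esub> x = x"
        by (induction x rule: CM_induct) (simp_all add: CM_simps CM_linear CM_single)
    next
      fix x assume "x \<in> carrier CM"
      then show "x \<otimes>\<^bsub>CM\<^esub> \<one>\<^bsub>CM\<^esub> = x"
        by (induction x rule: CM_induct) (simp_all add: CM_simps CM_linear CM_single)
    qed (rule CM_mult_closed)
  qed (simp_all add: CM_simps CM_linear)
next
  fix c x assume "x \<in> carrier CM"
  then show "c \<odot>\<^bsub>CM\<^esub> x \<in> carrier CM"
    unfolding CM_smult_def CM_simps mem_Collect_eq
    by (intro keys_sum_subset) (simp add: subset_iff)
next
  fix c d x assume "x \<in> carrier CM"
  then show "(c + d) \<odot>\<^bsub>CM\<^esub> x = c \<odot>\<^bsub>CM\<^esub> x \<oplus>\<^bsub>CM\<^esub> d \<odot>\<^bsub>CM\<^esub> x"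
    by (induction x rule: CM_induct)
       (simp_all add: CM_simps CM_linear CM_single distrib_right single_add)
next
  fix c d x assume "x \<in> carrier CM"
  then show "c \<odot>\<^bsub>CM\<^esub> (d \<odot>\<^bsub>CM\<^esub> x) = (c * d) \<odot>\<^bsub>CM\<^esub> x"
    by (induction x rule: CM_induct) (simp_all add: CM_linear CM_single mult.assoc)
next
  fix x assume "x \<in> carrier CM"
  then show "1 \<odot>\<^bsub>CM\<^esub> x = x"
    by (induction x rule: CM_induct) (simp_all add: CM_linear CM_single)
next
  fix c x y assume "x \<in> carrier CM" "y \<in> carrier CM"
  then show "(c \<odot>\<^bsub>CM\<^esub> x) \<otimes>\<^bsub>CM\<^esub> y = c \<odot>\<^bsub>CM\<^esub> (x \<otimes>\<^bsub>CM\<^esub> y)"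
  proof (induction x rule: CM_induct)
    case (single u c)
    from single(2,1) show ?case
      by (induction y rule: CM_induct) (simp_all add: CM_linear CM_single mult.assoc)
  qed (simp_all add: CM_linear)
next
  fix c x y assume "x \<in> carrier CM" "y \<in> carrier CM"
  then show "x \<otimes>\<^bsub>CM\<^esub> (c \<odot>\<^bsub>CM\<^esub> y) = c \<odot>\<^bsub>CM\<^esub> (x \<otimes>\<^bsub>CM\<^esub> y)"
  proof (induction x rule: CM_induct)
    case (single u c)
    from single(2,1) show ?case
      by (induction y rule: CM_induct) (simp_all add: CM_linear CM_single mult.left_commute)
  qed (simp_all add: CM_linear)
next
  fix x assume "x \<in> carrier CM"
  then show "invol CM x \<in> carrier CM"
    unfolding CM_invol_def CM_simps mem_Collect_eq
    by (intro keys_sum_subset) (simp add: subset_iff)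
next
  fix x assume "x \<in> carrier CM"
  then show "invol CM (invol CM x) = x"
    by (induction x rule: CM_induct) (simp_all add: CM_linear CM_single)
next
  fix x y assume "x \<in> carrier CM" "y \<in> carrier CM"
  then show "invol CM (x \<otimes>\<^bsub>CM\<^esub> y) = invol CM y \<otimes>\<^bsub>CM\<^esub> invol CM x"
  proof (induction x rule: CM_induct)
    case (single u c)
    from single(2,1) show ?case
      by (induction y rule: CM_induct) (simp_all add: CM_linear CM_single mult.commute)
  qed (simp_all add: CM_linear)
next
  fix c x assume "x \<in> carrier CM"
  then show "invol CM (c \<odot>\<^bsub>CM\<^esub> x) = cnj c \<odot>\<^bsub>CM\<^esub> invol CM x"
    by (induction x rule: CM_induct) (simp_all add: CM_linear CM_single)
qed (simp_all add: CM_simps CM_linear)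

end

definition lin_ext :: "('b, 'y) star_alg_scheme \<Rightarrow> ('m \<Rightarrow> 'b) \<Rightarrow> ('m \<Rightarrow>\<^sub>0 complex) \<Rightarrow> 'b" where
  "lin_ext B \<theta> x = (\<Oplus>\<^bsub>B\<^esub>u\<in>Poly_Mapping.keys x. Poly_Mapping.lookup x u \<odot>\<^bsub>B\<^esub> \<theta> u)"

context star_algebra
begin

lemma lin_ext_superset:
  assumes "finite K" "Poly_Mapping.keys x \<subseteq> K" "\<theta> \<in> K \<rightarrow> carrier S"
  shows "lin_ext S \<theta> x = (\<Oplus>u\<in>K. Poly_Mapping.lookup x u \<odot> \<theta> u)"
  unfolding lin_ext_def using assms
  by (intro add.finprod_mono_neutral_cong_left) (auto simp: in_keys_iff Pi_iff)

lemma lin_ext_closed: "\<theta> \<in> Poly_Mapping.keys x \<rightarrow> carrier S \<Longrightarrow> lin_ext S \<theta> x \<in> carrier S"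
  unfolding lin_ext_def by (intro finsum_closed) auto

lemma lin_ext_add:
  assumes "\<theta> \<in> Poly_Mapping.keys x \<rightarrow> carrier S" "\<theta> \<in> Poly_Mapping.keys y \<rightarrow> carrier S"
  shows "lin_ext S \<theta> (x + y) = lin_ext S \<theta> x \<oplus> lin_ext S \<theta> y"
proof -
  let ?K = "Poly_Mapping.keys x \<union> Poly_Mapping.keys y"
  have c: "\<theta> u \<in> carrier S" if "u \<in> ?K" for u using that assms by auto
  have "lin_ext S \<theta> (x + y) = (\<Oplus>u\<in>?K. Poly_Mapping.lookup (x + y) u \<odot> \<theta> u)"
    using Poly_Mapping.keys_add[of x y] assms by (intro lin_ext_superset) auto
  also have "\<dots> = (\<Oplus>u\<in>?K. Poly_Mapping.lookup x u \<odot> \<theta> u \<oplus> Poly_Mapping.lookup y u \<odot> \<theta> u)"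
    by (rule finsum_cong') (use c in \<open>auto simp: lookup_add smult_add_left\<close>)
  also have "\<dots> = (\<Oplus>u\<in>?K. Poly_Mapping.lookup x u \<odot> \<theta> u) \<oplus> (\<Oplus>u\<in>?K. Poly_Mapping.lookup y u \<odot> \<theta> u)"
    by (rule finsum_addf) (use c in auto)
  also have "\<dots> = lin_ext S \<theta> x \<oplus> lin_ext S \<theta> y"
    using assms by (simp add: lin_ext_superset[of ?K])
  finally show ?thesis .
qed

lemma lin_ext_single: "\<theta> u \<in> carrier S \<Longrightarrow> lin_ext S \<theta> (Poly_Mapping.single u c) = c \<odot> \<theta> u"
  by (subst lin_ext_superset[of "{u}"]) auto

lemma lin_ext_zero [simp]: "lin_ext S \<theta> 0 = \<zero>"
  by (simp add: lin_ext_def)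

text \<open>The universal property of the monoid algebra. The free star-algebra and the formal
  tensor product are both of this form, so this one construction yields the homomorphisms out of
  either.\<close>

lemma star_hom_lin_ext:
  assumes "star_monoid M \<tau>"
    and cl: "\<And>u. u \<in> carrier M \<Longrightarrow> \<theta> u \<in> carrier S"
    and mult: "\<And>u v. u \<in> carrier M \<Longrightarrow> v \<in> carrier M \<Longrightarrow> \<theta> (u \<otimes>\<^bsub>M\<^esub> v) = \<theta> u \<otimes> \<theta> v"
    and one: "\<theta> \<one>\<^bsub>M\<^esub> = \<one>"
    and inv: "\<And>u. u \<in> carrier M \<Longrightarrow> \<theta> (\<tau> u) = invol S (\<theta> u)"
  shows "star_hom (monoid_star_alg M \<tau>) S (lin_ext S \<theta>)"
proof -
  interpret M: star_monoid M \<tau> by fact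
  interpret C: star_algebra M.CM by (rule M.star_algebra_CM)
  note lin = lin_ext_closed
  have k: "\<theta> \<in> Poly_Mapping.keys x \<rightarrow> carrier S" if "x \<in> carrier M.CM" for x
    using that cl by (auto simp: M.CM_simps)
  note add = lin_ext_add[OF k k]
  note closed = lin_ext_closed[OF k]
  note [simp] = add closed lin_ext_single cl mult one inv
  show ?thesis
  proof (rule star_homI)
    fix x y assume "x \<in> carrier M.CM" "y \<in> carrier M.CM"
    then show "lin_ext S \<theta> (x \<otimes>\<^bsub>M.CM\<^esub> y) = lin_ext S \<theta> x \<otimes> lin_ext S \<theta> y"
    proof (induction x rule: M.CM_induct)
      case (single u c)
      from single(2,1) show ?case
        by (induction y rule: M.CM_induct)
          (simp_all add: M.CM_linear M.CM_single M.CM_mult_closed M.CM_single_closed r_distr mult.commute)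
    qed (simp_all add: M.CM_linear M.CM_mult_closed l_distr)
  next
    show "lin_ext S \<theta> \<one>\<^bsub>M.CM\<^esub> = \<one>" by (simp add: M.CM_simps)
  next
    fix c x assume "x \<in> carrier M.CM"
    then show "lin_ext S \<theta> (c \<odot>\<^bsub>M.CM\<^esub> x) = c \<odot> lin_ext S \<theta> x"
      by (induction x rule: M.CM_induct)
        (simp_all add: M.CM_linear M.CM_single smult_add_right)
  next
    fix x assume "x \<in> carrier M.CM"
    then show "lin_ext S \<theta> (invol M.CM x) = invol S (lin_ext S \<theta> x)"
      by (induction x rule: M.CM_induct)
        (simp_all add: M.CM_linear M.CM_single)
  qed (simp_all add: M.CM_simps(4))
qed

end

section \<open>C*-seminorms\<close>

lemma null_comparison:
  fixes f g :: "nat \<Rightarrow> real"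
  assumes "\<And>k. norm (f k) \<le> g k" and "g \<longlonglongrightarrow> 0"
  shows "f \<longlonglongrightarrow> 0"
proof (rule tendsto_0_le[OF assms(2), where K = 1])
  show "\<forall>\<^sub>F k in sequentially. norm (f k) \<le> norm (g k) * 1"
    using assms(1) by (intro always_eventually allI) (metis abs_ge_self mult_1_right order_trans real_norm_def)
qed

locale cstar_seminormed = star_algebra S for S :: "('a, 'x) star_alg_scheme" (structure) +
  fixes p :: "'a \<Rightarrow> real"
  assumes seminorm: "cstar_seminorm S p"
begin

lemma p_nonneg [simp]: "x \<in> carrier S \<Longrightarrow> 0 \<le> p x"
  using seminorm by (simp add: cstar_seminorm_def)

lemma p_add_le: "x \<in> carrier S \<Longrightarrow> y \<in> carrier S \<Longrightarrow> p (x \<oplus> y) \<le> p x + p y"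
  using seminorm by (simp add: cstar_seminorm_def)

lemma p_smult: "x \<in> carrier S \<Longrightarrow> p (c \<odot> x) = cmod c * p x"
  using seminorm by (simp add: cstar_seminorm_def)

lemma p_mult_le: "x \<in> carrier S \<Longrightarrow> y \<in> carrier S \<Longrightarrow> p (x \<otimes> y) \<le> p x * p y"
  using seminorm by (simp add: cstar_seminorm_def)

lemma p_cstar: "x \<in> carrier S \<Longrightarrow> p (invol S x \<otimes> x) = (p x)\<^sup>2"
  using seminorm by (simp add: cstar_seminorm_def)

lemma p_zero [simp]: "p \<zero> = 0"
  using p_smult[of \<zero> 0] by simp

lemma p_uminus: "x \<in> carrier S \<Longrightarrow> p (\<ominus> x) = p x"
  by (simp add: uminus_eq_smult p_smult)

lemma p_minus_commute: "x \<in> carrier S \<Longrightarrow> y \<in> carrier S \<Longrightarrow> p (x \<ominus> y) = p (y \<ominus> x)"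
proof -
  assume xy: "x \<in> carrier S" "y \<in> carrier S"
  then have "x \<ominus> y = \<ominus> (y \<ominus> x)"
    by (simp add: a_minus_def minus_add a_comm)
  then show ?thesis using xy by (simp add: p_uminus)
qed

lemma p_minus_le: "x \<in> carrier S \<Longrightarrow> y \<in> carrier S \<Longrightarrow> p (x \<ominus> y) \<le> p x + p y"
  using p_add_le[of x "\<ominus> y"] by (simp add: a_minus_def p_uminus)

lemma minus_add_minus:
  "x \<in> carrier S \<Longrightarrow> y \<in> carrier S \<Longrightarrow> z \<in> carrier S \<Longrightarrow> (x \<ominus> y) \<oplus> (y \<ominus> z) = x \<ominus> z"
  by algebra

lemma p_triangle:
  "x \<in> carrier S \<Longrightarrow> y \<in> carrier S \<Longrightarrow> z \<in> carrier S \<Longrightarrow> p (x \<ominus> z) \<le> p (x \<ominus> y) + p (y \<ominus> z)"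
  using p_add_le[of "x \<ominus> y" "y \<ominus> z"] by (simp add: minus_add_minus)

lemma p_le_add_minus: "x \<in> carrier S \<Longrightarrow> y \<in> carrier S \<Longrightarrow> p x \<le> p (x \<ominus> y) + p y"
  using p_triangle[of x y \<zero>] by (simp add: a_minus_def)

lemma p_abs_diff_le: "x \<in> carrier S \<Longrightarrow> y \<in> carrier S \<Longrightarrow> \<bar>p x - p y\<bar> \<le> p (x \<ominus> y)"
  using p_le_add_minus[of x y] p_le_add_minus[of y x] p_minus_commute[of x y] by linarith

text \<open>The C*-identity and submultiplicativity give
  \<open>(p x)^2 \<le> p (invol S x) * p x\<close>, from which \<open>p x\<close> cancels unless it
  is zero. That the involution is isometric is not among the axioms of
  \<open>cstar_seminorm\<close>.\<close>

lemma p_invol_le: "x \<in> carrier S \<Longrightarrow> p x \<le> p (invol S x)"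
proof -
  assume x: "x \<in> carrier S"
  then have "p x * p x \<le> p (invol S x) * p x"
    using p_cstar[of x] p_mult_le[of "invol S x" x] by (simp add: power2_eq_square)
  then show ?thesis
    using x p_nonneg[of x] p_nonneg[of "invol S x"] by (metis invol_closed mult_right_le_imp_le order_le_less)
qed

lemma p_invol [simp]: "x \<in> carrier S \<Longrightarrow> p (invol S x) = p x"
  using p_invol_le[of x] p_invol_le[of "invol S x"] by simp

text \<open>The C*-identity makes \<open>p \<one>\<close> equal to its square, so it is
  \<open>0\<close> or \<open>1\<close>; the value \<open>0\<close> belongs to the zero
  seminorm.\<close>

lemma p_one_le: "p \<one> \<le> 1"
  using p_cstar[of \<one>] by (auto simp: power2_eq_square)

lemma p_minus_mult_le:
  assumes "x \<in> carrier S" "y \<in> carrier S" "x' \<in> carrier S" "y' \<in> carrier S"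
  shows "p (x \<otimes> y \<ominus> x' \<otimes> y') \<le> p (x \<ominus> x') * p y + p x' * p (y \<ominus> y')"
proof -
  have "x \<otimes> y \<ominus> x' \<otimes> y' = (x \<ominus> x') \<otimes> y \<oplus> x' \<otimes> (y \<ominus> y')"
    using assms by (simp add: minus_mult_left minus_mult_right minus_add_minus)
  then have "p (x \<otimes> y \<ominus> x' \<otimes> y') \<le> p ((x \<ominus> x') \<otimes> y) + p (x' \<otimes> (y \<ominus> y'))"
    using assms by (simp add: p_add_le)
  also have "\<dots> \<le> p (x \<ominus> x') * p y + p x' * p (y \<ominus> y')"
    using assms by (intro add_mono p_mult_le) auto
  finally show ?thesis .
qed

lemma minus_add_add:
  "x \<in> carrier S \<Longrightarrow> y \<in> carrier S \<Longrightarrow> x' \<in> carrier S \<Longrightarrow> y' \<in> carrier S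
    \<Longrightarrow> (x \<oplus> y) \<ominus> (x' \<oplus> y') = (x \<ominus> x') \<oplus> (y \<ominus> y')"
  by algebra

lemma p_minus_add_le:
  "x \<in> carrier S \<Longrightarrow> y \<in> carrier S \<Longrightarrow> x' \<in> carrier S \<Longrightarrow> y' \<in> carrier S
    \<Longrightarrow> p ((x \<oplus> y) \<ominus> (x' \<oplus> y')) \<le> p (x \<ominus> x') + p (y \<ominus> y')"
  by (simp add: minus_add_add p_add_le)

definition tends :: "(nat \<Rightarrow> 'a) \<Rightarrow> 'a \<Rightarrow> bool" where
  "tends s x \<longleftrightarrow> range s \<subseteq> carrier S \<and> x \<in> carrier S \<and> (\<lambda>k. p (s k \<ominus> x)) \<longlonglongrightarrow> 0"

definition cauchy :: "(nat \<Rightarrow> 'a) \<Rightarrow> bool" where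
  "cauchy s \<longleftrightarrow> range s \<subseteq> carrier S \<and> (\<forall>\<epsilon>>0. \<exists>N. \<forall>k\<ge>N. \<forall>l\<ge>N. p (s k \<ominus> s l) < \<epsilon>)"

lemma cauchy_closed [simp]: "cauchy s \<Longrightarrow> s k \<in> carrier S"
  by (auto simp: cauchy_def)

lemma cauchyD: "cauchy s \<Longrightarrow> \<epsilon> > 0 \<Longrightarrow> \<exists>N. \<forall>k\<ge>N. \<forall>l\<ge>N. p (s k \<ominus> s l) < \<epsilon>"
  by (auto simp: cauchy_def)

lemma cauchy_const [simp]: "x \<in> carrier S \<Longrightarrow> cauchy (\<lambda>k. x)"
  by (auto simp: cauchy_def a_minus_def r_neg)

lemma tendsI: "(\<And>k. s k \<in> carrier S) \<Longrightarrow> x \<in> carrier S \<Longrightarrow> (\<lambda>k. p (s k \<ominus> x)) \<longlonglongrightarrow> 0 \<Longrightarrow> tends s x"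
  by (auto simp: tends_def)

lemma tendsD: "tends s x \<Longrightarrow> s k \<in> carrier S" "tends s x \<Longrightarrow> x \<in> carrier S"
  "tends s x \<Longrightarrow> (\<lambda>k. p (s k \<ominus> x)) \<longlonglongrightarrow> 0"
  by (auto simp: tends_def)

lemma tends_le:
  assumes "\<And>k. s k \<in> carrier S" "x \<in> carrier S" "f \<longlonglongrightarrow> 0" "\<And>k. p (s k \<ominus> x) \<le> f k"
  shows "tends s x"
  by (intro tendsI assms tendsto_sandwich[OF _ _ tendsto_const assms(3)])
     (use assms in auto)

lemma tends_norm: "tends s x \<Longrightarrow> (\<lambda>k. p (s k)) \<longlonglongrightarrow> p x"
  by (rule LIM_zero_cancel, rule null_comparison[where g = "\<lambda>k. p (s k \<ominus> x)"])
     (auto simp: tendsD p_abs_diff_le)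

lemma tends_const: "x \<in> carrier S \<Longrightarrow> tends (\<lambda>k. x) x"
  by (auto simp: tends_def a_minus_def r_neg)

lemma tends_add:
  assumes "tends s x" "tends t y"
  shows "tends (\<lambda>k. s k \<oplus> t k) (x \<oplus> y)"
proof (rule tends_le)
  show "(\<lambda>k. p (s k \<ominus> x) + p (t k \<ominus> y)) \<longlonglongrightarrow> 0"
    using tendsto_add[OF tendsD(3)[OF assms(1)] tendsD(3)[OF assms(2)]] by simp
qed (use assms[THEN tendsD(1)] assms[THEN tendsD(2)] in \<open>auto intro: p_minus_add_le\<close>)

lemma tends_mult:
  assumes "tends s x" "tends t y"
  shows "tends (\<lambda>k. s k \<otimes> t k) (x \<otimes> y)"
proof (rule tends_le)
  show "(\<lambda>k. p (s k \<ominus> x) * p (t k) + p x * p (t k \<ominus> y)) \<longlonglongrightarrow> 0"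
    using tendsto_add[OF tendsto_mult[OF tendsD(3)[OF assms(1)] tends_norm[OF assms(2)]]
        tendsto_mult[OF tendsto_const tendsD(3)[OF assms(2)]]] by simp
qed (use assms[THEN tendsD(1)] assms[THEN tendsD(2)] in \<open>auto intro: p_minus_mult_le\<close>)

lemma tends_smult:
  assumes "tends s x"
  shows "tends (\<lambda>k. c \<odot> s k) (c \<odot> x)"
  using assms tendsto_mult[OF tendsto_const tendsD(3)[OF assms], of "cmod c"]
  by (intro tends_le[where f = "\<lambda>k. cmod c * p (s k \<ominus> x)"])
     (auto simp: tendsD p_smult smult_diff_right[symmetric])

lemma tends_invol:
  assumes "tends s x"
  shows "tends (\<lambda>k. invol S (s k)) (invol S x)"
  using assms by (intro tends_le[OF _ _ tendsD(3)[OF assms]])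
     (auto simp: tendsD simp flip: invol_minus)

lemma tends_diff_null:
  assumes "tends s x" "\<And>k. t k \<in> carrier S" "(\<lambda>k. p (s k \<ominus> t k)) \<longlonglongrightarrow> 0"
  shows "tends t x"
proof (rule tends_le)
  show "(\<lambda>k. p (s k \<ominus> t k) + p (s k \<ominus> x)) \<longlonglongrightarrow> 0"
    using tendsto_add[OF assms(3) tendsD(3)[OF assms(1)]] by simp
  show "p (t k \<ominus> x) \<le> p (s k \<ominus> t k) + p (s k \<ominus> x)" for k
    using p_triangle[of "t k" "s k" x] p_minus_commute[of "t k" "s k"] assms tendsD[OF assms(1)]
    by simp
qed (use assms tendsD[OF assms(1)] in auto)

lemma tends_limit_null:
  assumes "tends s x" "tends s y"
  shows "p (x \<ominus> y) = 0"
proof (rule LIMSEQ_unique[OF tendsto_const])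
  have "(\<lambda>k. p (s k \<ominus> x) + p (s k \<ominus> y)) \<longlonglongrightarrow> 0"
    using tendsto_add[OF tendsD(3)[OF assms(1)] tendsD(3)[OF assms(2)]] by simp
  then show "(\<lambda>k::nat. p (x \<ominus> y)) \<longlonglongrightarrow> 0"
    by (rule null_comparison[rotated, where g = "\<lambda>k. p (s k \<ominus> x) + p (s k \<ominus> y)"])
       (use p_triangle[of x "s _" y] p_minus_commute[of x "s _"] tendsD[OF assms(1)] tendsD[OF assms(2)]
        in auto)
qed

lemma cauchy_norm_convergent:
  assumes "cauchy s"
  shows "convergent (\<lambda>k. p (s k))"
proof -
  have "Cauchy (\<lambda>k. p (s k))"
  proof (rule CauchyI)
    fix e :: real assume "e > 0"
    then obtain N where N: "\<And>k l. k \<ge> N \<Longrightarrow> l \<ge> N \<Longrightarrow> p (s k \<ominus> s l) < e"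
      using cauchyD[OF assms] by blast
    have "norm (p (s k) - p (s l)) < e" if "k \<ge> N" "l \<ge> N" for k l
      using p_abs_diff_le[of "s k" "s l"] N[OF that] assms by simp
    then show "\<exists>M. \<forall>m\<ge>M. \<forall>n\<ge>M. norm (p (s m) - p (s n)) < e" by blast
  qed
  then show ?thesis by (rule Cauchy_convergent)
qed

lemma cauchy_bounded: "cauchy s \<Longrightarrow> \<exists>K>0. \<forall>k. p (s k) \<le> K"
proof -
  assume "cauchy s"
  then have "Bseq (\<lambda>k. p (s k))" by (intro convergent_imp_Bseq cauchy_norm_convergent)
  then obtain K where "K > 0" "\<And>k. norm (p (s k)) \<le> K" by (auto simp: Bseq_def)
  then show ?thesis by (intro exI[of _ K]) (auto simp: abs_le_iff)
qed

text \<open>The one epsilon argument behind all operations on Cauchy sequences: each of them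
  supplies only a Lipschitz estimate. For unary operations \<open>t\<close> is the constant zero
  sequence.\<close>

lemma cauchy_le:
  assumes "cauchy s" "cauchy t" "K > 0" "\<And>k. u k \<in> carrier S"
    and "\<And>k l. p (u k \<ominus> u l) \<le> K * (p (s k \<ominus> s l) + p (t k \<ominus> t l))"
  shows "cauchy u"
  unfolding cauchy_def
proof (intro conjI allI impI)
  show "range u \<subseteq> carrier S" using assms by auto
  fix \<epsilon> :: real assume "\<epsilon> > 0"
  then have e: "\<epsilon> / (2 * K) > 0" using assms by simp
  obtain N1 where N1: "\<And>k l. k \<ge> N1 \<Longrightarrow> l \<ge> N1 \<Longrightarrow> p (s k \<ominus> s l) < \<epsilon> / (2 * K)"
    using cauchyD[OF assms(1) e] by blast
  obtain N2 where N2: "\<And>k l. k \<ge> N2 \<Longrightarrow> l \<ge> N2 \<Longrightarrow> p (t k \<ominus> t l) < \<epsilon> / (2 * K)"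
    using cauchyD[OF assms(2) e] by blast
  have "p (u k \<ominus> u l) < \<epsilon>" if "k \<ge> max N1 N2" "l \<ge> max N1 N2" for k l
  proof -
    have "p (s k \<ominus> s l) + p (t k \<ominus> t l) < \<epsilon> / K"
      using N1[of k l] N2[of k l] that by (simp add: field_simps)
    then have "K * (p (s k \<ominus> s l) + p (t k \<ominus> t l)) < \<epsilon>" using assms(3) by (simp add: field_simps)
    then show ?thesis using assms(5)[of k l] by linarith
  qed
  then show "\<exists>N. \<forall>k\<ge>N. \<forall>l\<ge>N. p (u k \<ominus> u l) < \<epsilon>" by blast
qed

lemma cauchy_add: "cauchy s \<Longrightarrow> cauchy t \<Longrightarrow> cauchy (\<lambda>k. s k \<oplus> t k)"
  by (rule cauchy_le[where K = 1 and s = s and t = t]) (auto intro: p_minus_add_le)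

lemma cauchy_smult: "cauchy s \<Longrightarrow> cauchy (\<lambda>k. c \<odot> s k)"
  by (rule cauchy_le[where K = "cmod c + 1" and s = s and t = "\<lambda>k. \<zero>"])
     (auto simp: p_smult a_minus_def r_neg add_nonneg_pos mult_right_mono distrib_right
       simp flip: smult_diff_right smult_minus_right smult_add_right)

lemma cauchy_invol: "cauchy s \<Longrightarrow> cauchy (\<lambda>k. invol S (s k))"
  by (rule cauchy_le[where K = 1 and s = s and t = "\<lambda>k. \<zero>"])
     (auto simp: a_minus_def r_neg simp flip: invol_add invol_uminus)

lemma cauchy_mult:
  assumes "cauchy s" "cauchy t"
  shows "cauchy (\<lambda>k. s k \<otimes> t k)"
proof -
  obtain K where K: "K > 0" "\<And>k. p (s k) \<le> K" using cauchy_bounded[OF assms(1)] by blast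
  obtain L where L: "L > 0" "\<And>k. p (t k) \<le> L" using cauchy_bounded[OF assms(2)] by blast
  have "p (s k \<otimes> t k \<ominus> s l \<otimes> t l) \<le> (K + L) * (p (s k \<ominus> s l) + p (t k \<ominus> t l))" for k l
  proof -
    have "p (s k \<otimes> t k \<ominus> s l \<otimes> t l) \<le> p (s k \<ominus> s l) * p (t k) + p (s l) * p (t k \<ominus> t l)"
      using assms by (intro p_minus_mult_le) auto
    also have "\<dots> \<le> p (s k \<ominus> s l) * (K + L) + (K + L) * p (t k \<ominus> t l)"
      using assms K(1) L(1) L(2)[of k] K(2)[of l]
      by (intro add_mono mult_mono) auto
    finally show ?thesis by (simp add: algebra_simps)
  qed
  then show ?thesis
    using K L assms by (intro cauchy_le[where K = "K + L", OF assms]) (auto intro: add_pos_pos)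
qed

end


section \<open>C*-algebras and Hausdorff completions\<close>

text \<open>Completeness is spelled out because \<open>cauchy\<close> and \<open>tends\<close>
  become available only through the sublocale declaration that follows.\<close>

locale cstar = star_algebra A for A :: "('a, 'x) cstar_alg_scheme" (structure) +
  assumes cnorm_seminorm: "cstar_seminorm A (cnorm A)"
    and cnorm_definite: "x \<in> carrier A \<Longrightarrow> cnorm A x = 0 \<Longrightarrow> x = \<zero>"
    and cnorm_complete: "range s \<subseteq> carrier A
      \<Longrightarrow> (\<forall>\<epsilon>>0. \<exists>N. \<forall>k\<ge>N. \<forall>l\<ge>N. cnorm A (s k \<ominus> s l) < \<epsilon>)
      \<Longrightarrow> \<exists>x\<in>carrier A. (\<lambda>k. cnorm A (s k \<ominus> x)) \<longlonglongrightarrow> 0"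

sublocale cstar \<subseteq> cstar_seminormed A "cnorm A"
  by unfold_locales (rule cnorm_seminorm)

context cstar
begin

lemma cauchy_tends: "cauchy s \<Longrightarrow> \<exists>x. tends s x"
  using cnorm_complete[of s] by (auto simp: cauchy_def tends_def)

lemma eq_if_cnorm_zero: "x \<in> carrier A \<Longrightarrow> y \<in> carrier A \<Longrightarrow> cnorm A (x \<ominus> y) = 0 \<Longrightarrow> x = y"
  using cnorm_definite[of "x \<ominus> y"] eq_if_minus_zero[of x y] by simp

lemma tends_unique: "tends s x \<Longrightarrow> tends s y \<Longrightarrow> x = y"
  using tends_limit_null[of s x y] eq_if_cnorm_zero[of x y] by (simp add: tendsD)

end

lemma cstarI:
  assumes "cstar_seminormed A (cnorm A)"
    and "\<And>x. x \<in> carrier A \<Longrightarrow> cnorm A x = 0 \<Longrightarrow> x = \<zero>\<^bsub>A\<^esub>"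
    and "\<And>s. cstar_seminormed.cauchy A (cnorm A) s \<Longrightarrow> \<exists>x. cstar_seminormed.tends A (cnorm A) s x"
  shows "cstar A"
proof -
  interpret cstar_seminormed A "cnorm A" by fact
  show ?thesis
  proof unfold_locales
    fix s :: "nat \<Rightarrow> _" assume "range s \<subseteq> carrier A"
      "\<forall>\<epsilon>>0. \<exists>N. \<forall>k\<ge>N. \<forall>l\<ge>N. cnorm A (s k \<ominus>\<^bsub>A\<^esub> s l) < \<epsilon>"
    then have "cauchy s" unfolding cauchy_def by (intro conjI)
    from assms(3)[OF this] show "\<exists>x\<in>carrier A. (\<lambda>k. cnorm A (s k \<ominus>\<^bsub>A\<^esub> x)) \<longlonglongrightarrow> 0"
      using tendsD by blast
  qed (fact seminorm, fact assms(2))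
qed

context cstar_seminormed
begin

abbreviation "H \<equiv> completion S p"
abbreviation "cls s \<equiv> cauchy_rel S p `` {s}"

lemma cauchy_rel_iff:
  "(s, t) \<in> cauchy_rel S p \<longleftrightarrow> cauchy s \<and> cauchy t \<and> (\<lambda>k. p (s k \<ominus> t k)) \<longlonglongrightarrow> 0"
  by (auto simp: cauchy_rel_def cauchy_def)

lemma null_le:
  assumes "(\<lambda>k. f k) \<longlonglongrightarrow> 0" "(\<lambda>k. g k) \<longlonglongrightarrow> 0" "\<And>k. u k \<in> carrier S" "\<And>k. p (u k) \<le> K * f k + L * g k"
  shows "(\<lambda>k. p (u k)) \<longlonglongrightarrow> 0"
proof (rule null_comparison)
  show "(\<lambda>k. K * f k + L * g k) \<longlonglongrightarrow> 0"
    using tendsto_add[OF tendsto_mult[OF tendsto_const assms(1)] tendsto_mult[OF tendsto_const assms(2)]]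
    by simp
qed (use assms in auto)

lemma equiv_cauchy_rel: "equiv (Collect cauchy) (cauchy_rel S p)"
proof (rule equivI)
  show "refl_on (Collect cauchy) (cauchy_rel S p)"
    by (auto simp: refl_on_def cauchy_rel_iff a_minus_def r_neg)
  show "cauchy_rel S p \<subseteq> Collect cauchy \<times> Collect cauchy"
    by (auto simp: cauchy_rel_iff)
  show "sym (cauchy_rel S p)"
    by (auto simp: sym_def cauchy_rel_iff p_minus_commute)
  show "trans (cauchy_rel S p)"
  proof (rule transI)
    fix s t u assume "(s, t) \<in> cauchy_rel S p" "(t, u) \<in> cauchy_rel S p"
    then have *: "cauchy s" "cauchy t" "cauchy u" "(\<lambda>k. p (s k \<ominus> t k)) \<longlonglongrightarrow> 0"
      "(\<lambda>k. p (t k \<ominus> u k)) \<longlonglongrightarrow> 0" by (auto simp: cauchy_rel_iff)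
    then have "(\<lambda>k. p (s k \<ominus> u k)) \<longlonglongrightarrow> 0"
      by (intro null_le[OF *(4,5), where K = 1 and L = 1]) (auto intro: p_triangle)
    then show "(s, u) \<in> cauchy_rel S p" using * by (simp add: cauchy_rel_iff)
  qed
qed

lemma Domain_cauchy_rel: "Domain (cauchy_rel S p) = Collect cauchy"
proof (intro equalityI subsetI)
  fix s assume "s \<in> Collect cauchy"
  then have "(s, s) \<in> cauchy_rel S p" by (simp add: cauchy_rel_iff a_minus_def r_neg)
  then show "s \<in> Domain (cauchy_rel S p)" by blast
qed (auto simp: cauchy_rel_iff)

lemma carrier_H: "carrier H = {cls s | s. cauchy s}"
  by (auto simp: completion_def Let_def Domain_cauchy_rel quotient_def)

lemma H_cases: "X \<in> carrier H \<Longrightarrow> (\<And>s. cauchy s \<Longrightarrow> X = cls s \<Longrightarrow> thesis) \<Longrightarrow> thesis"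
  by (auto simp: carrier_H)

lemma cls_closed [simp]: "cauchy s \<Longrightarrow> cls s \<in> carrier H"
  by (auto simp: carrier_H)

lemma cls_eq_iff: "cauchy s \<Longrightarrow> cauchy t \<Longrightarrow> cls s = cls t \<longleftrightarrow> (\<lambda>k. p (s k \<ominus> t k)) \<longlonglongrightarrow> 0"
  using eq_equiv_class_iff[OF equiv_cauchy_rel, of s t] by (simp add: cauchy_rel_iff)

lemma cls_eqI: "cauchy s \<Longrightarrow> cauchy t \<Longrightarrow> (\<lambda>k. p (s k \<ominus> t k)) \<longlonglongrightarrow> 0 \<Longrightarrow> cls s = cls t"
  by (simp add: cls_eq_iff)

lemma H_one: "\<one>\<^bsub>H\<^esub> = cls (\<lambda>k. \<one>)" and H_zero: "\<zero>\<^bsub>H\<^esub> = cls (\<lambda>k. \<zero>)"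
  by (simp_all add: completion_def Let_def)

lemma H_mult:
  assumes "cauchy s" "cauchy t"
  shows "cls s \<otimes>\<^bsub>H\<^esub> cls t = cls (\<lambda>k. s k \<otimes> t k)"
proof -
  have "congruent2 (cauchy_rel S p) (cauchy_rel S p) (\<lambda>s t. cls (\<lambda>k. s k \<otimes> t k))"
    unfolding congruent2_def
  proof clarify
    fix s s' t t' assume "(s, s') \<in> cauchy_rel S p" "(t, t') \<in> cauchy_rel S p"
    then have *: "cauchy s" "cauchy s'" "cauchy t" "cauchy t'" "(\<lambda>k. p (s k \<ominus> s' k)) \<longlonglongrightarrow> 0"
      "(\<lambda>k. p (t k \<ominus> t' k)) \<longlonglongrightarrow> 0" by (auto simp: cauchy_rel_iff)
    obtain K where K: "K > 0" "\<And>k. p (s' k) \<le> K" using cauchy_bounded[OF *(2)] by blast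
    obtain L where L: "L > 0" "\<And>k. p (t k) \<le> L" using cauchy_bounded[OF *(3)] by blast
    show "cls (\<lambda>k. s k \<otimes> t k) = cls (\<lambda>k. s' k \<otimes> t' k)"
    proof (intro cls_eqI cauchy_mult * null_le[OF *(5,6), where K = L and L = K])
      fix k
      have "p (s k \<otimes> t k \<ominus> s' k \<otimes> t' k) \<le> p (s k \<ominus> s' k) * p (t k) + p (s' k) * p (t k \<ominus> t' k)"
        using * by (intro p_minus_mult_le) auto
      also have "\<dots> \<le> p (s k \<ominus> s' k) * L + K * p (t k \<ominus> t' k)"
        using * K(2)[of k] L(2)[of k] by (intro add_mono mult_mono) (auto simp: K L less_imp_le)
      finally show "p (s k \<otimes> t k \<ominus> s' k \<otimes> t' k) \<le> L * p (s k \<ominus> s' k) + K * p (t k \<ominus> t' k)"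
        by (simp add: mult.commute)
    qed (use * in auto)
  qed
  from UN_equiv_class2[OF equiv_cauchy_rel equiv_cauchy_rel this] assms show ?thesis
    by (simp add: completion_def Let_def)
qed

lemma H_add:
  assumes "cauchy s" "cauchy t"
  shows "cls s \<oplus>\<^bsub>H\<^esub> cls t = cls (\<lambda>k. s k \<oplus> t k)"
proof -
  have "congruent2 (cauchy_rel S p) (cauchy_rel S p) (\<lambda>s t. cls (\<lambda>k. s k \<oplus> t k))"
    unfolding congruent2_def
  proof clarify
    fix s s' t t' assume "(s, s') \<in> cauchy_rel S p" "(t, t') \<in> cauchy_rel S p"
    then have *: "cauchy s" "cauchy s'" "cauchy t" "cauchy t'" "(\<lambda>k. p (s k \<ominus> s' k)) \<longlonglongrightarrow> 0"
      "(\<lambda>k. p (t k \<ominus> t' k)) \<longlonglongrightarrow> 0" by (auto simp: cauchy_rel_iff)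
    show "cls (\<lambda>k. s k \<oplus> t k) = cls (\<lambda>k. s' k \<oplus> t' k)"
      by (intro cls_eqI cauchy_add * null_le[OF *(5,6), where K = 1 and L = 1])
         (use * in \<open>auto intro: p_minus_add_le\<close>)
  qed
  from UN_equiv_class2[OF equiv_cauchy_rel equiv_cauchy_rel this] assms show ?thesis
    by (simp add: completion_def Let_def)
qed

lemma H_smult:
  assumes "cauchy s"
  shows "c \<odot>\<^bsub>H\<^esub> cls s = cls (\<lambda>k. c \<odot> s k)"
proof -
  have "congruent (cauchy_rel S p) (\<lambda>s. cls (\<lambda>k. c \<odot> s k))"
    unfolding congruent_def
  proof clarify
    fix s s' assume "(s, s') \<in> cauchy_rel S p"
    then have *: "cauchy s" "cauchy s'" "(\<lambda>k. p (s k \<ominus> s' k)) \<longlonglongrightarrow> 0" by (auto simp: cauchy_rel_iff)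
    show "cls (\<lambda>k. c \<odot> s k) = cls (\<lambda>k. c \<odot> s' k)"
      by (intro cls_eqI cauchy_smult * null_le[OF *(3) *(3), where K = "cmod c" and L = 0])
         (use * in \<open>auto simp: p_smult simp flip: smult_diff_right\<close>)
  qed
  from UN_equiv_class[OF equiv_cauchy_rel this] assms show ?thesis
    by (simp add: completion_def Let_def)
qed

lemma H_invol:
  assumes "cauchy s"
  shows "invol H (cls s) = cls (\<lambda>k. invol S (s k))"
proof -
  have "congruent (cauchy_rel S p) (\<lambda>s. cls (\<lambda>k. invol S (s k)))"
    unfolding congruent_def
  proof clarify
    fix s s' assume "(s, s') \<in> cauchy_rel S p"
    then have *: "cauchy s" "cauchy s'" "(\<lambda>k. p (s k \<ominus> s' k)) \<longlonglongrightarrow> 0" by (auto simp: cauchy_rel_iff)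
    show "cls (\<lambda>k. invol S (s k)) = cls (\<lambda>k. invol S (s' k))"
      by (intro cls_eqI cauchy_invol * null_le[OF *(3) *(3), where K = 1 and L = 0])
         (use * in \<open>auto simp flip: invol_minus\<close>)
  qed
  from UN_equiv_class[OF equiv_cauchy_rel this] assms show ?thesis
    by (simp add: completion_def Let_def)
qed

lemmas H_ops = H_mult H_add H_smult H_invol H_one H_zero
lemmas cauchy_ops = cauchy_mult cauchy_add cauchy_smult cauchy_invol cauchy_const

lemma star_algebra_H: "star_algebra H"
proof -
  note [simp] = H_ops cauchy_ops
  have add: "cls s \<oplus>\<^bsub>H\<^esub> cls t = cls t \<oplus>\<^bsub>H\<^esub> cls s" if "cauchy s" "cauchy t" for s t
    using that by (simp add: a_comm)
  show ?thesis
  proof (rule star_algebraI)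
    show "ring H"
    proof (rule ringI)
      show "abelian_group H"
      proof (rule abelian_groupI)
        fix X assume "X \<in> carrier H"
        then obtain s where s: "cauchy s" "X = cls s" by (rule H_cases)
        moreover have "(- 1) \<odot> x \<oplus> x = \<zero>" if "x \<in> carrier S" for x
          using that by (simp add: uminus_eq_smult[symmetric] l_neg)
        ultimately have "cls (\<lambda>k. (- 1) \<odot> s k) \<oplus>\<^bsub>H\<^esub> X = \<zero>\<^bsub>H\<^esub>" by simp
        moreover have "cls (\<lambda>k. (- 1) \<odot> s k) \<in> carrier H"
          using s by (intro cls_closed cauchy_smult)
        ultimately show "\<exists>Y\<in>carrier H. Y \<oplus>\<^bsub>H\<^esub> X = \<zero>\<^bsub>H\<^esub>" by blast
        show "\<zero>\<^bsub>H\<^esub> \<oplus>\<^bsub>H\<^esub> X = X" using s by simp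
        fix Y assume "Y \<in> carrier H"
        then obtain t where t: "cauchy t" "Y = cls t" by (rule H_cases)
        show "X \<oplus>\<^bsub>H\<^esub> Y \<in> carrier H" using s t by simp
        show "X \<oplus>\<^bsub>H\<^esub> Y = Y \<oplus>\<^bsub>H\<^esub> X" using s t add by blast
        fix Z assume "Z \<in> carrier H"
        then obtain u where u: "cauchy u" "Z = cls u" by (rule H_cases)
        show "X \<oplus>\<^bsub>H\<^esub> Y \<oplus>\<^bsub>H\<^esub> Z = X \<oplus>\<^bsub>H\<^esub> (Y \<oplus>\<^bsub>H\<^esub> Z)"
          using s t u by (simp add: a_assoc)
      qed simp
      show "Group.monoid H"
        by (rule monoidI) (auto simp: m_assoc elim!: H_cases)
    qed (auto simp: l_distr r_distr elim!: H_cases)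
  qed (auto simp: smult_add_left smult_add_right elim!: H_cases)
qed

interpretation H: star_algebra H by (rule star_algebra_H)

lemma H_minus: "cauchy s \<Longrightarrow> cauchy t \<Longrightarrow> cls s \<ominus>\<^bsub>H\<^esub> cls t = cls (\<lambda>k. s k \<ominus> t k)"
  by (simp add: H.minus_eq_smult minus_eq_smult H_ops cauchy_ops)

lemma cauchy_minus: "cauchy s \<Longrightarrow> cauchy t \<Longrightarrow> cauchy (\<lambda>k. s k \<ominus> t k)"
  by (simp add: minus_eq_smult cauchy_ops)

text \<open>Equivalent sequences have the same limit of seminorms, so the definite description in
  \<open>completion\<close> has a unique solution.\<close>

lemma H_norm:
  assumes "cauchy s"
  shows "(\<lambda>k. p (s k)) \<longlonglongrightarrow> cnorm H (cls s)"
proof -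
  obtain r where r: "(\<lambda>k. p (s k)) \<longlonglongrightarrow> r"
    using cauchy_norm_convergent[OF assms] by (auto simp: convergent_def)
  have lim: "(\<lambda>k. p (t k)) \<longlonglongrightarrow> r" if "t \<in> cls s" for t
  proof -
    have t: "cauchy t" "(\<lambda>k. p (s k \<ominus> t k)) \<longlonglongrightarrow> 0" using that by (auto simp: cauchy_rel_iff)
    have "(\<lambda>k. p (t k) - p (s k)) \<longlonglongrightarrow> 0"
      by (rule null_comparison[OF _ t(2)])
         (use t assms p_abs_diff_le[of "t _" "s _"] in \<open>auto simp: p_minus_commute\<close>)
    from tendsto_add[OF this r] show ?thesis by simp
  qed
  have s: "s \<in> cls s" using assms by (auto simp: cauchy_rel_iff a_minus_def r_neg)
  have "cnorm H (cls s) = (THE r. \<forall>t\<in>cls s. (\<lambda>k. p (t k)) \<longlonglongrightarrow> r)"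
    by (simp add: completion_def Let_def)
  also have "\<dots> = r"
    using s lim by (intro the_equality) (auto intro: LIMSEQ_unique r)
  finally show ?thesis using r by simp
qed

abbreviation "to_H \<equiv> to_completion S p"

lemma to_H_eq: "to_H x = cls (\<lambda>k. x)"
  by (simp add: to_completion_def)

lemma to_H_closed [simp]: "x \<in> carrier S \<Longrightarrow> to_H x \<in> carrier H"
  by (simp add: to_H_eq)

lemma star_hom_to_H: "star_hom S H to_H"
  by (rule star_homI) (simp_all add: to_H_eq H_ops)

lemma cnorm_to_H: "x \<in> carrier S \<Longrightarrow> cnorm H (to_H x) = p x"
  using H_norm[of "\<lambda>k. x"] by (simp add: to_H_eq LIMSEQ_const_iff)

lemma to_H_eq_iff: "x \<in> carrier S \<Longrightarrow> y \<in> carrier S \<Longrightarrow> to_H x = to_H y \<longleftrightarrow> p (x \<ominus> y) = 0"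
  by (auto simp: to_H_eq cls_eq_iff LIMSEQ_const_iff)

lemma cstar_seminorm_H: "cstar_seminorm H (cnorm H)"
  unfolding cstar_seminorm_def
proof (intro conjI ballI allI)
  fix X assume "X \<in> carrier H"
  then obtain s where s: "cauchy s" "X = cls s" by (rule H_cases)
  show "0 \<le> cnorm H X"
    using s by (intro LIMSEQ_le_const[OF H_norm[OF s(1), folded s(2)]]) auto
  show "cnorm H (c \<odot>\<^bsub>H\<^esub> X) = cmod c * cnorm H X" for c
    using s H_norm[OF cauchy_smult[OF s(1), of c]] tendsto_mult[OF tendsto_const H_norm[OF s(1)], of "cmod c"]
    by (simp add: H_ops p_smult LIMSEQ_unique)
  show "cnorm H (invol H X \<otimes>\<^bsub>H\<^esub> X) = (cnorm H X)\<^sup>2"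
    using s H_norm[OF cauchy_mult[OF cauchy_invol[OF s(1)] s(1)]] tendsto_power[OF H_norm[OF s(1)], of 2]
    by (simp add: H_ops p_cstar cauchy_ops LIMSEQ_unique)
  fix Y assume "Y \<in> carrier H"
  then obtain t where t: "cauchy t" "Y = cls t" by (rule H_cases)
  show "cnorm H (X \<oplus>\<^bsub>H\<^esub> Y) \<le> cnorm H X + cnorm H Y"
    using s t p_add_le
    by (auto intro!: LIMSEQ_le[OF H_norm[OF cauchy_add[OF s(1) t(1)]] tendsto_add[OF H_norm[OF s(1)] H_norm[OF t(1)]]]
        simp: H_ops)
  show "cnorm H (X \<otimes>\<^bsub>H\<^esub> Y) \<le> cnorm H X * cnorm H Y"
    using s t p_mult_le
    by (auto intro!: LIMSEQ_le[OF H_norm[OF cauchy_mult[OF s(1) t(1)]] tendsto_mult[OF H_norm[OF s(1)] H_norm[OF t(1)]]]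
        simp: H_ops)
qed

interpretation H: cstar_seminormed H "cnorm H"
  by unfold_locales (rule cstar_seminorm_H)

text \<open>A class is the limit of the constants taken from any of its representatives; hence the
  image of \<open>S\<close> is dense, and continuous maps are determined on it.\<close>

lemma H_tends_cls:
  assumes "cauchy s"
  shows "H.tends (\<lambda>k. to_H (s k)) (cls s)"
proof (rule H.tendsI)
  show "(\<lambda>k. cnorm H (to_H (s k) \<ominus>\<^bsub>H\<^esub> cls s)) \<longlonglongrightarrow> 0"
  proof (rule LIMSEQ_I)
    fix r :: real assume r: "0 < r"
    then obtain N where N: "\<And>k l. k \<ge> N \<Longrightarrow> l \<ge> N \<Longrightarrow> p (s k \<ominus> s l) < r / 2"
      using cauchyD[OF assms, of "r / 2"] by auto
    have "norm (cnorm H (to_H (s k) \<ominus>\<^bsub>H\<^esub> cls s) - 0) < r" if "k \<ge> N" for k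
    proof -
      have "(\<lambda>l. p (s k \<ominus> s l)) \<longlonglongrightarrow> cnorm H (to_H (s k) \<ominus>\<^bsub>H\<^esub> cls s)"
        using H_norm[OF cauchy_minus[of "\<lambda>l. s k" s]] assms by (simp add: to_H_eq H_minus)
      then have "cnorm H (to_H (s k) \<ominus>\<^bsub>H\<^esub> cls s) \<le> r / 2"
        by (rule LIMSEQ_le_const2) (use N[OF that] in \<open>auto intro!: exI[of _ N] less_imp_le\<close>)
      then show ?thesis using r H.p_nonneg[of "to_H (s k) \<ominus>\<^bsub>H\<^esub> cls s"] assms by simp
    qed
    then show "\<exists>N. \<forall>k\<ge>N. norm (cnorm H (to_H (s k) \<ominus>\<^bsub>H\<^esub> cls s) - 0) < r" by blast
  qed
qed (use assms in auto)

lemma H_dense: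
  assumes "X \<in> carrier H" "\<epsilon> > 0"
  shows "\<exists>x\<in>carrier S. cnorm H (to_H x \<ominus>\<^bsub>H\<^esub> X) < \<epsilon>"
proof -
  obtain s where s: "cauchy s" "X = cls s" using assms(1) by (rule H_cases)
  obtain k where "norm (cnorm H (to_H (s k) \<ominus>\<^bsub>H\<^esub> X)) < \<epsilon>"
    using LIMSEQ_D[OF H.tendsD(3)[OF H_tends_cls[OF s(1)]] assms(2)] s by auto
  then show ?thesis using s by (intro bexI[of _ "s k"]) auto
qed

theorem cstar_H: "cstar H"
proof (rule cstarI)
  show "cstar_seminormed H (cnorm H)" by unfold_locales
next
  fix X assume "X \<in> carrier H" "cnorm H X = 0"
  then obtain s where s: "cauchy s" "X = cls s" by (auto elim: H_cases)
  then have "(\<lambda>k. p (s k \<ominus> \<zero>)) \<longlonglongrightarrow> 0"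
    using H_norm[OF s(1)] \<open>cnorm H X = 0\<close> by (simp add: a_minus_def)
  then show "X = \<zero>\<^bsub>H\<^esub>" using s by (simp add: H_ops cls_eq_iff)
next
  fix X assume X: "H.cauchy X"
  \<comment> \<open>Constants chosen within \<open>1 / (k + 1)\<close> of \<open>X k\<close> form a
    Cauchy sequence in \<open>S\<close>, and the class of that sequence is the limit of
    \<open>X\<close>.\<close>
  have "\<exists>x. x \<in> carrier S \<and> cnorm H (to_H x \<ominus>\<^bsub>H\<^esub> X k) < inverse (real (Suc k))" for k
    using H_dense[of "X k" "inverse (real (Suc k))"] X by auto
  then obtain s where s: "\<And>k. s k \<in> carrier S"
    "\<And>k. cnorm H (to_H (s k) \<ominus>\<^bsub>H\<^esub> X k) < inverse (real (Suc k))" by metis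
  have null: "(\<lambda>k. cnorm H (to_H (s k) \<ominus>\<^bsub>H\<^esub> X k)) \<longlonglongrightarrow> 0"
    by (rule null_comparison[OF _ LIMSEQ_inverse_real_of_nat])
       (use s X in \<open>auto intro: less_imp_le\<close>)
  have Hs: "H.cauchy (\<lambda>k. to_H (s k))"
    unfolding H.cauchy_def
  proof (intro conjI allI impI)
    show "range (\<lambda>k. to_H (s k)) \<subseteq> carrier H" using s by auto
    fix \<epsilon> :: real assume e: "\<epsilon> > 0"
    obtain N1 where N1: "\<And>k. k \<ge> N1 \<Longrightarrow> \<bar>cnorm H (to_H (s k) \<ominus>\<^bsub>H\<^esub> X k)\<bar> < \<epsilon> / 3"
      using LIMSEQ_D[OF null, of "\<epsilon> / 3"] e by auto
    obtain N2 where N2: "\<And>k l. k \<ge> N2 \<Longrightarrow> l \<ge> N2 \<Longrightarrow> cnorm H (X k \<ominus>\<^bsub>H\<^esub> X l) < \<epsilon> / 3"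
      using H.cauchyD[OF X, of "\<epsilon> / 3"] e by auto
    have "cnorm H (to_H (s k) \<ominus>\<^bsub>H\<^esub> to_H (s l)) < \<epsilon>" if "k \<ge> max N1 N2" "l \<ge> max N1 N2" for k l
      using H.p_triangle[of "to_H (s k)" "X k" "to_H (s l)"] H.p_triangle[of "X k" "X l" "to_H (s l)"]
        N1[of k] N1[of l] N2[of k l] that s X H.p_minus_commute[of "X l" "to_H (s l)"]
      by auto
    then show "\<exists>N. \<forall>k\<ge>N. \<forall>l\<ge>N. cnorm H (to_H (s k) \<ominus>\<^bsub>H\<^esub> to_H (s l)) < \<epsilon>" by blast
  qed
  have "p (s k \<ominus> s l) = cnorm H (to_H (s k) \<ominus>\<^bsub>H\<^esub> to_H (s l))" for k l
    using s star_hom_minus[OF star_hom_to_H star_algebra_axioms star_algebra_H, of "s k" "s l"]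
      cnorm_to_H[of "s k \<ominus> s l"] by simp
  then have cs: "cauchy s" using Hs s by (auto simp: cauchy_def H.cauchy_def)
  have "H.tends X (cls s)"
    by (rule H.tends_diff_null[OF H_tends_cls[OF cs]]) (use X null in auto)
  then show "\<exists>x. H.tends X x" by blast
qed

text \<open>Domination by \<open>p\<close> makes \<open>h\<close> send Cauchy sequences to Cauchy
  sequences and null sequences to null sequences, so the limits in \<open>B\<close> depend only on
  the class.\<close>

theorem completion_extend:
  assumes "cstar B" and h: "star_hom S B h" and le: "\<And>x. x \<in> carrier S \<Longrightarrow> cnorm B (h x) \<le> p x"
  shows "\<exists>g. star_hom H B g \<and> (\<forall>x\<in>carrier S. g (to_H x) = h x)"
proof -
  interpret B: cstar B by fact
  note hs = star_hom_simps[OF h] star_hom_minus[OF h star_algebra_axioms B.star_algebra_axioms]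
  have cauchy_h: "B.cauchy (\<lambda>k. h (s k))" if s: "cauchy s" for s
    unfolding B.cauchy_def
  proof (intro conjI allI impI)
    show "range (\<lambda>k. h (s k)) \<subseteq> carrier B" using s by (auto simp: hs)
    fix \<epsilon> :: real assume e: "\<epsilon> > 0"
    then obtain N where N: "\<And>k l. k \<ge> N \<Longrightarrow> l \<ge> N \<Longrightarrow> p (s k \<ominus> s l) < \<epsilon>"
      using cauchyD[OF s] by blast
    have "cnorm B (h (s k) \<ominus>\<^bsub>B\<^esub> h (s l)) < \<epsilon>" if "k \<ge> N" "l \<ge> N" for k l
      using le[of "s k \<ominus> s l"] N[OF that] s by (simp add: hs)
    then show "\<exists>N. \<forall>k\<ge>N. \<forall>l\<ge>N. cnorm B (h (s k) \<ominus>\<^bsub>B\<^esub> h (s l)) < \<epsilon>" by blast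
  qed
  define g where "g X = (SOME b. \<exists>s\<in>X. B.tends (\<lambda>k. h (s k)) b)" for X
  have g: "g (cls s) = b" if s: "cauchy s" and b: "B.tends (\<lambda>k. h (s k)) b" for s b
    unfolding g_def
  proof (rule some_equality)
    show "\<exists>s\<in>cls s. B.tends (\<lambda>k. h (s k)) b"
      using s b by (intro bexI[of _ s]) (auto simp: cauchy_rel_iff a_minus_def r_neg)
    fix b' assume "\<exists>s\<in>cls s. B.tends (\<lambda>k. h (s k)) b'"
    then obtain t where t: "t \<in> cls s" "B.tends (\<lambda>k. h (t k)) b'" by blast
    then have ct: "cauchy t" and null: "(\<lambda>k. p (s k \<ominus> t k)) \<longlonglongrightarrow> 0" by (auto simp: cauchy_rel_iff)
    have "(\<lambda>k. cnorm B (h (s k) \<ominus>\<^bsub>B\<^esub> h (t k))) \<longlonglongrightarrow> 0"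
      by (rule null_comparison[OF _ null])
         (use le[of "s _ \<ominus> t _"] s ct in \<open>auto simp: hs\<close>)
    from B.tends_diff_null[OF b _ this] have "B.tends (\<lambda>k. h (t k)) b" using ct by (simp add: hs)
    with t(2) show "b' = b" by (rule B.tends_unique)
  qed
  have gt: "B.tends (\<lambda>k. h (s k)) (g (cls s))" if s: "cauchy s" for s
    using B.cauchy_tends[OF cauchy_h[OF s]] g[OF s] by auto
  have "star_hom H B g"
  proof (rule star_homI)
    fix X assume "X \<in> carrier H"
    then obtain s where s: "cauchy s" "X = cls s" by (rule H_cases)
    show "g X \<in> carrier B" using B.tendsD(2)[OF gt[OF s(1)]] s by simp
    show "g (c \<odot>\<^bsub>H\<^esub> X) = c \<odot>\<^bsub>B\<^esub> g X" for c
      using g[OF cauchy_smult[OF s(1), of c]] B.tends_smult[OF gt[OF s(1)], of c] s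
      by (simp add: H_ops hs)
    show "g (invol H X) = invol B (g X)"
      using g[OF cauchy_invol[OF s(1)]] B.tends_invol[OF gt[OF s(1)]] s by (simp add: H_ops hs)
    fix Y assume "Y \<in> carrier H"
    then obtain t where t: "cauchy t" "Y = cls t" by (rule H_cases)
    show "g (X \<oplus>\<^bsub>H\<^esub> Y) = g X \<oplus>\<^bsub>B\<^esub> g Y"
      using g[OF cauchy_add[OF s(1) t(1)]] B.tends_add[OF gt[OF s(1)] gt[OF t(1)]] s t
      by (simp add: H_ops hs)
    show "g (X \<otimes>\<^bsub>H\<^esub> Y) = g X \<otimes>\<^bsub>B\<^esub> g Y"
      using g[OF cauchy_mult[OF s(1) t(1)]] B.tends_mult[OF gt[OF s(1)] gt[OF t(1)]] s t
      by (simp add: H_ops hs)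
  next
    show "g \<one>\<^bsub>H\<^esub> = \<one>\<^bsub>B\<^esub>"
      using g[of "\<lambda>k. \<one>" "\<one>\<^bsub>B\<^esub>"] B.tends_const[of "\<one>\<^bsub>B\<^esub>"] by (simp add: H_ops hs)
  qed
  moreover have "g (to_H x) = h x" if "x \<in> carrier S" for x
    using g[of "\<lambda>k. x" "h x"] B.tends_const[of "h x"] that by (simp add: to_H_eq hs)
  ultimately show ?thesis by blast
qed

end

section \<open>Automatic contractivity\<close>

text \<open>Reduces contractivity of a homomorphism to a comparison of two C*-seminorms on one
  algebra; it also turns a homomorphism that respects given relations into an admissible
  seminorm.\<close>

lemma (in cstar_seminormed) cstar_seminorm_pullback:
  assumes "star_hom A S h" "star_algebra A"
  shows "cstar_seminorm A (\<lambda>x. p (h x))"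
proof -
  note hs = star_hom_simps[OF assms(1)]
  interpret A: star_algebra A by fact
  show ?thesis
    unfolding cstar_seminorm_def
    by (auto simp: hs p_smult p_cstar intro: p_add_le p_mult_le)
qed

section \<open>Square roots and unitaries by fixed points\<close>

context cstar
begin

text \<open>Banach's fixed point theorem on a closed subset \<open>Q\<close>. Staying inside
  \<open>Q\<close> lets the fixed point inherit properties such as self-adjointness and
  commutation.\<close>

lemma contraction_fixpoint:
  assumes Q: "Q \<subseteq> carrier A" "y0 \<in> Q" and F: "\<And>y. y \<in> Q \<Longrightarrow> F y \<in> Q"
    and closed: "\<And>s x. (\<And>k. s k \<in> Q) \<Longrightarrow> tends s x \<Longrightarrow> x \<in> Q"
    and r: "0 \<le> r" "r < 1"
    and contr: "\<And>y z. y \<in> Q \<Longrightarrow> z \<in> Q \<Longrightarrow> cnorm A (F y \<ominus> F z) \<le> r * cnorm A (y \<ominus> z)"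
  shows "\<exists>y\<in>Q. F y = y"
proof -
  define s where "s k = (F ^^ k) y0" for k
  have sQ: "s k \<in> Q" for k by (induction k) (auto simp: s_def Q F)
  have sc [simp]: "s k \<in> carrier A" for k using sQ Q by blast
  have s_Suc: "s (Suc k) = F (s k)" for k by (simp add: s_def)
  \<comment> \<open>The sum of the geometric series that bounds all distances to \<open>s 0\<close>,
    that is, the solution of \<open>r * D + cnorm A (s 1 \<ominus> s 0) = D\<close>; this equation
    closes the induction in \<open>base\<close>.\<close>
  define D where "D = cnorm A (s 1 \<ominus> s 0) / (1 - r)"
  have D0: "D \<ge> 0" using r by (simp add: D_def)
  have D: "r * D + cnorm A (s 1 \<ominus> s 0) = D"
    using r by (simp add: D_def field_simps)
  have base: "cnorm A (s m \<ominus> s 0) \<le> D" for m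
  proof (induction m)
    case 0 then show ?case using D0 by (simp add: a_minus_def r_neg)
  next
    case (Suc m)
    have "cnorm A (s (Suc m) \<ominus> s 0) \<le> cnorm A (s (Suc m) \<ominus> s 1) + cnorm A (s 1 \<ominus> s 0)"
      by (intro p_triangle) auto
    also have "cnorm A (s (Suc m) \<ominus> s 1) \<le> r * cnorm A (s m \<ominus> s 0)"
      using contr[OF sQ sQ, of m 0] by (simp add: s_Suc)
    also have "\<dots> \<le> r * D" using Suc.IH r by (intro mult_left_mono) auto
    finally show ?case using D by simp
  qed
  have step: "cnorm A (s (k + m) \<ominus> s k) \<le> r ^ k * D" for k m
  proof (induction k)
    case 0 then show ?case using base by simp
  next
    case (Suc k)
    have "cnorm A (s (Suc k + m) \<ominus> s (Suc k)) \<le> r * cnorm A (s (k + m) \<ominus> s k)"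
      using contr[OF sQ sQ, of "k + m" k] by (simp add: s_Suc)
    also have "\<dots> \<le> r * (r ^ k * D)" using Suc.IH r by (intro mult_left_mono) auto
    finally show ?case by (simp add: mult.assoc)
  qed
  have "cauchy s"
    unfolding cauchy_def
  proof (intro conjI allI impI)
    fix \<epsilon> :: real assume e: "\<epsilon> > 0"
    have "(\<lambda>k. r ^ k * D) \<longlonglongrightarrow> 0"
      using LIMSEQ_realpow_zero[OF r] tendsto_mult_left_zero by blast
    then obtain N where "norm (r ^ N * D) < \<epsilon> / 2"
      using LIMSEQ_D[of "\<lambda>k. r ^ k * D" 0 "\<epsilon> / 2"] e by auto
    then have N: "r ^ N * D < \<epsilon> / 2" by simp
    have "cnorm A (s k \<ominus> s l) < \<epsilon>" if "k \<ge> N" "l \<ge> N" for k l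
      using p_triangle[of "s k" "s N" "s l"] step[of N "k - N"] step[of N "l - N"] that N
        p_minus_commute[of "s N" "s l"] by simp
    then show "\<exists>N. \<forall>k\<ge>N. \<forall>l\<ge>N. cnorm A (s k \<ominus> s l) < \<epsilon>" by blast
  qed auto
  then obtain y where y: "tends s y" using cauchy_tends by blast
  then have yQ: "y \<in> Q" using closed sQ by blast
  have "tends (\<lambda>k. s (Suc k)) (F y)"
  proof (rule tends_le)
    show "(\<lambda>k. r * cnorm A (s k \<ominus> y)) \<longlonglongrightarrow> 0"
      using tendsto_mult[OF tendsto_const tendsD(3)[OF y], of r] by simp
  qed (use F[OF yQ] Q contr[OF sQ yQ] in \<open>auto simp: s_Suc[symmetric]\<close>)
  moreover have "tends (\<lambda>k. s (Suc k)) y"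
    using y tendsD(3)[OF y] LIMSEQ_Suc[of "\<lambda>k. cnorm A (s k \<ominus> y)"]
    by (auto simp: tends_def)
  ultimately show ?thesis using tends_unique yQ by blast
qed

text \<open>A substitute for the real commutative C*-algebra generated by a self-adjoint
  \<open>t\<close>: it is closed under limits, sums, real multiples and products, and its elements
  commute with each other. No generated subalgebra has to be constructed.\<close>

definition bicommutant_sa :: "'a \<Rightarrow> 'a set" where
  "bicommutant_sa t = {y \<in> carrier A. invol A y = y
     \<and> (\<forall>z\<in>carrier A. z \<otimes> t = t \<otimes> z \<longrightarrow> z \<otimes> y = y \<otimes> z)}"

lemma bicommutant_saD:
  "y \<in> bicommutant_sa t \<Longrightarrow> y \<in> carrier A" "y \<in> bicommutant_sa t \<Longrightarrow> invol A y = y"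
  "y \<in> bicommutant_sa t \<Longrightarrow> z \<in> carrier A \<Longrightarrow> z \<otimes> t = t \<otimes> z \<Longrightarrow> z \<otimes> y = y \<otimes> z"
  by (auto simp: bicommutant_sa_def)

text \<open>As \<open>t\<close> commutes with itself, \<open>y\<close> commutes with
  \<open>t\<close>; then \<open>z\<close> commutes with \<open>y\<close>.\<close>

lemma bicommutant_sa_commute:
  assumes "t \<in> carrier A" "y \<in> bicommutant_sa t" "z \<in> bicommutant_sa t"
  shows "y \<otimes> z = z \<otimes> y"
  using bicommutant_saD(3)[OF assms(2) assms(1)] bicommutant_saD(3)[OF assms(3)] bicommutant_saD(1)[OF assms(2)]
  by simp

lemma bicommutant_sa_zero: "t \<in> carrier A \<Longrightarrow> \<zero> \<in> bicommutant_sa t"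
  by (auto simp: bicommutant_sa_def)

lemma bicommutant_sa_one: "t \<in> carrier A \<Longrightarrow> \<one> \<in> bicommutant_sa t"
  by (auto simp: bicommutant_sa_def)

lemma bicommutant_sa_base: "t \<in> carrier A \<Longrightarrow> invol A t = t \<Longrightarrow> t \<in> bicommutant_sa t"
  by (auto simp: bicommutant_sa_def)

lemma bicommutant_sa_add:
  "y \<in> bicommutant_sa t \<Longrightarrow> z \<in> bicommutant_sa t \<Longrightarrow> y \<oplus> z \<in> bicommutant_sa t"
  by (auto simp: bicommutant_sa_def l_distr r_distr)

lemma bicommutant_sa_smult:
  "y \<in> bicommutant_sa t \<Longrightarrow> cnj c = c \<Longrightarrow> c \<odot> y \<in> bicommutant_sa t"
  by (auto simp: bicommutant_sa_def)

lemma bicommutant_sa_minus: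
  "y \<in> bicommutant_sa t \<Longrightarrow> z \<in> bicommutant_sa t \<Longrightarrow> y \<ominus> z \<in> bicommutant_sa t"
  by (auto simp: bicommutant_sa_def minus_mult_left minus_mult_right)

text \<open>A product of self-adjoint elements is self-adjoint when they commute, which
  \<open>bicommutant_sa_commute\<close> guarantees here.\<close>

lemma bicommutant_sa_mult:
  assumes t: "t \<in> carrier A" and y: "y \<in> bicommutant_sa t" and z: "z \<in> bicommutant_sa t"
  shows "y \<otimes> z \<in> bicommutant_sa t"
proof -
  note c = bicommutant_saD[OF y] bicommutant_saD[OF z]
  have "w \<otimes> (y \<otimes> z) = (y \<otimes> z) \<otimes> w" if w: "w \<in> carrier A" "w \<otimes> t = t \<otimes> w" for w
    using c(3)[OF w] c(6)[OF w] c(1) c(4) w(1) by (metis m_assoc)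
  then show ?thesis
    using c bicommutant_sa_commute[OF t y z] by (auto simp: bicommutant_sa_def)
qed

lemma bicommutant_sa_limit:
  assumes s: "\<And>k. s k \<in> bicommutant_sa t" and x: "tends s x"
  shows "x \<in> bicommutant_sa t"
proof -
  note c = bicommutant_saD[OF s]
  have "invol A x = x"
    using tends_unique[OF tends_invol[OF x]] x by (simp add: c)
  moreover have "z \<otimes> x = x \<otimes> z" if z: "z \<in> carrier A" "z \<otimes> t = t \<otimes> z" for z
    using tends_unique[OF tends_mult[OF tends_const[OF z(1)] x]] tends_mult[OF x tends_const[OF z(1)]]
    by (simp add: c(3)[OF z])
  ultimately show ?thesis using tendsD(2)[OF x] by (auto simp: bicommutant_sa_def)
qed

lemma cnorm_square_sa: "x \<in> carrier A \<Longrightarrow> invol A x = x \<Longrightarrow> cnorm A (x \<otimes> x) = (cnorm A x)\<^sup>2"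
  using p_cstar[of x] by simp

text \<open>
  The square root of \<open>1 - a\<^sup>2\<close> is \<open>1 - y\<close> for the fixed point \<open>y\<close> of \<open>y \<mapsto> (a\<^sup>2 + y\<^sup>2) / 2\<close>.
\<close>

lemma sqrt_one_minus_square:
  assumes a: "a \<in> carrier A" "invol A a = a" and norm: "cnorm A a < 1"
  shows "\<exists>b\<in>carrier A. invol A b = b \<and> a \<otimes> b = b \<otimes> a \<and> a \<otimes> a \<oplus> b \<otimes> b = \<one>"
proof -
  define t where "t = a \<otimes> a"
  define r where "r = cnorm A t"
  have t: "t \<in> carrier A" "invol A t = t" using a by (auto simp: t_def)
  have r: "0 \<le> r" "r < 1"
    using norm a t p_nonneg[of a] by (auto simp: r_def t_def cnorm_square_sa power_less_one_iff)
  \<comment> \<open>The ball of radius \<open>r = cnorm A t\<close> is mapped to itself since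
    \<open>(r + r^2) / 2 \<le> r\<close>. As its elements commute, \<open>F y \<ominus> F z\<close>
    is half of \<open>(y \<oplus> z) \<otimes> (y \<ominus> z)\<close>, which makes
    \<open>r < 1\<close> a Lipschitz constant.\<close>
  define Q where "Q = {y \<in> bicommutant_sa t. cnorm A y \<le> r}"
  define F where "F y = (1 / 2) \<odot> (t \<oplus> y \<otimes> y)" for y
  have QD: "y \<in> carrier A" "y \<in> bicommutant_sa t" "cnorm A y \<le> r" if "y \<in> Q" for y
    using that by (auto simp: Q_def bicommutant_saD)
  have "\<exists>y\<in>Q. F y = y"
  proof (rule contraction_fixpoint)
    show "\<zero> \<in> Q" using r t by (auto simp: Q_def bicommutant_sa_zero)
    show "F y \<in> Q" if "y \<in> Q" for y
    proof -
      note y = QD[OF that]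
      have "cnorm A (F y) \<le> (1 / 2) * (r + cnorm A y * cnorm A y)"
        using y t p_add_le[of t "y \<otimes> y"] p_mult_le[of y y] by (simp add: F_def p_smult r_def)
      also have "\<dots> \<le> (1 / 2) * (r + r * 1)"
        using y r by (intro mult_left_mono add_left_mono mult_mono) auto
      finally show ?thesis
        using y t by (simp add: Q_def F_def bicommutant_sa_add bicommutant_sa_mult bicommutant_sa_base bicommutant_sa_smult)
    qed
    show "x \<in> Q" if "\<And>k. s k \<in> Q" "tends s x" for s x
      using bicommutant_sa_limit[OF QD(2)[OF that(1)] that(2)]
        LIMSEQ_le_const2[OF tends_norm[OF that(2)], of r] QD(3)[OF that(1)]
      by (auto simp: Q_def)
    show "cnorm A (F y \<ominus> F z) \<le> r * cnorm A (y \<ominus> z)" if "y \<in> Q" "z \<in> Q" for y z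
    proof -
      note y = QD[OF that(1)] and z = QD[OF that(2)]
      have comm: "z \<otimes> y = y \<otimes> z" using bicommutant_sa_commute t y z by auto
      have "(y \<oplus> z) \<otimes> (y \<ominus> z) = y \<otimes> y \<ominus> z \<otimes> z \<oplus> (z \<otimes> y \<ominus> y \<otimes> z)"
        using y(1) z(1) by algebra
      also have "\<dots> = y \<otimes> y \<ominus> z \<otimes> z"
        using y(1) z(1) by (simp add: comm a_minus_def r_neg)
      also have "\<dots> = (t \<oplus> y \<otimes> y) \<ominus> (t \<oplus> z \<otimes> z)"
        using y(1) z(1) t(1) by algebra
      finally have "F y \<ominus> F z = (1 / 2) \<odot> ((y \<oplus> z) \<otimes> (y \<ominus> z))"
        using y(1) z(1) t(1) by (simp add: F_def smult_diff_right)
      then have "cnorm A (F y \<ominus> F z) = (1 / 2) * cnorm A ((y \<oplus> z) \<otimes> (y \<ominus> z))"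
        using y(1) z(1) by (simp add: p_smult)
      also have "\<dots> \<le> (1 / 2) * (cnorm A (y \<oplus> z) * cnorm A (y \<ominus> z))"
        using y(1) z(1) by (intro mult_left_mono p_mult_le) auto
      also have "\<dots> \<le> (1 / 2) * ((r + r) * cnorm A (y \<ominus> z))"
        using y z p_add_le[of y z] by (intro mult_left_mono mult_right_mono) auto
      finally show ?thesis by simp
    qed
  qed (use r in \<open>auto simp: Q_def bicommutant_saD\<close>)
  then obtain y where y: "y \<in> Q" "F y = y" by blast
  note yc = QD[OF y(1)]
  \<comment> \<open>The fixed point equation reads \<open>2 y = t + y^2\<close>, which is
    \<open>(1 - y)^2 = 1 - t\<close>; so \<open>\<one> \<ominus> y\<close> is the square
    root.\<close>
  have "y \<oplus> y = 2 \<odot> F y" using yc smult_add_left[of y 1 1] y(2) by simp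
  also have "\<dots> = t \<oplus> y \<otimes> y" using yc t by (simp add: F_def)
  finally have yy: "y \<oplus> y = t \<oplus> y \<otimes> y" .
  have "(\<one> \<ominus> y) \<otimes> (\<one> \<ominus> y) = (\<one> \<ominus> (y \<oplus> y)) \<oplus> y \<otimes> y"
    using yc(1) by (simp add: minus_mult_left minus_mult_right, algebra)
  also have "\<dots> = \<one> \<ominus> t" unfolding yy using yc(1) t(1) by algebra
  finally have "t \<oplus> (\<one> \<ominus> y) \<otimes> (\<one> \<ominus> y) = \<one>" using t(1) yc(1) by (simp, algebra)
  \<comment> \<open>\<open>a\<close> commutes with \<open>t = a^2\<close> and therefore with every
    element of the bicommutant of \<open>t\<close>.\<close>
  moreover have "a \<otimes> y = y \<otimes> a"
    using bicommutant_saD(3)[OF yc(2) a(1)] a by (simp add: t_def m_assoc)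
  ultimately show ?thesis
    using yc a bicommutant_saD(2)[OF yc(2)]
    by (intro bexI[of _ "\<one> \<ominus> y"]) (auto simp: t_def minus_mult_left minus_mult_right)
qed

text \<open>\<open>x + iy\<close> is unitary, so every C*-seminorm of its real and imaginary part is at most \<open>1\<close>.\<close>

lemma unitary_parts:
  assumes x: "x \<in> carrier A" "invol A x = x" and y: "y \<in> carrier A" "invol A y = y"
    and comm: "x \<otimes> y = y \<otimes> x" and one: "x \<otimes> x \<oplus> y \<otimes> y = \<one>"
    and q: "cstar_seminorm A q"
  shows "q x \<le> 1" "q y \<le> 1"
proof -
  interpret q: cstar_seminormed A q by unfold_locales (rule q)
  define u where "u = x \<oplus> \<i> \<odot> y"
  define v where "v = x \<oplus> (- \<i>) \<odot> y"
  have u: "u \<in> carrier A" and v: "v \<in> carrier A" using x y by (auto simp: u_def v_def)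
  have iu: "invol A u = v" using x y by (simp add: u_def v_def)
  have "v \<otimes> u = (x \<otimes> x \<oplus> y \<otimes> y) \<oplus> (\<i> \<odot> (x \<otimes> y) \<oplus> (- \<i>) \<odot> (x \<otimes> y))"
    using x y by (simp add: u_def v_def l_distr r_distr smult_add_right comm a_ac)
  also have "\<dots> = \<one>" using x y by (simp add: one smult_add_left[symmetric])
  finally have "q u ^ 2 \<le> 1"
    using q.p_cstar[OF u] q.p_one_le by (simp add: iu)
  then have qu: "q u \<le> 1" using q.p_nonneg[OF u] by (simp add: power2_le_imp_le[of _ 1, simplified])
  have qv: "q v \<le> 1" using qu q.p_invol[OF u] iu by simp
  have "u \<oplus> v = (x \<oplus> x) \<oplus> (\<i> \<odot> y \<oplus> (- \<i>) \<odot> y)" using x y by (simp add: u_def v_def a_ac)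
  then have "2 \<odot> x = u \<oplus> v"
    using x y smult_add_left[of x 1 1] by (simp add: smult_add_left[symmetric])
  then have "2 * q x \<le> q u + q v" using q.p_add_le[OF u v] q.p_smult[OF x(1), of 2] by simp
  then show "q x \<le> 1" using qu qv by simp
  have "u \<oplus> (- 1) \<odot> v = (x \<oplus> (- 1) \<odot> x) \<oplus> (\<i> \<odot> y \<oplus> \<i> \<odot> y)"
    using x y by (simp add: u_def v_def a_ac smult_add_right)
  also have "x \<oplus> (- 1) \<odot> x = \<zero>"
    using x smult_add_left[of x 1 "- 1"] by (metis add.right_inverse smult_one smult_zero_left)
  also have "\<i> \<odot> y \<oplus> \<i> \<odot> y = (2 * \<i>) \<odot> y"
    using y by (metis mult_2 smult_add_left)
  finally have "(2 * \<i>) \<odot> y = u \<oplus> (- 1) \<odot> v" using y by simp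
  then have "2 * q y \<le> q u + q v"
    using q.p_add_le[OF u smult_closed[OF v, of "- 1"]] q.p_smult[OF y(1), of "2 * \<i>"] q.p_smult[OF v, of "- 1"]
    by (simp add: norm_mult)
  then show "q y \<le> 1" using qu qv by simp
qed

text \<open>For self-adjoint \<open>a\<close> and \<open>r > cnorm A a\<close> the element
  \<open>a / r\<close> is the real part of a unitary, so \<open>q a \<le> r\<close>. The general
  case is this one for \<open>invol A x \<otimes> x\<close>, as both seminorms satisfy the
  C*-identity.\<close>

theorem cstar_seminorm_le_cnorm:
  assumes q: "cstar_seminorm A q" and x: "x \<in> carrier A"
  shows "q x \<le> cnorm A x"
proof -
  interpret q: cstar_seminormed A q by unfold_locales (rule q)
  have sa: "q a \<le> cnorm A a" if a: "a \<in> carrier A" "invol A a = a" for a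
  proof (rule dense_ge)
    fix r assume r: "cnorm A a < r"
    then have r0: "r > 0" using p_nonneg[OF a(1)] by linarith
    let ?a = "complex_of_real (inverse r) \<odot> a"
    have "cnorm A ?a < 1" using a r r0 by (simp add: p_smult norm_inverse field_simps norm_divide)
    then obtain b where "b \<in> carrier A" "invol A b = b" "?a \<otimes> b = b \<otimes> ?a" "?a \<otimes> ?a \<oplus> b \<otimes> b = \<one>"
      using sqrt_one_minus_square[of ?a] a by auto
    then have "q ?a \<le> 1" using unitary_parts(1)[of ?a b q] a q by simp
    then show "q a \<le> r" using a r0 by (simp add: q.p_smult norm_divide field_simps)
  qed
  have "(q x)\<^sup>2 \<le> (cnorm A x)\<^sup>2"
    using sa[of "invol A x \<otimes> x"] x by (simp add: q.p_cstar p_cstar)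
  then show ?thesis using p_nonneg[OF x] by (rule power2_le_imp_le)
qed

end

lemma star_hom_contractive:
  assumes "cstar A" "cstar B" "star_hom A B h" "x \<in> carrier A"
  shows "cnorm B (h x) \<le> cnorm A x"
proof -
  interpret A: cstar A by fact
  interpret B: cstar B by fact
  show ?thesis
    using A.cstar_seminorm_le_cnorm[OF B.cstar_seminorm_pullback[OF assms(3) A.star_algebra_axioms] assms(4)] .
qed

lemma star_hom_tends:
  assumes "cstar A" "cstar B" "star_hom A B h" "cstar_seminormed.tends A (cnorm A) s x"
  shows "cstar_seminormed.tends B (cnorm B) (\<lambda>k. h (s k)) (h x)"
proof -
  interpret A: cstar A by fact
  interpret B: cstar B by fact
  note c = A.tendsD[OF assms(4)]
  show ?thesis
  proof (rule B.tends_le[OF _ _ c(3)])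
    show "cnorm B (h (s k) \<ominus>\<^bsub>B\<^esub> h x) \<le> cnorm A (s k \<ominus>\<^bsub>A\<^esub> x)" for k
      using star_hom_contractive[OF assms(1-3), of "s k \<ominus>\<^bsub>A\<^esub> x"] c
      by (simp add: star_hom_minus[OF assms(3) A.star_algebra_axioms B.star_algebra_axioms])
  qed (use c star_hom_closed[OF assms(3)] in auto)
qed

text \<open>Homomorphisms between C*-algebras are contractive, hence continuous, so agreement on the
  dense image of \<open>S\<close> is enough.\<close>

lemma (in cstar_seminormed) completion_hom_unique:
  assumes "cstar B" "star_hom H B g" "star_hom H B h"
    and eq: "\<And>x. x \<in> carrier S \<Longrightarrow> g (to_H x) = h (to_H x)" and X: "X \<in> carrier H"
  shows "g X = h X"
proof -
  interpret B: cstar B by fact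
  interpret H: cstar H by (rule cstar_H)
  obtain s where s: "cauchy s" "X = cls s" using X by (rule H_cases)
  have "H.tends (\<lambda>k. to_H (s k)) X" using H_tends_cls[OF s(1)] s(2) by simp
  from star_hom_tends[OF H.cstar_axioms assms(1,2) this] star_hom_tends[OF H.cstar_axioms assms(1,3) this]
  show ?thesis using s eq by (simp add: B.tends_unique)
qed


section \<open>Quotients by closed ideals\<close>

context cstar
begin

text \<open>The resolvent \<open>d = (1 + h\<^sup>2)\<^sup>-\<^sup>1\<close>; the norm bounds hold as \<open>(1 - ih)\<^sup>2 d\<close> is unitary.\<close>

lemma resolvent:
  assumes h: "h \<in> carrier A" "invol A h = h"
  shows "\<exists>d\<in>carrier A. invol A d = d \<and> h \<otimes> d = d \<otimes> h \<and> d \<oplus> h \<otimes> (h \<otimes> d) = \<one>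
    \<and> cnorm A d \<le> 1 \<and> 2 * cnorm A (h \<otimes> d) \<le> 1"
proof -
  \<comment> \<open>Any positive bound above the square of the norm of \<open>h\<close> would do. It
    makes the norm of \<open>h / sqrt L\<close> less than \<open>1\<close>; hence
    \<open>c = L - h^2\<close> equals \<open>L b^2\<close> with \<open>cnorm A b \<le> 1\<close>,
    and so \<open>cnorm A c \<le> L\<close>.\<close>
  define L where "L = (cnorm A h)\<^sup>2 + 1"
  have L: "L > 0" "(cnorm A h)\<^sup>2 < L" by (auto simp: L_def add_nonneg_pos)
  define c where "c = complex_of_real L \<odot> \<one> \<ominus> h \<otimes> h"
  have c: "c \<in> carrier A" using h by (simp add: c_def)
  have normc: "cnorm A c \<le> L"
  proof -
    let ?a = "complex_of_real (inverse (sqrt L)) \<odot> h"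
    have "cnorm A h < sqrt L" using L by (simp add: real_less_rsqrt)
    then have "cnorm A ?a < 1" using h L by (simp add: p_smult norm_divide field_simps)
    then obtain b where b: "b \<in> carrier A" "invol A b = b" "?a \<otimes> b = b \<otimes> ?a" "?a \<otimes> ?a \<oplus> b \<otimes> b = \<one>"
      using sqrt_one_minus_square[of ?a] h by auto
    then have "cnorm A b \<le> 1" using unitary_parts(2)[of ?a b "cnorm A"] h cnorm_seminorm by simp
    then have bb: "cnorm A (b \<otimes> b) \<le> 1" using b p_nonneg[OF b(1)] by (simp add: cnorm_square_sa power_le_one)
    have "?a \<otimes> ?a = complex_of_real (inverse L) \<odot> (h \<otimes> h)"
      using h L by (simp flip: of_real_mult add: inverse_mult_distrib[symmetric] del: of_real_inverse)
    then have "complex_of_real L \<odot> (complex_of_real (inverse L) \<odot> (h \<otimes> h) \<oplus> b \<otimes> b) = complex_of_real L \<odot> \<one>"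
      using b(4) by simp
    then have e: "h \<otimes> h \<oplus> complex_of_real L \<odot> (b \<otimes> b) = complex_of_real L \<odot> \<one>"
      using h b L by (simp add: smult_add_right flip: of_real_mult)
    have "c = complex_of_real L \<odot> (b \<otimes> b)"
    proof -
      have "(x \<oplus> y) \<ominus> x = y" if "x \<in> carrier A" "y \<in> carrier A" for x y using that by algebra
      then show ?thesis unfolding c_def e[symmetric] using h b by simp
    qed
    then show ?thesis using bb b L by (simp add: p_smult mult_left_le)
  qed
  \<comment> \<open>\<open>(1 + h^2) d = 1\<close> is the same as
    \<open>(1 + L) d = 1 + c d\<close>. Dividing by \<open>1 + L\<close> gives the fixed point
    equation of \<open>F\<close>, with contraction constant \<open>L / (1 + L)\<close>.\<close>
  define K where "K = inverse (1 + L)"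
  have K: "K > 0" "(1 + L) * K = 1" "K * L = L / (1 + L)" using L by (auto simp: K_def field_simps)
  define F where "F y = complex_of_real K \<odot> (\<one> \<oplus> c \<otimes> y)" for y
  have cb: "c \<in> bicommutant_sa h"
    unfolding c_def using h
    by (intro bicommutant_sa_minus bicommutant_sa_smult bicommutant_sa_one bicommutant_sa_mult bicommutant_sa_base) auto
  have "\<exists>y\<in>bicommutant_sa h. F y = y"
  proof (rule contraction_fixpoint)
    show "\<zero> \<in> bicommutant_sa h" using h by (simp add: bicommutant_sa_zero)
    show "F y \<in> bicommutant_sa h" if "y \<in> bicommutant_sa h" for y
      unfolding F_def using h that cb
      by (intro bicommutant_sa_add bicommutant_sa_smult bicommutant_sa_one bicommutant_sa_mult) auto
    show "x \<in> bicommutant_sa h" if "\<And>k. s k \<in> bicommutant_sa h" "tends s x" for s x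
      using bicommutant_sa_limit that by blast
    show "0 \<le> L / (1 + L)" "L / (1 + L) < 1" using L by auto
    fix y z assume y: "y \<in> bicommutant_sa h" and z: "z \<in> bicommutant_sa h"
    note yz = bicommutant_saD(1)[OF y] bicommutant_saD(1)[OF z]
    have "(\<one> \<oplus> c \<otimes> y) \<ominus> (\<one> \<oplus> c \<otimes> z) = c \<otimes> (y \<ominus> z)" using c yz by algebra
    then have "F y \<ominus> F z = complex_of_real K \<odot> (c \<otimes> (y \<ominus> z))"
      using c yz by (simp add: F_def smult_diff_right[symmetric])
    then have "cnorm A (F y \<ominus> F z) = K * cnorm A (c \<otimes> (y \<ominus> z))"
      using c yz K by (simp add: p_smult)
    also have "\<dots> \<le> K * (L * cnorm A (y \<ominus> z))"
      using c yz K(1) p_mult_le[of c "y \<ominus> z"] mult_right_mono[OF normc, of "cnorm A (y \<ominus> z)"]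
      by (intro mult_left_mono) auto
    finally show "cnorm A (F y \<ominus> F z) \<le> L / (1 + L) * cnorm A (y \<ominus> z)"
      by (simp flip: K(3) mult.assoc)
  qed (auto simp: bicommutant_saD)
  then obtain d where d: "d \<in> bicommutant_sa h" "F d = d" by blast
  note dc = bicommutant_saD[OF d(1)]
  have hd: "h \<otimes> d = d \<otimes> h" using dc(3) h by simp
  define e where "e = h \<otimes> d"
  define w where "w = h \<otimes> e"
  have ew: "e \<in> bicommutant_sa h" "w \<in> bicommutant_sa h"
    using d h by (auto simp: e_def w_def intro!: bicommutant_sa_mult bicommutant_sa_base)
  note ec = bicommutant_saD[OF ew(1)] and wc = bicommutant_saD[OF ew(2)]
  have "complex_of_real (1 + L) \<odot> d = complex_of_real (1 + L) \<odot> F d" by (simp add: d(2))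
  also have "\<dots> = \<one> \<oplus> c \<otimes> d"
    using c dc(1) K(2) by (simp add: F_def del: of_real_add flip: of_real_mult)
  also have "c \<otimes> d = complex_of_real L \<odot> d \<ominus> w"
    using h dc(1) by (simp add: c_def minus_mult_left w_def e_def m_assoc)
  finally have "d \<oplus> complex_of_real L \<odot> d = \<one> \<oplus> (complex_of_real L \<odot> d \<ominus> w)"
    using dc(1) by (simp add: smult_add_left)
  then have "(d \<oplus> complex_of_real L \<odot> d) \<oplus> (w \<ominus> complex_of_real L \<odot> d)
      = (\<one> \<oplus> (complex_of_real L \<odot> d \<ominus> w)) \<oplus> (w \<ominus> complex_of_real L \<odot> d)" by simp
  moreover have "(d \<oplus> complex_of_real L \<odot> d) \<oplus> (w \<ominus> complex_of_real L \<odot> d) = d \<oplus> w"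
    using dc(1) wc(1) smult_closed[OF dc(1), of "complex_of_real L"] by algebra
  moreover have "(\<one> \<oplus> (complex_of_real L \<odot> d \<ominus> w)) \<oplus> (w \<ominus> complex_of_real L \<odot> d) = \<one>"
    using dc(1) wc(1) smult_closed[OF dc(1), of "complex_of_real L"] by algebra
  ultimately have one: "d \<oplus> w = \<one>" by simp
  have comm: "d \<otimes> w = w \<otimes> d" "d \<otimes> e = e \<otimes> d" "e \<otimes> w = w \<otimes> e"
    using bicommutant_sa_commute h ew d by auto
  have ee: "e \<otimes> e = d \<otimes> w"
    using h dc(1) by (simp add: e_def w_def hd m_assoc)
  \<comment> \<open>With \<open>w = h^2 d\<close> and \<open>d + w = 1\<close>, the element
    \<open>x + i y\<close> is \<open>(1 - i h)^2 d\<close>. Since \<open>(h d)^2 = d w\<close>, the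
    sum \<open>x^2 + y^2\<close> is \<open>(d - w)^2 + 4 d w = (d + w)^2 = 1\<close>. The bounds
    follow from \<open>2 d = 1 + x\<close> and \<open>y = - 2 h d\<close>.\<close>
  define x where "x = d \<ominus> w"
  define y where "y = (- 2) \<odot> e"
  have x: "x \<in> carrier A" "invol A x = x" and y: "y \<in> carrier A" "invol A y = y"
    using dc(1,2) wc(1,2) ec(1,2) by (auto simp: x_def y_def)
  have xy: "x \<otimes> y = y \<otimes> x"
    using dc(1) wc(1) ec(1) by (simp add: x_def y_def minus_mult_left minus_mult_right smult_diff_right comm)
  have "y \<otimes> y = 4 \<odot> (d \<otimes> w)" using ec(1) dc(1) wc(1) by (simp add: y_def ee)
  also have "\<dots> = (d \<otimes> w \<oplus> d \<otimes> w) \<oplus> (d \<otimes> w \<oplus> d \<otimes> w)"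
    using dc(1) wc(1) smult_add_left[of "d \<otimes> w" 1 1] smult_add_left[of "d \<otimes> w" 2 2] by simp
  finally have yy: "y \<otimes> y = (d \<otimes> w \<oplus> d \<otimes> w) \<oplus> (d \<otimes> w \<oplus> w \<otimes> d)" by (simp add: comm)
  have "x \<otimes> x = d \<otimes> d \<ominus> d \<otimes> w \<ominus> w \<otimes> d \<oplus> w \<otimes> w"
    unfolding x_def using dc(1) wc(1) by algebra
  also have "\<dots> = d \<otimes> d \<ominus> d \<otimes> w \<ominus> d \<otimes> w \<oplus> w \<otimes> w" by (simp add: comm)
  finally have xx: "x \<otimes> x = d \<otimes> d \<ominus> d \<otimes> w \<ominus> d \<otimes> w \<oplus> w \<otimes> w" .
  have "x \<otimes> x \<oplus> y \<otimes> y = (d \<oplus> w) \<otimes> (d \<oplus> w)"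
    unfolding xx yy using dc(1) wc(1) by algebra
  also have "\<dots> = \<one>" by (simp add: one)
  finally have "cnorm A x \<le> 1" "cnorm A y \<le> 1"
    using unitary_parts[OF x y xy _ cnorm_seminorm] by auto
  moreover have "d \<oplus> d = (d \<oplus> w) \<oplus> x" unfolding x_def using dc(1) wc(1) by algebra
  then have "2 \<odot> d = \<one> \<oplus> x"
    using smult_add_left[of d 1 1] dc(1) by (simp add: one)
  then have "2 * cnorm A d \<le> 1 + cnorm A x"
    using p_smult[OF dc(1), of 2] p_add_le[OF one_closed x(1)] p_one_le by simp
  ultimately have "cnorm A d \<le> 1" "2 * cnorm A e \<le> 1"
    using ec(1) by (auto simp: y_def p_smult)
  then show ?thesis using dc(1,2) hd one by (intro bexI[of _ d]) (auto simp: e_def w_def)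
qed

end

lemma a_r_coset_mem_iff:
  "z \<in> I +>\<^bsub>A\<^esub> x \<longleftrightarrow> (\<exists>i\<in>I. z = i \<oplus>\<^bsub>A\<^esub> x)"
  by (auto simp: a_r_coset_def r_coset_def)

lemma (in cstar) norm_closed_tends:
  "norm_closed A J \<Longrightarrow> (\<And>k. s k \<in> J) \<Longrightarrow> tends s x \<Longrightarrow> x \<in> J"
  unfolding norm_closed_def using tendsD[of s x] by blast

locale closed_star_ideal = cstar A + ideal I A for A :: "('a, 'x) cstar_alg_scheme" (structure) and I +
  assumes norm_closed: "norm_closed A I"
    and invol_ideal: "x \<in> I \<Longrightarrow> invol A x \<in> I"
begin

lemmas ideal_tends = norm_closed_tends[OF norm_closed]

lemma coset_mem: "x \<in> carrier A \<Longrightarrow> x \<in> I +> x"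
  using additive_subgroup.zero_closed[OF additive_subgroup_axioms]
  by (force simp: a_r_coset_mem_iff)

lemma ideal_smult: "x \<in> I \<Longrightarrow> c \<odot> x \<in> I"
  using I_l_closed[of x "c \<odot> \<one>"] by (simp add: Icarr)

text \<open>The quotient norm, kept as a seminorm on \<open>A\<close> itself: the theory of
  \<open>cstar_seminormed\<close> then applies to it before any quotient algebra is formed.\<close>

definition qn :: "'a \<Rightarrow> real" where
  "qn x = (INF z\<in>I +> x. cnorm A z)"

lemma coset_closed: "x \<in> carrier A \<Longrightarrow> z \<in> I +> x \<Longrightarrow> z \<in> carrier A"
  by (auto simp: a_r_coset_mem_iff Icarr)

lemma qn_bdd: "x \<in> carrier A \<Longrightarrow> bdd_below (cnorm A ` (I +> x))"
  by (rule bdd_belowI[of _ 0]) (auto dest: coset_closed)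

lemma qn_le: "x \<in> carrier A \<Longrightarrow> i \<in> I \<Longrightarrow> qn x \<le> cnorm A (i \<oplus> x)"
  unfolding qn_def by (rule cINF_lower[OF qn_bdd]) (auto simp: a_r_coset_mem_iff)

lemma qn_le_cnorm: "x \<in> carrier A \<Longrightarrow> qn x \<le> cnorm A x"
  using qn_le[of x \<zero>] by simp

lemma qn_approx:
  assumes "x \<in> carrier A" "\<epsilon> > 0"
  shows "\<exists>i\<in>I. cnorm A (i \<oplus> x) < qn x + \<epsilon>"
proof -
  have "I +> x \<noteq> {}" using coset_mem[OF assms(1)] by blast
  then show ?thesis
    using cINF_less_iff[OF _ qn_bdd[OF assms(1)], of "qn x + \<epsilon>"] assms(2)
    by (auto simp: qn_def[symmetric] a_r_coset_mem_iff)
qed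

lemma qn_nonneg: "x \<in> carrier A \<Longrightarrow> 0 \<le> qn x"
  unfolding qn_def
  by (rule cINF_greatest) (use coset_mem coset_closed in auto)

lemma qn_add_le:
  assumes x: "x \<in> carrier A" and y: "y \<in> carrier A"
  shows "qn (x \<oplus> y) \<le> qn x + qn y"
proof (rule field_le_epsilon)
  fix e :: real assume e: "e > 0"
  obtain i where i: "i \<in> I" "cnorm A (i \<oplus> x) < qn x + e / 2" using qn_approx[OF x, of "e / 2"] e by auto
  obtain j where j: "j \<in> I" "cnorm A (j \<oplus> y) < qn y + e / 2" using qn_approx[OF y, of "e / 2"] e by auto
  have c: "i \<in> carrier A" "j \<in> carrier A" using i j by (auto simp: Icarr)
  have "(i \<oplus> j) \<oplus> (x \<oplus> y) = (i \<oplus> x) \<oplus> (j \<oplus> y)" using c x y by (simp add: a_ac)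
  then have "qn (x \<oplus> y) \<le> cnorm A ((i \<oplus> x) \<oplus> (j \<oplus> y))"
    using qn_le[of "x \<oplus> y" "i \<oplus> j"] i j x y by simp
  also have "\<dots> \<le> cnorm A (i \<oplus> x) + cnorm A (j \<oplus> y)" using c x y by (intro p_add_le) auto
  finally show "qn (x \<oplus> y) \<le> qn x + qn y + e" using i j by simp
qed

lemma qn_mult_le:
  assumes x: "x \<in> carrier A" and y: "y \<in> carrier A"
  shows "qn (x \<otimes> y) \<le> qn x * qn y"
proof -
  have "qn (x \<otimes> y) \<le> (qn x + e) * (qn y + e)" if e: "e > 0" for e
  proof -
    obtain i where i: "i \<in> I" "cnorm A (i \<oplus> x) < qn x + e" using qn_approx[OF x e] by auto
    obtain j where j: "j \<in> I" "cnorm A (j \<oplus> y) < qn y + e" using qn_approx[OF y e] by auto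
    have c: "i \<in> carrier A" "j \<in> carrier A" using i j by (auto simp: Icarr)
    have "(i \<otimes> j \<oplus> i \<otimes> y \<oplus> x \<otimes> j) \<oplus> x \<otimes> y = (i \<oplus> x) \<otimes> (j \<oplus> y)"
      using c x y by algebra
    moreover have "i \<otimes> j \<oplus> i \<otimes> y \<oplus> x \<otimes> j \<in> I"
      using i j x y c by (intro a_closed I_l_closed I_r_closed)
    ultimately have "qn (x \<otimes> y) \<le> cnorm A ((i \<oplus> x) \<otimes> (j \<oplus> y))"
      using qn_le[of "x \<otimes> y" "i \<otimes> j \<oplus> i \<otimes> y \<oplus> x \<otimes> j"] x y by simp
    also have "\<dots> \<le> cnorm A (i \<oplus> x) * cnorm A (j \<oplus> y)" using c x y by (intro p_mult_le) auto
    also have "\<dots> \<le> (qn x + e) * (qn y + e)"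
      using i j c x y e qn_nonneg[OF x] by (intro mult_mono) auto
    finally show ?thesis .
  qed
  \<comment> \<open>The slack sits inside a product here, so it is removed by letting
    \<open>e\<close> tend to zero from the right.\<close>
  moreover have "((\<lambda>e. (qn x + e) * (qn y + e)) \<longlongrightarrow> (qn x + 0) * (qn y + 0)) (at_right 0)"
    by (intro tendsto_intros)
  ultimately show ?thesis
    by (intro tendsto_lowerbound[where F = "at_right (0 :: real)" and f = "\<lambda>e. (qn x + e) * (qn y + e)"])
       (auto simp: eventually_at_right_less eventually_at_filter intro!: eventually_at_rightI[of 0 1])
qed

lemma qn_smult:
  assumes x: "x \<in> carrier A"
  shows "qn (c \<odot> x) = cmod c * qn x"
proof -
  \<comment> \<open>This inequality for all scalars contains the converse: apply it to
    \<open>c \<odot> x\<close> with the scalar \<open>inverse c\<close>.\<close>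
  have le: "qn (c \<odot> x) \<le> cmod c * qn x" if x: "x \<in> carrier A" for c x
  proof (cases "c = 0")
    case True
    then show ?thesis using qn_le_cnorm[of \<zero>] x by simp
  next
    case False
    show ?thesis
    proof (rule field_le_epsilon)
      fix e :: real assume e: "e > 0"
      obtain i where i: "i \<in> I" "cnorm A (i \<oplus> x) < qn x + e / cmod c"
        using qn_approx[OF x, of "e / cmod c"] e False by auto
      have "qn (c \<odot> x) \<le> cnorm A (c \<odot> (i \<oplus> x))"
        using qn_le[of "c \<odot> x" "c \<odot> i"] i x by (simp add: smult_add_right Icarr ideal_smult)
      also have "\<dots> = cmod c * cnorm A (i \<oplus> x)" using i x by (simp add: p_smult Icarr)
      also have "\<dots> \<le> cmod c * (qn x + e / cmod c)" using i by (intro mult_left_mono) auto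
      also have "\<dots> = cmod c * qn x + e" using False by (simp add: field_simps)
      finally show "qn (c \<odot> x) \<le> cmod c * qn x + e" .
    qed
  qed
  show ?thesis
  proof (cases "c = 0")
    case True
    then show ?thesis using le[OF x, of 0] qn_nonneg[of \<zero>] x by simp
  next
    case False
    then have "qn x \<le> cmod (inverse c) * qn (c \<odot> x)" using le[of "c \<odot> x" "inverse c"] x by simp
    then have "cmod c * qn x \<le> qn (c \<odot> x)" using False by (simp add: norm_divide field_simps)
    then show ?thesis using le[OF x, of c] by simp
  qed
qed

lemma qn_invol_le: "x \<in> carrier A \<Longrightarrow> qn (invol A x) \<le> qn x"
proof (rule field_le_epsilon)
  fix e :: real assume x: "x \<in> carrier A" and e: "e > 0"
  obtain i where i: "i \<in> I" "cnorm A (i \<oplus> x) < qn x + e" using qn_approx[OF x e] by auto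
  have "qn (invol A x) \<le> cnorm A (invol A (i \<oplus> x))"
    using qn_le[of "invol A x" "invol A i"] i x by (simp add: Icarr invol_ideal del: p_invol)
  also have "\<dots> = cnorm A (i \<oplus> x)" using i x by (intro p_invol) (simp add: Icarr)
  finally show "qn (invol A x) \<le> qn x + e" using i by simp
qed

text \<open>
  For self-adjoint \<open>j \<in> I\<close> the element \<open>d\<close> of \<open>1 + I\<close> cuts off the part of \<open>A\<close> where \<open>j\<close> is large;
  it replaces an approximate unit.
\<close>

lemma qn_cstar:
  assumes x: "x \<in> carrier A"
  shows "qn (invol A x \<otimes> x) = (qn x)\<^sup>2"
proof (rule antisym)
  have "qn (invol A x \<otimes> x) \<le> qn (invol A x) * qn x" using x by (intro qn_mult_le) auto
  also have "\<dots> \<le> qn x * qn x" using x by (intro mult_right_mono qn_invol_le qn_nonneg)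
  finally show "qn (invol A x \<otimes> x) \<le> (qn x)\<^sup>2" by (simp add: power2_eq_square)
next
  define y where "y = invol A x \<otimes> x"
  have y: "y \<in> carrier A" "invol A y = y" using x by (auto simp: y_def)
  show "(qn x)\<^sup>2 \<le> qn y"
  proof (rule field_le_epsilon)
    fix e :: real assume e: "e > 0"
    obtain i where i: "i \<in> I" "cnorm A (i \<oplus> y) < qn y + e / 2" using qn_approx[OF y(1), of "e / 2"] e by auto
    have ic: "i \<in> carrier A" using i by (simp add: Icarr)
    \<comment> \<open>Symmetrising \<open>i\<close> costs nothing: \<open>y\<close> is self-adjoint,
      so the norm of \<open>j \<oplus> y\<close> is at most that of
      \<open>i \<oplus> y\<close>.\<close>
    define j where "j = (1 / 2) \<odot> (i \<oplus> invol A i)"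
    have j: "j \<in> I" "j \<in> carrier A" "invol A j = j"
      using i ic by (auto simp: j_def ideal_smult invol_ideal a_comm)
    have "y = (1 / 2) \<odot> (y \<oplus> y)"
      using y smult_add_left[of y "1/2" "1/2"] by (simp add: smult_add_right)
    then have "j \<oplus> y = (1 / 2) \<odot> ((i \<oplus> invol A i) \<oplus> (y \<oplus> y))"
      using ic y(1) by (simp add: j_def smult_add_right)
    also have "(i \<oplus> invol A i) \<oplus> (y \<oplus> y) = (i \<oplus> y) \<oplus> invol A (i \<oplus> y)"
      using ic y by (simp add: a_ac)
    finally have "cnorm A (j \<oplus> y) = (1 / 2) * cnorm A ((i \<oplus> y) \<oplus> invol A (i \<oplus> y))"
      using ic y(1) by (simp add: p_smult)
    also have "\<dots> \<le> (1 / 2) * (cnorm A (i \<oplus> y) + cnorm A (i \<oplus> y))"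
      using p_add_le[of "i \<oplus> y" "invol A (i \<oplus> y)"] p_invol[of "i \<oplus> y"] ic y(1) by simp
    finally have jy: "cnorm A (j \<oplus> y) < qn y + e / 2" using i by simp
    \<comment> \<open>Scaled so that the resolvent bound on \<open>h \<otimes> d\<close> becomes
      \<open>cnorm A (j \<otimes> d) \<le> e / 2\<close>.\<close>
    define h where "h = complex_of_real (1 / e) \<odot> j"
    have h: "h \<in> carrier A" "invol A h = h" "h \<in> I" using j by (auto simp: h_def ideal_smult)
    obtain d where d: "d \<in> carrier A" "invol A d = d" "h \<otimes> d = d \<otimes> h" "d \<oplus> h \<otimes> (h \<otimes> d) = \<one>"
      "cnorm A d \<le> 1" "2 * cnorm A (h \<otimes> d) \<le> 1"
      using resolvent[OF h(1,2)] by blast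
    have "j \<otimes> d = complex_of_real e \<odot> (h \<otimes> d)"
      using j(2) d(1) e by (simp add: h_def flip: of_real_mult)
    then have jd: "cnorm A (j \<otimes> d) \<le> e / 2"
      using d(6) h d(1) e by (simp add: p_smult)
    \<comment> \<open>As \<open>d \<oplus> k = \<one>\<close> with \<open>k \<in> I\<close>, the
      element \<open>x \<otimes> d\<close> lies in the coset of \<open>x\<close>. Its squared norm
      is that of \<open>d y d = d (j + y) d - d (j d)\<close>, where both terms are under
      control.\<close>
    define k where "k = h \<otimes> (h \<otimes> d)"
    have k: "k \<in> I" "k \<in> carrier A" using h d(1) by (auto simp: k_def I_r_closed)
    have "x = x \<otimes> d \<oplus> x \<otimes> k" using d(4) x d(1) k by (simp add: k_def[symmetric] r_distr[symmetric])
    then have "x \<otimes> d = \<ominus> (x \<otimes> k) \<oplus> x"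
      using x d(1) k by (metis a_comm m_closed r_neg1)
    then have "qn x \<le> cnorm A (x \<otimes> d)"
      using qn_le[of x "\<ominus> (x \<otimes> k)"] k x by (simp add: I_l_closed)
    then have "(qn x)\<^sup>2 \<le> (cnorm A (x \<otimes> d))\<^sup>2" using qn_nonneg[OF x] by (intro power_mono)
    also have "\<dots> = cnorm A (invol A (x \<otimes> d) \<otimes> (x \<otimes> d))" using x d(1) by (intro p_cstar[symmetric]) auto
    also have "invol A (x \<otimes> d) \<otimes> (x \<otimes> d) = d \<otimes> y \<otimes> d"
      using x d(1,2) by (simp add: y_def m_assoc)
    also have "\<dots> = d \<otimes> (j \<oplus> y) \<otimes> d \<ominus> d \<otimes> (j \<otimes> d)"
      using d(1) y(1) j(2) by algebra
    also have "cnorm A \<dots> \<le> cnorm A (d \<otimes> (j \<oplus> y) \<otimes> d) + cnorm A (d \<otimes> (j \<otimes> d))"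
      using d(1) y(1) j(2) by (intro p_minus_le) auto
    also have "cnorm A (d \<otimes> (j \<oplus> y) \<otimes> d) \<le> cnorm A d * cnorm A (j \<oplus> y) * cnorm A d"
      using p_mult_le[of "d \<otimes> (j \<oplus> y)" d] mult_right_mono[OF p_mult_le[of d "j \<oplus> y"] p_nonneg[of d]] d(1) y(1) j(2)
      by simp
    also have "\<dots> \<le> 1 * cnorm A (j \<oplus> y) * 1"
      using d(1,5) y(1) j(2) by (intro mult_mono) (auto intro: mult_nonneg_nonneg)
    also have "cnorm A (d \<otimes> (j \<otimes> d)) \<le> 1 * (e / 2)"
      using p_mult_le[of d "j \<otimes> d"] mult_mono[OF d(5) jd] d(1) j(2) by simp
    finally show "(qn x)\<^sup>2 \<le> qn y + e" using jy by simp
  qed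
qed

text \<open>If \<open>qn x = 0\<close>, then \<open>x\<close> is a limit of elements of
  \<open>I\<close>; this is where the closedness of the ideal is used.\<close>

lemma qn_zero_iff: "x \<in> carrier A \<Longrightarrow> qn x = 0 \<longleftrightarrow> x \<in> I"
proof
  assume x: "x \<in> carrier A" and "qn x = 0"
  then have "\<exists>i\<in>I. cnorm A (i \<oplus> x) < inverse (real (Suc k))" for k
    using qn_approx[OF x, of "inverse (real (Suc k))"] by simp
  then obtain f where f: "\<And>k. f k \<in> I" "\<And>k. cnorm A (f k \<oplus> x) < inverse (real (Suc k))" by metis
  have "tends (\<lambda>k. \<ominus> f k) x"
  proof (rule tends_le[OF _ x LIMSEQ_inverse_real_of_nat])
    fix k
    have "\<ominus> f k \<ominus> x = \<ominus> (f k \<oplus> x)" using f(1)[of k] x by (simp add: minus_add a_minus_def Icarr)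
    then show "cnorm A (\<ominus> f k \<ominus> x) \<le> inverse (real (Suc k))"
      using f[of k] x by (simp add: p_uminus Icarr less_imp_le)
  qed (use f in \<open>auto simp: Icarr\<close>)
  then show "x \<in> I" by (rule ideal_tends[rotated]) (use f in simp)
next
  assume x: "x \<in> carrier A" and "x \<in> I"
  then show "qn x = 0" using qn_le[of x "\<ominus> x"] qn_nonneg[OF x] by (simp add: l_neg)
qed

lemma cstar_seminorm_qn: "cstar_seminorm A qn"
  by (simp add: cstar_seminorm_def qn_nonneg qn_add_le qn_smult qn_mult_le qn_cstar)

sublocale q: cstar_seminormed A qn
  by unfold_locales (rule cstar_seminorm_qn)

text \<open>Completeness: lift a rapidly convergent subsequence with control of the increments.\<close>

lemma qn_complete:
  assumes X: "q.cauchy X"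
  shows "\<exists>x. q.tends X x"
proof -
  have "\<exists>N. \<forall>m\<ge>N. \<forall>n\<ge>N. qn (X m \<ominus> X n) < (1 / 2) ^ k" for k
    using q.cauchyD[OF X, of "(1 / 2) ^ k"] by simp
  then obtain N where N: "\<And>k m n. m \<ge> N k \<Longrightarrow> n \<ge> N k \<Longrightarrow> qn (X m \<ominus> X n) < (1 / 2) ^ k" by metis
  \<comment> \<open>Summing makes the indices monotone while keeping
    \<open>N k \<le> M k\<close>.\<close>
  define M where "M k = (\<Sum>i\<le>k. N i)" for k
  have M: "N k \<le> M k" "M k \<le> M (Suc k)" for k by (auto simp: M_def intro: member_le_sum)
  have Xc [simp]: "X k \<in> carrier A" for k using X by simp
  have step: "\<exists>y'. (\<exists>i\<in>I. y' = i \<oplus> X (M (Suc k))) \<and> cnorm A (y' \<ominus> y) < (1 / 2) ^ k"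
    if y: "\<exists>i\<in>I. y = i \<oplus> X (M k)" for y k
  proof -
    obtain i where i: "i \<in> I" "y = i \<oplus> X (M k)" using y by blast
    have "qn (X (M (Suc k)) \<ominus> X (M k)) < (1 / 2) ^ k" using N M order_trans by blast
    \<comment> \<open>The strict inequality leaves a positive gap below \<open>(1 / 2) ^ k\<close>,
      which serves as the slack in \<open>qn_approx\<close>.\<close>
    then obtain j where j: "j \<in> I" "cnorm A (j \<oplus> (X (M (Suc k)) \<ominus> X (M k))) < (1 / 2) ^ k"
      using qn_approx[of "X (M (Suc k)) \<ominus> X (M k)" "(1 / 2) ^ k - qn (X (M (Suc k)) \<ominus> X (M k))"] by auto
    have c: "i \<in> carrier A" "j \<in> carrier A" using i j by (auto simp: Icarr)
    have "((i \<oplus> j) \<oplus> X (M (Suc k))) \<ominus> (i \<oplus> X (M k)) = j \<oplus> (X (M (Suc k)) \<ominus> X (M k))"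
      using c Xc[of "M (Suc k)"] Xc[of "M k"] by algebra
    then show ?thesis
      using i j by (intro exI[of _ "(i \<oplus> j) \<oplus> X (M (Suc k))"]) auto
  qed
  have "\<exists>i\<in>I. X (M 0) = i \<oplus> X (M 0)" using coset_mem[of "X (M 0)"] by (simp add: a_r_coset_mem_iff)
  then obtain y where y: "\<And>k. \<exists>i\<in>I. y k = i \<oplus> X (M k)" "\<And>k. cnorm A (y (Suc k) \<ominus> y k) < (1 / 2) ^ k"
    using dependent_nat_choice[of "\<lambda>k y. \<exists>i\<in>I. y = i \<oplus> X (M k)" "\<lambda>k y y'. cnorm A (y' \<ominus> y) < (1 / 2) ^ k"] step
    by blast
  have yc [simp]: "y k \<in> carrier A" for k using y(1)[of k] by (auto simp: Icarr)
  have geo: "cnorm A (y (k + m) \<ominus> y k) \<le> 2 * (1 / 2) ^ k" for k m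
  proof (induction m arbitrary: k)
    case 0 then show ?case by (simp add: a_minus_def r_neg)
  next
    case (Suc m)
    have "cnorm A (y (k + Suc m) \<ominus> y k) \<le> cnorm A (y (Suc k + m) \<ominus> y (Suc k)) + cnorm A (y (Suc k) \<ominus> y k)"
      using p_triangle[of "y (Suc k + m)" "y (Suc k)" "y k"] by simp
    also have "\<dots> \<le> 2 * (1 / 2) ^ Suc k + (1 / 2) ^ k"
      using Suc.IH[of "Suc k"] y(2)[of k] by (intro add_mono) auto
    finally show ?case by simp
  qed
  have "cauchy y"
    unfolding cauchy_def
  proof (intro conjI allI impI)
    fix \<epsilon> :: real assume e: "\<epsilon> > 0"
    then obtain K where K: "(1 / 2) ^ K < \<epsilon> / 4" using real_arch_pow_inv[of "\<epsilon> / 4" "1 / 2"] by auto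
    have "cnorm A (y k \<ominus> y l) < \<epsilon>" if "k \<ge> K" "l \<ge> K" for k l
      using p_triangle[of "y k" "y K" "y l"] geo[of K "k - K"] geo[of K "l - K"] that K
        p_minus_commute[of "y K" "y l"] by simp
    then show "\<exists>N. \<forall>k\<ge>N. \<forall>l\<ge>N. cnorm A (y k \<ominus> y l) < \<epsilon>" by blast
  qed auto
  then obtain x where x: "tends y x" using cauchy_tends by blast
  have xc: "x \<in> carrier A" using x by (rule tendsD)
  have "q.tends X x"
  proof (rule q.tendsI)
    show "(\<lambda>k. qn (X k \<ominus> x)) \<longlonglongrightarrow> 0"
    proof (rule LIMSEQ_I)
      fix r :: real assume r: "r > 0"
      obtain K where K: "(1 / 2) ^ K < r / 2" using real_arch_pow_inv[of "r / 2" "1 / 2"] r by auto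
      obtain L where L: "\<And>k. k \<ge> L \<Longrightarrow> norm (cnorm A (y k \<ominus> x) - 0) < r / 2"
        using LIMSEQ_D[OF tendsD(3)[OF x], of "r / 2"] r by auto
      define m where "m = max K L"
      have "norm (qn (X k \<ominus> x) - 0) < r" if k: "k \<ge> N K" for k
      proof -
        have "M K \<le> M m" by (auto simp: M_def m_def intro!: sum_mono2)
        then have 1: "qn (X k \<ominus> X (M m)) < r / 2"
          using N[of K k "M m"] k M(1)[of K] K by simp
        obtain i where i: "i \<in> I" "y m = i \<oplus> X (M m)" using y(1) by blast
        have "i \<oplus> (X (M m) \<ominus> x) = y m \<ominus> x"
          using i Xc[of "M m"] xc by (simp add: a_minus_def a_assoc Icarr)
        then have "qn (X (M m) \<ominus> x) \<le> cnorm A (y m \<ominus> x)"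
          using qn_le[of "X (M m) \<ominus> x" i] i xc by simp
        also have "\<dots> < r / 2" using L[of m] xc by (simp add: m_def)
        finally show ?thesis
          using 1 q.p_triangle[of "X k" "X (M m)" x] xc q.p_nonneg[of "X k \<ominus> x"] by simp
      qed
      then show "\<exists>no. \<forall>k\<ge>no. norm (qn (X k \<ominus> x) - 0) < r" by blast
    qed
  qed (use xc in auto)
  then show ?thesis by blast
qed

abbreviation "Q \<equiv> cstar_quot A I"

lemma Q_carrier: "carrier Q = (\<lambda>x. I +> x) ` carrier A"
  by (auto simp: cstar_quot_def FactRing_simps)

lemma Q_cases: "X \<in> carrier Q \<Longrightarrow> (\<And>x. x \<in> carrier A \<Longrightarrow> X = I +> x \<Longrightarrow> thesis) \<Longrightarrow> thesis"
  by (auto simp: Q_carrier)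

lemma Q_closed [simp]: "x \<in> carrier A \<Longrightarrow> I +> x \<in> carrier Q"
  by (auto simp: Q_carrier)

lemma coset_eq_iff: "x \<in> carrier A \<Longrightarrow> y \<in> carrier A \<Longrightarrow> I +> x = I +> y \<longleftrightarrow> x \<ominus> y \<in> I"
  using quotient_eq_iff_same_a_r_cos[OF is_ideal] by simp

lemma Q_ops:
  "x \<in> carrier A \<Longrightarrow> y \<in> carrier A \<Longrightarrow> (I +> x) \<otimes>\<^bsub>Q\<^esub> (I +> y) = I +> (x \<otimes> y)"
  "x \<in> carrier A \<Longrightarrow> y \<in> carrier A \<Longrightarrow> (I +> x) \<oplus>\<^bsub>Q\<^esub> (I +> y) = I +> (x \<oplus> y)"
  "\<one>\<^bsub>Q\<^esub> = I +> \<one>"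
  "\<zero>\<^bsub>Q\<^esub> = I +> \<zero>"
  by (simp_all add: cstar_quot_def FactRing_def rcoset_mult_add a_rcos_sum a_subset)

lemma Q_smult:
  assumes x: "x \<in> carrier A"
  shows "c \<odot>\<^bsub>Q\<^esub> (I +> x) = I +> (c \<odot> x)"
proof -
  have "I +> (c \<odot> z) = I +> (c \<odot> x)" if z: "z \<in> I +> x" for z
  proof -
    obtain i where i: "i \<in> I" "z = i \<oplus> x" using z by (auto simp: a_r_coset_mem_iff)
    then have "c \<odot> z = c \<odot> i \<oplus> c \<odot> x" using x by (simp add: smult_add_right Icarr)
    then have "c \<odot> z \<in> I +> (c \<odot> x)" using ideal_smult[OF i(1)] by (auto simp: a_r_coset_mem_iff)
    then show ?thesis using x a_subgroup by (intro a_repr_independence[symmetric]) auto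
  qed
  then have "(\<Union>z\<in>I +> x. I +> (c \<odot> z)) = (\<Union>z\<in>I +> x. I +> (c \<odot> x))" by (rule SUP_cong[OF refl])
  moreover have "I +> x \<noteq> {}" using coset_mem[OF x] by blast
  ultimately show ?thesis by (simp add: cstar_quot_def)
qed

lemma Q_invol:
  assumes x: "x \<in> carrier A"
  shows "invol Q (I +> x) = I +> invol A x"
proof -
  have "I +> invol A z = I +> invol A x" if z: "z \<in> I +> x" for z
  proof -
    obtain i where i: "i \<in> I" "z = i \<oplus> x" using z by (auto simp: a_r_coset_mem_iff)
    then have "invol A z = invol A i \<oplus> invol A x" using x by (simp add: Icarr)
    then have "invol A z \<in> I +> invol A x" using invol_ideal[OF i(1)] by (auto simp: a_r_coset_mem_iff)
    then show ?thesis using x a_subgroup by (intro a_repr_independence[symmetric]) auto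
  qed
  then have "(\<Union>z\<in>I +> x. I +> invol A z) = (\<Union>z\<in>I +> x. I +> invol A x)" by (rule SUP_cong[OF refl])
  moreover have "I +> x \<noteq> {}" using coset_mem[OF x] by blast
  ultimately show ?thesis by (simp add: cstar_quot_def)
qed

lemma Q_cnorm: "cnorm Q (I +> x) = qn x"
  by (simp add: cstar_quot_def qn_def)

lemma star_algebra_Q: "star_algebra Q"
proof (rule star_algebraI)
  interpret R: ring "A Quot I" by (rule quotient_is_ring)
  have eqs: "carrier Q = carrier (A Quot I)" "monoid.mult Q = monoid.mult (A Quot I)"
    "one Q = one (A Quot I)" "zero Q = zero (A Quot I)" "add Q = add (A Quot I)"
    by (simp_all add: cstar_quot_def)
  show "ring Q"
  proof (rule ringI)
    show "abelian_group Q"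
      by (rule abelian_groupI) (use R.a_closed R.a_assoc R.a_comm R.l_zero R.add.l_inv_ex in \<open>auto simp: eqs\<close>)
    show "Group.monoid Q"
      by (rule monoidI) (auto simp: eqs R.m_assoc)
  qed (auto simp: eqs R.l_distr R.r_distr)
qed (auto simp: Q_ops Q_smult Q_invol smult_add_left smult_add_right elim!: Q_cases)

lemma star_hom_Q: "star_hom A Q (\<lambda>x. I +> x)"
  by (rule star_homI) (simp_all add: Q_ops Q_smult Q_invol)

theorem cstar_Q: "cstar Q"
proof -
  interpret Q: star_algebra Q by (rule star_algebra_Q)
  note minus = star_hom_minus[OF star_hom_Q star_algebra_axioms star_algebra_Q, symmetric]
  have sn: "cstar_seminorm Q (cnorm Q)"
    unfolding cstar_seminorm_def
    by (auto simp: Q_ops Q_smult Q_invol Q_cnorm qn_nonneg qn_add_le qn_smult qn_mult_le qn_cstar elim!: Q_cases)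
  interpret Qn: cstar_seminormed Q "cnorm Q" by unfold_locales (rule sn)
  show ?thesis
  proof (rule cstarI)
    show "cstar_seminormed Q (cnorm Q)" by unfold_locales
    fix X assume "X \<in> carrier Q" "cnorm Q X = 0"
    then obtain x where "x \<in> carrier A" "X = I +> x" by (auto elim: Q_cases)
    then show "X = \<zero>\<^bsub>Q\<^esub>"
      using \<open>cnorm Q X = 0\<close> by (simp add: Q_cnorm qn_zero_iff Q_ops coset_eq_iff a_minus_def)
  next
    fix X assume X: "Qn.cauchy X"
    then have "\<exists>x. x \<in> carrier A \<and> X k = I +> x" for k
      using Qn.cauchy_closed[OF X, of k] by (auto simp: Q_carrier)
    then obtain x where x: "\<And>k. x k \<in> carrier A" "\<And>k. X k = I +> x k" by metis
    have "q.cauchy x"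
      using X x by (auto simp: q.cauchy_def Qn.cauchy_def minus Q_cnorm)
    then obtain y where y: "q.tends x y" using qn_complete by blast
    have "Qn.tends X (I +> y)"
      using q.tendsD[OF y] x by (auto simp: Qn.tends_def minus Q_cnorm)
    then show "\<exists>x. Qn.tends X x" by blast
  qed
qed

lemma Q_extend:
  assumes B: "star_algebra B" and h: "star_hom A B h" and I: "\<And>i. i \<in> I \<Longrightarrow> h i = \<zero>\<^bsub>B\<^esub>"
  shows "\<exists>g. star_hom Q B g \<and> (\<forall>x\<in>carrier A. g (I +> x) = h x)"
proof -
  interpret B: star_algebra B by fact
  note hs = star_hom_simps[OF h]
  define g where "g X = h (SOME x. x \<in> X)" for X
  have g: "g (I +> x) = h x" if x: "x \<in> carrier A" for x
  proof -
    have "x \<in> I +> x" using x by (rule coset_mem)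
    then have "(SOME z. z \<in> I +> x) \<in> I +> x" by (rule someI)
    then obtain i where "i \<in> I" "(SOME z. z \<in> I +> x) = i \<oplus> x" by (auto simp: a_r_coset_mem_iff)
    then show ?thesis using x by (simp add: g_def hs I Icarr)
  qed
  have "star_hom Q B g"
    by (rule star_homI) (auto simp: Q_ops Q_smult Q_invol g hs elim!: Q_cases)
  then show ?thesis using g by blast
qed

end

text \<open>Closedness comes from automatic contractivity. It lets a homomorphism that kills a set
  also kill the closed ideal generated by that set.\<close>

lemma kernel_closed_ideal:
  assumes "cstar A" "cstar B" and h: "star_hom A B h"
  shows "ideal {x \<in> carrier A. h x = \<zero>\<^bsub>B\<^esub>} A" (is "ideal ?K A")
    and "norm_closed A {x \<in> carrier A. h x = \<zero>\<^bsub>B\<^esub>}"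
proof -
  interpret A: cstar A by fact
  interpret B: cstar B by fact
  note hs = star_hom_simps[OF h] star_hom_zero[OF h A.star_algebra_axioms B.star_algebra_axioms]
  have u: "h (\<ominus>\<^bsub>A\<^esub> x) = \<ominus>\<^bsub>B\<^esub> h x" if "x \<in> carrier A" for x
    using that by (simp add: A.uminus_eq_smult B.uminus_eq_smult hs)
  show "ideal ?K A"
  proof (rule idealI)
    show "subgroup ?K (add_monoid A)"
      by (rule A.add.subgroupI) (auto simp: hs u a_inv_def[symmetric])
  qed (auto simp: hs A.ring_axioms)
  show "norm_closed A ?K"
    unfolding norm_closed_def
  proof (intro allI ballI impI)
    fix s x assume s: "range s \<subseteq> ?K" and x: "x \<in> carrier A" and l: "(\<lambda>k. cnorm A (s k \<ominus>\<^bsub>A\<^esub> x)) \<longlonglongrightarrow> 0"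
    then have "A.tends s x" by (auto simp: A.tends_def)
    moreover have "h (s k) = \<zero>\<^bsub>B\<^esub>" for k using s by blast
    ultimately have "B.tends (\<lambda>k. \<zero>\<^bsub>B\<^esub>) (h x)" using star_hom_tends[OF assms, of s x] by simp
    from B.tends_unique[OF this B.tends_const] show "x \<in> ?K" using x by simp
  qed
qed

section \<open>Closed ideals generated by a set\<close>

context cstar
begin

lemma closed_ideal_gen_least:
  "ideal J A \<Longrightarrow> norm_closed A J \<Longrightarrow> T \<subseteq> J \<Longrightarrow> closed_ideal_gen A T \<subseteq> J"
  by (auto simp: closed_ideal_gen_def)

lemma closed_ideal_gen_superset: "T \<subseteq> closed_ideal_gen A T"
  by (auto simp: closed_ideal_gen_def)

text \<open>The carrier itself belongs to the family, so the intersection runs over a nonempty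
  family and stays inside the carrier.\<close>

lemma ideal_closed_ideal_gen:
  assumes "T \<subseteq> carrier A"
  shows "ideal (closed_ideal_gen A T) A" "norm_closed A (closed_ideal_gen A T)"
proof -
  let ?\<I> = "{I. ideal I A \<and> norm_closed A I \<and> T \<subseteq> I}"
  have car: "carrier A \<in> ?\<I>" using assms oneideal by (auto simp: norm_closed_def)
  have ids: "additive_subgroup J A" "ideal J A" if "J \<in> ?\<I>" for J
    using that by (auto simp: ideal_def)
  have zero: "\<zero> \<in> \<Inter>?\<I>" using additive_subgroup.zero_closed[OF ids(1)] by blast
  show "ideal (closed_ideal_gen A T) A"
    unfolding closed_ideal_gen_def
  proof (rule idealI[OF ring_axioms])
    show "subgroup (\<Inter>?\<I>) (add_monoid A)"
    proof (rule add.subgroupI)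
      show "\<Inter>?\<I> \<noteq> {}" using zero by blast
    qed (use car in \<open>auto simp: a_inv_def[symmetric]
          intro: additive_subgroup.a_closed[OF ids(1)] additive_subgroup.a_inv_closed[OF ids(1)]\<close>)
  qed (auto intro: ideal.I_l_closed[OF ids(2)] ideal.I_r_closed[OF ids(2)])
  show "norm_closed A (closed_ideal_gen A T)"
    unfolding norm_closed_def closed_ideal_gen_def by blast
qed

text \<open>If \<open>T\<close> is invariant under the involution up to sign, the preimage of the ideal under the involution is such an ideal again.\<close>

lemma closed_star_ideal_gen:
  assumes T: "T \<subseteq> carrier A" and inv: "\<And>t. t \<in> T \<Longrightarrow> \<ominus> invol A t \<in> T"
  shows "closed_star_ideal A (closed_ideal_gen A T)"
proof -
  let ?I = "closed_ideal_gen A T"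
  interpret I: ideal ?I A by (rule ideal_closed_ideal_gen[OF T])
  define J where "J = {x \<in> carrier A. invol A x \<in> ?I}"
  have "ideal J A"
  proof (rule idealI[OF ring_axioms])
    show "subgroup J (add_monoid A)"
    proof (rule add.subgroupI)
      have "\<zero> \<in> J" by (simp add: J_def additive_subgroup.zero_closed[OF I.additive_subgroup_axioms])
      then show "J \<noteq> {}" by blast
    qed (auto simp: J_def a_inv_def[symmetric])
  qed (auto simp: J_def I.I_l_closed I.I_r_closed)
  moreover have "norm_closed A J"
    unfolding norm_closed_def
  proof (intro allI ballI impI)
    fix s x assume s: "range s \<subseteq> J" and x: "x \<in> carrier A" and l: "(\<lambda>k. cnorm A (s k \<ominus> x)) \<longlonglongrightarrow> 0"
    then have "tends s x" by (auto simp: tends_def J_def)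
    from tends_invol[OF this] have "invol A x \<in> ?I"
      by (rule norm_closed_tends[OF ideal_closed_ideal_gen(2)[OF T], rotated]) (use s in \<open>auto simp: J_def\<close>)
    then show "x \<in> J" using x by (simp add: J_def)
  qed
  moreover have "T \<subseteq> J"
  proof
    fix t assume t: "t \<in> T"
    then have "\<ominus> invol A t \<in> ?I" using inv closed_ideal_gen_superset by blast
    then have "\<ominus> (\<ominus> invol A t) \<in> ?I" by (rule I.a_inv_closed)
    then show "t \<in> J" using t T by (auto simp: J_def)
  qed
  ultimately have "?I \<subseteq> J" by (rule closed_ideal_gen_least)
  then show ?thesis
    using ideal_closed_ideal_gen(2)[OF T]
    by (unfold_locales) (auto simp: J_def)
qed

end

section \<open>Universal C*-algebras\<close>

interpretation words: star_monoid "\<lparr>carrier = lists (Gs \<times> UNIV), monoid.mult = (@), one = []\<rparr>"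
    "\<lambda>w. rev (map (\<lambda>(g, b). (g, \<not> b)) w)" for Gs :: "'g set"
proof unfold_locales
  fix u :: "('g \<times> bool) list"
  have "map ((\<lambda>(g, b). (g, \<not> b)) \<circ> (\<lambda>(g, b). (g, \<not> b))) u = u"
    by (rule map_idI) auto
  then show "rev (map (\<lambda>(g, b). (g, \<not> b)) (rev (map (\<lambda>(g, b). (g, \<not> b)) u))) = u"
    by (simp add: rev_map)
qed (auto simp: lists_eq_set)

context
  fixes Gs :: "'g set"
begin

lemma star_algebra_free: "star_algebra (free_star_alg Gs)"
  unfolding free_star_alg_def by (rule words.star_algebra_CM)

interpretation F: star_algebra "free_star_alg Gs" by (rule star_algebra_free)

lemma gen_closed [simp]: "g \<in> Gs \<Longrightarrow> gen g \<in> carrier (free_star_alg Gs)"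
  unfolding free_star_alg_def gen_def by (rule words.CM_single_closed) simp

text \<open>Words disappear behind this rule: a word is a product of letters, each a generator or
  the adjoint of one. Zero needs no case of its own, being \<open>0 \<odot> \<one>\<close>.\<close>

lemma free_induct [consumes 1, case_names one gen invol mult add smult]:
  assumes x: "x \<in> carrier (free_star_alg Gs)"
    and one: "P \<one>\<^bsub>free_star_alg Gs\<^esub>" and gen: "\<And>g. g \<in> Gs \<Longrightarrow> P (gen g)"
    and invol: "\<And>x. x \<in> carrier (free_star_alg Gs) \<Longrightarrow> P x \<Longrightarrow> P (invol (free_star_alg Gs) x)"
    and mult: "\<And>x y. x \<in> carrier (free_star_alg Gs) \<Longrightarrow> y \<in> carrier (free_star_alg Gs) \<Longrightarrow> P x \<Longrightarrow> P y \<Longrightarrow> P (x \<otimes>\<^bsub>free_star_alg Gs\<^esub> y)"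
    and add: "\<And>x y. x \<in> carrier (free_star_alg Gs) \<Longrightarrow> y \<in> carrier (free_star_alg Gs) \<Longrightarrow> P x \<Longrightarrow> P y \<Longrightarrow> P (x \<oplus>\<^bsub>free_star_alg Gs\<^esub> y)"
    and smult: "\<And>c x. x \<in> carrier (free_star_alg Gs) \<Longrightarrow> P x \<Longrightarrow> P (c \<odot>\<^bsub>free_star_alg Gs\<^esub> x)"
  shows "P x"
  using x unfolding free_star_alg_def
proof (induction x rule: words.CM_induct)
  case zero
  have "P \<zero>\<^bsub>free_star_alg Gs\<^esub>" using smult[OF F.one_closed one, of 0] by simp
  then show ?case by (simp add: free_star_alg_def words.CM_simps(3))
next
  case (add x y)
  then show ?case using assms(6)[of x y] by (simp add: free_star_alg_def words.CM_simps(4))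
next
  case (single u c)
  have "Poly_Mapping.single u 1 \<in> carrier (free_star_alg Gs) \<and> P (Poly_Mapping.single u 1)"
    using single
  proof (induction u)
    case Nil
    then show ?case using one F.one_closed by (simp add: free_star_alg_def words.CM_simps(2))
  next
    case (Cons a u)
    obtain g b where a: "a = (g, b)" by force
    with Cons have g: "g \<in> Gs" and u: "Poly_Mapping.single u 1 \<in> carrier (free_star_alg Gs)" "P (Poly_Mapping.single u 1)"
      by auto
    have letter: "Poly_Mapping.single [(g, b)] 1 = (if b then invol (free_star_alg Gs) (gen g) else gen g)"
      by (simp add: free_star_alg_def gen_def words.CM_single)
    have "Poly_Mapping.single (a # u) 1 = Poly_Mapping.single [(g, b)] 1 \<otimes>\<^bsub>free_star_alg Gs\<^esub> Poly_Mapping.single u 1"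
      by (simp add: free_star_alg_def words.CM_single a)
    then show ?case using u g letter by (auto intro!: mult invol gen)
  qed
  then have "P (c \<odot>\<^bsub>free_star_alg Gs\<^esub> Poly_Mapping.single u 1)" by (intro smult) auto
  then show ?case by (simp add: free_star_alg_def words.CM_single)
qed

text \<open>Words are evaluated letter by letter, \<open>True\<close> marking an adjoint. Reversing
  a word and flipping its letters evaluates to the adjoint, which is the compatibility that
  \<open>star_hom_lin_ext\<close> asks for.\<close>

lemma free_extend:
  assumes B: "star_algebra B" and f: "\<And>g. g \<in> Gs \<Longrightarrow> f g \<in> carrier B"
  shows "\<exists>h. star_hom (free_star_alg Gs) B h \<and> (\<forall>g\<in>Gs. h (gen g) = f g)"
proof -
  interpret B: star_algebra B by fact
  define L where "L a = (case a of (g, b) \<Rightarrow> if b then invol B (f g) else f g)" for a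
  define \<theta> where "\<theta> w = foldr (\<lambda>a y. L a \<otimes>\<^bsub>B\<^esub> y) w \<one>\<^bsub>B\<^esub>" for w
  have L: "L a \<in> carrier B" if "a \<in> Gs \<times> UNIV" for a using that f by (auto simp: L_def)
  have cl: "\<theta> w \<in> carrier B" if "w \<in> lists (Gs \<times> UNIV)" for w
    using that by (induction w) (auto simp: \<theta>_def L)
  have \<theta>_simps: "\<theta> [] = \<one>\<^bsub>B\<^esub>" "\<theta> (a # w) = L a \<otimes>\<^bsub>B\<^esub> \<theta> w" for a w by (simp_all add: \<theta>_def)
  have mult: "\<theta> (u @ v) = \<theta> u \<otimes>\<^bsub>B\<^esub> \<theta> v" if "u \<in> lists (Gs \<times> UNIV)" "v \<in> lists (Gs \<times> UNIV)" for u v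
    using that(1) by (induction u) (simp_all add: \<theta>_simps cl L B.m_assoc that(2))
  have inv: "\<theta> (rev (map (\<lambda>(g, b). (g, \<not> b)) u)) = invol B (\<theta> u)" if "u \<in> lists (Gs \<times> UNIV)" for u
    using that
  proof (induction u)
    case (Cons a u)
    obtain g b where a: "a = (g, b)" "g \<in> Gs" using Cons by auto
    have "rev (map (\<lambda>(g, b). (g, \<not> b)) u) \<in> lists (Gs \<times> UNIV)"
      using Cons words.tau_closed[of u] by simp
    then have "\<theta> (rev (map (\<lambda>(g, b). (g, \<not> b)) (a # u))) = invol B (\<theta> u) \<otimes>\<^bsub>B\<^esub> L (g, \<not> b)"
      using Cons a by (simp add: mult \<theta>_simps L)
    moreover have "L (g, \<not> b) = invol B (L a)" using a f by (simp add: L_def)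
    ultimately show ?case using Cons by (simp add: \<theta>_simps L cl)
  qed (simp add: \<theta>_simps)
  have "star_hom (free_star_alg Gs) B (lin_ext B \<theta>)"
    unfolding free_star_alg_def
    by (rule B.star_hom_lin_ext[OF words.star_monoid_axioms]) (simp_all add: cl mult inv \<theta>_simps)
  moreover have "lin_ext B \<theta> (gen g) = f g" if "g \<in> Gs" for g
    using that f by (simp add: gen_def B.lin_ext_single \<theta>_simps L_def)
  ultimately show ?thesis by blast
qed

lemma free_hom_unique:
  assumes "star_hom (free_star_alg Gs) B g" "star_hom (free_star_alg Gs) B h" "\<And>x. x \<in> Gs \<Longrightarrow> g (gen x) = h (gen x)" "x \<in> carrier (free_star_alg Gs)"
  shows "g x = h x"
  using assms(4)
  by (induction rule: free_induct)
     (simp_all add: assms(3) star_hom_simps[OF assms(1)] star_hom_simps[OF assms(2)])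

end

definition admissible ::
    "'g set \<Rightarrow> ('g star_poly \<times> 'g star_poly) set \<Rightarrow> ('g star_poly \<Rightarrow> real) \<Rightarrow> bool" where
  "admissible Gs R p \<longleftrightarrow> cstar_seminorm (free_star_alg Gs) p
    \<and> (\<forall>(l, r)\<in>R. p (l \<ominus>\<^bsub>free_star_alg Gs\<^esub> r) = 0)"

text \<open>Uniform bounds on the generators propagate to all star-polynomials, which keeps the
  supremum defining \<open>univ_seminorm\<close> finite.\<close>

locale bounded_relations =
  fixes Gs :: "'g set" and R :: "('g star_poly \<times> 'g star_poly) set"
  assumes relations: "R \<subseteq> carrier (free_star_alg Gs) \<times> carrier (free_star_alg Gs)"
    and gen_bounded: "g \<in> Gs \<Longrightarrow> \<exists>K. \<forall>p. admissible Gs R p \<longrightarrow> p (gen g) \<le> K"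
begin

abbreviation "F \<equiv> free_star_alg Gs"
abbreviation "U \<equiv> univ_cstar Gs R"
abbreviation "\<upsilon> \<equiv> univ_seminorm Gs R"

sublocale F: star_algebra F by (rule star_algebra_free)

lemma admissible_seminormed: "admissible Gs R p \<Longrightarrow> cstar_seminormed F p"
  by unfold_locales (simp add: admissible_def)

lemma bounded: "x \<in> carrier F \<Longrightarrow> \<exists>K. \<forall>p. admissible Gs R p \<longrightarrow> p x \<le> K"
proof (induction rule: free_induct)
  case one
  show ?case using cstar_seminormed.p_one_le[OF admissible_seminormed] by blast
next
  case (gen g)
  then show ?case by (rule gen_bounded)
next
  case (invol x)
  then show ?case using cstar_seminormed.p_invol[OF admissible_seminormed] by metis
next
  case (mult x y)
  then obtain K L where K: "\<And>p. admissible Gs R p \<Longrightarrow> p x \<le> K" and L: "\<And>p. admissible Gs R p \<Longrightarrow> p y \<le> L"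
    by blast
  have "p (x \<otimes>\<^bsub>F\<^esub> y) \<le> K * L" if p: "admissible Gs R p" for p
  proof -
    interpret cstar_seminormed F p by (rule admissible_seminormed[OF p])
    have "p (x \<otimes>\<^bsub>F\<^esub> y) \<le> p x * p y" using mult by (intro p_mult_le)
    also have "\<dots> \<le> K * L"
      using K[OF p] L[OF p] p_nonneg[OF mult(1)] p_nonneg[OF mult(2)] by (intro mult_mono) linarith+
    finally show ?thesis .
  qed
  then show ?case by blast
next
  case (add x y)
  then obtain K L where K: "\<And>p. admissible Gs R p \<Longrightarrow> p x \<le> K" and L: "\<And>p. admissible Gs R p \<Longrightarrow> p y \<le> L"
    by blast
  have "p (x \<oplus>\<^bsub>F\<^esub> y) \<le> K + L" if p: "admissible Gs R p" for p
    using cstar_seminormed.p_add_le[OF admissible_seminormed[OF p] add(1,2)] K[OF p] L[OF p] by simp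
  then show ?case by blast
next
  case (smult c x)
  then obtain K where K: "\<And>p. admissible Gs R p \<Longrightarrow> p x \<le> K" by blast
  have "p (c \<odot>\<^bsub>F\<^esub> x) \<le> cmod c * K" if p: "admissible Gs R p" for p
    using cstar_seminormed.p_smult[OF admissible_seminormed[OF p] smult(1), of c] K[OF p]
    by (simp add: mult_left_mono)
  then show ?case by blast
qed

lemma univ_seminorm_eq: "\<upsilon> x = (SUP p\<in>Collect (admissible Gs R). p x)"
  unfolding univ_seminorm_def admissible_def by (rule arg_cong[where f = Sup]) auto

text \<open>Makes the family of admissible seminorms nonempty, so that upper bounds pass to the
  supremum.\<close>

lemma admissible_zero: "admissible Gs R (\<lambda>x. 0)"
  by (auto simp: admissible_def cstar_seminorm_def)

lemma admissible_le: "admissible Gs R p \<Longrightarrow> x \<in> carrier F \<Longrightarrow> p x \<le> \<upsilon> x"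
  unfolding univ_seminorm_eq using bounded[of x]
  by (intro cSUP_upper) (auto simp: bdd_above_def)

lemma univ_le: "(\<And>p. admissible Gs R p \<Longrightarrow> p x \<le> K) \<Longrightarrow> \<upsilon> x \<le> K"
  unfolding univ_seminorm_eq using admissible_zero by (intro cSUP_least) auto

lemma univ_nonneg: "x \<in> carrier F \<Longrightarrow> 0 \<le> \<upsilon> x"
  using admissible_le[OF admissible_zero] by simp

text \<open>The supremum of the admissible seminorms is itself one of them. In the C*-identity one
  inequality passes to the supremum directly, the other after taking square roots.\<close>

lemma admissible_univ: "admissible Gs R \<upsilon>"
  unfolding admissible_def cstar_seminorm_def
proof (intro conjI ballI allI)
  fix x y c assume x: "x \<in> carrier F"
  show "0 \<le> \<upsilon> x" using x by (rule univ_nonneg)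
  show "\<upsilon> (invol F x \<otimes>\<^bsub>F\<^esub> x) = (\<upsilon> x)\<^sup>2"
  proof (rule antisym)
    show "\<upsilon> (invol F x \<otimes>\<^bsub>F\<^esub> x) \<le> (\<upsilon> x)\<^sup>2"
    proof (rule univ_le)
      fix p assume p: "admissible Gs R p"
      interpret cstar_seminormed F p by (rule admissible_seminormed[OF p])
      show "p (invol F x \<otimes>\<^bsub>F\<^esub> x) \<le> (\<upsilon> x)\<^sup>2"
        using admissible_le[OF p x] p_nonneg[OF x] by (simp add: p_cstar[OF x] power_mono)
    qed
    have "\<upsilon> x \<le> sqrt (\<upsilon> (invol F x \<otimes>\<^bsub>F\<^esub> x))"
    proof (rule univ_le)
      fix p assume p: "admissible Gs R p"
      interpret cstar_seminormed F p by (rule admissible_seminormed[OF p])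
      show "p x \<le> sqrt (\<upsilon> (invol F x \<otimes>\<^bsub>F\<^esub> x))"
        using admissible_le[OF p, of "invol F x \<otimes>\<^bsub>F\<^esub> x"] x p_nonneg[OF x]
        by (intro real_le_rsqrt) (simp add: p_cstar)
    qed
    then have "(\<upsilon> x)\<^sup>2 \<le> (sqrt (\<upsilon> (invol F x \<otimes>\<^bsub>F\<^esub> x)))\<^sup>2"
      using univ_nonneg[OF x] by (rule power_mono)
    then show "(\<upsilon> x)\<^sup>2 \<le> \<upsilon> (invol F x \<otimes>\<^bsub>F\<^esub> x)" using x univ_nonneg by simp
  qed
  have le: "\<upsilon> (c \<odot>\<^bsub>F\<^esub> x) \<le> cmod c * \<upsilon> x" if x: "x \<in> carrier F" for c x
  proof (rule univ_le)
    fix p assume p: "admissible Gs R p"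
    have "cmod c * p x \<le> cmod c * \<upsilon> x" using admissible_le[OF p x] by (rule mult_left_mono) simp
    then show "p (c \<odot>\<^bsub>F\<^esub> x) \<le> cmod c * \<upsilon> x"
      using cstar_seminormed.p_smult[OF admissible_seminormed[OF p] x] by simp
  qed
  show "\<upsilon> (c \<odot>\<^bsub>F\<^esub> x) = cmod c * \<upsilon> x"
  proof (cases "c = 0")
    case True
    then show ?thesis using le[OF x, of 0] univ_nonneg[of "\<zero>\<^bsub>F\<^esub>"] x by simp
  next
    case False
    then have "\<upsilon> x \<le> cmod (inverse c) * \<upsilon> (c \<odot>\<^bsub>F\<^esub> x)" using le[of "c \<odot>\<^bsub>F\<^esub> x" "inverse c"] x by simp
    then have "cmod c * \<upsilon> x \<le> \<upsilon> (c \<odot>\<^bsub>F\<^esub> x)" using False by (simp add: norm_divide field_simps)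
    then show ?thesis using le[OF x, of c] by simp
  qed
  assume y: "y \<in> carrier F"
  show "\<upsilon> (x \<oplus>\<^bsub>F\<^esub> y) \<le> \<upsilon> x + \<upsilon> y"
  proof (rule univ_le)
    fix p assume p: "admissible Gs R p"
    show "p (x \<oplus>\<^bsub>F\<^esub> y) \<le> \<upsilon> x + \<upsilon> y"
      using cstar_seminormed.p_add_le[OF admissible_seminormed[OF p] x y]
        admissible_le[OF p x] admissible_le[OF p y] by simp
  qed
  show "\<upsilon> (x \<otimes>\<^bsub>F\<^esub> y) \<le> \<upsilon> x * \<upsilon> y"
  proof (rule univ_le)
    fix p assume p: "admissible Gs R p"
    interpret cstar_seminormed F p by (rule admissible_seminormed[OF p])
    have "p (x \<otimes>\<^bsub>F\<^esub> y) \<le> p x * p y" using x y by (rule p_mult_le)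
    also have "\<dots> \<le> \<upsilon> x * \<upsilon> y"
      using x y admissible_le[OF p x] admissible_le[OF p y] univ_nonneg by (intro mult_mono) auto
    finally show "p (x \<otimes>\<^bsub>F\<^esub> y) \<le> \<upsilon> x * \<upsilon> y" .
  qed
next
  fix lr assume lr: "lr \<in> R"
  obtain l r where [simp]: "lr = (l, r)" by force
  have "\<upsilon> (l \<ominus>\<^bsub>F\<^esub> r) \<le> 0" using lr by (intro univ_le) (auto simp: admissible_def)
  then show "case lr of (l, r) \<Rightarrow> \<upsilon> (l \<ominus>\<^bsub>F\<^esub> r) = 0"
    using univ_nonneg[of "l \<ominus>\<^bsub>F\<^esub> r"] relations lr by auto
qed

sublocale univ: cstar_seminormed F \<upsilon>
  by (rule admissible_seminormed[OF admissible_univ])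

abbreviation "to_U \<equiv> to_completion F \<upsilon>"

lemma cstar_U: "cstar U"
  unfolding univ_cstar_def by (rule univ.cstar_H)

lemma star_hom_to_U: "star_hom F U to_U"
  unfolding univ_cstar_def by (rule univ.star_hom_to_H)

lemma univ_gen_eq: "univ_gen Gs R g = to_U (gen g)"
  by (simp add: univ_gen_def)

lemma univ_relation: "\<forall>(l, r)\<in>R. to_U l = to_U r"
proof
  fix z assume z: "z \<in> R"
  obtain l r where lr [simp]: "z = (l, r)" by force
  have "\<upsilon> (l \<ominus>\<^bsub>F\<^esub> r) = 0" "l \<in> carrier F" "r \<in> carrier F"
    using z admissible_univ relations by (auto simp: admissible_def)
  then show "case z of (l, r) \<Rightarrow> to_U l = to_U r" by (simp add: univ.to_H_eq_iff)
qed

text \<open>The norm of \<open>B\<close> pulled back along the free extension \<open>h\<close> of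
  \<open>f\<close> is an admissible seminorm, so \<open>univ_seminorm\<close> dominates it and
  \<open>completion_extend\<close> applies. The premise \<open>rel\<close> speaks of every such
  \<open>h\<close> because the extension is only produced inside the proof.\<close>

theorem univ_extend:
  assumes B: "cstar B" and f: "\<And>g. g \<in> Gs \<Longrightarrow> f g \<in> carrier B"
    and rel: "\<And>h. star_hom F B h \<Longrightarrow> (\<And>g. g \<in> Gs \<Longrightarrow> h (gen g) = f g) \<Longrightarrow> \<forall>(l, r)\<in>R. h l = h r"
  shows "\<exists>k. star_hom U B k \<and> (\<forall>g\<in>Gs. k (univ_gen Gs R g) = f g)"
proof -
  interpret B: cstar B by fact
  from free_extend[OF B.star_algebra_axioms, of Gs f] f
  obtain h where "star_hom F B h \<and> (\<forall>g\<in>Gs. h (gen g) = f g)" by blast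
  then have h: "star_hom F B h" "\<And>g. g \<in> Gs \<Longrightarrow> h (gen g) = f g" by simp_all
  have null: "cnorm B (h (l \<ominus>\<^bsub>F\<^esub> r)) = 0" if lr: "(l, r) \<in> R" for l r
  proof -
    have "h l = h r" using rel[OF h] lr by blast
    moreover have "l \<in> carrier F" "r \<in> carrier F" using relations lr by auto
    ultimately have "h (l \<ominus>\<^bsub>F\<^esub> r) = h r \<ominus>\<^bsub>B\<^esub> h r" "h r \<in> carrier B"
      using star_hom_minus[OF h(1) F.star_algebra_axioms B.star_algebra_axioms, of l r]
        star_hom_closed[OF h(1), of r] by simp_all
    then show ?thesis by (simp add: a_minus_def B.r_neg)
  qed
  have "admissible Gs R (\<lambda>x. cnorm B (h x))"
    unfolding admissible_def
    using B.cstar_seminorm_pullback[OF h(1) F.star_algebra_axioms] null by blast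
  from univ.completion_extend[OF B h(1) admissible_le[OF this]]
  obtain k where "star_hom U B k" "\<forall>x\<in>carrier F. k (to_U x) = h x"
    unfolding univ_cstar_def by blast
  then show ?thesis using h(2) by (intro exI[of _ k]) (simp add: univ_gen_eq)
qed

theorem univ_unique:
  assumes B: "cstar B" and g: "star_hom U B g" and h: "star_hom U B h"
    and eq: "\<And>x. x \<in> Gs \<Longrightarrow> g (univ_gen Gs R x) = h (univ_gen Gs R x)"
    and X: "X \<in> carrier U"
  shows "g X = h X"
proof (rule univ.completion_hom_unique[OF B])
  show "star_hom (completion F \<upsilon>) B g" "star_hom (completion F \<upsilon>) B h" "X \<in> carrier (completion F \<upsilon>)"
    using g h X by (simp_all add: univ_cstar_def)
  show "g (to_U x) = h (to_U x)" if "x \<in> carrier F" for x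
    using free_hom_unique[OF star_hom_comp[OF star_hom_to_U g] star_hom_comp[OF star_hom_to_U h] _ that]
      eq by (simp add: univ_gen_eq)
qed

end


section \<open>Free products\<close>

lemma ball_setcompr:
  "(\<forall>z\<in>{f a | a. P a}. Q z) \<longleftrightarrow> (\<forall>a. P a \<longrightarrow> Q (f a))"
  "(\<forall>z\<in>{f2 a b | a b. P2 a b}. Q z) \<longleftrightarrow> (\<forall>a b. P2 a b \<longrightarrow> Q (f2 a b))"
  "(\<forall>z\<in>{f3 a b c | a b c. P3 a b c}. Q z) \<longleftrightarrow> (\<forall>a b c. P3 a b c \<longrightarrow> Q (f3 a b c))"
  by blast+

text \<open>Turns the syntactic relations into a property of the map
  \<open>a \<mapsto> h (gen (\<iota> a))\<close>. One direction yields the canonical maps into free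
  products, the other the extensions out of them.\<close>

lemma hom_relations_iff:
  assumes A: "star_algebra A" and B: "star_algebra B" and h: "star_hom (free_star_alg Gs) B h"
    and \<iota>: "\<iota> ` carrier A \<subseteq> Gs"
  shows "(\<forall>(l, r)\<in>hom_relations Gs A \<iota>. h l = h r) \<longleftrightarrow> star_hom A B (\<lambda>a. h (gen (\<iota> a)))"
proof -
  interpret A: star_algebra A by fact
  have cl: "gen (\<iota> a) \<in> carrier (free_star_alg Gs)" if "a \<in> carrier A" for a
    using that \<iota> by (intro gen_closed) auto
  show ?thesis
    unfolding hom_relations_def Let_def ball_Un ball_setcompr star_hom_def ring_hom_def
    by (auto simp: cl star_hom_simps[OF h])
qed

lemma hom_relations_closed:
  assumes A: "star_algebra A" and \<iota>: "\<iota> ` carrier A \<subseteq> Gs"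
  shows "hom_relations Gs A \<iota> \<subseteq> carrier (free_star_alg Gs) \<times> carrier (free_star_alg Gs)"
proof -
  interpret A: star_algebra A by fact
  interpret F: star_algebra "free_star_alg Gs" by (rule star_algebra_free)
  have cl: "gen (\<iota> a) \<in> carrier (free_star_alg Gs)" if "a \<in> carrier A" for a
    using that \<iota> by (intro gen_closed) auto
  show ?thesis by (auto simp: hom_relations_def Let_def cl)
qed

text \<open>In the completion for \<open>p\<close> the relations hold, so \<open>A\<close> maps to
  it by a star-homomorphism. Automatic contractivity bounds \<open>p\<close> by the norm of
  \<open>A\<close>, uniformly in \<open>p\<close>.\<close>

lemma hom_relations_bounded:
  assumes A: "cstar A" and \<iota>: "\<iota> ` carrier A \<subseteq> Gs"
    and p: "admissible Gs R p" and R: "hom_relations Gs A \<iota> \<subseteq> R" and a: "a \<in> carrier A"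
  shows "p (gen (\<iota> a)) \<le> cnorm A a"
proof -
  interpret A: cstar A by fact
  interpret F: star_algebra "free_star_alg Gs" by (rule star_algebra_free)
  interpret p: cstar_seminormed "free_star_alg Gs" p
    by unfold_locales (use p in \<open>simp add: admissible_def\<close>)
  interpret H: cstar "completion (free_star_alg Gs) p" by (rule p.cstar_H)
  have "\<forall>(l, r)\<in>hom_relations Gs A \<iota>. p.to_H l = p.to_H r"
  proof
    fix z assume z: "z \<in> hom_relations Gs A \<iota>"
    obtain l r where lr [simp]: "z = (l, r)" by force
    have "p (l \<ominus>\<^bsub>free_star_alg Gs\<^esub> r) = 0" "l \<in> carrier (free_star_alg Gs)" "r \<in> carrier (free_star_alg Gs)"
      using z p R hom_relations_closed[OF A.star_algebra_axioms \<iota>] by (auto simp: admissible_def)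
    then show "case z of (l, r) \<Rightarrow> p.to_H l = p.to_H r" by (simp add: p.to_H_eq_iff)
  qed
  then have "star_hom A p.H (\<lambda>a. p.to_H (gen (\<iota> a)))"
    using hom_relations_iff[OF A.star_algebra_axioms H.star_algebra_axioms p.star_hom_to_H \<iota>] by simp
  from star_hom_contractive[OF A H.cstar_axioms this a] show ?thesis
    using a \<iota> by (subst (asm) p.cnorm_to_H) (auto intro!: gen_closed)
qed

locale free_power_cstar = A: cstar A for A :: "('a, 'x) cstar_alg_scheme" + fixes n :: nat
begin

abbreviation "R \<equiv> (\<Union>i\<in>{1..n}. hom_relations ({1..n} \<times> carrier A) A (Pair i))"

sublocale fp: bounded_relations "{1..n} \<times> carrier A" R
proof unfold_locales
  show "R \<subseteq> carrier (free_star_alg ({1..n} \<times> carrier A)) \<times> carrier (free_star_alg ({1..n} \<times> carrier A))"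
    using hom_relations_closed[OF A.star_algebra_axioms, of "Pair _" "{1..n} \<times> carrier A"] by blast
  fix g assume "g \<in> {1..n} \<times> carrier A"
  then obtain i a where g: "g = (i, a)" "i \<in> {1..n}" "a \<in> carrier A" by blast
  have "p (gen (i, a)) \<le> cnorm A a" if "admissible ({1..n} \<times> carrier A) R p" for p
    by (rule hom_relations_bounded[OF A.cstar_axioms _ that _ g(3)]) (use g in auto)
  then show "\<exists>K. \<forall>p. admissible ({1..n} \<times> carrier A) R p \<longrightarrow> p (gen g) \<le> K" using g by blast
qed

lemma free_power_eq: "free_power A n = fp.U"
  and free_power_inj_eq: "free_power_inj A n i a = univ_gen ({1..n} \<times> carrier A) R (i, a)"
  by (simp_all add: free_power_def free_power_inj_def Let_def)

lemma cstar_free_power: "cstar (free_power A n)"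
  by (subst free_power_eq) (rule fp.cstar_U)

lemma Pair_subset: "i \<in> {1..n} \<Longrightarrow> Pair i ` carrier A \<subseteq> {1..n} \<times> carrier A"
  by auto

lemma star_hom_free_power_inj:
  assumes "i \<in> {1..n}"
  shows "star_hom A (free_power A n) (free_power_inj A n i)"
proof -
  interpret U: cstar fp.U by (rule fp.cstar_U)
  have "\<forall>(l, r)\<in>hom_relations ({1..n} \<times> carrier A) A (Pair i). fp.to_U l = fp.to_U r"
    using fp.univ_relation assms by blast
  then have "star_hom A fp.U (\<lambda>a. fp.to_U (gen (i, a)))"
    by (rule hom_relations_iff[OF A.star_algebra_axioms U.star_algebra_axioms fp.star_hom_to_U
          Pair_subset[OF assms], THEN iffD1])
  then show ?thesis unfolding free_power_eq free_power_inj_eq[abs_def] fp.univ_gen_eq .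
qed

lemma free_power_extend:
  assumes B: "cstar B" and f: "\<And>i. i \<in> {1..n} \<Longrightarrow> star_hom A B (f i)"
  shows "\<exists>h. star_hom (free_power A n) B h
    \<and> (\<forall>i\<in>{1..n}. \<forall>a\<in>carrier A. h (free_power_inj A n i a) = f i a)"
proof -
  interpret B: cstar B by fact
  have "\<exists>k. star_hom fp.U B k
      \<and> (\<forall>g\<in>{1..n} \<times> carrier A. k (univ_gen ({1..n} \<times> carrier A) R g) = (case g of (i, a) \<Rightarrow> f i a))"
  proof (rule fp.univ_extend[OF B])
    fix h assume h: "star_hom fp.F B h" "\<And>g. g \<in> {1..n} \<times> carrier A \<Longrightarrow> h (gen g) = (case g of (i, a) \<Rightarrow> f i a)"
    have "\<forall>(l, r)\<in>hom_relations ({1..n} \<times> carrier A) A (Pair i). h l = h r" if i: "i \<in> {1..n}" for i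
    proof (rule hom_relations_iff[OF A.star_algebra_axioms B.star_algebra_axioms h(1) Pair_subset[OF i], THEN iffD2])
      show "star_hom A B (\<lambda>a. h (gen (i, a)))"
        by (rule star_hom_cong[OF A.star_algebra_axioms f[OF i]]) (use h(2) i in auto)
    qed
    then show "\<forall>(l, r)\<in>R. h l = h r" by blast
  qed (use star_hom_closed[OF f] in auto)
  then show ?thesis by (auto simp: free_power_eq free_power_inj_eq)
qed

lemma free_power_unique:
  assumes B: "cstar B" and g: "star_hom (free_power A n) B g" and h: "star_hom (free_power A n) B h"
    and "\<And>i a. i \<in> {1..n} \<Longrightarrow> a \<in> carrier A \<Longrightarrow> g (free_power_inj A n i a) = h (free_power_inj A n i a)"
    and "x \<in> carrier (free_power A n)"
  shows "g x = h x"
  using fp.univ_unique[OF B g[unfolded free_power_eq] h[unfolded free_power_eq]] assms(4,5)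
  by (auto simp: free_power_eq free_power_inj_eq)

end

locale free_prod_cstar = A: cstar A + B: cstar B
  for A :: "('a, 'x) cstar_alg_scheme" and B :: "('b, 'y) cstar_alg_scheme"
begin

abbreviation "Gs \<equiv> carrier A <+> carrier B"
abbreviation "R \<equiv> hom_relations Gs A Inl \<union> hom_relations Gs B Inr"

sublocale fp: bounded_relations Gs R
proof unfold_locales
  show "R \<subseteq> carrier (free_star_alg Gs) \<times> carrier (free_star_alg Gs)"
    using hom_relations_closed[OF A.star_algebra_axioms, of Inl Gs]
      hom_relations_closed[OF B.star_algebra_axioms, of Inr Gs] by blast
  fix g assume "g \<in> Gs"
  then consider a where "a \<in> carrier A" "g = Inl a" | b where "b \<in> carrier B" "g = Inr b" by blast
  then show "\<exists>K. \<forall>p. admissible Gs R p \<longrightarrow> p (gen g) \<le> K"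
  proof cases
    case 1
    then have "p (gen g) \<le> cnorm A a" if "admissible Gs R p" for p
      using hom_relations_bounded[OF A.cstar_axioms _ that, of Inl a] by auto
    then show ?thesis by blast
  next
    case 2
    then have "p (gen g) \<le> cnorm B b" if "admissible Gs R p" for p
      using hom_relations_bounded[OF B.cstar_axioms _ that, of Inr b] by auto
    then show ?thesis by blast
  qed
qed

lemma free_prod_eq: "free_prod A B = fp.U"
  and free_prod_inj_eq: "free_prod_inj A B z = univ_gen Gs R z"
  by (simp_all add: free_prod_def free_prod_inj_def Let_def)

lemma cstar_free_prod: "cstar (free_prod A B)"
  by (subst free_prod_eq) (rule fp.cstar_U)

lemma Plus_subset: "Inl ` carrier A \<subseteq> Gs" "Inr ` carrier B \<subseteq> Gs"
  by auto

lemma star_hom_free_prod_inj: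
  "star_hom A (free_prod A B) (\<lambda>a. free_prod_inj A B (Inl a))"
  "star_hom B (free_prod A B) (\<lambda>b. free_prod_inj A B (Inr b))"
proof -
  interpret U: cstar fp.U by (rule fp.cstar_U)
  have "\<forall>(l, r)\<in>hom_relations Gs A Inl. fp.to_U l = fp.to_U r"
    using fp.univ_relation by blast
  then show "star_hom A (free_prod A B) (\<lambda>a. free_prod_inj A B (Inl a))"
    unfolding free_prod_eq free_prod_inj_eq fp.univ_gen_eq
    by (rule hom_relations_iff[OF A.star_algebra_axioms U.star_algebra_axioms fp.star_hom_to_U
          Plus_subset(1), THEN iffD1])
  have "\<forall>(l, r)\<in>hom_relations Gs B Inr. fp.to_U l = fp.to_U r"
    using fp.univ_relation by blast
  then show "star_hom B (free_prod A B) (\<lambda>b. free_prod_inj A B (Inr b))"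
    unfolding free_prod_eq free_prod_inj_eq fp.univ_gen_eq
    by (rule hom_relations_iff[OF B.star_algebra_axioms U.star_algebra_axioms fp.star_hom_to_U
          Plus_subset(2), THEN iffD1])
qed

lemma free_prod_extend:
  assumes C: "cstar C" and f: "star_hom A C f" and g: "star_hom B C g"
  shows "\<exists>h. star_hom (free_prod A B) C h \<and> (\<forall>a\<in>carrier A. h (free_prod_inj A B (Inl a)) = f a)
    \<and> (\<forall>b\<in>carrier B. h (free_prod_inj A B (Inr b)) = g b)"
proof -
  interpret C: cstar C by fact
  have "\<exists>k. star_hom fp.U C k \<and> (\<forall>z\<in>Gs. k (univ_gen Gs R z) = case_sum f g z)"
  proof (rule fp.univ_extend[OF C])
    fix h assume h: "star_hom fp.F C h" "\<And>z. z \<in> Gs \<Longrightarrow> h (gen z) = case_sum f g z"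
    have "\<forall>(l, r)\<in>hom_relations Gs A Inl. h l = h r"
    proof (rule hom_relations_iff[OF A.star_algebra_axioms C.star_algebra_axioms h(1) Plus_subset(1), THEN iffD2])
      show "star_hom A C (\<lambda>a. h (gen (Inl a)))"
        by (rule star_hom_cong[OF A.star_algebra_axioms f]) (use h(2)[OF InlI] in simp)
    qed
    moreover have "\<forall>(l, r)\<in>hom_relations Gs B Inr. h l = h r"
    proof (rule hom_relations_iff[OF B.star_algebra_axioms C.star_algebra_axioms h(1) Plus_subset(2), THEN iffD2])
      show "star_hom B C (\<lambda>a. h (gen (Inr a)))"
        by (rule star_hom_cong[OF B.star_algebra_axioms g]) (use h(2)[OF InrI] in simp)
    qed
    ultimately show "\<forall>(l, r)\<in>R. h l = h r" by blast
  qed (use star_hom_closed[OF f] star_hom_closed[OF g] in auto)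
  then obtain k where k: "star_hom fp.U C k" "\<forall>z\<in>Gs. k (univ_gen Gs R z) = case_sum f g z" by blast
  then show ?thesis
    unfolding free_prod_eq free_prod_inj_eq by (intro exI[of _ k]) (simp add: InlI InrI)
qed

lemma free_prod_unique:
  assumes C: "cstar C" and g: "star_hom (free_prod A B) C g" and h: "star_hom (free_prod A B) C h"
    and "\<And>a. a \<in> carrier A \<Longrightarrow> g (free_prod_inj A B (Inl a)) = h (free_prod_inj A B (Inl a))"
    and "\<And>b. b \<in> carrier B \<Longrightarrow> g (free_prod_inj A B (Inr b)) = h (free_prod_inj A B (Inr b))"
    and "x \<in> carrier (free_prod A B)"
  shows "g x = h x"
  using fp.univ_unique[OF C g[unfolded free_prod_eq] h[unfolded free_prod_eq]] assms(4-6)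
  by (auto simp: free_prod_eq free_prod_inj_eq)

end

section \<open>Magic unitaries and representations of graph relations\<close>

definition magic :: "'v set \<Rightarrow> ('b, 'y) star_alg_scheme \<Rightarrow> ('v \<Rightarrow> 'v \<Rightarrow> 'b) \<Rightarrow> bool" where
  "magic V B X \<longleftrightarrow>
     (\<forall>i\<in>V. \<forall>j\<in>V. X i j \<in> carrier B \<and> invol B (X i j) = X i j)
   \<and> (\<forall>i\<in>V. \<forall>j\<in>V. \<forall>k\<in>V. X i j \<otimes>\<^bsub>B\<^esub> X i k = (if j = k then X i j else \<zero>\<^bsub>B\<^esub>))
   \<and> (\<forall>i\<in>V. \<forall>j\<in>V. \<forall>k\<in>V. X j i \<otimes>\<^bsub>B\<^esub> X k i = (if j = k then X j i else \<zero>\<^bsub>B\<^esub>))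
   \<and> (\<forall>i\<in>V. (\<Oplus>\<^bsub>B\<^esub>l\<in>V. X i l) = \<one>\<^bsub>B\<^esub>)
   \<and> (\<forall>i\<in>V. (\<Oplus>\<^bsub>B\<^esub>l\<in>V. X l i) = \<one>\<^bsub>B\<^esub>)"

text \<open>The conjuncts follow the sets in \<open>graph_relations\<close> one by one, so that
  \<open>graph_relations_iff\<close> is proved by unfolding. \<open>graph_repD\<close> and
  \<open>graph_repI\<close> provide the forms used in calculations.\<close>

definition graph_rep :: "'v pair_pre_digraph \<Rightarrow> ('b, 'y) star_alg_scheme \<Rightarrow> ('v \<Rightarrow> 'v \<Rightarrow> 'b) \<Rightarrow> bool" where
  "graph_rep G B X \<longleftrightarrow> magic (pverts G) B X
   \<and> (\<forall>e i k. e \<in> parcs G \<and> (i, k) \<in> pverts G \<times> pverts G - parcs G \<longrightarrow> X (fst e) i \<otimes>\<^bsub>B\<^esub> X (snd e) k = \<zero>\<^bsub>B\<^esub>)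
   \<and> (\<forall>e i k. e \<in> parcs G \<and> (i, k) \<in> pverts G \<times> pverts G - parcs G \<longrightarrow> X (snd e) k \<otimes>\<^bsub>B\<^esub> X (fst e) i = \<zero>\<^bsub>B\<^esub>)
   \<and> (\<forall>e i k. e \<in> parcs G \<and> (i, k) \<in> pverts G \<times> pverts G - parcs G \<longrightarrow> X i (fst e) \<otimes>\<^bsub>B\<^esub> X k (snd e) = \<zero>\<^bsub>B\<^esub>)
   \<and> (\<forall>e i k. e \<in> parcs G \<and> (i, k) \<in> pverts G \<times> pverts G - parcs G \<longrightarrow> X k (snd e) \<otimes>\<^bsub>B\<^esub> X i (fst e) = \<zero>\<^bsub>B\<^esub>)
   \<and> (\<forall>e e'. e \<in> parcs G \<and> e' \<in> parcs G \<longrightarrow>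
        X (fst e) (fst e') \<otimes>\<^bsub>B\<^esub> X (snd e) (snd e') = X (snd e) (snd e') \<otimes>\<^bsub>B\<^esub> X (fst e) (fst e'))
   \<and> (\<forall>e. e \<in> parcs G \<longrightarrow> (\<Oplus>\<^bsub>B\<^esub>e'\<in>parcs G. X (fst e') (fst e) \<otimes>\<^bsub>B\<^esub> X (snd e') (snd e)) = \<one>\<^bsub>B\<^esub>)
   \<and> (\<forall>e. e \<in> parcs G \<longrightarrow> (\<Oplus>\<^bsub>B\<^esub>e'\<in>parcs G. X (fst e) (fst e') \<otimes>\<^bsub>B\<^esub> X (snd e) (snd e')) = \<one>\<^bsub>B\<^esub>)"

lemma magicD:
  assumes "magic V B X"
  shows "i \<in> V \<Longrightarrow> j \<in> V \<Longrightarrow> X i j \<in> carrier B"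
    and "i \<in> V \<Longrightarrow> j \<in> V \<Longrightarrow> invol B (X i j) = X i j"
    and "i \<in> V \<Longrightarrow> j \<in> V \<Longrightarrow> k \<in> V \<Longrightarrow> X i j \<otimes>\<^bsub>B\<^esub> X i k = (if j = k then X i j else \<zero>\<^bsub>B\<^esub>)"
    and "i \<in> V \<Longrightarrow> j \<in> V \<Longrightarrow> k \<in> V \<Longrightarrow> X j i \<otimes>\<^bsub>B\<^esub> X k i = (if j = k then X j i else \<zero>\<^bsub>B\<^esub>)"
    and "i \<in> V \<Longrightarrow> (\<Oplus>\<^bsub>B\<^esub>l\<in>V. X i l) = \<one>\<^bsub>B\<^esub>"
    and "i \<in> V \<Longrightarrow> (\<Oplus>\<^bsub>B\<^esub>l\<in>V. X l i) = \<one>\<^bsub>B\<^esub>"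
  using assms by (simp_all add: magic_def)

lemma magicI:
  assumes "\<And>i j. i \<in> V \<Longrightarrow> j \<in> V \<Longrightarrow> X i j \<in> carrier B"
    and "\<And>i j. i \<in> V \<Longrightarrow> j \<in> V \<Longrightarrow> invol B (X i j) = X i j"
    and "\<And>i j k. i \<in> V \<Longrightarrow> j \<in> V \<Longrightarrow> k \<in> V \<Longrightarrow> X i j \<otimes>\<^bsub>B\<^esub> X i k = (if j = k then X i j else \<zero>\<^bsub>B\<^esub>)"
    and "\<And>i j k. i \<in> V \<Longrightarrow> j \<in> V \<Longrightarrow> k \<in> V \<Longrightarrow> X j i \<otimes>\<^bsub>B\<^esub> X k i = (if j = k then X j i else \<zero>\<^bsub>B\<^esub>)"
    and "\<And>i. i \<in> V \<Longrightarrow> (\<Oplus>\<^bsub>B\<^esub>l\<in>V. X i l) = \<one>\<^bsub>B\<^esub>"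
    and "\<And>i. i \<in> V \<Longrightarrow> (\<Oplus>\<^bsub>B\<^esub>l\<in>V. X l i) = \<one>\<^bsub>B\<^esub>"
  shows "magic V B X"
  unfolding magic_def using assms by blast

lemma graph_repD:
  assumes "graph_rep G B X"
  shows "magic (pverts G) B X"
    and "(s, t) \<in> parcs G \<Longrightarrow> i \<in> pverts G \<Longrightarrow> k \<in> pverts G \<Longrightarrow> (i, k) \<notin> parcs G
      \<Longrightarrow> X s i \<otimes>\<^bsub>B\<^esub> X t k = \<zero>\<^bsub>B\<^esub>"
    and "(s, t) \<in> parcs G \<Longrightarrow> i \<in> pverts G \<Longrightarrow> k \<in> pverts G \<Longrightarrow> (i, k) \<notin> parcs G
      \<Longrightarrow> X t k \<otimes>\<^bsub>B\<^esub> X s i = \<zero>\<^bsub>B\<^esub>"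
    and "(s, t) \<in> parcs G \<Longrightarrow> i \<in> pverts G \<Longrightarrow> k \<in> pverts G \<Longrightarrow> (i, k) \<notin> parcs G
      \<Longrightarrow> X i s \<otimes>\<^bsub>B\<^esub> X k t = \<zero>\<^bsub>B\<^esub>"
    and "(s, t) \<in> parcs G \<Longrightarrow> i \<in> pverts G \<Longrightarrow> k \<in> pverts G \<Longrightarrow> (i, k) \<notin> parcs G
      \<Longrightarrow> X k t \<otimes>\<^bsub>B\<^esub> X i s = \<zero>\<^bsub>B\<^esub>"
    and "(s, t) \<in> parcs G \<Longrightarrow> (s', t') \<in> parcs G \<Longrightarrow> X s s' \<otimes>\<^bsub>B\<^esub> X t t' = X t t' \<otimes>\<^bsub>B\<^esub> X s s'"
    and "(s, t) \<in> parcs G \<Longrightarrow> (\<Oplus>\<^bsub>B\<^esub>e\<in>parcs G. X (fst e) s \<otimes>\<^bsub>B\<^esub> X (snd e) t) = \<one>\<^bsub>B\<^esub>"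
    and "(s, t) \<in> parcs G \<Longrightarrow> (\<Oplus>\<^bsub>B\<^esub>e\<in>parcs G. X s (fst e) \<otimes>\<^bsub>B\<^esub> X t (snd e)) = \<one>\<^bsub>B\<^esub>"
proof -
  note c = assms[unfolded graph_rep_def]
  show "magic (pverts G) B X" using c by (rule conjunct1)
  show "X s i \<otimes>\<^bsub>B\<^esub> X t k = \<zero>\<^bsub>B\<^esub>"
    if "(s, t) \<in> parcs G" "i \<in> pverts G" "k \<in> pverts G" "(i, k) \<notin> parcs G"
    using c[THEN conjunct2, THEN conjunct1, rule_format, of "(s, t)" i k] that by simp
  show "X t k \<otimes>\<^bsub>B\<^esub> X s i = \<zero>\<^bsub>B\<^esub>"
    if "(s, t) \<in> parcs G" "i \<in> pverts G" "k \<in> pverts G" "(i, k) \<notin> parcs G"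
    using c[THEN conjunct2, THEN conjunct2, THEN conjunct1, rule_format, of "(s, t)" i k] that by simp
  show "X i s \<otimes>\<^bsub>B\<^esub> X k t = \<zero>\<^bsub>B\<^esub>"
    if "(s, t) \<in> parcs G" "i \<in> pverts G" "k \<in> pverts G" "(i, k) \<notin> parcs G"
    using c[THEN conjunct2, THEN conjunct2, THEN conjunct2, THEN conjunct1, rule_format, of "(s, t)" i k] that by simp
  show "X k t \<otimes>\<^bsub>B\<^esub> X i s = \<zero>\<^bsub>B\<^esub>"
    if "(s, t) \<in> parcs G" "i \<in> pverts G" "k \<in> pverts G" "(i, k) \<notin> parcs G"
    using c[THEN conjunct2, THEN conjunct2, THEN conjunct2, THEN conjunct2, THEN conjunct1, rule_format, of "(s, t)" i k] that by simp
  show "X s s' \<otimes>\<^bsub>B\<^esub> X t t' = X t t' \<otimes>\<^bsub>B\<^esub> X s s'" if "(s, t) \<in> parcs G" "(s', t') \<in> parcs G"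
    using c[THEN conjunct2, THEN conjunct2, THEN conjunct2, THEN conjunct2, THEN conjunct2, THEN conjunct1, rule_format, of "(s, t)" "(s', t')"] that by simp
  show "(\<Oplus>\<^bsub>B\<^esub>e\<in>parcs G. X (fst e) s \<otimes>\<^bsub>B\<^esub> X (snd e) t) = \<one>\<^bsub>B\<^esub>" if "(s, t) \<in> parcs G"
    using c[THEN conjunct2, THEN conjunct2, THEN conjunct2, THEN conjunct2, THEN conjunct2, THEN conjunct2, THEN conjunct1, rule_format, of "(s, t)"] that by simp
  show "(\<Oplus>\<^bsub>B\<^esub>e\<in>parcs G. X s (fst e) \<otimes>\<^bsub>B\<^esub> X t (snd e)) = \<one>\<^bsub>B\<^esub>" if "(s, t) \<in> parcs G"
    using c[THEN conjunct2, THEN conjunct2, THEN conjunct2, THEN conjunct2, THEN conjunct2, THEN conjunct2, THEN conjunct2, rule_format, of "(s, t)"] that by simp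
qed

text \<open>Half of the relations (R2) follow from the other half by applying the involution.\<close>

lemma graph_repI:
  assumes B: "star_algebra B" and wf: "parcs G \<subseteq> pverts G \<times> pverts G"
    and m: "magic (pverts G) B X"
    and r2: "\<And>s t i k. (s, t) \<in> parcs G \<Longrightarrow> i \<in> pverts G \<Longrightarrow> k \<in> pverts G \<Longrightarrow> (i, k) \<notin> parcs G
      \<Longrightarrow> X s i \<otimes>\<^bsub>B\<^esub> X t k = \<zero>\<^bsub>B\<^esub> \<and> X i s \<otimes>\<^bsub>B\<^esub> X k t = \<zero>\<^bsub>B\<^esub>"
    and r3: "\<And>s t s' t'. (s, t) \<in> parcs G \<Longrightarrow> (s', t') \<in> parcs G
      \<Longrightarrow> X s s' \<otimes>\<^bsub>B\<^esub> X t t' = X t t' \<otimes>\<^bsub>B\<^esub> X s s'"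
    and r4: "\<And>s t. (s, t) \<in> parcs G \<Longrightarrow> (\<Oplus>\<^bsub>B\<^esub>e\<in>parcs G. X (fst e) s \<otimes>\<^bsub>B\<^esub> X (snd e) t) = \<one>\<^bsub>B\<^esub>"
      "\<And>s t. (s, t) \<in> parcs G \<Longrightarrow> (\<Oplus>\<^bsub>B\<^esub>e\<in>parcs G. X s (fst e) \<otimes>\<^bsub>B\<^esub> X t (snd e)) = \<one>\<^bsub>B\<^esub>"
  shows "graph_rep G B X"
proof -
  interpret B: star_algebra B by fact
  note X = magicD(1,2)[OF m]
  have inv: "X b d \<otimes>\<^bsub>B\<^esub> X a c = \<zero>\<^bsub>B\<^esub>"
    if "X a c \<otimes>\<^bsub>B\<^esub> X b d = \<zero>\<^bsub>B\<^esub>" "a \<in> pverts G" "b \<in> pverts G" "c \<in> pverts G" "d \<in> pverts G" for a b c d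
  proof -
    have "X b d \<otimes>\<^bsub>B\<^esub> X a c = invol B (X a c \<otimes>\<^bsub>B\<^esub> X b d)" using that(2-5) by (simp add: X)
    then show ?thesis by (simp add: that(1))
  qed
  have v: "fst e \<in> pverts G" "snd e \<in> pverts G" if "e \<in> parcs G" for e using that wf by auto
  show ?thesis
    unfolding graph_rep_def
  proof (intro conjI allI impI m; (elim conjE)?)
    fix e i k assume *: "e \<in> parcs G" "(i, k) \<in> pverts G \<times> pverts G - parcs G"
    then have r: "X (fst e) i \<otimes>\<^bsub>B\<^esub> X (snd e) k = \<zero>\<^bsub>B\<^esub>" "X i (fst e) \<otimes>\<^bsub>B\<^esub> X k (snd e) = \<zero>\<^bsub>B\<^esub>"
      using r2[of "fst e" "snd e" i k] by simp_all
    show "X (fst e) i \<otimes>\<^bsub>B\<^esub> X (snd e) k = \<zero>\<^bsub>B\<^esub>" "X i (fst e) \<otimes>\<^bsub>B\<^esub> X k (snd e) = \<zero>\<^bsub>B\<^esub>" by fact+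
    show "X (snd e) k \<otimes>\<^bsub>B\<^esub> X (fst e) i = \<zero>\<^bsub>B\<^esub>" using inv[OF r(1)] * v by simp
    show "X k (snd e) \<otimes>\<^bsub>B\<^esub> X i (fst e) = \<zero>\<^bsub>B\<^esub>" using inv[OF r(2)] * v by simp
  next
    fix e e' assume "e \<in> parcs G" "e' \<in> parcs G"
    then show "X (fst e) (fst e') \<otimes>\<^bsub>B\<^esub> X (snd e) (snd e') = X (snd e) (snd e') \<otimes>\<^bsub>B\<^esub> X (fst e) (fst e')"
      using r3[of "fst e" "snd e" "fst e'" "snd e'"] by simp
  next
    fix e assume "e \<in> parcs G"
    then show "(\<Oplus>\<^bsub>B\<^esub>e'\<in>parcs G. X (fst e') (fst e) \<otimes>\<^bsub>B\<^esub> X (snd e') (snd e)) = \<one>\<^bsub>B\<^esub>"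
      "(\<Oplus>\<^bsub>B\<^esub>e'\<in>parcs G. X (fst e) (fst e') \<otimes>\<^bsub>B\<^esub> X (snd e) (snd e')) = \<one>\<^bsub>B\<^esub>"
      using r4[of "fst e" "snd e"] by simp_all
  qed
qed

lemma magic_cong:
  assumes B: "star_algebra B" and m: "magic V B X"
    and eq: "\<And>i j. i \<in> V \<Longrightarrow> j \<in> V \<Longrightarrow> Y i j = X i j"
  shows "magic V B Y"
proof -
  interpret B: star_algebra B by fact
  have "(\<Oplus>\<^bsub>B\<^esub>l\<in>V. Y i l) = (\<Oplus>\<^bsub>B\<^esub>l\<in>V. X i l)" "(\<Oplus>\<^bsub>B\<^esub>l\<in>V. Y l i) = (\<Oplus>\<^bsub>B\<^esub>l\<in>V. X l i)"
    if "i \<in> V" for i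
    using that magicD(1)[OF m] by (auto intro!: B.finsum_cong' simp: eq)
  then show ?thesis using m eq by (intro magicI) (simp_all add: magicD)
qed

lemma magic_hom:
  assumes "star_algebra B" "star_algebra C" "star_hom B C h" "magic V B X"
  shows "magic V C (\<lambda>i j. h (X i j))"
proof -
  interpret B: star_algebra B by fact
  interpret C: star_algebra C by fact
  note hs = star_hom_simps[OF assms(3)] star_hom_zero[OF assms(3,1,2)]
  note X = magicD[OF assms(4)]
  have sums: "(\<Oplus>\<^bsub>C\<^esub>l\<in>V. h (X i l)) = h (\<Oplus>\<^bsub>B\<^esub>l\<in>V. X i l)"
    "(\<Oplus>\<^bsub>C\<^esub>l\<in>V. h (X l i)) = h (\<Oplus>\<^bsub>B\<^esub>l\<in>V. X l i)" if "i \<in> V" for i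
    using that X(1) by (auto intro!: star_hom_finsum[OF assms(3,1,2), symmetric])
  have mult: "h (X i j) \<otimes>\<^bsub>C\<^esub> h (X k l) = h (X i j \<otimes>\<^bsub>B\<^esub> X k l)"
    if "i \<in> V" "j \<in> V" "k \<in> V" "l \<in> V" for i j k l using that X by (simp add: hs)
  show ?thesis
    by (rule magicI) (simp_all add: sums mult X hs star_hom_invol[OF assms(3), symmetric])
qed

lemma graph_rep_cong:
  assumes B: "star_algebra B" and wf: "parcs G \<subseteq> pverts G \<times> pverts G" and r: "graph_rep G B X"
    and eq: "\<And>i j. i \<in> pverts G \<Longrightarrow> j \<in> pverts G \<Longrightarrow> Y i j = X i j"
  shows "graph_rep G B Y"
proof -
  interpret B: star_algebra B by fact
  have v: "fst e \<in> pverts G" "snd e \<in> pverts G" if "e \<in> parcs G" for e using that wf by auto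
  have v': "s \<in> pverts G" "t \<in> pverts G" if "(s, t) \<in> parcs G" for s t using that wf by auto
  note cl = magicD(1)[OF graph_repD(1)[OF r]]
  have "(\<Oplus>\<^bsub>B\<^esub>e\<in>parcs G. Y (fst e) s \<otimes>\<^bsub>B\<^esub> Y (snd e) t) = (\<Oplus>\<^bsub>B\<^esub>e\<in>parcs G. X (fst e) s \<otimes>\<^bsub>B\<^esub> X (snd e) t)"
    "(\<Oplus>\<^bsub>B\<^esub>e\<in>parcs G. Y s (fst e) \<otimes>\<^bsub>B\<^esub> Y t (snd e)) = (\<Oplus>\<^bsub>B\<^esub>e\<in>parcs G. X s (fst e) \<otimes>\<^bsub>B\<^esub> X t (snd e))"
    if "(s, t) \<in> parcs G" for s t
    using v'[OF that] by (auto intro!: B.finsum_cong' B.m_closed cl simp: eq v')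
  then show ?thesis
    by (intro graph_repI[OF B wf magic_cong[OF B graph_repD(1)[OF r] eq]])
       (simp_all add: eq v' graph_repD(2,4,7,8)[OF r], rule graph_repD(6)[OF r])
qed

lemma magic_relations_iff:
  assumes B: "star_algebra B" and h: "star_hom (free_star_alg (V \<times> V)) B h"
  shows "(\<forall>(l, r)\<in>magic_relations V. h l = h r) \<longleftrightarrow> magic V B (\<lambda>i j. h (gen (i, j)))"
proof -
  interpret F: star_algebra "free_star_alg (V \<times> V)" by (rule star_algebra_free)
  interpret B: star_algebra B by fact
  have cl: "gen (i, j) \<in> carrier (free_star_alg (V \<times> V))" if "i \<in> V" "j \<in> V" for i j
    using that by (intro gen_closed) auto
  note hs = star_hom_simps[OF h] star_hom_zero[OF h F.star_algebra_axioms B.star_algebra_axioms]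
  have sums: "h (\<Oplus>\<^bsub>free_star_alg (V \<times> V)\<^esub>l\<in>V. gen (i, l)) = (\<Oplus>\<^bsub>B\<^esub>l\<in>V. h (gen (i, l)))"
    "h (\<Oplus>\<^bsub>free_star_alg (V \<times> V)\<^esub>l\<in>V. gen (l, i)) = (\<Oplus>\<^bsub>B\<^esub>l\<in>V. h (gen (l, i)))" if "i \<in> V" for i
    using that by (auto intro!: star_hom_finsum[OF h F.star_algebra_axioms B.star_algebra_axioms] cl)
  show ?thesis
    unfolding magic_relations_def magic_def Let_def ball_Un ball_setcompr
    by (simp add: cl hs sums if_distrib[of h] Ball_def cong: if_cong) blast
qed

lemma graph_relations_iff:
  assumes B: "star_algebra B" and wf: "parcs G \<subseteq> pverts G \<times> pverts G"
    and h: "star_hom (free_star_alg (pverts G \<times> pverts G)) B h"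
  shows "(\<forall>(l, r)\<in>graph_relations G. h l = h r) \<longleftrightarrow> graph_rep G B (\<lambda>i j. h (gen (i, j)))"
proof -
  let ?F = "free_star_alg (pverts G \<times> pverts G)"
  interpret F: star_algebra ?F by (rule star_algebra_free)
  interpret B: star_algebra B by fact
  have cl: "gen (i, j) \<in> carrier ?F" if "i \<in> pverts G" "j \<in> pverts G" for i j
    using that by (intro gen_closed) auto
  have v: "fst e \<in> pverts G" "snd e \<in> pverts G" if "e \<in> parcs G" for e using that wf by auto
  have v': "s \<in> pverts G" "t \<in> pverts G" if "(s, t) \<in> parcs G" for s t using that wf by auto
  note hs = star_hom_simps[OF h] star_hom_zero[OF h F.star_algebra_axioms B.star_algebra_axioms]
  have sums: "h (\<Oplus>\<^bsub>?F\<^esub>e'\<in>parcs G. gen (fst e', fst e) \<otimes>\<^bsub>?F\<^esub> gen (snd e', snd e))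
      = (\<Oplus>\<^bsub>B\<^esub>e'\<in>parcs G. h (gen (fst e', fst e)) \<otimes>\<^bsub>B\<^esub> h (gen (snd e', snd e)))"
    "h (\<Oplus>\<^bsub>?F\<^esub>e'\<in>parcs G. gen (fst e, fst e') \<otimes>\<^bsub>?F\<^esub> gen (snd e, snd e'))
      = (\<Oplus>\<^bsub>B\<^esub>e'\<in>parcs G. h (gen (fst e, fst e')) \<otimes>\<^bsub>B\<^esub> h (gen (snd e, snd e')))" if "e \<in> parcs G" for e
  proof -
    note hsum = star_hom_finsum[OF h F.star_algebra_axioms B.star_algebra_axioms]
    show "h (\<Oplus>\<^bsub>?F\<^esub>e'\<in>parcs G. gen (fst e', fst e) \<otimes>\<^bsub>?F\<^esub> gen (snd e', snd e))
        = (\<Oplus>\<^bsub>B\<^esub>e'\<in>parcs G. h (gen (fst e', fst e)) \<otimes>\<^bsub>B\<^esub> h (gen (snd e', snd e)))"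
      using v[OF that] by (rule_tac trans[OF hsum B.finsum_cong']) (auto simp: cl v' hs intro!: B.m_closed)
    show "h (\<Oplus>\<^bsub>?F\<^esub>e'\<in>parcs G. gen (fst e, fst e') \<otimes>\<^bsub>?F\<^esub> gen (snd e, snd e'))
        = (\<Oplus>\<^bsub>B\<^esub>e'\<in>parcs G. h (gen (fst e, fst e')) \<otimes>\<^bsub>B\<^esub> h (gen (snd e, snd e')))"
      using v[OF that] by (rule_tac trans[OF hsum B.finsum_cong']) (auto simp: cl v' hs intro!: B.m_closed)
  qed
  show ?thesis
    unfolding graph_relations_def graph_rep_def Let_def ball_Un ball_setcompr magic_relations_iff[OF B h]
    by (simp add: cl v hs sums)
qed

lemma magic_relations_closed:
  "magic_relations V \<subseteq> carrier (free_star_alg (V \<times> V)) \<times> carrier (free_star_alg (V \<times> V))"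
proof -
  interpret F: star_algebra "free_star_alg (V \<times> V)" by (rule star_algebra_free)
  have cl: "gen (i, j) \<in> carrier (free_star_alg (V \<times> V))" if "i \<in> V" "j \<in> V" for i j
    using that by (intro gen_closed) auto
  show ?thesis by (auto simp: magic_relations_def Let_def cl intro!: F.finsum_closed)
qed

lemma graph_relations_closed:
  assumes wf: "parcs G \<subseteq> pverts G \<times> pverts G"
  shows "graph_relations G \<subseteq> carrier (free_star_alg (pverts G \<times> pverts G)) \<times> carrier (free_star_alg (pverts G \<times> pverts G))"
proof -
  interpret F: star_algebra "free_star_alg (pverts G \<times> pverts G)" by (rule star_algebra_free)
  have cl: "gen (i, j) \<in> carrier (free_star_alg (pverts G \<times> pverts G))" if "i \<in> pverts G" "j \<in> pverts G" for i j
    using that by (intro gen_closed) auto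
  have v: "fst e \<in> pverts G" "snd e \<in> pverts G" if "e \<in> parcs G" for e using that wf by auto
  have v': "s \<in> pverts G" "t \<in> pverts G" if "(s, t) \<in> parcs G" for s t using that wf by auto
  show ?thesis
    unfolding graph_relations_def Let_def
    by (intro Un_least magic_relations_closed) (auto simp: cl v' intro!: F.finsum_closed F.m_closed)
qed

text \<open>In the completion for \<open>p\<close> the generator becomes a projection, and the norm
  of a projection equals its own square.\<close>

lemma magic_bounded:
  assumes p: "admissible (V \<times> V) R p" and R: "magic_relations V \<subseteq> R" and ij: "i \<in> V" "j \<in> V"
  shows "p (gen (i, j)) \<le> 1"
proof -
  let ?F = "free_star_alg (V \<times> V)"
  interpret F: star_algebra ?F by (rule star_algebra_free)
  interpret p: cstar_seminormed ?F p
    by unfold_locales (use p in \<open>simp add: admissible_def\<close>)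
  interpret H: cstar p.H by (rule p.cstar_H)
  have "\<forall>(l, r)\<in>magic_relations V. p.to_H l = p.to_H r"
  proof
    fix z assume z: "z \<in> magic_relations V"
    obtain l r where lr [simp]: "z = (l, r)" by force
    have "p (l \<ominus>\<^bsub>?F\<^esub> r) = 0" "l \<in> carrier ?F" "r \<in> carrier ?F"
      using z p R magic_relations_closed[of V] by (auto simp: admissible_def)
    then show "case z of (l, r) \<Rightarrow> p.to_H l = p.to_H r" by (simp add: p.to_H_eq_iff)
  qed
  then have m: "magic V p.H (\<lambda>i j. p.to_H (gen (i, j)))"
    by (rule magic_relations_iff[OF H.star_algebra_axioms p.star_hom_to_H, THEN iffD1])
  have "(cnorm p.H (p.to_H (gen (i, j))))\<^sup>2 = cnorm p.H (p.to_H (gen (i, j)))"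
    using H.p_cstar[OF magicD(1)[OF m ij]] magicD(2,3)[OF m ij] ij by simp
  then have "(p (gen (i, j)))\<^sup>2 = p (gen (i, j))"
    using ij by (simp add: p.cnorm_to_H)
  then show ?thesis by (auto simp: power2_eq_square)
qed

lemma bounded_magic: "bounded_relations (V \<times> V) (magic_relations V)"
proof
  show "\<exists>K. \<forall>p. admissible (V \<times> V) (magic_relations V) p \<longrightarrow> p (gen g) \<le> K" if "g \<in> V \<times> V" for g
    using that magic_bounded[of V "magic_relations V" _ "fst g" "snd g"] by (intro exI[of _ 1]) auto
qed (rule magic_relations_closed)

lemma bounded_graph:
  assumes "parcs G \<subseteq> pverts G \<times> pverts G"
  shows "bounded_relations (pverts G \<times> pverts G) (graph_relations G)"
proof
  show "graph_relations G \<subseteq> carrier (free_star_alg (pverts G \<times> pverts G)) \<times> carrier (free_star_alg (pverts G \<times> pverts G))"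
    by (rule graph_relations_closed[OF assms])
  have "magic_relations (pverts G) \<subseteq> graph_relations G"
    by (auto simp: graph_relations_def Let_def)
  then show "\<exists>K. \<forall>p. admissible (pverts G \<times> pverts G) (graph_relations G) p \<longrightarrow> p (gen g) \<le> K"
    if "g \<in> pverts G \<times> pverts G" for g
    using that magic_bounded[of "pverts G" "graph_relations G" _ "fst g" "snd g"]
    by (intro exI[of _ 1]) auto
qed

section \<open>Universal properties of \<open>A_aut_X\<close> and of the graph algebras\<close>

locale magic_cstar =
  fixes n :: nat
begin

sublocale u: bounded_relations "{1..n} \<times> {1..n}" "magic_relations {1..n}"
  by (rule bounded_magic)

lemma cstar_A_aut_X: "cstar (A_aut_X n)"
  unfolding A_aut_X_def by (rule u.cstar_U)

lemma magic_X_gen: "magic {1..n} (A_aut_X n) (X_gen n)"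
proof -
  interpret U: cstar u.U by (rule u.cstar_U)
  show ?thesis
    using u.univ_relation magic_relations_iff[OF U.star_algebra_axioms u.star_hom_to_U]
    unfolding A_aut_X_def X_gen_def[abs_def] u.univ_gen_eq by blast
qed

lemma A_aut_X_extend:
  assumes B: "cstar B" and y: "magic {1..n} B y"
  shows "\<exists>h. star_hom (A_aut_X n) B h \<and> (\<forall>i\<in>{1..n}. \<forall>j\<in>{1..n}. h (X_gen n i j) = y i j)"
proof -
  interpret B: cstar B by fact
  have "\<exists>k. star_hom u.U B k
      \<and> (\<forall>g\<in>{1..n} \<times> {1..n}. k (univ_gen ({1..n} \<times> {1..n}) (magic_relations {1..n}) g) = (case g of (i, j) \<Rightarrow> y i j))"
  proof (rule u.univ_extend[OF B])
    fix h assume h: "star_hom u.F B h" "\<And>g. g \<in> {1..n} \<times> {1..n} \<Longrightarrow> h (gen g) = (case g of (i, j) \<Rightarrow> y i j)"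
    have e: "h (gen (i, j)) = y i j" if "i \<in> {1..n}" "j \<in> {1..n}" for i j using h(2)[of "(i, j)"] that by simp
    have "magic {1..n} B (\<lambda>i j. h (gen (i, j)))" by (rule magic_cong[OF B.star_algebra_axioms y e])
    then show "\<forall>(l, r)\<in>magic_relations {1..n}. h l = h r"
      using magic_relations_iff[OF B.star_algebra_axioms h(1)] by blast
  qed (use magicD(1)[OF y] in auto)
  then show ?thesis unfolding A_aut_X_def X_gen_def by force
qed

lemma A_aut_X_unique:
  assumes B: "cstar B" and g: "star_hom (A_aut_X n) B g" and h: "star_hom (A_aut_X n) B h"
    and "\<And>i j. i \<in> {1..n} \<Longrightarrow> j \<in> {1..n} \<Longrightarrow> g (X_gen n i j) = h (X_gen n i j)"
    and "x \<in> carrier (A_aut_X n)"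
  shows "g x = h x"
  using u.univ_unique[OF B g[unfolded A_aut_X_def] h[unfolded A_aut_X_def]] assms(4,5)
  by (auto simp: A_aut_X_def X_gen_def)

end

locale graph_algebra =
  fixes G :: "'v pair_pre_digraph"
  assumes wf: "parcs G \<subseteq> pverts G \<times> pverts G"
begin

sublocale u: bounded_relations "pverts G \<times> pverts G" "graph_relations G"
  by (rule bounded_graph[OF wf])

lemma cstar_graph_cstar: "cstar (graph_cstar G)"
  unfolding graph_cstar_def by (rule u.cstar_U)

lemma graph_rep_graph_gen: "graph_rep G (graph_cstar G) (graph_gen G)"
proof -
  interpret U: cstar u.U by (rule u.cstar_U)
  show ?thesis
    using u.univ_relation graph_relations_iff[OF U.star_algebra_axioms wf u.star_hom_to_U]
    unfolding graph_cstar_def graph_gen_def[abs_def] u.univ_gen_eq by blast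
qed

lemma graph_cstar_extend:
  assumes B: "cstar B" and y: "graph_rep G B y"
  shows "\<exists>h. star_hom (graph_cstar G) B h
    \<and> (\<forall>i\<in>pverts G. \<forall>j\<in>pverts G. h (graph_gen G i j) = y i j)"
proof -
  interpret B: cstar B by fact
  let ?Gs = "pverts G \<times> pverts G"
  have "\<exists>k. star_hom u.U B k
      \<and> (\<forall>g\<in>?Gs. k (univ_gen ?Gs (graph_relations G) g) = (case g of (i, j) \<Rightarrow> y i j))"
  proof (rule u.univ_extend[OF B])
    fix h assume h: "star_hom u.F B h" "\<And>g. g \<in> ?Gs \<Longrightarrow> h (gen g) = (case g of (i, j) \<Rightarrow> y i j)"
    have e: "h (gen (i, j)) = y i j" if "i \<in> pverts G" "j \<in> pverts G" for i j using h(2)[of "(i, j)"] that by simp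
    have "graph_rep G B (\<lambda>i j. h (gen (i, j)))" by (rule graph_rep_cong[OF B.star_algebra_axioms wf y e])
    then show "\<forall>(l, r)\<in>graph_relations G. h l = h r"
      by (rule graph_relations_iff[OF B.star_algebra_axioms wf h(1), THEN iffD2])
  qed (use magicD(1)[OF graph_repD(1)[OF y]] in auto)
  then show ?thesis unfolding graph_cstar_def graph_gen_def by force
qed

lemma graph_cstar_unique:
  assumes B: "cstar B" and g: "star_hom (graph_cstar G) B g" and h: "star_hom (graph_cstar G) B h"
    and eq: "\<And>i j. i \<in> pverts G \<Longrightarrow> j \<in> pverts G \<Longrightarrow> g (graph_gen G i j) = h (graph_gen G i j)"
    and x: "x \<in> carrier (graph_cstar G)"
  shows "g x = h x"
proof (rule u.univ_unique[OF B g[unfolded graph_cstar_def] h[unfolded graph_cstar_def] _ x[unfolded graph_cstar_def]])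
  fix z assume "z \<in> pverts G \<times> pverts G"
  then show "g (univ_gen (pverts G \<times> pverts G) (graph_relations G) z)
      = h (univ_gen (pverts G \<times> pverts G) (graph_relations G) z)"
    using eq[of "fst z" "snd z"] by (auto simp: graph_gen_def)
qed

end


section \<open>Free wreath products\<close>

locale wreath = A: cstar A for A :: "('a, 'x) cstar_alg_scheme" + fixes n :: nat
begin

sublocale pw: free_power_cstar A n by unfold_locales
sublocale mx: magic_cstar n .

interpretation FP: cstar "free_power A n" by (rule pw.cstar_free_power)
interpretation MX: cstar "A_aut_X n" by (rule mx.cstar_A_aut_X)
interpretation pr: free_prod_cstar "free_power A n" "A_aut_X n" by unfold_locales

abbreviation "P \<equiv> wreath_free A n"
abbreviation "W \<equiv> wreath_cstar A n"

lemma cstar_P: "cstar P"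
  unfolding wreath_free_def by (rule pr.cstar_free_prod)

interpretation P: cstar P by (rule cstar_P)

text \<open>The canonical maps into the free product, before the commutators are divided
  out.\<close>

definition nu0 where
  "nu0 k a = free_prod_inj (free_power A n) (A_aut_X n) (Inl (free_power_inj A n k a))"
definition x0 where
  "x0 k i = free_prod_inj (free_power A n) (A_aut_X n) (Inr (X_gen n k i))"

lemma star_hom_nu0: "k \<in> {1..n} \<Longrightarrow> star_hom A P (nu0 k)"
  unfolding nu0_def[abs_def] wreath_free_def
  using star_hom_comp[OF pw.star_hom_free_power_inj pr.star_hom_free_prod_inj(1)] .

lemma magic_x0: "magic {1..n} P x0"
  unfolding x0_def[abs_def] wreath_free_def
  by (rule magic_hom[OF MX.star_algebra_axioms P.star_algebra_axioms[unfolded wreath_free_def]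
        pr.star_hom_free_prod_inj(2) mx.magic_X_gen])

definition T where
  "T = {nu0 k a \<otimes>\<^bsub>P\<^esub> x0 k i \<ominus>\<^bsub>P\<^esub> x0 k i \<otimes>\<^bsub>P\<^esub> nu0 k a | k i a.
     k \<in> {1..n} \<and> i \<in> {1..n} \<and> a \<in> carrier A}"

lemma wreath_ideal_eq: "wreath_ideal A n = closed_ideal_gen P T"
  by (simp add: wreath_ideal_def T_def nu0_def x0_def Let_def)

lemma T_closed: "T \<subseteq> carrier P"
  using star_hom_closed[OF star_hom_nu0] magicD(1)[OF magic_x0]
  unfolding T_def by (auto intro!: P.minus_closed P.m_closed)

text \<open>The negative adjoint of the commutator of \<open>nu0 k a\<close> with the self-adjoint
  \<open>x0 k i\<close> is the commutator for \<open>invol A a\<close>. So the closed ideal is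
  invariant under the involution, as \<open>closed_star_ideal\<close> demands.\<close>

lemma T_invol: "t \<in> T \<Longrightarrow> \<ominus>\<^bsub>P\<^esub> invol P t \<in> T"
proof -
  assume "t \<in> T"
  then obtain k i a where t: "t = nu0 k a \<otimes>\<^bsub>P\<^esub> x0 k i \<ominus>\<^bsub>P\<^esub> x0 k i \<otimes>\<^bsub>P\<^esub> nu0 k a"
    and ki: "k \<in> {1..n}" "i \<in> {1..n}" and a: "a \<in> carrier A" unfolding T_def by blast
  have c: "nu0 k a \<in> carrier P" "nu0 k (invol A a) \<in> carrier P" "x0 k i \<in> carrier P"
    using a ki star_hom_closed[OF star_hom_nu0[OF ki(1)]] magicD(1)[OF magic_x0 ki] by auto
  have i: "invol P (nu0 k a) = nu0 k (invol A a)" "invol P (x0 k i) = x0 k i"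
    using a ki star_hom_invol[OF star_hom_nu0[OF ki(1)]] magicD(2)[OF magic_x0 ki] by auto
  have "\<ominus>\<^bsub>P\<^esub> (x \<ominus>\<^bsub>P\<^esub> y) = y \<ominus>\<^bsub>P\<^esub> x" if "x \<in> carrier P" "y \<in> carrier P" for x y
    using that by (simp add: a_minus_def P.minus_add P.a_comm)
  then have "\<ominus>\<^bsub>P\<^esub> invol P t = nu0 k (invol A a) \<otimes>\<^bsub>P\<^esub> x0 k i \<ominus>\<^bsub>P\<^esub> x0 k i \<otimes>\<^bsub>P\<^esub> nu0 k (invol A a)"
    unfolding t using c by (simp add: i)
  then show ?thesis using ki a unfolding T_def by blast
qed

interpretation I: closed_star_ideal P "wreath_ideal A n"
  unfolding wreath_ideal_eq using T_closed T_invol by (rule P.closed_star_ideal_gen)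

lemma cstar_W: "cstar W"
  unfolding wreath_cstar_def by (rule I.cstar_Q)

interpretation W: cstar W by (rule cstar_W)

lemma star_hom_PW: "star_hom P W (\<lambda>z. wreath_ideal A n +>\<^bsub>P\<^esub> z)"
  unfolding wreath_cstar_def by (rule I.star_hom_Q)

lemma wreath_nu_eq: "wreath_nu A n k a = wreath_ideal A n +>\<^bsub>P\<^esub> nu0 k a"
  and wreath_x_eq: "wreath_x A n k i = wreath_ideal A n +>\<^bsub>P\<^esub> x0 k i"
  by (simp_all add: wreath_nu_def wreath_x_def nu0_def x0_def)

lemma star_hom_wreath_nu: "k \<in> {1..n} \<Longrightarrow> star_hom A W (wreath_nu A n k)"
  unfolding wreath_nu_eq[abs_def] using star_hom_comp[OF star_hom_nu0 star_hom_PW] .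

lemma magic_wreath_x: "magic {1..n} W (wreath_x A n)"
  unfolding wreath_x_eq[abs_def]
  by (rule magic_hom[OF P.star_algebra_axioms W.star_algebra_axioms star_hom_PW magic_x0])

lemma wreath_commute:
  assumes "k \<in> {1..n}" "i \<in> {1..n}" "a \<in> carrier A"
  shows "wreath_nu A n k a \<otimes>\<^bsub>W\<^esub> wreath_x A n k i = wreath_x A n k i \<otimes>\<^bsub>W\<^esub> wreath_nu A n k a"
proof -
  have c: "nu0 k a \<in> carrier P" "x0 k i \<in> carrier P"
    using assms star_hom_closed[OF star_hom_nu0] magicD(1)[OF magic_x0] by auto
  have "nu0 k a \<otimes>\<^bsub>P\<^esub> x0 k i \<ominus>\<^bsub>P\<^esub> x0 k i \<otimes>\<^bsub>P\<^esub> nu0 k a \<in> wreath_ideal A n"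
    using P.closed_ideal_gen_superset[of T] assms unfolding wreath_ideal_eq T_def by blast
  then show ?thesis
    using c unfolding wreath_nu_eq wreath_x_eq
    by (simp add: star_hom_mult[OF star_hom_PW, symmetric] I.coset_eq_iff)
qed

text \<open>The three universal properties in succession: free power, free product, quotient. By
  \<open>comm\<close> the homomorphism on the free product kills the commutators, hence the closed
  ideal they generate.\<close>

lemma wreath_extend:
  assumes B: "cstar B" and f: "\<And>k. k \<in> {1..n} \<Longrightarrow> star_hom A B (f k)" and y: "magic {1..n} B y"
    and comm: "\<And>k i a. k \<in> {1..n} \<Longrightarrow> i \<in> {1..n} \<Longrightarrow> a \<in> carrier A \<Longrightarrow> f k a \<otimes>\<^bsub>B\<^esub> y k i = y k i \<otimes>\<^bsub>B\<^esub> f k a"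
  shows "\<exists>h. star_hom W B h \<and> (\<forall>k\<in>{1..n}. \<forall>a\<in>carrier A. h (wreath_nu A n k a) = f k a)
    \<and> (\<forall>i\<in>{1..n}. \<forall>j\<in>{1..n}. h (wreath_x A n i j) = y i j)"
proof -
  interpret B: cstar B by fact
  obtain f' where f': "star_hom (free_power A n) B f'"
    "\<And>i a. i \<in> {1..n} \<Longrightarrow> a \<in> carrier A \<Longrightarrow> f' (free_power_inj A n i a) = f i a"
    using pw.free_power_extend[OF B, of f] f by blast
  obtain y' where y': "star_hom (A_aut_X n) B y'"
    "\<And>i j. i \<in> {1..n} \<Longrightarrow> j \<in> {1..n} \<Longrightarrow> y' (X_gen n i j) = y i j"
    using mx.A_aut_X_extend[OF B y] by blast
  obtain h where h: "star_hom P B h"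
    "\<And>a. a \<in> carrier (free_power A n) \<Longrightarrow> h (free_prod_inj (free_power A n) (A_aut_X n) (Inl a)) = f' a"
    "\<And>b. b \<in> carrier (A_aut_X n) \<Longrightarrow> h (free_prod_inj (free_power A n) (A_aut_X n) (Inr b)) = y' b"
    using pr.free_prod_extend[OF B f'(1) y'(1)] unfolding wreath_free_def by blast
  have hn: "h (nu0 k a) = f k a" if "k \<in> {1..n}" "a \<in> carrier A" for k a
    using that star_hom_closed[OF pw.star_hom_free_power_inj] by (simp add: nu0_def h f')
  have hx: "h (x0 i j) = y i j" if "i \<in> {1..n}" "j \<in> {1..n}" for i j
    using that magicD(1)[OF mx.magic_X_gen] by (simp add: x0_def h y')
  have "T \<subseteq> {z \<in> carrier P. h z = \<zero>\<^bsub>B\<^esub>}"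
  proof
    fix t assume t: "t \<in> T"
    then obtain k i a where te: "t = nu0 k a \<otimes>\<^bsub>P\<^esub> x0 k i \<ominus>\<^bsub>P\<^esub> x0 k i \<otimes>\<^bsub>P\<^esub> nu0 k a"
      and ki: "k \<in> {1..n}" "i \<in> {1..n}" "a \<in> carrier A" unfolding T_def by blast
    have c: "nu0 k a \<in> carrier P" "x0 k i \<in> carrier P"
      using ki star_hom_closed[OF star_hom_nu0] magicD(1)[OF magic_x0] by auto
    have "h t = f k a \<otimes>\<^bsub>B\<^esub> y k i \<ominus>\<^bsub>B\<^esub> y k i \<otimes>\<^bsub>B\<^esub> f k a"
      unfolding te using c hn[OF ki(1,3)] hx[OF ki(1,2)]
      by (simp add: star_hom_minus[OF h(1) P.star_algebra_axioms B.star_algebra_axioms] star_hom_mult[OF h(1)])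
    also have "\<dots> = \<zero>\<^bsub>B\<^esub>"
      using comm[OF ki] star_hom_closed[OF f[OF ki(1)] ki(3)] magicD(1)[OF y ki(1,2)]
      by (simp add: a_minus_def B.r_neg)
    finally show "t \<in> {z \<in> carrier P. h z = \<zero>\<^bsub>B\<^esub>}" using T_closed t by blast
  qed
  then have "wreath_ideal A n \<subseteq> {z \<in> carrier P. h z = \<zero>\<^bsub>B\<^esub>}"
    unfolding wreath_ideal_eq using kernel_closed_ideal[OF cstar_P B h(1)]
    by (intro P.closed_ideal_gen_least)
  then have "\<And>z. z \<in> wreath_ideal A n \<Longrightarrow> h z = \<zero>\<^bsub>B\<^esub>" by blast
  from I.Q_extend[OF B.star_algebra_axioms h(1) this]
  obtain g where g: "star_hom W B g" "\<And>z. z \<in> carrier P \<Longrightarrow> g (wreath_ideal A n +>\<^bsub>P\<^esub> z) = h z"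
    unfolding wreath_cstar_def by blast
  have "g (wreath_nu A n k a) = f k a" if "k \<in> {1..n}" "a \<in> carrier A" for k a
    using that g(2)[of "nu0 k a"] star_hom_closed[OF star_hom_nu0] hn by (simp add: wreath_nu_eq)
  moreover have "g (wreath_x A n i j) = y i j" if "i \<in> {1..n}" "j \<in> {1..n}" for i j
    using that g(2)[of "x0 i j"] magicD(1)[OF magic_x0] hx by (simp add: wreath_x_eq)
  ultimately show ?thesis using g(1) by blast
qed

lemma wreath_unique:
  assumes B: "cstar B" and g: "star_hom W B g" and h: "star_hom W B h"
    and nu: "\<And>k a. k \<in> {1..n} \<Longrightarrow> a \<in> carrier A \<Longrightarrow> g (wreath_nu A n k a) = h (wreath_nu A n k a)"
    and x: "\<And>i j. i \<in> {1..n} \<Longrightarrow> j \<in> {1..n} \<Longrightarrow> g (wreath_x A n i j) = h (wreath_x A n i j)"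
    and z: "z \<in> carrier W"
  shows "g z = h z"
proof -
  let ?q = "\<lambda>z. wreath_ideal A n +>\<^bsub>P\<^esub> z"
  note gq = star_hom_comp[OF star_hom_PW g] and hq = star_hom_comp[OF star_hom_PW h]
  obtain w where w: "w \<in> carrier P" "z = ?q w"
    using z unfolding wreath_cstar_def by (rule I.Q_cases)
  have "g (?q w) = h (?q w)"
  proof (rule pr.free_prod_unique[OF B])
    show "star_hom (free_prod (free_power A n) (A_aut_X n)) B (\<lambda>w. g (?q w))"
      "star_hom (free_prod (free_power A n) (A_aut_X n)) B (\<lambda>w. h (?q w))"
      "w \<in> carrier (free_prod (free_power A n) (A_aut_X n))"
      using gq hq w(1) by (simp_all add: wreath_free_def)
    let ?i = "\<lambda>a. free_prod_inj (free_power A n) (A_aut_X n) (Inl a)"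
    let ?j = "\<lambda>a. free_prod_inj (free_power A n) (A_aut_X n) (Inr a)"
    have i: "star_hom (free_power A n) P ?i" and j: "star_hom (A_aut_X n) P ?j"
      using pr.star_hom_free_prod_inj by (simp_all add: wreath_free_def)
    show "g (?q (?i a)) = h (?q (?i a))" if "a \<in> carrier (free_power A n)" for a
      by (rule pw.free_power_unique[OF B star_hom_comp[OF i gq] star_hom_comp[OF i hq] _ that])
         (use nu in \<open>simp add: wreath_nu_eq nu0_def\<close>)
    show "g (?q (?j b)) = h (?q (?j b))" if "b \<in> carrier (A_aut_X n)" for b
      by (rule mx.A_aut_X_unique[OF B star_hom_comp[OF j gq] star_hom_comp[OF j hq] _ that])
         (use x in \<open>simp add: wreath_x_eq x0_def\<close>)
  qed
  then show ?thesis using w by simp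
qed

end

section \<open>Positive functionals\<close>

text \<open>States without the normalisation. Functionals such as
  \<open>a \<mapsto> \<phi> (c* a c)\<close>, made from a state and a vector, are positive but need
  not have mass one.\<close>

definition pos_functional :: "('a, 'x) star_alg_scheme \<Rightarrow> ('a \<Rightarrow> complex) \<Rightarrow> bool" where
  "pos_functional S \<omega> \<longleftrightarrow>
     (\<forall>x\<in>carrier S. \<forall>y\<in>carrier S. \<omega> (x \<oplus>\<^bsub>S\<^esub> y) = \<omega> x + \<omega> y)
   \<and> (\<forall>c. \<forall>x\<in>carrier S. \<omega> (c \<odot>\<^bsub>S\<^esub> x) = c * \<omega> x)
   \<and> (\<forall>x\<in>carrier S. \<omega> (invol S x \<otimes>\<^bsub>S\<^esub> x) \<in> \<real>\<^sub>\<ge>\<^sub>0)"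

lemma state_iff: "state A \<phi> \<longleftrightarrow> pos_functional A \<phi> \<and> \<phi> \<one>\<^bsub>A\<^esub> = 1"
  by (auto simp: state_def pos_functional_def complex_nonneg_Reals_iff)

locale star_functional = star_algebra S for S :: "('a, 'x) star_alg_scheme" (structure) +
  fixes \<omega> :: "'a \<Rightarrow> complex"
  assumes pos_functional: "pos_functional S \<omega>"
begin

lemma \<omega>_add: "x \<in> carrier S \<Longrightarrow> y \<in> carrier S \<Longrightarrow> \<omega> (x \<oplus> y) = \<omega> x + \<omega> y"
  and \<omega>_smult: "x \<in> carrier S \<Longrightarrow> \<omega> (c \<odot> x) = c * \<omega> x"
  and \<omega>_pos: "x \<in> carrier S \<Longrightarrow> \<omega> (invol S x \<otimes> x) \<in> \<real>\<^sub>\<ge>\<^sub>0"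
  using pos_functional by (auto simp: pos_functional_def)

lemma \<omega>_zero [simp]: "\<omega> \<zero> = 0"
  using \<omega>_smult[of \<zero> 0] by simp

lemma \<omega>_finsum: "f \<in> I \<rightarrow> carrier S \<Longrightarrow> finite I \<Longrightarrow> \<omega> (\<Oplus>i\<in>I. f i) = (\<Sum>i\<in>I. \<omega> (f i))"
  by (induction I rule: infinite_finite_induct) (auto simp: \<omega>_add Pi_iff)

text \<open>The length of the vector of \<open>x\<close> in the GNS representation of
  \<open>\<omega>\<close>. All operator arguments below are carried out with these lengths, without
  forming a Hilbert space.\<close>

definition nrm :: "'a \<Rightarrow> real" where
  "nrm x = sqrt (Re (\<omega> (invol S x \<otimes> x)))"

lemma nrm_square: "x \<in> carrier S \<Longrightarrow> (nrm x)\<^sup>2 = Re (\<omega> (invol S x \<otimes> x))"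
  using \<omega>_pos[of x] by (auto simp: nrm_def complex_nonneg_Reals_iff)

lemma nrm_nonneg [simp]: "x \<in> carrier S \<Longrightarrow> 0 \<le> nrm x"
  using \<omega>_pos[of x] by (auto simp: nrm_def complex_nonneg_Reals_iff)

lemma \<omega>_expand:
  assumes "x \<in> carrier S" "y \<in> carrier S"
  shows "\<omega> (invol S (x \<oplus> c \<odot> y) \<otimes> (x \<oplus> c \<odot> y))
    = \<omega> (invol S x \<otimes> x) + c * \<omega> (invol S x \<otimes> y) + cnj c * \<omega> (invol S y \<otimes> x)
      + (cmod c)\<^sup>2 * \<omega> (invol S y \<otimes> y)"
proof -
  have "invol S (x \<oplus> c \<odot> y) \<otimes> (x \<oplus> c \<odot> y)
    = (invol S x \<otimes> x \<oplus> c \<odot> (invol S x \<otimes> y)) \<oplus> (cnj c \<odot> (invol S y \<otimes> x) \<oplus> (cnj c * c) \<odot> (invol S y \<otimes> y))"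
    using assms by (simp add: l_distr r_distr smult_add_right a_ac mult.commute[of c "cnj c"])
  moreover have "cnj c * c = (complex_of_real (cmod c))\<^sup>2"
    using complex_norm_square[of c] by (simp add: mult.commute)
  ultimately show ?thesis using assms by (simp add: \<omega>_add \<omega>_smult)
qed

text \<open>In \<open>\<omega>_expand\<close> the value on the left is real for every
  \<open>c\<close>, so the cross terms have a real sum; the choices \<open>1\<close> and
  \<open>\<i>\<close> of \<open>c\<close> separate real and imaginary part.\<close>

lemma \<omega>_hermitian:
  assumes "x \<in> carrier S" "y \<in> carrier S"
  shows "\<omega> (invol S y \<otimes> x) = cnj (\<omega> (invol S x \<otimes> y))"
proof -
  have im: "Im (\<omega> (invol S z \<otimes> z)) = 0" if "z \<in> carrier S" for z
    using \<omega>_pos[OF that] by (simp add: complex_nonneg_Reals_iff)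
  have "Im (c * \<omega> (invol S x \<otimes> y) + cnj c * \<omega> (invol S y \<otimes> x)) = 0" for c
    using arg_cong[OF \<omega>_expand[OF assms, of c], of Im] im[of "x \<oplus> c \<odot> y"] im[of x] im[of y] assms by simp
  from this[of 1] this[of "\<i>"] show ?thesis by (simp add: complex_eq_iff)
qed

lemma cauchy_schwarz:
  assumes "x \<in> carrier S" "y \<in> carrier S"
  shows "cmod (\<omega> (invol S x \<otimes> y)) \<le> nrm x * nrm y"
proof -
  define m where "m = \<omega> (invol S x \<otimes> y)"
  define a where "a = (nrm x)\<^sup>2"
  define b where "b = (nrm y)\<^sup>2"
  have ineq: "0 \<le> a - 2 * t * (cmod m)\<^sup>2 + t\<^sup>2 * (cmod m)\<^sup>2 * b" for t :: real
  proof -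
    \<comment> \<open>The phase of \<open>c\<close> aligns the two cross terms and leaves a real
      quadratic polynomial in \<open>t\<close>.\<close>
    define c where "c = - (complex_of_real t * cnj m)"
    have "0 \<le> Re (\<omega> (invol S (x \<oplus> c \<odot> y) \<otimes> (x \<oplus> c \<odot> y)))"
      using \<omega>_pos[of "x \<oplus> c \<odot> y"] assms by (simp add: complex_nonneg_Reals_iff)
    also have "\<dots> = a + Re (c * m + cnj c * cnj m) + (cmod c)\<^sup>2 * b"
      unfolding \<omega>_expand[OF assms]
      by (simp add: a_def b_def nrm_square assms m_def \<omega>_hermitian[OF assms] flip: of_real_power)
    also have "Re (c * m + cnj c * cnj m) = - 2 * t * (cmod m)\<^sup>2"
      unfolding cmod_power2 by (simp add: c_def algebra_simps power2_eq_square)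
    also have "(cmod c)\<^sup>2 = t\<^sup>2 * (cmod m)\<^sup>2"
      by (simp add: c_def norm_mult power_mult_distrib)
    finally show ?thesis by simp
  qed
  have "(cmod m)\<^sup>2 \<le> a * b"
  proof (cases "b = 0")
    case True
    have "cmod m = 0"
    proof (rule ccontr)
      assume "cmod m \<noteq> 0"
      then have "(cmod m)\<^sup>2 > 0" by simp
      \<comment> \<open>For this \<open>t\<close> the inequality would read
        \<open>0 \<le> - 1\<close>.\<close>
      then show False using ineq[of "(a + 1) / (2 * (cmod m)\<^sup>2)"] True by (simp add: field_simps)
    qed
    then show ?thesis using True by simp
  next
    case False
    then have "b > 0" using assms by (auto simp: b_def)
    \<comment> \<open>The quadratic polynomial attains its minimum at
      \<open>t = 1 / b\<close>.\<close>
    then show ?thesis using ineq[of "1 / b"] by (simp add: field_simps power2_eq_square)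
  qed
  then have "(cmod m)\<^sup>2 \<le> (nrm x * nrm y)\<^sup>2" by (simp add: a_def b_def power_mult_distrib)
  then show ?thesis unfolding m_def using assms by (rule_tac power2_le_imp_le) auto
qed

lemma nrm_add_le:
  assumes "x \<in> carrier S" "y \<in> carrier S"
  shows "nrm (x \<oplus> y) \<le> nrm x + nrm y"
proof -
  have "(nrm (x \<oplus> y))\<^sup>2 = (nrm x)\<^sup>2 + 2 * Re (\<omega> (invol S x \<otimes> y)) + (nrm y)\<^sup>2"
    using assms \<omega>_expand[OF assms, of 1] \<omega>_hermitian[OF assms] by (simp add: nrm_square)
  also have "\<dots> \<le> (nrm x)\<^sup>2 + 2 * (nrm x * nrm y) + (nrm y)\<^sup>2"
    using cauchy_schwarz[OF assms] complex_Re_le_cmod[of "\<omega> (invol S x \<otimes> y)"] by simp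
  also have "\<dots> = (nrm x + nrm y)\<^sup>2" by (simp add: power2_sum)
  finally show ?thesis using assms by (rule_tac power2_le_imp_le) auto
qed

lemma nrm_smult: "x \<in> carrier S \<Longrightarrow> nrm (c \<odot> x) = cmod c * nrm x"
proof -
  assume x: "x \<in> carrier S"
  have "c * cnj c = (complex_of_real (cmod c))\<^sup>2" using complex_norm_square[of c] by simp
  then have "(nrm (c \<odot> x))\<^sup>2 = (cmod c * nrm x)\<^sup>2"
    using x by (simp add: nrm_square \<omega>_smult power_mult_distrib mult.commute flip: of_real_power)
  then show ?thesis using x by (simp add: power2_eq_iff_nonneg)
qed

text \<open>Moves \<open>x\<close> to the other side of the inner product and applies
  Cauchy-Schwarz. It stands in for the norm identities between an operator and its adjoint, and it
  drives the power argument of \<open>nrm_bound_improve\<close>.\<close>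

lemma nrm_mult_square_le:
  assumes "x \<in> carrier S" "y \<in> carrier S"
  shows "(nrm (x \<otimes> y))\<^sup>2 \<le> nrm y * nrm ((invol S x \<otimes> x) \<otimes> y)"
proof -
  have "(nrm (x \<otimes> y))\<^sup>2 = Re (\<omega> (invol S y \<otimes> ((invol S x \<otimes> x) \<otimes> y)))"
    using assms by (simp add: nrm_square m_assoc)
  also have "\<dots> \<le> nrm y * nrm ((invol S x \<otimes> x) \<otimes> y)"
    using cauchy_schwarz[of y "(invol S x \<otimes> x) \<otimes> y"] complex_Re_le_cmod assms
    by (meson invol_closed m_closed order_trans)
  finally show ?thesis .
qed

end

text \<open>Only \<open>1 - x^2\<close> has been given a square root, not \<open>1 - x\<close>. For
  \<open>cnorm A a < 1\<close> and \<open>x = invol A a \<otimes> a\<close> this bounds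
  \<open>\<theta> (x \<otimes> x)\<close> by \<open>\<theta> \<one>\<close>, and Cauchy-Schwarz
  against \<open>\<one>\<close> then bounds \<open>\<theta> x\<close>. The general case follows by
  scaling with \<open>r\<close> and letting \<open>r\<close> decrease to the norm of
  \<open>a\<close>.\<close>

lemma (in cstar) pos_functional_bound:
  assumes \<theta>: "pos_functional A \<theta>" and a: "a \<in> carrier A"
  shows "Re (\<theta> (invol A a \<otimes> a)) \<le> (cnorm A a)\<^sup>2 * Re (\<theta> \<one>)"
proof -
  interpret f: star_functional A \<theta> by unfold_locales (rule \<theta>)
  have one: "(f.nrm \<one>)\<^sup>2 = Re (\<theta> \<one>)" by (simp add: f.nrm_square)
  have small: "Re (\<theta> (invol A a \<otimes> a)) \<le> Re (\<theta> \<one>)" if a: "a \<in> carrier A" and n: "cnorm A a < 1" for a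
  proof -
    define x where "x = invol A a \<otimes> a"
    have x: "x \<in> carrier A" "invol A x = x" using a by (auto simp: x_def)
    have "cnorm A x < 1" using n a by (simp add: x_def p_cstar power_less_one_iff)
    then obtain b where b: "b \<in> carrier A" "invol A b = b" "x \<otimes> x \<oplus> b \<otimes> b = \<one>"
      using sqrt_one_minus_square[OF x] by blast
    have "(f.nrm x)\<^sup>2 + (f.nrm b)\<^sup>2 = (f.nrm \<one>)\<^sup>2"
      using x b f.\<omega>_add[of "x \<otimes> x" "b \<otimes> b"] by (simp add: f.nrm_square)
    then have "(f.nrm x)\<^sup>2 \<le> (f.nrm \<one>)\<^sup>2" using zero_le_power2[of "f.nrm b"] by linarith
    then have le: "f.nrm x \<le> f.nrm \<one>" by (rule power2_le_imp_le) simp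
    have "Re (\<theta> x) \<le> f.nrm \<one> * f.nrm x"
      using f.cauchy_schwarz[OF one_closed x(1)] complex_Re_le_cmod[of "\<theta> x"] x by simp
    also have "\<dots> \<le> f.nrm \<one> * f.nrm \<one>" using le by (intro mult_left_mono) auto
    finally show ?thesis using one by (simp add: x_def power2_eq_square)
  qed
  have one0: "0 \<le> Re (\<theta> \<one>)" using one by (metis zero_le_power2)
  have "Re (\<theta> (invol A a \<otimes> a)) \<le> r\<^sup>2 * Re (\<theta> \<one>)" if r: "r > cnorm A a" for r
  proof -
    have r0: "r > 0" using r p_nonneg[OF a] by linarith
    let ?a = "complex_of_real (inverse r) \<odot> a"
    have "cnorm A ?a < 1" using r r0 a by (simp add: p_smult norm_divide field_simps)
    then have "Re (\<theta> (invol A ?a \<otimes> ?a)) \<le> Re (\<theta> \<one>)" using a by (intro small) auto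
    moreover have "\<theta> (invol A ?a \<otimes> ?a) = complex_of_real (inverse r * inverse r) * \<theta> (invol A a \<otimes> a)"
      using a by (simp add: f.\<omega>_smult)
    then have "Re (\<theta> (invol A ?a \<otimes> ?a)) = inverse r * inverse r * Re (\<theta> (invol A a \<otimes> a))"
      by (simp only: times_complex.sel Re_complex_of_real Im_complex_of_real mult_zero_left diff_0_right)
    ultimately have "inverse r * inverse r * Re (\<theta> (invol A a \<otimes> a)) \<le> Re (\<theta> \<one>)" by linarith
    then show ?thesis using r0 by (simp add: field_simps power2_eq_square)
  qed
  moreover have "((\<lambda>r. r\<^sup>2 * Re (\<theta> \<one>)) \<longlongrightarrow> (cnorm A a)\<^sup>2 * Re (\<theta> \<one>)) (at_right (cnorm A a))"
    by (intro tendsto_intros)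
  ultimately show ?thesis
    by (intro tendsto_lowerbound[where F = "at_right (cnorm A a)"]) (auto simp: eventually_at_filter)
qed

subsection \<open>The Schur product theorem\<close>

text \<open>Positive semidefiniteness of a kernel. Hermitian symmetry is a consequence of testing
  with complex vectors, see \<open>psd_hermitian\<close>.\<close>

definition psd :: "'i set \<Rightarrow> ('i \<Rightarrow> 'i \<Rightarrow> complex) \<Rightarrow> bool" where
  "psd K P \<longleftrightarrow> (\<forall>c. (\<Sum>i\<in>K. \<Sum>j\<in>K. cnj (c i) * c j * P i j) \<in> \<real>\<^sub>\<ge>\<^sub>0)"

lemma psdD: "psd K P \<Longrightarrow> (\<Sum>i\<in>K. \<Sum>j\<in>K. cnj (c i) * c j * P i j) \<in> \<real>\<^sub>\<ge>\<^sub>0"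
  by (simp add: psd_def)

lemma psd_two:
  assumes "psd (insert m K) P" "finite K" "m \<notin> K" "i \<in> K"
  shows "cnj a * a * P m m + cnj a * b * P m i + cnj b * a * P i m + cnj b * b * P i i \<in> \<real>\<^sub>\<ge>\<^sub>0"
proof -
  define c where "c k = (if k = m then a else if k = i then b else 0)" for k
  have sub: "{m, i} \<subseteq> insert m K" "m \<noteq> i" using assms by auto
  have 1: "(\<Sum>l\<in>insert m K. c l * g l) = a * g m + b * g i" for g
    using sub assms(2) sum.mono_neutral_right[OF _ sub(1), of "\<lambda>l. c l * g l"] by (simp add: c_def)
  have 2: "(\<Sum>l\<in>insert m K. cnj (c l) * g l) = cnj a * g m + cnj b * g i" for g
    using sub assms(2) sum.mono_neutral_right[OF _ sub(1), of "\<lambda>l. cnj (c l) * g l"] by (simp add: c_def)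
  have "(\<Sum>k\<in>insert m K. \<Sum>l\<in>insert m K. cnj (c k) * c l * P k l)
      = (\<Sum>k\<in>insert m K. cnj (c k) * (\<Sum>l\<in>insert m K. c l * P k l))"
    by (simp only: sum_distrib_left mult.assoc)
  also have "\<dots> = cnj a * a * P m m + cnj a * b * P m i + cnj b * a * P i m + cnj b * b * P i i"
    unfolding 1 2 by (simp add: algebra_simps)
  finally show ?thesis using psdD[OF assms(1), of c] by simp
qed

lemma psd_diag:
  assumes "psd (insert m K) P" "finite K" "m \<notin> K"
  shows "P m m \<in> \<real>\<^sub>\<ge>\<^sub>0"
proof -
  define c :: "'a \<Rightarrow> complex" where "c k = (if k = m then 1 else 0)" for k
  have 1: "(\<Sum>l\<in>insert m K. c l * g l) = g m" "(\<Sum>l\<in>insert m K. cnj (c l) * g l) = g m" for g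
    using assms(2) sum.mono_neutral_right[of "insert m K" "{m}" "\<lambda>l. c l * g l"]
      sum.mono_neutral_right[of "insert m K" "{m}" "\<lambda>l. cnj (c l) * g l"] by (simp_all add: c_def)
  have "(\<Sum>k\<in>insert m K. \<Sum>l\<in>insert m K. cnj (c k) * c l * P k l)
      = (\<Sum>k\<in>insert m K. cnj (c k) * (\<Sum>l\<in>insert m K. c l * P k l))"
    by (simp only: sum_distrib_left mult.assoc)
  also have "\<dots> = P m m" unfolding 1 ..
  finally show ?thesis using psdD[OF assms(1), of c] by simp
qed

lemma psd_hermitian:
  assumes "psd (insert m K) P" "finite K" "m \<notin> K" "i \<in> K"
  shows "P i m = cnj (P m i)"
proof -
  note two = psd_two[OF assms]
  have *: "Im (P m m) = 0" "Im (P i i) = 0"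
    using two[of 1 0] two[of 0 1] by (simp_all add: complex_nonneg_Reals_iff)
  show ?thesis
    using two[of 1 1] two[of 1 "\<i>"] * by (simp add: complex_nonneg_Reals_iff complex_eq_iff)
qed

text \<open>With \<open>P m m = 0\<close> the form is affine in the coefficient at \<open>m\<close>,
  so it would take negative values if \<open>P m i\<close> were nonzero; \<open>t\<close> is chosen
  to make its value \<open>- 1\<close>.\<close>

lemma psd_zero_diag:
  assumes "psd (insert m K) P" "finite K" "m \<notin> K" "i \<in> K" "P m m = 0"
  shows "P m i = 0"
proof (rule ccontr)
  assume nz: "P m i \<noteq> 0"
  define q where "q = (cmod (P m i))\<^sup>2"
  have q: "q > 0" using nz by (simp add: q_def)
  define t where "t = (Re (P i i) + 1) / (2 * q)"
  let ?a = "- (complex_of_real t * P m i)"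
  have h: "P i m = cnj (P m i)" by (rule psd_hermitian[OF assms(1-4)])
  have "q = Re (P m i) * Re (P m i) + Im (P m i) * Im (P m i)"
    unfolding q_def cmod_power2 by (simp add: power2_eq_square)
  then have "0 \<le> - 2 * t * q + Re (P i i)"
    using psd_two[OF assms(1-4), of ?a 1] assms(5) h by (simp add: complex_nonneg_Reals_iff)
  moreover have "2 * t * q = Re (P i i) + 1" using q by (simp add: t_def)
  ultimately show False by simp
qed

text \<open>One step of Gaussian elimination: subtract from \<open>Q\<close> the rank-one kernel
  through its row \<open>m\<close>. The remainder \<open>Q'\<close>, a Schur complement, is positive
  on \<open>K\<close> and vanishes in row and column \<open>m\<close>, while the rank-one part
  contributes \<open>d\<close> times a value of the form of \<open>P\<close>. Only the sum of all
  entries is treated; coefficients are absorbed beforehand by \<open>psd_scale\<close>.\<close>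

lemma schur_product:
  assumes "finite K" "psd K P" "psd K Q"
  shows "(\<Sum>i\<in>K. \<Sum>j\<in>K. P i j * Q i j) \<in> \<real>\<^sub>\<ge>\<^sub>0"
  using assms
proof (induction K arbitrary: Q)
  case empty
  then show ?case by simp
next
  case (insert m K)
  note Q = insert.prems(2) insert.hyps
  define d where "d = Q m m"
  \<comment> \<open>For \<open>d = 0\<close> the division yields \<open>r = 0\<close>, in agreement
    with \<open>psd_zero_diag\<close>, by which row \<open>m\<close> of \<open>Q\<close>
    vanishes.\<close>
  define r where "r j = Q m j / d" for j
  define Q' where "Q' i j = Q i j - Q i m * r j" for i j
  have d: "d \<in> \<real>\<^sub>\<ge>\<^sub>0" unfolding d_def by (rule psd_diag[OF Q])
  then have dr: "cnj d = d" by (auto simp: complex_nonneg_Reals_iff complex_eq_iff)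
  have row: "Q m j = d * r j" if "j \<in> insert m K" for j
    using that psd_zero_diag[OF Q, of j] by (cases "j = m") (auto simp: r_def d_def)
  have col: "Q i m = d * cnj (r i)" if "i \<in> insert m K" for i
  proof (cases "i = m")
    case True
    then show ?thesis using dr by (auto simp: r_def d_def)
  next
    case False
    then show ?thesis using that psd_hermitian[OF Q, of i] row[of i] dr by simp
  qed
  have psdK: "psd K P"
    unfolding psd_def
  proof
    fix c
    have "(\<Sum>i\<in>insert m K. \<Sum>j\<in>insert m K. cnj (if i = m then 0 else c i) * (if j = m then 0 else c j) * P i j)
        = (\<Sum>i\<in>K. \<Sum>j\<in>K. cnj (c i) * c j * P i j)"
      using insert.hyps by (auto intro!: sum.cong)
    then show "(\<Sum>i\<in>K. \<Sum>j\<in>K. cnj (c i) * c j * P i j) \<in> \<real>\<^sub>\<ge>\<^sub>0"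
      using psdD[OF insert.prems(1), of "\<lambda>i. if i = m then 0 else c i"] by simp
  qed
  have "psd K Q'"
    unfolding psd_def
  proof
    fix c
    define w where "w = (\<Sum>j\<in>K. r j * c j)"
    \<comment> \<open>Extending \<open>c\<close> by \<open>- w\<close> at \<open>m\<close> completes
      the square: the form of \<open>Q\<close> at \<open>c'\<close> is the form of \<open>Q'\<close>
      at \<open>c\<close>.\<close>
    define c' where "c' j = (if j = m then - w else c j)" for j
    have "(\<Sum>i\<in>insert m K. \<Sum>j\<in>insert m K. cnj (c' i) * c' j * Q i j)
      = (\<Sum>j\<in>insert m K. cnj (c' m) * c' j * Q m j) + (\<Sum>i\<in>K. \<Sum>j\<in>insert m K. cnj (c' i) * c' j * Q i j)"
      using insert.hyps by simp
    also have "(\<Sum>j\<in>insert m K. cnj (c' m) * c' j * Q m j) = cnj w * w * d - cnj w * d * w"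
    proof -
      have "(\<Sum>j\<in>K. cnj (c' m) * c' j * Q m j) = (\<Sum>j\<in>K. - (cnj w * d) * (r j * c j))"
        using insert.hyps row by (intro sum.cong) (auto simp: c'_def)
      also have "\<dots> = - (cnj w * d) * w" by (simp add: w_def sum_distrib_left)
      finally show ?thesis using insert.hyps by (simp add: c'_def d_def)
    qed
    also have "(\<Sum>i\<in>K. \<Sum>j\<in>insert m K. cnj (c' i) * c' j * Q i j)
      = (\<Sum>i\<in>K. (\<Sum>j\<in>K. cnj (c i) * c j * Q i j) - cnj (c i) * cnj (r i) * (d * w))"
      using insert.hyps col by (intro sum.cong) (auto simp: c'_def intro!: sum.cong)
    also have "\<dots> = (\<Sum>i\<in>K. \<Sum>j\<in>K. cnj (c i) * c j * Q' i j)"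
    proof (rule sum.cong[OF refl])
      fix i assume i: "i \<in> K"
      have "(\<Sum>j\<in>K. cnj (c i) * c j * (Q i m * r j)) = cnj (c i) * Q i m * w"
        unfolding w_def sum_distrib_left by (intro sum.cong) (auto simp: algebra_simps)
      then show "(\<Sum>j\<in>K. cnj (c i) * c j * Q i j) - cnj (c i) * cnj (r i) * (d * w)
          = (\<Sum>j\<in>K. cnj (c i) * c j * Q' i j)"
        using i by (simp add: Q'_def right_diff_distrib sum_subtractf col algebra_simps)
    qed
    finally show "(\<Sum>i\<in>K. \<Sum>j\<in>K. cnj (c i) * c j * Q' i j) \<in> \<real>\<^sub>\<ge>\<^sub>0"
      using psdD[OF Q(1), of c'] by (simp add: algebra_simps)
  qed
  from insert.IH[OF psdK this]
  have IH: "(\<Sum>i\<in>K. \<Sum>j\<in>K. P i j * Q' i j) \<in> \<real>\<^sub>\<ge>\<^sub>0" .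
  have "(\<Sum>i\<in>insert m K. \<Sum>j\<in>insert m K. P i j * Q i j)
      = (\<Sum>i\<in>insert m K. \<Sum>j\<in>insert m K. P i j * Q' i j + d * (cnj (r i) * r j * P i j))"
    by (intro sum.cong refl) (simp add: Q'_def col algebra_simps)
  also have "\<dots> = (\<Sum>i\<in>insert m K. \<Sum>j\<in>insert m K. P i j * Q' i j)
      + d * (\<Sum>i\<in>insert m K. \<Sum>j\<in>insert m K. cnj (r i) * r j * P i j)"
    by (simp only: sum.distrib sum_distrib_left)
  also have "(\<Sum>i\<in>insert m K. \<Sum>j\<in>insert m K. P i j * Q' i j) = (\<Sum>i\<in>K. \<Sum>j\<in>K. P i j * Q' i j)"
  proof -
    have "Q' m j = 0" if "j \<in> insert m K" for j using row[OF that] by (simp add: Q'_def d_def)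
    moreover have "Q' i m = 0" if "i \<in> insert m K" for i
      using col[OF that] by (cases "d = 0") (auto simp: Q'_def r_def d_def)
    ultimately show ?thesis using insert.hyps by simp
  qed
  finally show ?case
    using IH d psdD[OF insert.prems(1), of r] by simp
qed


subsection \<open>The seminorm of a family of positive functionals\<close>

text \<open>The formula of \<open>min_seminorm\<close> for an arbitrary family of functionals: the
  supremum of the operator norms in their GNS representations.\<close>

definition gns_seminorm :: "('a, 'x) star_alg_scheme \<Rightarrow> ('a \<Rightarrow> complex) set \<Rightarrow> 'a \<Rightarrow> real" where
  "gns_seminorm S \<Omega> x = Sup (insert 0 {sqrt (Re (\<omega> (invol S (x \<otimes>\<^bsub>S\<^esub> y) \<otimes>\<^bsub>S\<^esub> (x \<otimes>\<^bsub>S\<^esub> y)))) | \<omega> y.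
     \<omega> \<in> \<Omega> \<and> y \<in> carrier S \<and> Re (\<omega> (invol S y \<otimes>\<^bsub>S\<^esub> y)) \<le> 1})"

text \<open>\<open>bounded\<close> says that left multiplication by \<open>x\<close> acts as a
  bounded operator, uniformly over the family; this makes the supremum finite.\<close>

locale gns_family = star_algebra S for S :: "('a, 'x) star_alg_scheme" (structure) +
  fixes \<Omega> :: "('a \<Rightarrow> complex) set"
  assumes pos: "\<omega> \<in> \<Omega> \<Longrightarrow> pos_functional S \<omega>"
    and bounded: "x \<in> carrier S \<Longrightarrow> \<exists>K. \<forall>\<omega>\<in>\<Omega>. \<forall>y\<in>carrier S.
      star_functional.nrm S \<omega> (x \<otimes> y) \<le> K * star_functional.nrm S \<omega> y"
begin

abbreviation "N \<equiv> star_functional.nrm S"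
abbreviation "p \<equiv> gns_seminorm S \<Omega>"

lemma star_functional: "\<omega> \<in> \<Omega> \<Longrightarrow> star_functional S \<omega>"
  by unfold_locales (rule pos)

lemma gns_eq: "p x = Sup (insert 0 {N \<omega> (x \<otimes> y) | \<omega> y. \<omega> \<in> \<Omega> \<and> y \<in> carrier S \<and> N \<omega> y \<le> 1})"
proof -
  have N: "N \<omega> y = sqrt (Re (\<omega> (invol S y \<otimes> y)))" if "\<omega> \<in> \<Omega>" for \<omega> y
    by (rule star_functional.nrm_def[OF star_functional[OF that]])
  then have "{sqrt (Re (\<omega> (invol S (x \<otimes> y) \<otimes> (x \<otimes> y)))) | \<omega> y.
      \<omega> \<in> \<Omega> \<and> y \<in> carrier S \<and> Re (\<omega> (invol S y \<otimes> y)) \<le> 1}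
    = {N \<omega> (x \<otimes> y) | \<omega> y. \<omega> \<in> \<Omega> \<and> y \<in> carrier S \<and> N \<omega> y \<le> 1}"
    by (intro Collect_cong iff_exI) (auto simp: N)
  then show ?thesis by (simp add: gns_seminorm_def)
qed

lemma bdd: "x \<in> carrier S \<Longrightarrow>
  bdd_above (insert 0 {N \<omega> (x \<otimes> y) | \<omega> y. \<omega> \<in> \<Omega> \<and> y \<in> carrier S \<and> N \<omega> y \<le> 1})"
proof -
  assume x: "x \<in> carrier S"
  obtain K where K: "\<And>\<omega> y. \<omega> \<in> \<Omega> \<Longrightarrow> y \<in> carrier S \<Longrightarrow> N \<omega> (x \<otimes> y) \<le> K * N \<omega> y"
    using bounded[OF x] by blast
  have "N \<omega> (x \<otimes> y) \<le> \<bar>K\<bar>" if "\<omega> \<in> \<Omega>" "y \<in> carrier S" "N \<omega> y \<le> 1" for \<omega> y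
  proof -
    have "N \<omega> (x \<otimes> y) \<le> K * N \<omega> y" by (rule K[OF that(1,2)])
    also have "\<dots> \<le> \<bar>K\<bar> * 1"
      using that star_functional.nrm_nonneg[OF star_functional[OF that(1)] that(2)]
      by (intro mult_mono) auto
    finally show ?thesis by simp
  qed
  then show ?thesis by (auto simp: bdd_above_def intro!: exI[of _ "\<bar>K\<bar>"])
qed

lemma p_nonneg: "x \<in> carrier S \<Longrightarrow> 0 \<le> p x"
  unfolding gns_eq by (rule cSup_upper[OF _ bdd]) auto

lemma p_le:
  assumes "0 \<le> K" "\<And>\<omega> y. \<omega> \<in> \<Omega> \<Longrightarrow> y \<in> carrier S \<Longrightarrow> N \<omega> (x \<otimes> y) \<le> K * N \<omega> y"
  shows "p x \<le> K"
  unfolding gns_eq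
proof (rule cSup_least)
  fix r assume "r \<in> insert 0 {N \<omega> (x \<otimes> y) | \<omega> y. \<omega> \<in> \<Omega> \<and> y \<in> carrier S \<and> N \<omega> y \<le> 1}"
  then consider "r = 0" | \<omega> y where "r = N \<omega> (x \<otimes> y)" "\<omega> \<in> \<Omega>" "y \<in> carrier S" "N \<omega> y \<le> 1" by blast
  then show "r \<le> K"
  proof cases
    case 2
    then have "r \<le> K * N \<omega> y" using assms(2) by simp
    also have "\<dots> \<le> K * 1" using 2 assms(1) by (intro mult_left_mono) auto
    finally show ?thesis by simp
  qed (use assms in simp)
qed auto

lemma p_bound:
  assumes \<omega>: "\<omega> \<in> \<Omega>" and x: "x \<in> carrier S" and y: "y \<in> carrier S"
  shows "N \<omega> (x \<otimes> y) \<le> p x * N \<omega> y"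
proof -
  interpret f: star_functional S \<omega> by (rule star_functional[OF \<omega>])
  show ?thesis
  proof (cases "N \<omega> y = 0")
    case True
    \<comment> \<open>A null vector cannot be rescaled to length one; that
      \<open>x \<otimes> y\<close> is null again is taken from \<open>bounded\<close>.\<close>
    obtain K where "N \<omega> (x \<otimes> y) \<le> K * N \<omega> y" using bounded[OF x] \<omega> y by blast
    then show ?thesis using True by simp
  next
    case False
    then have pos: "N \<omega> y > 0" using f.nrm_nonneg[OF y] by simp
    let ?c = "complex_of_real (inverse (N \<omega> y))"
    have "N \<omega> (x \<otimes> (?c \<odot> y)) \<in> insert 0 {N \<omega> (x \<otimes> y) | \<omega> y. \<omega> \<in> \<Omega> \<and> y \<in> carrier S \<and> N \<omega> y \<le> 1}"
    proof (intro insertI2 CollectI exI conjI)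
      show "N \<omega> (?c \<odot> y) \<le> 1" using pos f.nrm_smult[OF y, of ?c] by (simp add: norm_inverse)
    qed (use \<omega> y in auto)
    then have "N \<omega> (x \<otimes> (?c \<odot> y)) \<le> p x"
      unfolding gns_eq by (rule cSup_upper[OF _ bdd[OF x]])
    then show ?thesis using x y pos by (simp add: f.nrm_smult norm_divide field_simps)
  qed
qed

lemma cstar_seminorm_gns: "cstar_seminorm S p"
proof -
  have add: "p (x \<oplus> y) \<le> p x + p y" if x: "x \<in> carrier S" and y: "y \<in> carrier S" for x y
  proof (rule p_le)
    fix \<omega> z assume \<omega>: "\<omega> \<in> \<Omega>" and z: "z \<in> carrier S"
    interpret f: star_functional S \<omega> by (rule star_functional[OF \<omega>])
    show "N \<omega> ((x \<oplus> y) \<otimes> z) \<le> (p x + p y) * N \<omega> z"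
      using f.nrm_add_le[of "x \<otimes> z" "y \<otimes> z"] p_bound[OF \<omega> x z] p_bound[OF \<omega> y z] x y z
      by (simp add: l_distr distrib_right)
  qed (use x y p_nonneg in auto)
  have mult: "p (x \<otimes> y) \<le> p x * p y" if x: "x \<in> carrier S" and y: "y \<in> carrier S" for x y
  proof (rule p_le)
    fix \<omega> z assume \<omega>: "\<omega> \<in> \<Omega>" and z: "z \<in> carrier S"
    have "N \<omega> (x \<otimes> (y \<otimes> z)) \<le> p x * N \<omega> (y \<otimes> z)" using x y z by (intro p_bound[OF \<omega>]) auto
    also have "\<dots> \<le> p x * (p y * N \<omega> z)" using x y z by (intro mult_left_mono p_bound[OF \<omega>] p_nonneg)
    finally show "N \<omega> ((x \<otimes> y) \<otimes> z) \<le> p x * p y * N \<omega> z" using x y z by (simp add: m_assoc mult.assoc)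
  qed (use x y p_nonneg in auto)
  have smult_le: "p (c \<odot> x) \<le> cmod c * p x" if x: "x \<in> carrier S" for x c
  proof (rule p_le)
    fix \<omega> z assume \<omega>: "\<omega> \<in> \<Omega>" and z: "z \<in> carrier S"
    interpret f: star_functional S \<omega> by (rule star_functional[OF \<omega>])
    show "N \<omega> ((c \<odot> x) \<otimes> z) \<le> cmod c * p x * N \<omega> z"
      using p_bound[OF \<omega> x z] x z by (simp add: f.nrm_smult mult.assoc mult_left_mono)
  qed (use x p_nonneg in auto)
  have smult: "p (c \<odot> x) = cmod c * p x" if x: "x \<in> carrier S" for x c
  proof (cases "c = 0")
    case True
    then show ?thesis using smult_le[OF x, of 0] p_nonneg[of \<zero>] x by simp
  next
    case False
    then have "p x \<le> cmod (inverse c) * p (c \<odot> x)" using smult_le[of "c \<odot> x" "inverse c"] x by simp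
    then have "cmod c * p x \<le> p (c \<odot> x)" using False by (simp add: norm_divide field_simps)
    then show ?thesis using smult_le[OF x, of c] by simp
  qed
  have invol: "p (invol S x) \<le> p x" if x: "x \<in> carrier S" for x
  proof (rule p_le[OF p_nonneg[OF x]])
    fix \<omega> z assume \<omega>: "\<omega> \<in> \<Omega>" and z: "z \<in> carrier S"
    interpret f: star_functional S \<omega> by (rule star_functional[OF \<omega>])
    let ?w = "invol S x \<otimes> z"
    \<comment> \<open>Once \<open>x\<close> is bounded by \<open>p x\<close>, the length of
      \<open>?w\<close> occurs squared on the left and once on the right; cancelling it bounds the
      action of the adjoint by \<open>p x\<close>.\<close>
    have "(N \<omega> ?w)\<^sup>2 \<le> N \<omega> z * N \<omega> (x \<otimes> ?w)"
      using f.nrm_mult_square_le[of "invol S x" z] x z by (simp add: m_assoc)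
    also have "\<dots> \<le> N \<omega> z * (p x * N \<omega> ?w)" using x z by (intro mult_left_mono p_bound[OF \<omega>]) auto
    finally have "N \<omega> ?w * N \<omega> ?w \<le> (p x * N \<omega> z) * N \<omega> ?w" by (simp add: power2_eq_square algebra_simps)
    then show "N \<omega> ?w \<le> p x * N \<omega> z"
      using f.nrm_nonneg[of ?w] x z p_nonneg[OF x] f.nrm_nonneg[OF z]
        mult_right_le_imp_le[of "N \<omega> ?w" "N \<omega> ?w" "p x * N \<omega> z"]
      by (cases "N \<omega> ?w = 0") (auto simp: mult_nonneg_nonneg order_le_less)
  qed
  have cstar: "p (invol S x \<otimes> x) = (p x)\<^sup>2" if x: "x \<in> carrier S" for x
  proof (rule antisym)
    have "p (invol S x \<otimes> x) \<le> p (invol S x) * p x" using x by (intro mult) auto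
    also have "\<dots> \<le> p x * p x" using x by (intro mult_right_mono invol p_nonneg)
    finally show "p (invol S x \<otimes> x) \<le> (p x)\<^sup>2" by (simp add: power2_eq_square)
    have xx: "0 \<le> p (invol S x \<otimes> x)" using x by (intro p_nonneg) auto
    have "p x \<le> sqrt (p (invol S x \<otimes> x))"
    proof (rule p_le)
      fix \<omega> z assume \<omega>: "\<omega> \<in> \<Omega>" and z: "z \<in> carrier S"
      interpret f: star_functional S \<omega> by (rule star_functional[OF \<omega>])
      have "(N \<omega> (x \<otimes> z))\<^sup>2 \<le> N \<omega> z * N \<omega> ((invol S x \<otimes> x) \<otimes> z)"
        by (rule f.nrm_mult_square_le[OF x z])
      also have "\<dots> \<le> N \<omega> z * (p (invol S x \<otimes> x) * N \<omega> z)"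
        using x z by (intro mult_left_mono p_bound[OF \<omega>]) auto
      also have "\<dots> = (sqrt (p (invol S x \<otimes> x)) * N \<omega> z)\<^sup>2"
        using xx by (simp add: power_mult_distrib power2_eq_square)
      finally have "(N \<omega> (x \<otimes> z))\<^sup>2 \<le> (sqrt (p (invol S x \<otimes> x)) * N \<omega> z)\<^sup>2" .
      then show "N \<omega> (x \<otimes> z) \<le> sqrt (p (invol S x \<otimes> x)) * N \<omega> z"
        by (rule power2_le_imp_le) (use xx f.nrm_nonneg[OF z] in simp)
    qed (use xx in auto)
    then have "(p x)\<^sup>2 \<le> (sqrt (p (invol S x \<otimes> x)))\<^sup>2" using p_nonneg[OF x] by (rule power_mono)
    then show "(p x)\<^sup>2 \<le> p (invol S x \<otimes> x)" using xx by simp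
  qed
  show ?thesis by (simp add: cstar_seminorm_def p_nonneg add mult smult cstar)
qed

end

text \<open>If \<open>a > b > 0\<close>, the powers of \<open>a / b\<close> would eventually exceed
  the bound \<open>C / c\<close>.\<close>

lemma power_two_power_compare:
  fixes a b c C :: real
  assumes "0 \<le> a" "0 \<le> b" "c > 0" and le: "\<And>j. a ^ 2 ^ j * c \<le> C * b ^ 2 ^ j"
  shows "a \<le> b"
proof (rule ccontr)
  assume "\<not> a \<le> b"
  then have ab: "a > b" by simp
  show False
  proof (cases "b = 0")
    case True
    then have "a * c \<le> 0" using le[of 0] by simp
    then show False using ab True assms(3) by (simp add: mult_le_0_iff)
  next
    case False
    define r where "r = a / b"
    have b: "b > 0" and r: "r > 1" using False assms ab by (auto simp: r_def)
    obtain n where n: "C / c < r ^ n" using real_arch_pow[OF r] by blast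
    have "n \<le> 2 ^ n" by (simp add: less_imp_le)
    then have "C / c < r ^ 2 ^ n" using n r power_increasing[of n "2 ^ n" r] by linarith
    then have "C * b ^ 2 ^ n < a ^ 2 ^ n * c" using b assms(3) by (simp add: r_def power_divide field_simps)
    then show False using le[of n] by simp
  qed
qed

text \<open>
  A growth bound for the vector \<open>y\<close> with a constant depending on \<open>y\<close> improves itself: apply it to
  \<open>(x\<^sup>*x)\<close> raised to the powers \<open>2\<^sup>j\<close>.
\<close>

lemma (in star_functional) nrm_bound_improve:
  assumes S': "cstar_seminormed S' q" and h: "star_hom S' S h" and y: "y \<in> carrier S"
    and C: "\<And>z. z \<in> carrier S' \<Longrightarrow> nrm (h z \<otimes> y) \<le> C * q z" and x: "x \<in> carrier S'"
  shows "nrm (h x \<otimes> y) \<le> q x * nrm y"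
proof (cases "nrm y = 0")
  interpret S': cstar_seminormed S' q by fact
  note hs = star_hom_simps[OF h]
  case True
  have "(nrm (h x \<otimes> y))\<^sup>2 \<le> nrm y * nrm ((invol S (h x) \<otimes> h x) \<otimes> y)"
    using x y by (intro nrm_mult_square_le) (auto simp: hs)
  then show ?thesis using True by simp
next
  interpret S': cstar_seminormed S' q by fact
  note hs = star_hom_simps[OF h]
  case False
  then have n: "nrm y > 0" using nrm_nonneg[OF y] by simp
  \<comment> \<open>At each step \<open>q\<close> is squared exactly, by the C*-identity, while the
    ratio \<open>R\<close> introduced below becomes at least its square, by
    \<open>nrm_mult_square_le\<close>. Thus the constant \<open>C\<close> loses its influence as
    \<open>j\<close> grows.\<close>
  define s where "s j = ((\<lambda>z. invol S' z \<otimes>\<^bsub>S'\<^esub> z) ^^ j) x" for j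
  have sc: "s j \<in> carrier S'" for j by (induction j) (auto simp: s_def x)
  have s_Suc: "s (Suc j) = invol S' (s j) \<otimes>\<^bsub>S'\<^esub> s j" for j by (simp add: s_def)
  have qs: "q (s j) = q x ^ 2 ^ j" for j
  proof (induction j)
    case 0 then show ?case by (simp add: s_def)
  next
    case (Suc j)
    then show ?case using sc[of j] by (simp add: s_Suc S'.p_cstar power_mult[symmetric] mult.commute)
  qed
  define R where "R z = nrm (h z \<otimes> y) / nrm y" for z
  have R0: "R z \<ge> 0" if "z \<in> carrier S'" for z using that n y by (auto simp: R_def hs)
  have "R x ^ 2 ^ j \<le> R (s j)" for j
  proof (induction j)
    case 0 then show ?case by (simp add: s_def)
  next
    case (Suc j)
    have "(nrm (h (s j) \<otimes> y))\<^sup>2 \<le> nrm y * nrm (h (s (Suc j)) \<otimes> y)"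
      using nrm_mult_square_le[of "h (s j)" y] sc[of j] y by (simp add: s_Suc hs)
    then have "(R (s j))\<^sup>2 \<le> R (s (Suc j))"
      using n by (simp add: R_def field_simps power2_eq_square)
    moreover have "(R x ^ 2 ^ j)\<^sup>2 \<le> (R (s j))\<^sup>2" using Suc R0[OF x] by (intro power_mono) auto
    ultimately show ?case by (simp add: power_mult[symmetric] mult.commute)
  qed
  moreover have "R (s j) \<le> C * q x ^ 2 ^ j / nrm y" for j
    using C[OF sc[of j]] n unfolding qs R_def by (simp add: divide_right_mono)
  ultimately have "R x ^ 2 ^ j * nrm y \<le> C * q x ^ 2 ^ j" for j
    using n order_trans pos_le_divide_eq by metis
  then have "R x \<le> q x"
    by (rule power_two_power_compare[OF R0[OF x] S'.p_nonneg[OF x] n])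
  then show ?thesis using n by (simp add: R_def field_simps)
qed

section \<open>The minimal tensor product\<close>

lemma psd_scale:
  assumes "psd K P"
  shows "psd K (\<lambda>u v. cnj (d u) * d v * P u v)"
  unfolding psd_def
proof
  fix c
  show "(\<Sum>u\<in>K. \<Sum>v\<in>K. cnj (c u) * c v * (cnj (d u) * d v * P u v)) \<in> \<real>\<^sub>\<ge>\<^sub>0"
    using psdD[OF assms, of "\<lambda>u. c u * d u"] by (simp add: mult_ac)
qed

text \<open>The form at \<open>c\<close> is the value of \<open>\<omega>\<close> at
  \<open>invol S w \<otimes> w\<close>, where \<open>w\<close> combines the \<open>f u\<close> with
  the coefficients \<open>c u\<close>.\<close>

lemma (in star_functional) psd_gram:
  assumes "finite K" "\<And>u. u \<in> K \<Longrightarrow> f u \<in> carrier S"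
  shows "psd K (\<lambda>u v. \<omega> (invol S (f u) \<otimes> f v))"
  unfolding psd_def
proof
  fix c
  define w where "w = (\<Oplus>u\<in>K. c u \<odot> f u)"
  have w: "w \<in> carrier S" using assms by (auto simp: w_def intro!: finsum_closed)
  have iw: "invol S w = (\<Oplus>u\<in>K. cnj (c u) \<odot> invol S (f u))"
    unfolding w_def using assms
    by (subst finsum_invol) (auto intro!: finsum_cong')
  have "\<omega> (invol S w \<otimes> w) = (\<Sum>u\<in>K. \<omega> ((cnj (c u) \<odot> invol S (f u)) \<otimes> w))"
  proof -
    have "invol S w \<otimes> w = (\<Oplus>u\<in>K. (cnj (c u) \<odot> invol S (f u)) \<otimes> w)"
      unfolding iw using assms w by (intro finsum_ldistr) auto
    then show ?thesis by (simp only:) (rule \<omega>_finsum, use assms w in auto)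
  qed
  also have "\<dots> = (\<Sum>u\<in>K. \<Sum>v\<in>K. cnj (c u) * c v * \<omega> (invol S (f u) \<otimes> f v))"
  proof (rule sum.cong[OF refl])
    fix u assume u: "u \<in> K"
    have "\<omega> ((cnj (c u) \<odot> invol S (f u)) \<otimes> w)
        = (\<Sum>v\<in>K. \<omega> ((cnj (c u) \<odot> invol S (f u)) \<otimes> (c v \<odot> f v)))"
    proof -
      have "(cnj (c u) \<odot> invol S (f u)) \<otimes> w = (\<Oplus>v\<in>K. (cnj (c u) \<odot> invol S (f u)) \<otimes> (c v \<odot> f v))"
        unfolding w_def using assms u by (intro finsum_rdistr) auto
      then show ?thesis by (simp only:) (rule \<omega>_finsum, use assms u in auto)
    qed
    also have "\<dots> = (\<Sum>v\<in>K. cnj (c u) * c v * \<omega> (invol S (f u) \<otimes> f v))"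
      using assms u by (intro sum.cong) (auto simp: \<omega>_smult mult_ac)
    finally show "\<omega> ((cnj (c u) \<odot> invol S (f u)) \<otimes> w) = \<dots>" .
  qed
  finally show "(\<Sum>u\<in>K. \<Sum>v\<in>K. cnj (c u) * c v * \<omega> (invol S (f u) \<otimes> f v)) \<in> \<real>\<^sub>\<ge>\<^sub>0"
    using \<omega>_pos[OF w] by simp
qed

locale tensor_product = A: cstar A + B: cstar B
  for A :: "('a, 'x) cstar_alg_scheme" and B :: "('b, 'y) cstar_alg_scheme"
begin

sublocale M: star_monoid "A \<times>\<times> B" "map_prod (invol A) (invol B)"
proof -
  interpret m: monoid "A \<times>\<times> B" by (intro DirProd_monoid A.monoid_axioms B.monoid_axioms)
  show "star_monoid (A \<times>\<times> B) (map_prod (invol A) (invol B))"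
    by unfold_locales (auto simp: mult_DirProd')
qed

abbreviation "T \<equiv> formal_tensor A B"
abbreviation "e u \<equiv> Poly_Mapping.single u (1 :: complex)"
abbreviation "tf \<equiv> tensor_functional"

lemma T_eq: "T = M.CM"
  by (simp add: formal_tensor_def)

sublocale T: star_algebra T
  unfolding T_eq by (rule M.star_algebra_CM)

lemma e_closed [simp]: "a \<in> carrier A \<Longrightarrow> b \<in> carrier B \<Longrightarrow> Poly_Mapping.single (a, b) c \<in> carrier T"
  unfolding T_eq by (rule M.CM_single_closed) simp

lemma T_single:
  "Poly_Mapping.single (a, b) c \<otimes>\<^bsub>T\<^esub> Poly_Mapping.single (a', b') d
    = Poly_Mapping.single (a \<otimes>\<^bsub>A\<^esub> a', b \<otimes>\<^bsub>B\<^esub> b') (c * d)"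
  "c \<odot>\<^bsub>T\<^esub> Poly_Mapping.single (a, b) d = Poly_Mapping.single (a, b) (c * d)"
  "invol T (Poly_Mapping.single (a, b) c) = Poly_Mapping.single (invol A a, invol B b) (cnj c)"
  "\<one>\<^bsub>T\<^esub> = e (\<one>\<^bsub>A\<^esub>, \<one>\<^bsub>B\<^esub>)"
  unfolding T_eq by (simp_all add: M.CM_single M.CM_simps(2))

lemma T_add: "x \<oplus>\<^bsub>T\<^esub> y = x + y" and T_zero: "\<zero>\<^bsub>T\<^esub> = 0"
  unfolding T_eq by (rule M.CM_simps)+

lemma T_induct [consumes 1, case_names zero single add]:
  assumes "x \<in> carrier T" and "P \<zero>\<^bsub>T\<^esub>"
    and "\<And>a b c. a \<in> carrier A \<Longrightarrow> b \<in> carrier B \<Longrightarrow> P (c \<odot>\<^bsub>T\<^esub> e (a, b))"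
    and "\<And>x y. x \<in> carrier T \<Longrightarrow> y \<in> carrier T \<Longrightarrow> P x \<Longrightarrow> P y \<Longrightarrow> P (x \<oplus>\<^bsub>T\<^esub> y)"
  shows "P x"
proof -
  have "x \<in> carrier M.CM" using assms(1) by (simp add: T_eq)
  then show ?thesis
  proof (induction x rule: M.CM_induct)
    case zero
    then show ?case using assms(2) by (simp add: T_zero)
  next
    case (single u c)
    then show ?case using assms(3)[of "fst u" "snd u" c] by (auto simp: T_single)
  next
    case (add x y)
    then show ?case using assms(4)[of x y] by (simp add: T_eq M.CM_simps(4))
  qed
qed

lemma tf_eq: "tf \<phi> \<psi> x = (\<Sum>u\<in>Poly_Mapping.keys x. Poly_Mapping.lookup x u * (\<phi> (fst u) * \<psi> (snd u)))"
  by (simp add: tensor_functional_def case_prod_beta')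

lemma tf_add: "tf \<phi> \<psi> (x \<oplus>\<^bsub>T\<^esub> y) = tf \<phi> \<psi> x + tf \<phi> \<psi> y"
  unfolding tf_eq T_add
  by (rule sum_keys_add[where f = "\<lambda>u c. c * (\<phi> (fst u) * \<psi> (snd u))"]) (simp_all add: distrib_right)

lemma tf_single: "tf \<phi> \<psi> (Poly_Mapping.single (a, b) c) = c * (\<phi> a * \<psi> b)"
  unfolding tf_eq
  by (subst sum_keys_single[where f = "\<lambda>u c. c * (\<phi> (fst u) * \<psi> (snd u))"]) simp_all

lemma tf_zero: "tf \<phi> \<psi> \<zero>\<^bsub>T\<^esub> = 0"
  by (simp add: tf_eq T_zero)

lemma tf_smult: "x \<in> carrier T \<Longrightarrow> tf \<phi> \<psi> (c \<odot>\<^bsub>T\<^esub> x) = c * tf \<phi> \<psi> x"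
  by (induction x rule: T_induct)
     (simp_all add: tf_zero T_single tf_single T.smult_add_right tf_add algebra_simps)

lemma tf_minus: "x \<in> carrier T \<Longrightarrow> y \<in> carrier T \<Longrightarrow> tf \<phi> \<psi> (x \<ominus>\<^bsub>T\<^esub> y) = tf \<phi> \<psi> x - tf \<phi> \<psi> y"
  by (simp add: T.minus_eq_smult tf_add tf_smult)

lemma tf_vanish:
  assumes n: "n \<in> carrier T"
    and single: "\<And>a b a' b'. a \<in> carrier A \<Longrightarrow> b \<in> carrier B \<Longrightarrow> a' \<in> carrier A \<Longrightarrow> b' \<in> carrier B
      \<Longrightarrow> tf \<phi> \<psi> (e (a, b) \<otimes>\<^bsub>T\<^esub> n \<otimes>\<^bsub>T\<^esub> e (a', b')) = 0"
    and z: "z \<in> carrier T" and y: "y \<in> carrier T"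
  shows "tf \<phi> \<psi> (z \<otimes>\<^bsub>T\<^esub> n \<otimes>\<^bsub>T\<^esub> y) = 0"
  using z
proof (induction z rule: T_induct)
  case (single a b c)
  from y show ?case
  proof (induction y rule: T_induct)
    case (single a' b' c')
    then show ?case
      using assms(2)[of a b a' b'] \<open>a \<in> carrier A\<close> \<open>b \<in> carrier B\<close> n
      by (simp add: tf_smult del: T.smult_smult T_single)
  qed (use single n in \<open>simp_all add: tf_zero tf_add T.r_distr\<close>)
qed (use y n in \<open>simp_all add: tf_zero tf_add T.l_distr\<close>)

text \<open>The elements invisible to all products of positive functionals, even after
  multiplication from both sides. The multiplications are built in because the lengths of vectors
  \<open>n \<otimes> y\<close> and the functionals of \<open>nrm_tensor_left\<close> involve
  them.\<close>

definition tensor_null :: "('a \<times> 'b \<Rightarrow>\<^sub>0 complex) \<Rightarrow> bool" where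
  "tensor_null n \<longleftrightarrow> n \<in> carrier T \<and> (\<forall>\<phi> \<psi>. pos_functional A \<phi> \<longrightarrow> pos_functional B \<psi> \<longrightarrow>
     (\<forall>z\<in>carrier T. \<forall>y\<in>carrier T. tf \<phi> \<psi> (z \<otimes>\<^bsub>T\<^esub> n \<otimes>\<^bsub>T\<^esub> y) = 0))"

lemma tensor_nullI:
  assumes "x \<in> carrier T" "y \<in> carrier T"
    and "\<And>\<phi> \<psi> a b a' b'. pos_functional A \<phi> \<Longrightarrow> pos_functional B \<psi> \<Longrightarrow> a \<in> carrier A \<Longrightarrow> b \<in> carrier B
      \<Longrightarrow> a' \<in> carrier A \<Longrightarrow> b' \<in> carrier B
      \<Longrightarrow> tf \<phi> \<psi> (e (a, b) \<otimes>\<^bsub>T\<^esub> x \<otimes>\<^bsub>T\<^esub> e (a', b')) = tf \<phi> \<psi> (e (a, b) \<otimes>\<^bsub>T\<^esub> y \<otimes>\<^bsub>T\<^esub> e (a', b'))"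
  shows "tensor_null (x \<ominus>\<^bsub>T\<^esub> y)"
  unfolding tensor_null_def
proof (intro conjI allI impI ballI)
  fix \<phi> \<psi> z w assume p: "pos_functional A \<phi>" "pos_functional B \<psi>" and zw: "z \<in> carrier T" "w \<in> carrier T"
  show "tf \<phi> \<psi> (z \<otimes>\<^bsub>T\<^esub> (x \<ominus>\<^bsub>T\<^esub> y) \<otimes>\<^bsub>T\<^esub> w) = 0"
  proof (rule tf_vanish[OF _ _ zw])
    fix a b a' b' assume "a \<in> carrier A" "b \<in> carrier B" "a' \<in> carrier A" "b' \<in> carrier B"
    then show "tf \<phi> \<psi> (e (a, b) \<otimes>\<^bsub>T\<^esub> (x \<ominus>\<^bsub>T\<^esub> y) \<otimes>\<^bsub>T\<^esub> e (a', b')) = 0"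
      using assms p by (simp add: T.minus_mult_left T.minus_mult_right tf_minus)
  qed (use assms in auto)
qed (use assms in auto)

text \<open>Formal combinations of pairs are not bilinear in the pair; these differences are the
  relations that define the algebraic tensor product.\<close>

lemma tensor_null_bilinear:
  assumes "a \<in> carrier A" "a' \<in> carrier A" "b \<in> carrier B" "b' \<in> carrier B"
  shows "tensor_null (e (a \<oplus>\<^bsub>A\<^esub> a', b) \<ominus>\<^bsub>T\<^esub> (e (a, b) \<oplus>\<^bsub>T\<^esub> e (a', b)))"
    and "tensor_null (e (a, b \<oplus>\<^bsub>B\<^esub> b') \<ominus>\<^bsub>T\<^esub> (e (a, b) \<oplus>\<^bsub>T\<^esub> e (a, b')))"
    and "tensor_null (e (c \<odot>\<^bsub>A\<^esub> a, b) \<ominus>\<^bsub>T\<^esub> c \<odot>\<^bsub>T\<^esub> e (a, b))"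
    and "tensor_null (e (a, c \<odot>\<^bsub>B\<^esub> b) \<ominus>\<^bsub>T\<^esub> c \<odot>\<^bsub>T\<^esub> e (a, b))"
  using assms
  by (intro tensor_nullI; simp add: T_single tf_single tf_add T.l_distr T.r_distr A.l_distr A.r_distr
      B.l_distr B.r_distr pos_functional_def distrib_left distrib_right mult_ac; fail)+

text \<open>The coefficients are grouped with \<open>\<phi>\<close> so that each summand is an entry
  of one kernel times an entry of another, the shape that \<open>schur_product\<close>
  requires.\<close>

lemma tf_sesquilinear:
  assumes "x \<in> carrier T" "y \<in> carrier T"
  shows "tf \<phi> \<psi> (invol T x \<otimes>\<^bsub>T\<^esub> y) = (\<Sum>u\<in>Poly_Mapping.keys x. \<Sum>v\<in>Poly_Mapping.keys y.
    (cnj (Poly_Mapping.lookup x u) * Poly_Mapping.lookup y v * \<phi> (invol A (fst u) \<otimes>\<^bsub>A\<^esub> fst v))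
      * \<psi> (invol B (snd u) \<otimes>\<^bsub>B\<^esub> snd v))"
proof -
  define g where "g u v = \<phi> (invol A (fst u) \<otimes>\<^bsub>A\<^esub> fst v) * \<psi> (invol B (snd u) \<otimes>\<^bsub>B\<^esub> snd v)" for u v
  define L where "L x y = (\<Sum>u\<in>Poly_Mapping.keys x. \<Sum>v\<in>Poly_Mapping.keys y.
    cnj (Poly_Mapping.lookup x u) * Poly_Mapping.lookup y v * g u v)" for x y
  have L1: "L (x + x') y = L x y + L x' y" for x x' y
    unfolding L_def
    by (rule sum_keys_add[where f = "\<lambda>u c. \<Sum>v\<in>Poly_Mapping.keys y. cnj c * Poly_Mapping.lookup y v * g u v"])
       (simp_all add: distrib_right sum.distrib)
  have L2: "L x (y + y') = L x y + L x y'" for x y y'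
    unfolding L_def sum.distrib[symmetric]
    by (intro sum.cong refl sum_keys_add[where f = "\<lambda>v c. cnj (Poly_Mapping.lookup x _) * c * g _ v"])
       (simp_all add: distrib_left distrib_right)
  have L3: "L (Poly_Mapping.single u c) (Poly_Mapping.single v d) = cnj c * d * g u v" for u v c d
    by (simp add: L_def)
  have L0: "L 0 y = 0" "L x 0 = 0" for x y by (simp_all add: L_def)
  have "tf \<phi> \<psi> (invol T x \<otimes>\<^bsub>T\<^esub> y) = L x y"
    using assms(1)
  proof (induction x rule: T_induct)
    case (single a b c)
    from assms(2) show ?case
    proof (induction y rule: T_induct)
      case (single a' b' c')
      then show ?case by (simp add: T_single tf_single L3 g_def)
    qed (use single in \<open>simp_all add: T.r_distr tf_add L0 tf_zero T_zero[symmetric] L2 T_add[symmetric] L2[folded T_add] L0[folded T_zero]\<close>)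
  qed (use assms(2) in \<open>simp_all add: T.l_distr tf_add tf_zero L1[folded T_add] L0[folded T_zero]\<close>)
  then show ?thesis by (simp add: L_def g_def mult.assoc)
qed

text \<open>Both factors in \<open>tf_sesquilinear\<close> are Gram kernels, the first one rescaled
  by the coefficients of \<open>x\<close>; Schur's theorem makes the sum of their products
  nonnegative.\<close>

lemma pos_functional_tf:
  assumes \<phi>: "pos_functional A \<phi>" and \<psi>: "pos_functional B \<psi>"
  shows "pos_functional T (tf \<phi> \<psi>)"
  unfolding pos_functional_def
proof (intro conjI ballI allI)
  interpret f: star_functional A \<phi> by unfold_locales (rule \<phi>)
  interpret g: star_functional B \<psi> by unfold_locales (rule \<psi>)
  fix x assume x: "x \<in> carrier T"
  then have k: "fst u \<in> carrier A" "snd u \<in> carrier B" if "u \<in> Poly_Mapping.keys x" for u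
    using that by (auto simp: T_eq M.CM_simps)
  show "tf \<phi> \<psi> (invol T x \<otimes>\<^bsub>T\<^esub> x) \<in> \<real>\<^sub>\<ge>\<^sub>0"
    unfolding tf_sesquilinear[OF x x]
    by (intro schur_product psd_scale[where d = "Poly_Mapping.lookup x"] f.psd_gram g.psd_gram k) auto
qed (simp_all add: tf_add tf_smult)

lemma star_functional_tf:
  "pos_functional A \<phi> \<Longrightarrow> pos_functional B \<psi> \<Longrightarrow> star_functional T (tf \<phi> \<psi>)"
  by unfold_locales (rule pos_functional_tf)

lemma tensor_null_tf:
  assumes "tensor_null (x \<ominus>\<^bsub>T\<^esub> y)" "pos_functional A \<phi>" "pos_functional B \<psi>"
    "x \<in> carrier T" "y \<in> carrier T" "z \<in> carrier T" "w \<in> carrier T"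
  shows "tf \<phi> \<psi> (z \<otimes>\<^bsub>T\<^esub> x \<otimes>\<^bsub>T\<^esub> w) = tf \<phi> \<psi> (z \<otimes>\<^bsub>T\<^esub> y \<otimes>\<^bsub>T\<^esub> w)"
  using assms unfolding tensor_null_def
  by (simp add: T.minus_mult_left T.minus_mult_right tf_minus)

text \<open>\<open>\<theta> s\<close> is the diagonal matrix coefficient at the vector
  \<open>y\<close> of the operator given by \<open>s\<close> in the first leg. It is a positive
  functional on \<open>A\<close> whose mass is the squared length of \<open>y\<close>, so
  \<open>pos_functional_bound\<close> applies. Its linearity relies on \<open>tensor_null\<close>
  elements not contributing.\<close>

lemma nrm_tensor_left:
  assumes \<phi>: "pos_functional A \<phi>" and \<psi>: "pos_functional B \<psi>" and a: "a \<in> carrier A" and y: "y \<in> carrier T"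
  shows "star_functional.nrm T (tf \<phi> \<psi>) (e (a, \<one>\<^bsub>B\<^esub>) \<otimes>\<^bsub>T\<^esub> y) \<le> cnorm A a * star_functional.nrm T (tf \<phi> \<psi>) y"
proof -
  interpret f: star_functional T "tf \<phi> \<psi>" by (rule star_functional_tf[OF \<phi> \<psi>])
  define \<theta> where "\<theta> s = tf \<phi> \<psi> (invol T y \<otimes>\<^bsub>T\<^esub> e (s, \<one>\<^bsub>B\<^esub>) \<otimes>\<^bsub>T\<^esub> y)" for s
  have sq: "\<theta> (invol A s \<otimes>\<^bsub>A\<^esub> s) = tf \<phi> \<psi> (invol T (e (s, \<one>\<^bsub>B\<^esub>) \<otimes>\<^bsub>T\<^esub> y) \<otimes>\<^bsub>T\<^esub> (e (s, \<one>\<^bsub>B\<^esub>) \<otimes>\<^bsub>T\<^esub> y))"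
    if s: "s \<in> carrier A" for s
  proof -
    have "e (invol A s \<otimes>\<^bsub>A\<^esub> s, \<one>\<^bsub>B\<^esub>) = invol T (e (s, \<one>\<^bsub>B\<^esub>)) \<otimes>\<^bsub>T\<^esub> e (s, \<one>\<^bsub>B\<^esub>)"
      using s by (simp add: T_single)
    then show ?thesis using s y by (simp add: \<theta>_def T.m_assoc)
  qed
  have "pos_functional A \<theta>"
    unfolding pos_functional_def
  proof (intro conjI ballI allI)
    fix s t c assume s: "s \<in> carrier A"
    show "\<theta> (c \<odot>\<^bsub>A\<^esub> s) = c * \<theta> s"
      unfolding \<theta>_def using s y
      by (subst tensor_null_tf[OF tensor_null_bilinear(3) \<phi> \<psi>]) (auto simp: tf_smult)
    show "\<theta> (invol A s \<otimes>\<^bsub>A\<^esub> s) \<in> \<real>\<^sub>\<ge>\<^sub>0" unfolding sq[OF s] using s y by (intro f.\<omega>_pos) auto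
    assume t: "t \<in> carrier A"
    show "\<theta> (s \<oplus>\<^bsub>A\<^esub> t) = \<theta> s + \<theta> t"
      unfolding \<theta>_def using s t y
      by (subst tensor_null_tf[OF tensor_null_bilinear(1) \<phi> \<psi>]) (auto simp: tf_add T.l_distr T.r_distr)
  qed
  then have "Re (\<theta> (invol A a \<otimes>\<^bsub>A\<^esub> a)) \<le> (cnorm A a)\<^sup>2 * Re (\<theta> \<one>\<^bsub>A\<^esub>)"
    by (rule A.pos_functional_bound[OF _ a])
  moreover have "\<theta> \<one>\<^bsub>A\<^esub> = tf \<phi> \<psi> (invol T y \<otimes>\<^bsub>T\<^esub> y)"
    using y by (simp add: \<theta>_def T_single(4)[symmetric])
  ultimately have "(f.nrm (e (a, \<one>\<^bsub>B\<^esub>) \<otimes>\<^bsub>T\<^esub> y))\<^sup>2 \<le> (cnorm A a * f.nrm y)\<^sup>2"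
    using a y by (simp add: f.nrm_square sq power_mult_distrib)
  then show ?thesis by (rule power2_le_imp_le) (use a y in simp)
qed

lemma nrm_tensor_right:
  assumes \<phi>: "pos_functional A \<phi>" and \<psi>: "pos_functional B \<psi>" and b: "b \<in> carrier B" and y: "y \<in> carrier T"
  shows "star_functional.nrm T (tf \<phi> \<psi>) (e (\<one>\<^bsub>A\<^esub>, b) \<otimes>\<^bsub>T\<^esub> y) \<le> cnorm B b * star_functional.nrm T (tf \<phi> \<psi>) y"
proof -
  interpret f: star_functional T "tf \<phi> \<psi>" by (rule star_functional_tf[OF \<phi> \<psi>])
  define \<theta> where "\<theta> s = tf \<phi> \<psi> (invol T y \<otimes>\<^bsub>T\<^esub> e (\<one>\<^bsub>A\<^esub>, s) \<otimes>\<^bsub>T\<^esub> y)" for s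
  have sq: "\<theta> (invol B s \<otimes>\<^bsub>B\<^esub> s) = tf \<phi> \<psi> (invol T (e (\<one>\<^bsub>A\<^esub>, s) \<otimes>\<^bsub>T\<^esub> y) \<otimes>\<^bsub>T\<^esub> (e (\<one>\<^bsub>A\<^esub>, s) \<otimes>\<^bsub>T\<^esub> y))"
    if s: "s \<in> carrier B" for s
  proof -
    have "e (\<one>\<^bsub>A\<^esub>, invol B s \<otimes>\<^bsub>B\<^esub> s) = invol T (e (\<one>\<^bsub>A\<^esub>, s)) \<otimes>\<^bsub>T\<^esub> e (\<one>\<^bsub>A\<^esub>, s)"
      using s by (simp add: T_single)
    then show ?thesis using s y by (simp add: \<theta>_def T.m_assoc)
  qed
  have "pos_functional B \<theta>"
    unfolding pos_functional_def
  proof (intro conjI ballI allI)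
    fix s t c assume s: "s \<in> carrier B"
    show "\<theta> (c \<odot>\<^bsub>B\<^esub> s) = c * \<theta> s"
      unfolding \<theta>_def using s y
      by (subst tensor_null_tf[OF tensor_null_bilinear(4) \<phi> \<psi>]) (auto simp: tf_smult)
    show "\<theta> (invol B s \<otimes>\<^bsub>B\<^esub> s) \<in> \<real>\<^sub>\<ge>\<^sub>0" unfolding sq[OF s] using s y by (intro f.\<omega>_pos) auto
    assume t: "t \<in> carrier B"
    show "\<theta> (s \<oplus>\<^bsub>B\<^esub> t) = \<theta> s + \<theta> t"
      unfolding \<theta>_def using s t y
      by (subst tensor_null_tf[OF tensor_null_bilinear(2) \<phi> \<psi>]) (auto simp: tf_add T.l_distr T.r_distr)
  qed
  then have "Re (\<theta> (invol B b \<otimes>\<^bsub>B\<^esub> b)) \<le> (cnorm B b)\<^sup>2 * Re (\<theta> \<one>\<^bsub>B\<^esub>)"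
    by (rule B.pos_functional_bound[OF _ b])
  moreover have "\<theta> \<one>\<^bsub>B\<^esub> = tf \<phi> \<psi> (invol T y \<otimes>\<^bsub>T\<^esub> y)"
    using y by (simp add: \<theta>_def T_single(4)[symmetric])
  ultimately have "(f.nrm (e (\<one>\<^bsub>A\<^esub>, b) \<otimes>\<^bsub>T\<^esub> y))\<^sup>2 \<le> (cnorm B b * f.nrm y)\<^sup>2"
    using b y by (simp add: f.nrm_square sq power_mult_distrib)
  then show ?thesis by (rule power2_le_imp_le) (use b y in simp)
qed

definition product_states :: "(('a \<times> 'b \<Rightarrow>\<^sub>0 complex) \<Rightarrow> complex) set" where
  "product_states = {tf \<phi> \<psi> | \<phi> \<psi>. state A \<phi> \<and> state B \<psi>}"

lemma min_seminorm_eq: "min_seminorm A B = gns_seminorm T product_states"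
  unfolding min_seminorm_def gns_seminorm_def Let_def product_states_def
  by (intro ext arg_cong[where f = Sup] arg_cong[where f = "insert 0"] Collect_cong) blast

text \<open>Boundedness follows by factoring an elementary tensor into one with unit second leg and
  one with unit first leg, each bounded by a norm.\<close>

sublocale G: gns_family T product_states
proof unfold_locales
  show "pos_functional T \<omega>" if "\<omega> \<in> product_states" for \<omega>
    using that by (auto simp: product_states_def state_iff intro: pos_functional_tf)
  fix x assume "x \<in> carrier T"
  then show "\<exists>K. \<forall>\<omega>\<in>product_states. \<forall>y\<in>carrier T.
      star_functional.nrm T \<omega> (x \<otimes>\<^bsub>T\<^esub> y) \<le> K * star_functional.nrm T \<omega> y"
  proof (induction x rule: T_induct)
    case zero
    have "star_functional.nrm T \<omega> (\<zero>\<^bsub>T\<^esub> \<otimes>\<^bsub>T\<^esub> y) \<le> 0 * star_functional.nrm T \<omega> y"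
      if "\<omega> \<in> product_states" "y \<in> carrier T" for \<omega> y
    proof -
      interpret f: star_functional T \<omega>
        using that(1) by (auto simp: product_states_def state_iff intro: star_functional_tf)
      show ?thesis using that(2) by (simp add: f.nrm_def)
    qed
    then show ?case by blast
  next
    case (single a b c)
    have "star_functional.nrm T \<omega> ((c \<odot>\<^bsub>T\<^esub> e (a, b)) \<otimes>\<^bsub>T\<^esub> y)
        \<le> (cmod c * (cnorm A a * cnorm B b)) * star_functional.nrm T \<omega> y"
      if \<omega>: "\<omega> \<in> product_states" and y: "y \<in> carrier T" for \<omega> y
    proof -
      obtain \<phi> \<psi> where s: "pos_functional A \<phi>" "pos_functional B \<psi>" and w: "\<omega> = tf \<phi> \<psi>"
        using \<omega> by (auto simp: product_states_def state_iff)
      interpret f: star_functional T \<omega> unfolding w by (rule star_functional_tf[OF s])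
      have "e (a, b) = e (a, \<one>\<^bsub>B\<^esub>) \<otimes>\<^bsub>T\<^esub> e (\<one>\<^bsub>A\<^esub>, b)" using single by (simp add: T_single)
      then have eq: "e (a, b) \<otimes>\<^bsub>T\<^esub> y = e (a, \<one>\<^bsub>B\<^esub>) \<otimes>\<^bsub>T\<^esub> (e (\<one>\<^bsub>A\<^esub>, b) \<otimes>\<^bsub>T\<^esub> y)"
        using single y by (simp add: T.m_assoc)
      have "f.nrm (e (a, b) \<otimes>\<^bsub>T\<^esub> y) \<le> cnorm A a * f.nrm (e (\<one>\<^bsub>A\<^esub>, b) \<otimes>\<^bsub>T\<^esub> y)"
        unfolding eq w using single y by (intro nrm_tensor_left[OF s]) auto
      also have "\<dots> \<le> cnorm A a * (cnorm B b * f.nrm y)"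
        unfolding w using single y by (intro mult_left_mono nrm_tensor_right[OF s]) auto
      finally have "cmod c * f.nrm (e (a, b) \<otimes>\<^bsub>T\<^esub> y) \<le> cmod c * (cnorm A a * (cnorm B b * f.nrm y))"
        by (rule mult_left_mono) simp
      moreover have "f.nrm ((c \<odot>\<^bsub>T\<^esub> e (a, b)) \<otimes>\<^bsub>T\<^esub> y) = cmod c * f.nrm (e (a, b) \<otimes>\<^bsub>T\<^esub> y)"
        using single y f.nrm_smult[of "e (a, b) \<otimes>\<^bsub>T\<^esub> y" c] by simp
      ultimately show ?thesis by (simp add: mult.assoc)
    qed
    then show ?case by blast
  next
    case (add x x')
    then obtain K L where K: "\<And>\<omega> y. \<omega> \<in> product_states \<Longrightarrow> y \<in> carrier T
        \<Longrightarrow> star_functional.nrm T \<omega> (x \<otimes>\<^bsub>T\<^esub> y) \<le> K * star_functional.nrm T \<omega> y"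
      and L: "\<And>\<omega> y. \<omega> \<in> product_states \<Longrightarrow> y \<in> carrier T
        \<Longrightarrow> star_functional.nrm T \<omega> (x' \<otimes>\<^bsub>T\<^esub> y) \<le> L * star_functional.nrm T \<omega> y" by blast
    have "star_functional.nrm T \<omega> ((x \<oplus>\<^bsub>T\<^esub> x') \<otimes>\<^bsub>T\<^esub> y) \<le> (K + L) * star_functional.nrm T \<omega> y"
      if \<omega>: "\<omega> \<in> product_states" and y: "y \<in> carrier T" for \<omega> y
    proof -
      interpret f: star_functional T \<omega>
        using \<omega> by (auto simp: product_states_def state_iff intro: star_functional_tf)
      show ?thesis
        using f.nrm_add_le[of "x \<otimes>\<^bsub>T\<^esub> y" "x' \<otimes>\<^bsub>T\<^esub> y"] K[OF \<omega> y] L[OF \<omega> y] add y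
        by (simp add: T.l_distr distrib_right)
    qed
    then show ?case by blast
  qed
qed

sublocale min: cstar_seminormed T "min_seminorm A B"
  unfolding min_seminorm_eq by unfold_locales (rule G.cstar_seminorm_gns)

abbreviation "TT \<equiv> min_tensor A B"
abbreviation "E \<equiv> elem_tensor A B"

lemma cstar_TT: "cstar TT"
  unfolding min_tensor_def by (rule min.cstar_H)

lemma star_hom_to_TT: "star_hom T TT min.to_H"
  unfolding min_tensor_def by (rule min.star_hom_to_H)

lemma min_seminorm_null:
  assumes "tensor_null n"
  shows "min_seminorm A B n = 0"
proof (rule antisym)
  have n: "n \<in> carrier T" using assms by (simp add: tensor_null_def)
  show "0 \<le> min_seminorm A B n" using n by simp
  show "min_seminorm A B n \<le> 0"
    unfolding min_seminorm_eq
  proof (rule G.p_le)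
    fix \<omega> y assume \<omega>: "\<omega> \<in> product_states" and y: "y \<in> carrier T"
    obtain \<phi> \<psi> where s: "pos_functional A \<phi>" "pos_functional B \<psi>" and w: "\<omega> = tf \<phi> \<psi>"
      using \<omega> by (auto simp: product_states_def state_iff)
    interpret f: star_functional T \<omega> unfolding w by (rule star_functional_tf[OF s])
    have "tf \<phi> \<psi> (invol T (n \<otimes>\<^bsub>T\<^esub> y) \<otimes>\<^bsub>T\<^esub> n \<otimes>\<^bsub>T\<^esub> y) = 0"
      using assms s n y unfolding tensor_null_def by blast
    then have "\<omega> (invol T (n \<otimes>\<^bsub>T\<^esub> y) \<otimes>\<^bsub>T\<^esub> (n \<otimes>\<^bsub>T\<^esub> y)) = 0"
      using n y by (simp add: w T.m_assoc)
    then have "f.nrm (n \<otimes>\<^bsub>T\<^esub> y) = 0" unfolding f.nrm_def by simp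
    then show "G.N \<omega> (n \<otimes>\<^bsub>T\<^esub> y) \<le> 0 * G.N \<omega> y" by simp
  qed simp
qed

lemma E_eq: "E a b = min.to_H (e (a, b))"
  by (simp add: elem_tensor_def)

lemma E_closed [simp]: "a \<in> carrier A \<Longrightarrow> b \<in> carrier B \<Longrightarrow> E a b \<in> carrier TT"
  unfolding E_eq by (rule star_hom_closed[OF star_hom_to_TT]) simp

lemma E_mult: "a \<in> carrier A \<Longrightarrow> b \<in> carrier B \<Longrightarrow> a' \<in> carrier A \<Longrightarrow> b' \<in> carrier B
    \<Longrightarrow> E a b \<otimes>\<^bsub>TT\<^esub> E a' b' = E (a \<otimes>\<^bsub>A\<^esub> a') (b \<otimes>\<^bsub>B\<^esub> b')"
  unfolding E_eq by (simp add: star_hom_mult[OF star_hom_to_TT, symmetric] T_single)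

lemma E_invol: "a \<in> carrier A \<Longrightarrow> b \<in> carrier B \<Longrightarrow> invol TT (E a b) = E (invol A a) (invol B b)"
  unfolding E_eq by (simp add: star_hom_invol[OF star_hom_to_TT, symmetric] T_single)

lemma E_one: "E \<one>\<^bsub>A\<^esub> \<one>\<^bsub>B\<^esub> = \<one>\<^bsub>TT\<^esub>"
  unfolding E_eq by (simp add: star_hom_one[OF star_hom_to_TT, symmetric] T_single)

lemma to_H_null: "x \<in> carrier T \<Longrightarrow> y \<in> carrier T \<Longrightarrow> tensor_null (x \<ominus>\<^bsub>T\<^esub> y) \<Longrightarrow> min.to_H x = min.to_H y"
  by (simp add: min.to_H_eq_iff min_seminorm_null)

lemma E_bilinear:
  assumes "a \<in> carrier A" "a' \<in> carrier A" "b \<in> carrier B" "b' \<in> carrier B"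
  shows "E (a \<oplus>\<^bsub>A\<^esub> a') b = E a b \<oplus>\<^bsub>TT\<^esub> E a' b"
    and "E a (b \<oplus>\<^bsub>B\<^esub> b') = E a b \<oplus>\<^bsub>TT\<^esub> E a b'"
    and "E (c \<odot>\<^bsub>A\<^esub> a) b = c \<odot>\<^bsub>TT\<^esub> E a b"
    and "E a (c \<odot>\<^bsub>B\<^esub> b) = c \<odot>\<^bsub>TT\<^esub> E a b"
  unfolding E_eq
  using assms
  by (simp_all add: star_hom_add[OF star_hom_to_TT, symmetric] star_hom_smult[OF star_hom_to_TT, symmetric]
      to_H_null[OF _ _ tensor_null_bilinear(1)] to_H_null[OF _ _ tensor_null_bilinear(2)]
      to_H_null[OF _ _ tensor_null_bilinear(3)] to_H_null[OF _ _ tensor_null_bilinear(4)])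

sublocale TT: cstar TT by (rule cstar_TT)

lemma E_zero: "b \<in> carrier B \<Longrightarrow> E \<zero>\<^bsub>A\<^esub> b = \<zero>\<^bsub>TT\<^esub>" "a \<in> carrier A \<Longrightarrow> E a \<zero>\<^bsub>B\<^esub> = \<zero>\<^bsub>TT\<^esub>"
  using E_bilinear(3)[of "\<zero>\<^bsub>A\<^esub>" "\<zero>\<^bsub>A\<^esub>" b b 0] E_bilinear(4)[of a a "\<zero>\<^bsub>B\<^esub>" "\<zero>\<^bsub>B\<^esub>" 0] by simp_all

lemma E_finsum_left:
  "f \<in> I \<rightarrow> carrier A \<Longrightarrow> finite I \<Longrightarrow> b \<in> carrier B \<Longrightarrow> E (\<Oplus>\<^bsub>A\<^esub>i\<in>I. f i) b = (\<Oplus>\<^bsub>TT\<^esub>i\<in>I. E (f i) b)"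
  by (induction I rule: infinite_finite_induct) (auto simp: E_zero E_bilinear(1)[of _ _ b b] Pi_iff)

lemma E_finsum_right:
  "f \<in> I \<rightarrow> carrier B \<Longrightarrow> finite I \<Longrightarrow> a \<in> carrier A \<Longrightarrow> E a (\<Oplus>\<^bsub>B\<^esub>i\<in>I. f i) = (\<Oplus>\<^bsub>TT\<^esub>i\<in>I. E a (f i))"
  by (induction I rule: infinite_finite_induct) (auto simp: E_zero E_bilinear(2)[of a a] Pi_iff)

lemma tensor_hom_unique:
  assumes C: "cstar C" and g: "star_hom TT C g" and h: "star_hom TT C h"
    and eq: "\<And>a b. a \<in> carrier A \<Longrightarrow> b \<in> carrier B \<Longrightarrow> g (E a b) = h (E a b)" and X: "X \<in> carrier TT"
  shows "g X = h X"
proof (rule min.completion_hom_unique[OF C])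
  interpret C: cstar C by fact
  note gh = star_hom_simps[OF star_hom_comp[OF star_hom_to_TT g]] star_hom_simps[OF star_hom_comp[OF star_hom_to_TT h]]
    star_hom_zero[OF star_hom_comp[OF star_hom_to_TT g] T.star_algebra_axioms C.star_algebra_axioms]
    star_hom_zero[OF star_hom_comp[OF star_hom_to_TT h] T.star_algebra_axioms C.star_algebra_axioms]
  show "star_hom min.H C g" "star_hom min.H C h" "X \<in> carrier min.H"
    using g h X by (simp_all add: min_tensor_def)
  fix x assume "x \<in> carrier T"
  then show "g (min.to_H x) = h (min.to_H x)"
    by (induction x rule: T_induct) (simp_all add: gh eq[unfolded E_eq])
qed

text \<open>The minimal seminorm only sees states, but functionals of any mass arise when states are
  pulled back. They are normalised here; if one of them has mass zero, Cauchy-Schwarz against the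
  unit makes it vanish.\<close>

lemma nrm_one_bound:
  assumes \<phi>: "pos_functional A \<phi>" and \<psi>: "pos_functional B \<psi>" and x: "x \<in> carrier T"
  shows "Re (tf \<phi> \<psi> (invol T x \<otimes>\<^bsub>T\<^esub> x))
    \<le> (min_seminorm A B x)\<^sup>2 * (Re (\<phi> \<one>\<^bsub>A\<^esub>) * Re (\<psi> \<one>\<^bsub>B\<^esub>))"
proof -
  interpret f: star_functional A \<phi> by unfold_locales (rule \<phi>)
  interpret g: star_functional B \<psi> by unfold_locales (rule \<psi>)
  have one: "\<phi> \<one>\<^bsub>A\<^esub> = complex_of_real (Re (\<phi> \<one>\<^bsub>A\<^esub>))" "0 \<le> Re (\<phi> \<one>\<^bsub>A\<^esub>)"
    "\<psi> \<one>\<^bsub>B\<^esub> = complex_of_real (Re (\<psi> \<one>\<^bsub>B\<^esub>))" "0 \<le> Re (\<psi> \<one>\<^bsub>B\<^esub>)"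
    using f.\<omega>_pos[of "\<one>\<^bsub>A\<^esub>"] g.\<omega>_pos[of "\<one>\<^bsub>B\<^esub>"] by (auto simp: complex_nonneg_Reals_iff complex_eq_iff)
  show ?thesis
  proof (cases "\<phi> \<one>\<^bsub>A\<^esub> = 0 \<or> \<psi> \<one>\<^bsub>B\<^esub> = 0")
    case True
    have z0: "\<phi> a * \<psi> b = 0" if "a \<in> carrier A" "b \<in> carrier B" for a b
      using f.cauchy_schwarz[of "\<one>\<^bsub>A\<^esub>" a] g.cauchy_schwarz[of "\<one>\<^bsub>B\<^esub>" b] that True
      by (auto simp: f.nrm_def[of "\<one>\<^bsub>A\<^esub>"] g.nrm_def[of "\<one>\<^bsub>B\<^esub>"])
    have "tf \<phi> \<psi> z = 0" if "z \<in> carrier T" for z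
      using that by (induction z rule: T_induct) (use z0 in \<open>auto simp: tf_zero tf_add tf_smult tf_single\<close>)
    then show ?thesis using x True by auto
  next
    case False
    define \<alpha> where "\<alpha> = Re (\<phi> \<one>\<^bsub>A\<^esub>)"
    define \<beta> where "\<beta> = Re (\<psi> \<one>\<^bsub>B\<^esub>)"
    have \<alpha>: "\<phi> \<one>\<^bsub>A\<^esub> = complex_of_real \<alpha>" "\<alpha> > 0" and \<beta>: "\<psi> \<one>\<^bsub>B\<^esub> = complex_of_real \<beta>" "\<beta> > 0"
      using one False by (auto simp: \<alpha>_def \<beta>_def order_le_less)
    define \<phi>' where "\<phi>' a = \<phi> a / complex_of_real \<alpha>" for a
    define \<psi>' where "\<psi>' b = \<psi> b / complex_of_real \<beta>" for b
    have s: "state A \<phi>'" "state B \<psi>'"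
      using \<alpha> \<beta> f.\<omega>_pos g.\<omega>_pos
      by (auto simp: state_iff pos_functional_def \<phi>'_def \<psi>'_def f.\<omega>_add g.\<omega>_add f.\<omega>_smult g.\<omega>_smult add_divide_distrib)
    have "tf \<phi>' \<psi>' \<in> product_states" using s by (auto simp: product_states_def)
    interpret h: star_functional T "tf \<phi>' \<psi>'" by (rule star_functional_tf) (use s in \<open>auto simp: state_iff\<close>)
    have "h.nrm (x \<otimes>\<^bsub>T\<^esub> \<one>\<^bsub>T\<^esub>) \<le> min_seminorm A B x * h.nrm \<one>\<^bsub>T\<^esub>"
      unfolding min_seminorm_eq by (rule G.p_bound) (use x \<open>tf \<phi>' \<psi>' \<in> product_states\<close> in auto)
    moreover have "h.nrm \<one>\<^bsub>T\<^esub> = 1"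
      using s by (simp add: h.nrm_def T_single tf_single state_iff)
    ultimately have "h.nrm x \<le> min_seminorm A B x" using x by simp
    then have "(h.nrm x)\<^sup>2 \<le> (min_seminorm A B x)\<^sup>2" using x by (intro power_mono) auto
    moreover have div: "tf \<phi>' \<psi>' z = tf \<phi> \<psi> z / complex_of_real (\<alpha> * \<beta>)" if "z \<in> carrier T" for z
      using that by (induction z rule: T_induct)
        (simp_all add: tf_zero tf_add tf_smult tf_single \<phi>'_def \<psi>'_def add_divide_distrib)
    have "tf \<phi>' \<psi>' (invol T x \<otimes>\<^bsub>T\<^esub> x) = tf \<phi> \<psi> (invol T x \<otimes>\<^bsub>T\<^esub> x) / complex_of_real (\<alpha> * \<beta>)"
      using x by (intro div) auto
    then have "(h.nrm x)\<^sup>2 = Re (tf \<phi> \<psi> (invol T x \<otimes>\<^bsub>T\<^esub> x)) / (\<alpha> * \<beta>)"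
      using x by (simp only: h.nrm_square Re_divide_of_real)
    ultimately show ?thesis using \<alpha> \<beta> by (simp add: field_simps flip: \<alpha>_def \<beta>_def)
  qed
qed

end

text \<open>Pulling functionals back along \<open>f\<close> and \<open>g\<close> controls
  \<open>h z\<close> only on elementary tensors, since a general vector does not give a product
  functional on \<open>A\<close> and \<open>B\<close>. The triangle inequality extends the estimate
  to any vector, at the price of a constant depending on the vector, and
  \<open>nrm_bound_improve\<close> removes that constant.\<close>

theorem tensor_map_hom:
  assumes A: "cstar A" and B: "cstar B" and C: "cstar C" and D: "cstar D"
    and f: "star_hom A C f" and g: "star_hom B D g"
  shows "star_hom (min_tensor A B) (min_tensor C D) (tensor_map A B C D f g)"
    and "a \<in> carrier A \<Longrightarrow> b \<in> carrier B
      \<Longrightarrow> tensor_map A B C D f g (elem_tensor A B a b) = elem_tensor C D (f a) (g b)"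
proof -
  interpret AB: tensor_product A B using A B by (rule tensor_product.intro)
  interpret CD: tensor_product C D using C D by (rule tensor_product.intro)
  note fs = star_hom_simps[OF f] and gs = star_hom_simps[OF g]
  define \<theta> where "\<theta> u = CD.e (f (fst u), g (snd u))" for u
  define h where "h = lin_ext CD.T \<theta>"
  have h: "star_hom AB.T CD.T h"
    unfolding h_def AB.T_eq
    by (rule CD.T.star_hom_lin_ext[OF AB.M.star_monoid_axioms])
       (auto simp: \<theta>_def fs gs CD.T_single)
  note hs = star_hom_simps[OF h]
  have h_single: "h (AB.e (a, b)) = CD.e (f a, g b)" if "a \<in> carrier A" "b \<in> carrier B" for a b
    using that by (simp add: h_def CD.T.lin_ext_single \<theta>_def fs gs)
  have simple: "Re (CD.tf \<phi> \<psi> (invol CD.T (h z \<otimes>\<^bsub>CD.T\<^esub> CD.e (c, d)) \<otimes>\<^bsub>CD.T\<^esub> (h z \<otimes>\<^bsub>CD.T\<^esub> CD.e (c, d))))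
      \<le> (min_seminorm A B z)\<^sup>2 * (Re (\<phi> (invol C c \<otimes>\<^bsub>C\<^esub> c)) * Re (\<psi> (invol D d \<otimes>\<^bsub>D\<^esub> d)))"
    if \<phi>: "pos_functional C \<phi>" and \<psi>: "pos_functional D \<psi>"
      and c: "c \<in> carrier C" and d: "d \<in> carrier D" and z: "z \<in> carrier AB.T" for \<phi> \<psi> c d z
  proof -
    \<comment> \<open>The vector functionals at \<open>c\<close> and \<open>d\<close>, pulled back
      along \<open>f\<close> and \<open>g\<close>. Their product is the pullback along
      \<open>h\<close> of the vector functional at the elementary tensor of \<open>c\<close> and
      \<open>d\<close>; their masses are the two factors on the right of
      \<open>simple\<close>.\<close>
    define \<phi>' where "\<phi>' a = \<phi> (invol C c \<otimes>\<^bsub>C\<^esub> f a \<otimes>\<^bsub>C\<^esub> c)" for a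
    define \<psi>' where "\<psi>' b = \<psi> (invol D d \<otimes>\<^bsub>D\<^esub> g b \<otimes>\<^bsub>D\<^esub> d)" for b
    have p1: "pos_functional A \<phi>'"
      unfolding pos_functional_def
    proof (intro conjI ballI allI)
      fix x assume x: "x \<in> carrier A"
      have "\<phi>' (invol A x \<otimes>\<^bsub>A\<^esub> x) = \<phi> (invol C (f x \<otimes>\<^bsub>C\<^esub> c) \<otimes>\<^bsub>C\<^esub> (f x \<otimes>\<^bsub>C\<^esub> c))"
        using x c by (simp add: \<phi>'_def fs CD.A.m_assoc)
      also have "\<dots> \<in> \<real>\<^sub>\<ge>\<^sub>0"
        by (rule \<phi>[unfolded pos_functional_def, THEN conjunct2, THEN conjunct2, THEN bspec]) (use x c in \<open>simp add: fs\<close>)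
      finally show "\<phi>' (invol A x \<otimes>\<^bsub>A\<^esub> x) \<in> \<real>\<^sub>\<ge>\<^sub>0" .
    qed (use \<phi> c in \<open>simp_all add: \<phi>'_def fs CD.A.l_distr CD.A.r_distr pos_functional_def\<close>)
    have p2: "pos_functional B \<psi>'"
      unfolding pos_functional_def
    proof (intro conjI ballI allI)
      fix x assume x: "x \<in> carrier B"
      have "\<psi>' (invol B x \<otimes>\<^bsub>B\<^esub> x) = \<psi> (invol D (g x \<otimes>\<^bsub>D\<^esub> d) \<otimes>\<^bsub>D\<^esub> (g x \<otimes>\<^bsub>D\<^esub> d))"
        using x d by (simp add: \<psi>'_def gs CD.B.m_assoc)
      also have "\<dots> \<in> \<real>\<^sub>\<ge>\<^sub>0"
        by (rule \<psi>[unfolded pos_functional_def, THEN conjunct2, THEN conjunct2, THEN bspec]) (use x d in \<open>simp add: gs\<close>)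
      finally show "\<psi>' (invol B x \<otimes>\<^bsub>B\<^esub> x) \<in> \<real>\<^sub>\<ge>\<^sub>0" .
    qed (use \<psi> d in \<open>simp_all add: \<psi>'_def gs CD.B.l_distr CD.B.r_distr pos_functional_def\<close>)
    have "AB.tf \<phi>' \<psi>' w = CD.tf \<phi> \<psi> (invol CD.T (CD.e (c, d)) \<otimes>\<^bsub>CD.T\<^esub> h w \<otimes>\<^bsub>CD.T\<^esub> CD.e (c, d))"
      if "w \<in> carrier AB.T" for w
      using that
    proof (induction w rule: AB.T_induct)
      case zero
      then show ?case
        using c d star_hom_zero[OF h AB.T.star_algebra_axioms CD.T.star_algebra_axioms]
        by (simp add: AB.tf_zero CD.tf_zero)
    next
      case (single a b k)
      then show ?case
        using c d
        by (simp add: AB.tf_smult AB.tf_single hs h_single fs gs CD.tf_smult del: CD.T_single(2))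
           (simp add: CD.T_single CD.tf_single \<phi>'_def \<psi>'_def)
    next
      case (add x y)
      then show ?case
        using c d by (simp add: AB.tf_add hs CD.tf_add CD.T.l_distr CD.T.r_distr)
    qed
    from this[of "invol AB.T z \<otimes>\<^bsub>AB.T\<^esub> z"]
    have "CD.tf \<phi> \<psi> (invol CD.T (h z \<otimes>\<^bsub>CD.T\<^esub> CD.e (c, d)) \<otimes>\<^bsub>CD.T\<^esub> (h z \<otimes>\<^bsub>CD.T\<^esub> CD.e (c, d)))
        = AB.tf \<phi>' \<psi>' (invol AB.T z \<otimes>\<^bsub>AB.T\<^esub> z)"
      using z c d by (simp add: hs CD.T.m_assoc)
    then show ?thesis
      using AB.nrm_one_bound[OF p1 p2 z] c d by (simp add: \<phi>'_def \<psi>'_def fs gs)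
  qed
  have bound: "\<exists>K. \<forall>z\<in>carrier AB.T. star_functional.nrm CD.T (CD.tf \<phi> \<psi>) (h z \<otimes>\<^bsub>CD.T\<^esub> y) \<le> K * min_seminorm A B z"
    if \<phi>: "pos_functional C \<phi>" and \<psi>: "pos_functional D \<psi>" and y: "y \<in> carrier CD.T" for \<phi> \<psi> y
  proof -
    interpret s: star_functional CD.T "CD.tf \<phi> \<psi>" by (rule CD.star_functional_tf[OF \<phi> \<psi>])
    show ?thesis
      using y
    proof (induction y rule: CD.T_induct)
      case zero
      show ?case by (intro exI[of _ 0]) (simp add: hs s.nrm_def)
    next
      case (single c d k)
      define K where "K = Re (\<phi> (invol C c \<otimes>\<^bsub>C\<^esub> c)) * Re (\<psi> (invol D d \<otimes>\<^bsub>D\<^esub> d))"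
      have K: "K \<ge> 0"
        using \<phi> \<psi> single by (auto simp: K_def pos_functional_def complex_nonneg_Reals_iff intro!: mult_nonneg_nonneg)
      have "s.nrm (h z \<otimes>\<^bsub>CD.T\<^esub> (k \<odot>\<^bsub>CD.T\<^esub> CD.e (c, d))) \<le> (cmod k * sqrt K) * min_seminorm A B z"
        if z: "z \<in> carrier AB.T" for z
      proof -
        have "s.nrm (h z \<otimes>\<^bsub>CD.T\<^esub> CD.e (c, d)) \<le> sqrt ((min_seminorm A B z)\<^sup>2 * K)"
          unfolding s.nrm_def K_def by (rule real_sqrt_le_mono[OF simple[OF \<phi> \<psi> single z]])
        also have "\<dots> = min_seminorm A B z * sqrt K"
          using AB.min.p_nonneg[OF z] by (simp add: real_sqrt_mult)
        finally have "cmod k * s.nrm (h z \<otimes>\<^bsub>CD.T\<^esub> CD.e (c, d)) \<le> cmod k * (min_seminorm A B z * sqrt K)"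
          by (rule mult_left_mono) simp
        then show ?thesis
          using single z s.nrm_smult[of "h z \<otimes>\<^bsub>CD.T\<^esub> CD.e (c, d)" k] by (simp add: hs mult_ac)
      qed
      then show ?case by blast
    next
      case (add y y')
      then obtain K L where K: "\<And>z. z \<in> carrier AB.T \<Longrightarrow> s.nrm (h z \<otimes>\<^bsub>CD.T\<^esub> y) \<le> K * min_seminorm A B z"
        and L: "\<And>z. z \<in> carrier AB.T \<Longrightarrow> s.nrm (h z \<otimes>\<^bsub>CD.T\<^esub> y') \<le> L * min_seminorm A B z" by blast
      have "s.nrm (h z \<otimes>\<^bsub>CD.T\<^esub> (y \<oplus>\<^bsub>CD.T\<^esub> y')) \<le> (K + L) * min_seminorm A B z" if z: "z \<in> carrier AB.T" for z
        using s.nrm_add_le[of "h z \<otimes>\<^bsub>CD.T\<^esub> y" "h z \<otimes>\<^bsub>CD.T\<^esub> y'"] K[OF z] L[OF z] add z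
        by (simp add: hs CD.T.r_distr distrib_right)
      then show ?case by blast
    qed
  qed
  have le: "min_seminorm C D (h x) \<le> min_seminorm A B x" if x: "x \<in> carrier AB.T" for x
    unfolding CD.min_seminorm_eq
  proof (rule CD.G.p_le)
    show "0 \<le> min_seminorm A B x" using x by simp
    fix \<omega> y assume \<omega>: "\<omega> \<in> CD.product_states" and y: "y \<in> carrier CD.T"
    obtain \<phi> \<psi> where s: "pos_functional C \<phi>" "pos_functional D \<psi>" and w: "\<omega> = CD.tf \<phi> \<psi>"
      using \<omega> by (auto simp: CD.product_states_def state_iff)
    obtain K where K: "\<And>z. z \<in> carrier AB.T \<Longrightarrow> CD.G.N \<omega> (h z \<otimes>\<^bsub>CD.T\<^esub> y) \<le> K * min_seminorm A B z"
      using bound[OF s y] unfolding w by blast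
    show "CD.G.N \<omega> (h x \<otimes>\<^bsub>CD.T\<^esub> y) \<le> min_seminorm A B x * CD.G.N \<omega> y"
      by (rule star_functional.nrm_bound_improve[OF _ AB.min.cstar_seminormed_axioms h y K x])
         (simp_all add: w CD.star_functional_tf[OF s])
  qed
  have h': "star_hom AB.T CD.TT (\<lambda>x. CD.min.to_H (h x))"
    by (rule star_hom_comp[OF h CD.star_hom_to_TT])
  have le': "cnorm CD.TT (CD.min.to_H (h x)) \<le> min_seminorm A B x" if x: "x \<in> carrier AB.T" for x
    using le[OF x] x CD.min.cnorm_to_H[of "h x"] by (simp add: min_tensor_def hs)
  obtain k where k: "star_hom AB.TT CD.TT k" "\<And>x. x \<in> carrier AB.T \<Longrightarrow> k (AB.min.to_H x) = CD.min.to_H (h x)"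
    using AB.min.completion_extend[OF CD.cstar_TT h' le'] unfolding min_tensor_def by blast
  have kE: "k (AB.E a b) = CD.E (f a) (g b)" if "a \<in> carrier A" "b \<in> carrier B" for a b
    using that k(2)[of "AB.e (a, b)"] by (simp add: AB.E_eq CD.E_eq h_single)
  have "tensor_map A B C D f g = restrict k (carrier AB.TT)"
    unfolding tensor_map_def
  proof (rule the_star_hom_eq[OF AB.TT.star_algebra_axioms k(1)])
    show "\<forall>a\<in>carrier A. \<forall>b\<in>carrier B. restrict k (carrier AB.TT) (AB.E a b) = CD.E (f a) (g b)"
      by (simp add: kE)
  qed (use AB.tensor_hom_unique[OF CD.cstar_TT] in auto)
  then show "star_hom (min_tensor A B) (min_tensor C D) (tensor_map A B C D f g)"
    "a \<in> carrier A \<Longrightarrow> b \<in> carrier B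
      \<Longrightarrow> tensor_map A B C D f g (elem_tensor A B a b) = elem_tensor C D (f a) (g b)"
    using star_hom_restrict[OF AB.TT.star_algebra_axioms k(1)] kE by auto
qed

section \<open>Computations with representations of graphs\<close>

context star_algebra
begin

lemma finsum_mult:
  assumes "finite I" "finite J" "f \<in> I \<rightarrow> carrier S" "g \<in> J \<rightarrow> carrier S"
  shows "(\<Oplus>i\<in>I. f i) \<otimes> (\<Oplus>j\<in>J. g j) = (\<Oplus>i\<in>I. \<Oplus>j\<in>J. f i \<otimes> g j)"
proof -
  have "(\<Oplus>i\<in>I. f i) \<otimes> (\<Oplus>j\<in>J. g j) = (\<Oplus>i\<in>I. f i \<otimes> (\<Oplus>j\<in>J. g j))"
    using assms by (intro finsum_ldistr) auto
  also have "\<dots> = (\<Oplus>i\<in>I. \<Oplus>j\<in>J. f i \<otimes> g j)"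
    using assms by (intro finsum_cong' finsum_rdistr) (auto intro!: finsum_closed)
  finally show ?thesis .
qed

lemma finsum_swap:
  assumes "finite I" "finite J" "\<And>i j. i \<in> I \<Longrightarrow> j \<in> J \<Longrightarrow> f i j \<in> carrier S"
  shows "(\<Oplus>i\<in>I. \<Oplus>j\<in>J. f i j) = (\<Oplus>j\<in>J. \<Oplus>i\<in>I. f i j)"
  using assms(1,3)
proof (induction I)
  case (insert i I)
  have "(\<Oplus>i\<in>insert i I. \<Oplus>j\<in>J. f i j) = (\<Oplus>j\<in>J. f i j) \<oplus> (\<Oplus>i\<in>I. \<Oplus>j\<in>J. f i j)"
    using insert by (subst finsum_insert) (auto intro!: finsum_closed)
  also have "(\<Oplus>i\<in>I. \<Oplus>j\<in>J. f i j) = (\<Oplus>j\<in>J. \<Oplus>i\<in>I. f i j)" using insert by simp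
  also have "(\<Oplus>j\<in>J. f i j) \<oplus> (\<Oplus>j\<in>J. \<Oplus>i\<in>I. f i j) = (\<Oplus>j\<in>J. f i j \<oplus> (\<Oplus>i\<in>I. f i j))"
    using insert by (subst finsum_addf) (auto intro!: finsum_closed)
  also have "\<dots> = (\<Oplus>j\<in>J. \<Oplus>i\<in>insert i I. f i j)"
    using insert by (intro finsum_cong') (auto intro!: finsum_closed)
  finally show ?case .
qed simp

lemma finsum_only:
  assumes "finite I" "j \<in> I" "f j \<in> carrier S" "\<And>i. i \<in> I \<Longrightarrow> i \<noteq> j \<Longrightarrow> f i = \<zero>"
  shows "(\<Oplus>i\<in>I. f i) = f j"
proof -
  have "(\<Oplus>i\<in>I. f i) = (\<Oplus>i\<in>{j}. f i)"
  proof (rule add.finprod_mono_neutral_cong_right)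
    show "f \<in> I \<rightarrow> carrier S"
    proof
      fix i assume "i \<in> I"
      then show "f i \<in> carrier S" using assms(3,4) by (cases "i = j") auto
    qed
  qed (use assms in auto)
  then show ?thesis using assms by simp
qed

lemma finsum_diag:
  assumes "finite I" "\<And>i. i \<in> I \<Longrightarrow> f i i \<in> carrier S"
    and "\<And>i j. i \<in> I \<Longrightarrow> j \<in> I \<Longrightarrow> i \<noteq> j \<Longrightarrow> f i j = \<zero>"
  shows "(\<Oplus>i\<in>I. \<Oplus>j\<in>I. f i j) = (\<Oplus>i\<in>I. f i i)"
  using assms by (intro finsum_cong' refl finsum_only) auto

lemma finsum_Sigma:
  assumes "finite I" "finite J" "\<And>i j. i \<in> I \<Longrightarrow> j \<in> J \<Longrightarrow> f (i, j) \<in> carrier S"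
  shows "(\<Oplus>u\<in>I \<times> J. f u) = (\<Oplus>i\<in>I. \<Oplus>j\<in>J. f (i, j))"
  using assms(1,3)
proof (induction I)
  case (insert i I)
  have "insert i I \<times> J = (Pair i ` J) \<union> (I \<times> J)" by auto
  then have "(\<Oplus>u\<in>insert i I \<times> J. f u) = (\<Oplus>u\<in>Pair i ` J. f u) \<oplus> (\<Oplus>u\<in>I \<times> J. f u)"
    using insert assms(2) by (simp only:) (intro finsum_Un_disjoint, auto)
  also have "(\<Oplus>u\<in>Pair i ` J. f u) = (\<Oplus>j\<in>J. f (i, j))"
    using insert by (intro finsum_reindex) (auto simp: inj_on_def)
  also have "(\<Oplus>u\<in>I \<times> J. f u) = (\<Oplus>i\<in>I. \<Oplus>j\<in>J. f (i, j))" using insert by simp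
  also have "(\<Oplus>j\<in>J. f (i, j)) \<oplus> \<dots> = (\<Oplus>i\<in>insert i I. \<Oplus>j\<in>J. f (i, j))"
    using insert by (intro finsum_insert[symmetric]) (auto intro!: finsum_closed)
  finally show ?case .
qed simp

text \<open>Serves to pass from double sums over vertices to sums over edges, the terms off the
  edges being killed by (R2).\<close>

lemma finsum_support:
  assumes "finite I" "finite J" "R \<subseteq> I \<times> J" "\<And>i j. (i, j) \<in> R \<Longrightarrow> f i j \<in> carrier S"
    and "\<And>i j. i \<in> I \<Longrightarrow> j \<in> J \<Longrightarrow> (i, j) \<notin> R \<Longrightarrow> f i j = \<zero>"
  shows "(\<Oplus>i\<in>I. \<Oplus>j\<in>J. f i j) = (\<Oplus>e\<in>R. f (fst e) (snd e))"
proof -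
  have cl: "f i j \<in> carrier S" if "i \<in> I" "j \<in> J" for i j
    using assms(4,5)[of i j] that by (cases "(i, j) \<in> R") auto
  have "(\<Oplus>i\<in>I. \<Oplus>j\<in>J. f i j) = (\<Oplus>u\<in>I \<times> J. f (fst u) (snd u))"
    using cl assms(1,2) by (subst finsum_Sigma) auto
  also have "\<dots> = (\<Oplus>e\<in>R. f (fst e) (snd e))"
    using assms cl by (intro add.finprod_mono_neutral_cong_right) auto
  finally show ?thesis .
qed

lemma finsum_const_smult:
  assumes "finite I" "c \<in> carrier S"
  shows "(\<Oplus>i\<in>I. c) = of_nat (card I) \<odot> c"
  using assms by (induction I) (auto simp: smult_add_left)

end

text \<open>The relations are symmetric under exchanging rows and columns of the matrix, so each
  result about rows yields one about columns.\<close>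

lemma graph_rep_transpose:
  assumes "graph_rep G B X"
  shows "graph_rep G B (\<lambda>i j. X j i)"
proof -
  have m: "magic (pverts G) B (\<lambda>i j. X j i)"
    using magicD[OF graph_repD(1)[OF assms]] by (intro magicI) simp_all
  have r3: "\<forall>e e'. e \<in> parcs G \<and> e' \<in> parcs G \<longrightarrow>
      X (fst e') (fst e) \<otimes>\<^bsub>B\<^esub> X (snd e') (snd e) = X (snd e') (snd e) \<otimes>\<^bsub>B\<^esub> X (fst e') (fst e)"
  proof (intro allI impI, elim conjE)
    fix e e' assume "e \<in> parcs G" "e' \<in> parcs G"
    then show "X (fst e') (fst e) \<otimes>\<^bsub>B\<^esub> X (snd e') (snd e) = X (snd e') (snd e) \<otimes>\<^bsub>B\<^esub> X (fst e') (fst e)"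
      using graph_repD(6)[OF assms, of "fst e'" "snd e'" "fst e" "snd e"] by simp
  qed
  show ?thesis
    unfolding graph_rep_def
    by (insert r3 assms[unfolded graph_rep_def], elim conjE, intro conjI m; assumption)
qed

lemma graph_rep_hom:
  assumes B: "star_algebra B" and C: "star_algebra C" and h: "star_hom B C h"
    and wf: "parcs G \<subseteq> pverts G \<times> pverts G" and X: "graph_rep G B X"
  shows "graph_rep G C (\<lambda>i j. h (X i j))"
proof -
  interpret B: star_algebra B by fact
  interpret C: star_algebra C by fact
  note hs = star_hom_simps[OF h] star_hom_zero[OF h B C]
  have v: "s \<in> pverts G" "t \<in> pverts G" if "(s, t) \<in> parcs G" for s t using that wf by auto
  have v2: "fst e \<in> pverts G" "snd e \<in> pverts G" if "e \<in> parcs G" for e using that wf by auto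
  note Xc = magicD(1)[OF graph_repD(1)[OF X]]
  have m: "h (X i j) \<otimes>\<^bsub>C\<^esub> h (X k l) = h (X i j \<otimes>\<^bsub>B\<^esub> X k l)"
    if "i \<in> pverts G" "j \<in> pverts G" "k \<in> pverts G" "l \<in> pverts G" for i j k l
    using that by (simp add: hs Xc)
  show ?thesis
  proof (rule graph_repI[OF C wf magic_hom[OF B C h graph_repD(1)[OF X]]])
    fix s t assume st: "(s, t) \<in> parcs G"
    have "(\<Oplus>\<^bsub>C\<^esub>e\<in>parcs G. h (X (fst e) s) \<otimes>\<^bsub>C\<^esub> h (X (snd e) t))
        = (\<Oplus>\<^bsub>C\<^esub>e\<in>parcs G. h (X (fst e) s \<otimes>\<^bsub>B\<^esub> X (snd e) t))"
      by (intro C.finsum_cong') (simp_all add: Pi_iff v[OF st] v2 hs Xc)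
    also have "\<dots> = h (\<Oplus>\<^bsub>B\<^esub>e\<in>parcs G. X (fst e) s \<otimes>\<^bsub>B\<^esub> X (snd e) t)"
      by (intro star_hom_finsum[OF h B C, symmetric]) (simp add: Pi_iff v[OF st] v2 Xc)
    finally show "(\<Oplus>\<^bsub>C\<^esub>e\<in>parcs G. h (X (fst e) s) \<otimes>\<^bsub>C\<^esub> h (X (snd e) t)) = \<one>\<^bsub>C\<^esub>"
      using graph_repD(7)[OF X st] by (simp add: hs)
    have "(\<Oplus>\<^bsub>C\<^esub>e\<in>parcs G. h (X s (fst e)) \<otimes>\<^bsub>C\<^esub> h (X t (snd e)))
        = (\<Oplus>\<^bsub>C\<^esub>e\<in>parcs G. h (X s (fst e) \<otimes>\<^bsub>B\<^esub> X t (snd e)))"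
      by (intro C.finsum_cong') (simp_all add: Pi_iff v[OF st] v2 hs Xc)
    also have "\<dots> = h (\<Oplus>\<^bsub>B\<^esub>e\<in>parcs G. X s (fst e) \<otimes>\<^bsub>B\<^esub> X t (snd e))"
      by (intro star_hom_finsum[OF h B C, symmetric]) (simp add: Pi_iff v[OF st] v2 Xc)
    finally show "(\<Oplus>\<^bsub>C\<^esub>e\<in>parcs G. h (X s (fst e)) \<otimes>\<^bsub>C\<^esub> h (X t (snd e))) = \<one>\<^bsub>C\<^esub>"
      using graph_repD(8)[OF X st] by (simp add: hs)
    fix s' t' assume st': "(s', t') \<in> parcs G"
    show "h (X s s') \<otimes>\<^bsub>C\<^esub> h (X t t') = h (X t t') \<otimes>\<^bsub>C\<^esub> h (X s s')"
      using graph_repD(6)[OF X st st'] v[OF st] v[OF st'] by (simp add: m)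
  next
    fix s t i k assume st: "(s, t) \<in> parcs G" "i \<in> pverts G" "k \<in> pverts G" "(i, k) \<notin> parcs G"
    show "h (X s i) \<otimes>\<^bsub>C\<^esub> h (X t k) = \<zero>\<^bsub>C\<^esub> \<and> h (X i s) \<otimes>\<^bsub>C\<^esub> h (X k t) = \<zero>\<^bsub>C\<^esub>"
      using graph_repD(2,4)[OF X st] v[OF st(1)] st by (simp add: m star_hom_zero[OF h B C])
  qed
qed

text \<open>The matrix product of two commuting representations. With the two legs of a tensor
  square as \<open>X\<close> and \<open>Y\<close> it shows that the coproduct formula respects the
  relations.\<close>

lemma (in star_algebra) graph_rep_product:
  assumes wf: "parcs G \<subseteq> pverts G \<times> pverts G" and fin: "finite (pverts G)"
    and X: "graph_rep G S X" and Y: "graph_rep G S Y"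
    and comm: "\<And>i j k l. i \<in> pverts G \<Longrightarrow> j \<in> pverts G \<Longrightarrow> k \<in> pverts G \<Longrightarrow> l \<in> pverts G
      \<Longrightarrow> Y i j \<otimes> X k l = X k l \<otimes> Y i j"
  shows "graph_rep G S (\<lambda>i j. \<Oplus>k\<in>pverts G. X i k \<otimes> Y k j)"
proof -
  let ?V = "pverts G"
  define D where "D i j = (\<Oplus>k\<in>?V. X i k \<otimes> Y k j)" for i j
  have finE: "finite (parcs G)" using finite_subset[OF wf] fin by simp
  have v: "s \<in> ?V" "t \<in> ?V" if "(s, t) \<in> parcs G" for s t using that wf by auto
  have v2: "fst e \<in> ?V" "snd e \<in> ?V" if "e \<in> parcs G" for e using that wf by auto
  note mX = magicD[OF graph_repD(1)[OF X]] and mY = magicD[OF graph_repD(1)[OF Y]]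
  note cl = mX(1) mY(1)
  have Dc: "D i j \<in> carrier S" if "i \<in> ?V" "j \<in> ?V" for i j
    using that unfolding D_def by (intro finsum_closed) (auto simp: cl)
  have mm: "(X i k \<otimes> Y k j) \<otimes> (X i' l \<otimes> Y l j') = (X i k \<otimes> X i' l) \<otimes> (Y k j \<otimes> Y l j')"
    if "i \<in> ?V" "j \<in> ?V" "i' \<in> ?V" "j' \<in> ?V" "k \<in> ?V" "l \<in> ?V" for i j i' j' k l
  proof -
    have "(X i k \<otimes> Y k j) \<otimes> (X i' l \<otimes> Y l j') = X i k \<otimes> (Y k j \<otimes> X i' l) \<otimes> Y l j'"
      using that by (simp add: cl m_assoc)
    then show ?thesis using that by (simp add: cl m_assoc comm)
  qed
  have DD: "D i j \<otimes> D i' j'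
      = (\<Oplus>k\<in>?V. \<Oplus>l\<in>?V. ((X i k \<otimes> X i' l) \<otimes> (Y k j \<otimes> Y l j')))"
    if "i \<in> ?V" "j \<in> ?V" "i' \<in> ?V" "j' \<in> ?V" for i j i' j'
  proof -
    have "D i j \<otimes> D i' j' = (\<Oplus>k\<in>?V. \<Oplus>l\<in>?V. (X i k \<otimes> Y k j) \<otimes> (X i' l \<otimes> Y l j'))"
      unfolding D_def using that fin by (intro finsum_mult) (auto simp: cl)
    also have "\<dots> = (\<Oplus>k\<in>?V. \<Oplus>l\<in>?V. ((X i k \<otimes> X i' l) \<otimes> (Y k j \<otimes> Y l j')))"
      using that by (intro finsum_cong' refl) (auto simp: cl mm intro!: finsum_closed)
    finally show ?thesis .
  qed
  have Ec: "((X i k \<otimes> X i' l) \<otimes> (Y k' j \<otimes> Y l' j')) \<in> carrier S"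
    if "i \<in> ?V" "j \<in> ?V" "i' \<in> ?V" "j' \<in> ?V" "k \<in> ?V" "l \<in> ?V" "k' \<in> ?V" "l' \<in> ?V" for i j i' j' k l k' l'
    using that by (simp add: cl)
  have m: "magic ?V S D"
  proof (rule magicI)
    fix i j assume ij: "i \<in> ?V" "j \<in> ?V"
    show "D i j \<in> carrier S" by (rule Dc[OF ij])
    show "invol S (D i j) = D i j"
      unfolding D_def using ij
      by (subst finsum_invol) (auto simp: cl comm mX(2) mY(2) intro!: finsum_cong')
  next
    fix i j k assume ijk: "i \<in> ?V" "j \<in> ?V" "k \<in> ?V"
    have "D i j \<otimes> D i k = (\<Oplus>p\<in>?V. ((X i p \<otimes> X i p) \<otimes> (Y p j \<otimes> Y p k)))"
      unfolding DD[OF ijk(1,2,1,3)] using ijk fin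
      by (intro finsum_diag) (auto simp: Ec mX(3) cl)
    also have "\<dots> = (\<Oplus>p\<in>?V. if j = k then (X i p \<otimes> Y p j) else \<zero>)"
      using ijk by (intro finsum_cong') (auto simp: mX(3) mY(3) cl)
    also have "\<dots> = (if j = k then D i j else \<zero>)" by (simp add: D_def)
    finally show "D i j \<otimes> D i k = (if j = k then D i j else \<zero>)" .
    have "D j i \<otimes> D k i = (\<Oplus>p\<in>?V. ((X j p \<otimes> X k p) \<otimes> (Y p i \<otimes> Y p i)))"
      unfolding DD[OF ijk(2,1,3,1)] using ijk fin
      by (intro finsum_diag) (auto simp: Ec mY(4) cl)
    also have "\<dots> = (\<Oplus>p\<in>?V. if j = k then (X j p \<otimes> Y p i) else \<zero>)"
      using ijk by (intro finsum_cong') (auto simp: mX(4) mY(4) cl)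
    also have "\<dots> = (if j = k then D j i else \<zero>)" by (simp add: D_def)
    finally show "D j i \<otimes> D k i = (if j = k then D j i else \<zero>)" .
  next
    fix i assume i: "i \<in> ?V"
    have "(\<Oplus>j\<in>?V. D i j) = (\<Oplus>k\<in>?V. \<Oplus>j\<in>?V. X i k \<otimes> Y k j)"
      unfolding D_def using i fin by (intro finsum_swap) (auto simp: cl)
    also have "\<dots> = (\<Oplus>k\<in>?V. (X i k \<otimes> \<one>))"
      using i fin by (intro finsum_cong') (auto simp: cl mY(5) finsum_rdistr[symmetric])
    also have "\<dots> = \<one>"
      using i fin by (subst finsum_ldistr[symmetric]) (auto simp: cl mX(5))
    finally show "(\<Oplus>j\<in>?V. D i j) = \<one>" .
    have "(\<Oplus>j\<in>?V. D j i) = (\<Oplus>k\<in>?V. \<Oplus>j\<in>?V. X j k \<otimes> Y k i)"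
      unfolding D_def using i fin by (intro finsum_swap) (auto simp: cl)
    also have "\<dots> = (\<Oplus>k\<in>?V. \<one> \<otimes> Y k i)"
      using i fin by (intro finsum_cong') (auto simp: cl mX(6) finsum_ldistr[symmetric])
    also have "\<dots> = \<one>"
      using i fin by (subst finsum_rdistr[symmetric]) (auto simp: cl mY(6))
    finally show "(\<Oplus>j\<in>?V. D j i) = \<one>" .
  qed
  have "graph_rep G S D"
  proof (rule graph_repI[OF star_algebra_axioms wf m])
    fix s t i k assume st: "(s, t) \<in> parcs G" and ik: "i \<in> ?V" "k \<in> ?V" "(i, k) \<notin> parcs G"
    \<comment> \<open>If \<open>(p, q)\<close> is an edge, (R2) kills the \<open>Y\<close> factors;
      if not, it kills the \<open>X\<close> factors.\<close>
    have "((X s p \<otimes> X t q) \<otimes> (Y p i \<otimes> Y q k)) = \<zero>" if "p \<in> ?V" "q \<in> ?V" for p q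
      using graph_repD(2)[OF X st that] graph_repD(2)[OF Y _ ik, of p q] that v[OF st] ik
      by (cases "(p, q) \<in> parcs G") (auto simp: cl)
    moreover have "((X i p \<otimes> X k q) \<otimes> (Y p s \<otimes> Y q t)) = \<zero>" if "p \<in> ?V" "q \<in> ?V" for p q
      using graph_repD(4)[OF Y st that] graph_repD(4)[OF X _ ik, of p q] that v[OF st] ik
      by (cases "(p, q) \<in> parcs G") (auto simp: cl)
    ultimately show "D s i \<otimes> D t k = \<zero> \<and> D i s \<otimes> D k t = \<zero>"
      using v[OF st] ik by (auto simp: DD intro!: add.finprod_one_eqI)
  next
    fix s t s' t' assume st: "(s, t) \<in> parcs G" and st': "(s', t') \<in> parcs G"
    note v' = v[OF st] v[OF st']
    \<comment> \<open>On edges \<open>(p, q)\<close> both pairs of factors commute by (R3); off the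
      edges both sides vanish by (R2).\<close>
    have "((X s p \<otimes> X t q) \<otimes> (Y p s' \<otimes> Y q t')) = ((X t q \<otimes> X s p) \<otimes> (Y q t' \<otimes> Y p s'))"
      if "p \<in> ?V" "q \<in> ?V" for p q
      using graph_repD(2,3)[OF X st that] graph_repD(6)[OF X st, of p q] graph_repD(6)[OF Y _ st', of p q] that v'
      by (cases "(p, q) \<in> parcs G") (auto simp: cl)
    then have "D s s' \<otimes> D t t'
        = (\<Oplus>p\<in>?V. \<Oplus>q\<in>?V. ((X t q \<otimes> X s p) \<otimes> (Y q t' \<otimes> Y p s')))"
      unfolding DD[OF v'(1,3,2,4)] using v'
      by (intro finsum_cong' refl) (auto simp: Ec intro!: finsum_closed)
    also have "\<dots> = D t t' \<otimes> D s s'"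
      unfolding DD[OF v'(2,4,1,3)] using v' fin by (intro finsum_swap) (auto simp: Ec)
    finally show "D s s' \<otimes> D t t' = D t t' \<otimes> D s s'" .
  next
    fix s t assume st: "(s, t) \<in> parcs G"
    note v' = v[OF st]
    \<comment> \<open>Only edges \<open>f\<close> survive in the double sum, so (R4) for
      \<open>X\<close> applies to the sum over \<open>e\<close>, and then (R4) for \<open>Y\<close>
      to the sum over \<open>f\<close>.\<close>
    have "D (fst e) s \<otimes> D (snd e) t
        = (\<Oplus>f\<in>parcs G. ((X (fst e) (fst f) \<otimes> X (snd e) (snd f)) \<otimes> (Y (fst f) s \<otimes> Y (snd f) t)))"
      if "e \<in> parcs G" for e
      using v' that
      by (subst DD, simp_all add: v2, intro finsum_support fin wf)
         (use wf in \<open>auto intro!: Ec simp: cl v2 graph_repD(4)[OF Y st]\<close>)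
    then have "(\<Oplus>e\<in>parcs G. D (fst e) s \<otimes> D (snd e) t)
        = (\<Oplus>e\<in>parcs G. \<Oplus>f\<in>parcs G.
            ((X (fst e) (fst f) \<otimes> X (snd e) (snd f)) \<otimes> (Y (fst f) s \<otimes> Y (snd f) t)))"
      using v' by (intro finsum_cong' refl) (simp_all add: Pi_iff v2 cl)
    also have "\<dots> = (\<Oplus>f\<in>parcs G. \<Oplus>e\<in>parcs G.
            ((X (fst e) (fst f) \<otimes> X (snd e) (snd f)) \<otimes> (Y (fst f) s \<otimes> Y (snd f) t)))"
      using v' finE by (intro finsum_swap) (simp_all add: v2 cl)
    also have "\<dots> = (\<Oplus>f\<in>parcs G. (\<one> \<otimes> (Y (fst f) s \<otimes> Y (snd f) t)))"
    proof (intro finsum_cong' refl)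
      fix f assume f: "f \<in> parcs G"
      show "(\<Oplus>e\<in>parcs G. ((X (fst e) (fst f) \<otimes> X (snd e) (snd f)) \<otimes> (Y (fst f) s \<otimes> Y (snd f) t)))
          = (\<one> \<otimes> (Y (fst f) s \<otimes> Y (snd f) t))"
        using v' f finE v2[OF f] graph_repD(7)[OF X, of "fst f" "snd f"]
        by (subst finsum_ldistr[symmetric]) (simp_all add: Pi_iff v2 cl)
    qed (use v' in \<open>simp add: Pi_iff v2 cl\<close>)
    also have "\<dots> = \<one>"
      using v' finE graph_repD(7)[OF Y st]
      by (subst finsum_rdistr[symmetric]) (simp_all add: Pi_iff v2 cl)
    finally show "(\<Oplus>e\<in>parcs G. D (fst e) s \<otimes> D (snd e) t) = \<one>" .
    have "D s (fst e) \<otimes> D t (snd e)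
        = (\<Oplus>f\<in>parcs G. ((X s (fst f) \<otimes> X t (snd f)) \<otimes> (Y (fst f) (fst e) \<otimes> Y (snd f) (snd e))))"
      if "e \<in> parcs G" for e
      using v' that
      by (subst DD, simp_all add: v2, intro finsum_support fin wf)
         (use wf in \<open>auto intro!: Ec simp: cl v2 graph_repD(2)[OF X st]\<close>)
    then have "(\<Oplus>e\<in>parcs G. D s (fst e) \<otimes> D t (snd e))
        = (\<Oplus>e\<in>parcs G. \<Oplus>f\<in>parcs G.
            ((X s (fst f) \<otimes> X t (snd f)) \<otimes> (Y (fst f) (fst e) \<otimes> Y (snd f) (snd e))))"
      using v' by (intro finsum_cong' refl) (simp_all add: Pi_iff v2 cl)
    also have "\<dots> = (\<Oplus>f\<in>parcs G. \<Oplus>e\<in>parcs G.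
            ((X s (fst f) \<otimes> X t (snd f)) \<otimes> (Y (fst f) (fst e) \<otimes> Y (snd f) (snd e))))"
      using v' finE by (intro finsum_swap) (simp_all add: v2 cl)
    also have "\<dots> = (\<Oplus>f\<in>parcs G. ((X s (fst f) \<otimes> X t (snd f)) \<otimes> \<one>))"
    proof (intro finsum_cong' refl)
      fix f assume f: "f \<in> parcs G"
      show "(\<Oplus>e\<in>parcs G. ((X s (fst f) \<otimes> X t (snd f)) \<otimes> (Y (fst f) (fst e) \<otimes> Y (snd f) (snd e))))
          = ((X s (fst f) \<otimes> X t (snd f)) \<otimes> \<one>)"
        using v' f finE v2[OF f] graph_repD(8)[OF Y, of "fst f" "snd f"]
        by (subst finsum_rdistr[symmetric]) (simp_all add: Pi_iff v2 cl)
    qed (use v' in \<open>simp add: Pi_iff v2 cl\<close>)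
    also have "\<dots> = \<one>"
      using v' finE graph_repD(8)[OF X st]
      by (subst finsum_ldistr[symmetric]) (simp_all add: Pi_iff v2 cl)
    finally show "(\<Oplus>e\<in>parcs G. D s (fst e) \<otimes> D t (snd e)) = \<one>" .
  qed
  then show ?thesis unfolding D_def .
qed

section \<open>Disjoint copies of a graph\<close>

lemma pverts_copies: "pverts (disjoint_copies n G) = {1..n} \<times> pverts G"
  by (simp add: disjoint_copies_def)

lemma arcs_copies:
  "((k, i), (l, j)) \<in> parcs (disjoint_copies n G) \<longleftrightarrow> k = l \<and> k \<in> {1..n} \<and> (i, j) \<in> parcs G"
  by (auto simp: disjoint_copies_def)

lemma wf_copies:
  "parcs G \<subseteq> pverts G \<times> pverts G
    \<Longrightarrow> parcs (disjoint_copies n G) \<subseteq> pverts (disjoint_copies n G) \<times> pverts (disjoint_copies n G)"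
  by (auto simp: disjoint_copies_def)

text \<open>The edges of the disjoint union are reindexed by pairs of a copy and an edge of
  \<open>G\<close>.\<close>

lemma (in star_algebra) finsum_arcs_copies:
  assumes "finite (parcs G)"
    and cl: "\<And>k e. k \<in> {1..n} \<Longrightarrow> e \<in> parcs G \<Longrightarrow> f (k, fst e) (k, snd e) \<in> carrier S"
  shows "(\<Oplus>e\<in>parcs (disjoint_copies n G). f (fst e) (snd e))
    = (\<Oplus>k\<in>{1..n}. \<Oplus>e\<in>parcs G. f (k, fst e) (k, snd e))"
proof -
  let ?\<pi> = "\<lambda>u. ((fst u, fst (snd u)), (fst u, snd (snd u)))"
  have arcs: "parcs (disjoint_copies n G) = ?\<pi> ` ({1..n} \<times> parcs G)"
    by (force simp: disjoint_copies_def)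
  have "inj_on ?\<pi> ({1..n} \<times> parcs G)" by (auto simp: inj_on_def)
  then have "(\<Oplus>e\<in>parcs (disjoint_copies n G). f (fst e) (snd e))
      = (\<Oplus>u\<in>{1..n} \<times> parcs G. f (fst (?\<pi> u)) (snd (?\<pi> u)))"
    unfolding arcs using cl by (intro finsum_reindex) (simp_all add: Pi_iff)
  also have "\<dots> = (\<Oplus>k\<in>{1..n}. \<Oplus>e\<in>parcs G. f (k, fst e) (k, snd e))"
    using assms by (subst finsum_Sigma) simp_all
  finally show ?thesis .
qed

text \<open>The direction starting from the wreath data. In a product of two entries from one block
  row or block column the factors \<open>x\<close> can be moved together, where they collapse to a
  single projection or to zero (\<open>K1\<close>, \<open>K2\<close>); what remains are the
  relations for \<open>N k\<close>.\<close>

lemma (in star_algebra) graph_rep_copies: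
  assumes wf: "parcs G \<subseteq> pverts G \<times> pverts G" and fin: "finite (pverts G)"
    and x: "magic {1..n} S x" and N: "\<And>k. k \<in> {1..n} \<Longrightarrow> graph_rep G S (N k)"
    and comm: "\<And>k l i j. k \<in> {1..n} \<Longrightarrow> l \<in> {1..n} \<Longrightarrow> i \<in> pverts G \<Longrightarrow> j \<in> pverts G
      \<Longrightarrow> N k i j \<otimes> x k l = x k l \<otimes> N k i j"
  shows "graph_rep (disjoint_copies n G) S (\<lambda>u v. N (fst u) (snd u) (snd v) \<otimes> x (fst u) (fst v))"
proof -
  define K where "K = {1..n}"
  have finK: "finite K" by (simp add: K_def)
  let ?V = "pverts G"
  have finE: "finite (parcs G)" using finite_subset[OF wf] fin by simp
  have v: "s \<in> ?V" "t \<in> ?V" if "(s, t) \<in> parcs G" for s t using that wf by auto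
  have v2: "fst e \<in> ?V" "snd e \<in> ?V" if "e \<in> parcs G" for e using that wf by auto
  note x = x[folded K_def] and N = N[folded K_def] and comm = comm[folded K_def]
  note mx = magicD[OF x] and mN = magicD[OF graph_repD(1)[OF N]]
  note cl = mx(1) mN(1)
  define Z where "Z u v = N (fst u) (snd u) (snd v) \<otimes> x (fst u) (fst v)" for u v
  have Z: "Z (k, i) (l, j) = N k i j \<otimes> x k l" for k i l j by (simp add: Z_def)
  have K1: "Z (k, i) (l, j) \<otimes> Z (k, i') (m, j') = (if l = m then (N k i j \<otimes> N k i' j') \<otimes> x k l else \<zero>)"
    if "k \<in> K" "l \<in> K" "m \<in> K" "i \<in> ?V" "j \<in> ?V" "i' \<in> ?V" "j' \<in> ?V" for k l m i j i' j'
  proof -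
    have "Z (k, i) (l, j) \<otimes> Z (k, i') (m, j') = N k i j \<otimes> (x k l \<otimes> N k i' j') \<otimes> x k m"
      using that by (simp add: Z cl m_assoc)
    also have "\<dots> = (N k i j \<otimes> N k i' j') \<otimes> (x k l \<otimes> x k m)"
      using that by (simp add: cl m_assoc comm[symmetric])
    finally show ?thesis using that by (simp add: mx(3) cl)
  qed
  have K2: "Z (k, i) (l, j) \<otimes> Z (m, i') (l, j') = (if k = m then (N k i j \<otimes> N k i' j') \<otimes> x k l else \<zero>)"
    if "k \<in> K" "l \<in> K" "m \<in> K" "i \<in> ?V" "j \<in> ?V" "i' \<in> ?V" "j' \<in> ?V" for k l m i j i' j'
  proof (cases "k = m")
    case True then show ?thesis using K1[of k l l i j i' j'] that by simp
  next
    case False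
    have "Z (k, i) (l, j) \<otimes> Z (m, i') (l, j') = N k i j \<otimes> ((x k l \<otimes> x m l) \<otimes> N m i' j')"
      using that by (simp add: Z cl m_assoc comm[of m l i' j'])
    then show ?thesis using that False by (simp add: mx(4) cl)
  qed
  have Zc: "Z (k, i) (l, j) \<in> carrier S" if "k \<in> K" "l \<in> K" "i \<in> ?V" "j \<in> ?V" for k l i j
    using that by (simp add: Z cl)
  have m: "magic (K \<times> ?V) S Z"
  proof (rule magicI; (elim SigmaE)?; simp only:)
    fix k i l j assume *: "k \<in> K" "i \<in> ?V" "l \<in> K" "j \<in> ?V"
    show "Z (k, i) (l, j) \<in> carrier S" using * by (simp add: Zc)
    show "invol S (Z (k, i) (l, j)) = Z (k, i) (l, j)"
      using * by (simp add: Z cl mx(2) mN(2) comm)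
  next
    fix k i l j m j' assume *: "k \<in> K" "i \<in> ?V" "l \<in> K" "j \<in> ?V" "m \<in> K" "j' \<in> ?V"
    show "Z (k, i) (l, j) \<otimes> Z (k, i) (m, j') = (if (l, j) = (m, j') then Z (k, i) (l, j) else \<zero>)"
      using * by (simp add: K1 mN(3) cl) (simp add: Z)
    show "Z (l, j) (k, i) \<otimes> Z (m, j') (k, i) = (if (l, j) = (m, j') then Z (l, j) (k, i) else \<zero>)"
      using * by (simp add: K2 mN(4) cl) (simp add: Z)
  next
    fix k i assume *: "k \<in> K" "i \<in> ?V"
    have "(\<Oplus>u\<in>K \<times> ?V. Z (k, i) u) = (\<Oplus>l\<in>K. \<Oplus>j\<in>?V. N k i j \<otimes> x k l)"
      using * finK fin by (subst finsum_Sigma) (simp_all add: Z cl)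
    also have "\<dots> = (\<Oplus>l\<in>K. x k l)"
      using * fin by (intro finsum_cong') (simp_all add: Pi_iff cl finsum_ldistr[symmetric] mN(5))
    finally show "(\<Oplus>u\<in>K \<times> ?V. Z (k, i) u) = \<one>" using * by (simp add: mx(5))
    have "(\<Oplus>u\<in>K \<times> ?V. Z u (k, i)) = (\<Oplus>l\<in>K. \<Oplus>j\<in>?V. N l j i \<otimes> x l k)"
      using * finK fin by (subst finsum_Sigma) (simp_all add: Z cl)
    also have "\<dots> = (\<Oplus>l\<in>K. x l k)"
      using * fin by (intro finsum_cong') (simp_all add: Pi_iff cl finsum_ldistr[symmetric] mN(6))
    finally show "(\<Oplus>u\<in>K \<times> ?V. Z u (k, i)) = \<one>" using * by (simp add: mx(6))
  qed
  have arcs: "((k, i), (l, j)) \<in> parcs (disjoint_copies n G) \<longleftrightarrow> k = l \<and> k \<in> K \<and> (i, j) \<in> parcs G"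
    for k i l j by (simp add: arcs_copies K_def)
  have sums: "(\<Oplus>e\<in>parcs (disjoint_copies n G). f (fst e) (snd e))
      = (\<Oplus>k\<in>K. \<Oplus>e\<in>parcs G. f (k, fst e) (k, snd e))"
    if "\<And>k e. k \<in> K \<Longrightarrow> e \<in> parcs G \<Longrightarrow> f (k, fst e) (k, snd e) \<in> carrier S" for f
    using that unfolding K_def by (intro finsum_arcs_copies finE)
  have V: "pverts (disjoint_copies n G) = K \<times> ?V" by (simp add: pverts_copies K_def)
  have "graph_rep (disjoint_copies n G) S Z"
  proof (rule graph_repI[OF star_algebra_axioms wf_copies[OF wf]]; (simp only: V)?)
    show "magic (K \<times> ?V) S Z" by (rule m)
  next
    fix u w a b
    assume uw: "(u, w) \<in> parcs (disjoint_copies n G)" and ab: "a \<in> K \<times> ?V" "b \<in> K \<times> ?V"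
      "(a, b) \<notin> parcs (disjoint_copies n G)"
    obtain k s t where u: "u = (k, s)" "w = (k, t)" "k \<in> K" "(s, t) \<in> parcs G"
      using uw arcs by (cases u; cases w) auto
    obtain l i m j where a: "a = (l, i)" "b = (m, j)" by (cases a; cases b)
    have e: "l = m \<Longrightarrow> (i, j) \<notin> parcs G" using ab arcs a by auto
    show "Z u a \<otimes> Z w b = \<zero> \<and> Z a u \<otimes> Z b w = \<zero>"
      using ab u(3) v[OF u(4)] e unfolding a u(1,2)
      by (simp add: K1 K2 graph_repD(2,4)[OF N u(4)] cl)
  next
    fix u w u' w' assume "(u, w) \<in> parcs (disjoint_copies n G)" "(u', w') \<in> parcs (disjoint_copies n G)"
    then obtain k s t l s' t' where u: "u = (k, s)" "w = (k, t)" "k \<in> K" "(s, t) \<in> parcs G"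
      "u' = (l, s')" "w' = (l, t')" "l \<in> K" "(s', t') \<in> parcs G"
      using arcs by (cases u; cases w; cases u'; cases w') auto
    show "Z u u' \<otimes> Z w w' = Z w w' \<otimes> Z u u'"
      using u v[OF u(4)] v[OF u(8)] graph_repD(6)[OF N u(4) u(8)] by (simp add: K1)
  next
    fix u w assume "(u, w) \<in> parcs (disjoint_copies n G)"
    then obtain l s t where u: "u = (l, s)" "w = (l, t)" "l \<in> K" "(s, t) \<in> parcs G"
      using arcs by (cases u; cases w) auto
    note st = v[OF u(4)]
    have "(\<Oplus>e\<in>parcs (disjoint_copies n G). Z (fst e) u \<otimes> Z (snd e) w)
        = (\<Oplus>k\<in>K. \<Oplus>e\<in>parcs G. Z (k, fst e) u \<otimes> Z (k, snd e) w)"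
      using u(3) st by (subst sums) (simp_all add: u(1,2) Zc v2)
    also have "\<dots> = (\<Oplus>k\<in>K. \<Oplus>e\<in>parcs G. (N k (fst e) s \<otimes> N k (snd e) t) \<otimes> x k l)"
      using u(3) st by (intro finsum_cong') (simp_all add: Pi_iff u(1,2) K1 v2 cl)
    also have "\<dots> = (\<Oplus>k\<in>K. x k l)"
      using u(3) st finE by (intro finsum_cong')
        (simp_all add: Pi_iff cl v2 finsum_ldistr[symmetric] graph_repD(7)[OF N u(4)])
    finally show "(\<Oplus>e\<in>parcs (disjoint_copies n G). Z (fst e) u \<otimes> Z (snd e) w) = \<one>"
      using u(3) by (simp add: mx(6))
    have "(\<Oplus>e\<in>parcs (disjoint_copies n G). Z u (fst e) \<otimes> Z w (snd e))
        = (\<Oplus>k\<in>K. \<Oplus>e\<in>parcs G. Z u (k, fst e) \<otimes> Z w (k, snd e))"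
      using u(3) st by (subst sums) (simp_all add: u(1,2) Zc v2)
    also have "\<dots> = (\<Oplus>k\<in>K. \<Oplus>e\<in>parcs G. (N l s (fst e) \<otimes> N l t (snd e)) \<otimes> x l k)"
      using u(3) st by (intro finsum_cong') (simp_all add: Pi_iff u(1,2) K1 v2 cl)
    also have "\<dots> = (\<Oplus>k\<in>K. x l k)"
      using u(3) st finE by (intro finsum_cong')
        (simp_all add: Pi_iff cl v2 finsum_ldistr[symmetric] graph_repD(8)[OF N u(4)])
    finally show "(\<Oplus>e\<in>parcs (disjoint_copies n G). Z u (fst e) \<otimes> Z w (snd e)) = \<one>"
      using u(3) by (simp add: mx(5))
  qed
  then show ?thesis unfolding Z_def .
qed

text \<open>It suffices to follow the value at the first endpoint of each edge: \<open>f\<close>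
  agrees at both ends of an edge, so it does not matter which endpoints consecutive edges
  share.\<close>

lemma edge_connected_const:
  assumes "edge_connected G" and step: "\<And>s t. (s, t) \<in> parcs G \<Longrightarrow> f s = f t"
    and "i \<in> pverts G" "j \<in> pverts G"
  shows "f i = f j"
proof -
  obtain es where es: "es \<noteq> []" "set es \<subseteq> parcs G" "i \<in> {fst (hd es), snd (hd es)}"
    "j \<in> {fst (last es), snd (last es)}"
    "\<And>k. Suc k < length es \<Longrightarrow> {fst (es ! k), snd (es ! k)} \<inter> {fst (es ! Suc k), snd (es ! Suc k)} \<noteq> {}"
    using assms(1,3,4) unfolding edge_connected_def by blast
  have e: "f (fst (es ! k)) = f (snd (es ! k))" if "k < length es" for k
    using step[of "fst (es ! k)" "snd (es ! k)"] es(2) nth_mem[OF that] by auto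
  have "f (fst (es ! k)) = f i" if "k < length es" for k
    using that
  proof (induction k)
    case 0
    then show ?case using es(1,3) e[of 0] by (auto simp: hd_conv_nth)
  next
    case (Suc k)
    then show ?case using es(5)[OF Suc.prems] e[of k] e[of "Suc k"] by auto
  qed
  from this[of "length es - 1"] show ?thesis
    using es(1,4) e[of "length es - 1"] by (auto simp: last_conv_nth)
qed


text \<open>
  In a representation \<open>Y\<close> of the disjoint union, the sums \<open>\<Oplus>j. Y (k, i) (l, j)\<close> do not depend on \<open>i\<close>:
  they agree along every edge because of (R2), and \<open>G\<close> is connected.
\<close>

locale copies = star_algebra S for S :: "('a, 'x) star_alg_scheme" (structure) +
  fixes G :: "'v pair_pre_digraph" and K :: "nat set" and n :: nat and Y :: "nat \<times> 'v \<Rightarrow> nat \<times> 'v \<Rightarrow> 'a"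
  assumes K: "K = {1..n}" and fin: "finite (pverts G)" and nonempty: "pverts G \<noteq> {}"
    and wf: "parcs G \<subseteq> pverts G \<times> pverts G" and conn: "edge_connected G"
    and rep: "graph_rep (disjoint_copies n G) S Y"
begin

abbreviation "V \<equiv> pverts G"
abbreviation "E \<equiv> parcs G"

lemma finK: "finite K" by (simp add: K)
lemma finE: "finite E" using finite_subset[OF wf] fin by simp
lemma arc_verts: "(s, t) \<in> E \<Longrightarrow> s \<in> V" "(s, t) \<in> E \<Longrightarrow> t \<in> V" using wf by auto
lemma arc_ends: "e \<in> E \<Longrightarrow> fst e \<in> V" "e \<in> E \<Longrightarrow> snd e \<in> V" using wf by auto

text \<open>Gives access to the column versions of the statements about rows, with the two block
  indices exchanged.\<close>

lemma transposed: "copies S G K n (\<lambda>u v. Y v u)"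
  by unfold_locales (fact K fin nonempty wf conn graph_rep_transpose[OF rep])+

lemma V': "pverts (disjoint_copies n G) = K \<times> V" by (simp add: pverts_copies K)

lemma arc: "((k, i), (l, j)) \<in> parcs (disjoint_copies n G) \<longleftrightarrow> k = l \<and> k \<in> K \<and> (i, j) \<in> E"
  by (simp add: arcs_copies K)

lemmas magicY = magicD[OF graph_repD(1)[OF rep], unfolded V']

lemma Yc [simp]: "k \<in> K \<Longrightarrow> i \<in> V \<Longrightarrow> l \<in> K \<Longrightarrow> j \<in> V \<Longrightarrow> Y (k, i) (l, j) \<in> carrier S"
  by (simp add: magicY(1))

lemma Yi: "k \<in> K \<Longrightarrow> i \<in> V \<Longrightarrow> l \<in> K \<Longrightarrow> j \<in> V \<Longrightarrow> invol S (Y (k, i) (l, j)) = Y (k, i) (l, j)"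
  by (simp add: magicY(2))

lemma Yrow: "k \<in> K \<Longrightarrow> i \<in> V \<Longrightarrow> l \<in> K \<Longrightarrow> j \<in> V \<Longrightarrow> m \<in> K \<Longrightarrow> j' \<in> V
    \<Longrightarrow> Y (k, i) (l, j) \<otimes> Y (k, i) (m, j') = (if l = m \<and> j = j' then Y (k, i) (l, j) else \<zero>)"
  by (simp add: magicY(3))

lemma Ycol: "k \<in> K \<Longrightarrow> i \<in> V \<Longrightarrow> l \<in> K \<Longrightarrow> j \<in> V \<Longrightarrow> m \<in> K \<Longrightarrow> j' \<in> V
    \<Longrightarrow> Y (l, j) (k, i) \<otimes> Y (m, j') (k, i) = (if l = m \<and> j = j' then Y (l, j) (k, i) else \<zero>)"
  by (simp add: magicY(4))

lemma Yrowsum: "k \<in> K \<Longrightarrow> i \<in> V \<Longrightarrow> (\<Oplus>l\<in>K. \<Oplus>j\<in>V. Y (k, i) (l, j)) = \<one>"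
  using magicY(5)[of "(k, i)"] finsum_Sigma[OF finK fin, of "Y (k, i)"] by simp

lemma Y_nonarc: "(s, t) \<in> E \<Longrightarrow> k \<in> K \<Longrightarrow> l \<in> K \<Longrightarrow> m \<in> K \<Longrightarrow> i \<in> V \<Longrightarrow> j \<in> V
    \<Longrightarrow> l \<noteq> m \<or> (i, j) \<notin> E \<Longrightarrow> Y (k, s) (l, i) \<otimes> Y (k, t) (m, j) = \<zero>"
  by (rule graph_repD(2)[OF rep]) (auto simp: V' arc)

lemma Y_arcs_commute: "(s, t) \<in> E \<Longrightarrow> (s', t') \<in> E \<Longrightarrow> k \<in> K \<Longrightarrow> l \<in> K
    \<Longrightarrow> Y (k, s) (l, s') \<otimes> Y (k, t) (l, t') = Y (k, t) (l, t') \<otimes> Y (k, s) (l, s')"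
  by (rule graph_repD(6)[OF rep]) (auto simp: arc)

lemma Y_arcs_sum:
  assumes "(s, t) \<in> E" "k \<in> K"
  shows "(\<Oplus>l\<in>K. \<Oplus>e\<in>E. Y (k, s) (l, fst e) \<otimes> Y (k, t) (l, snd e)) = \<one>"
  using finsum_arcs_copies[where f = "\<lambda>u w. Y (k, s) u \<otimes> Y (k, t) w" and n = n, OF finE, folded K]
    graph_repD(8)[OF rep, of "(k, s)" "(k, t)"] assms arc_verts[OF assms(1)]
  by (simp add: arc arc_ends)

definition Q where "Q k l i = (\<Oplus>j\<in>V. Y (k, i) (l, j))"

lemma Q_closed [simp]: "k \<in> K \<Longrightarrow> l \<in> K \<Longrightarrow> i \<in> V \<Longrightarrow> Q k l i \<in> carrier S"
  by (simp add: Q_def Pi_iff)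

text \<open>No edge runs between different copies, so (R2) makes \<open>Q k l s\<close> and
  \<open>Q k m t\<close> orthogonal for \<open>l \<noteq> m\<close>. As each family sums to one over
  the copies, both sides equal the product \<open>Q k l s \<otimes> Q k l t\<close>.\<close>

lemma Q_arc:
  assumes st: "(s, t) \<in> E" and kl: "k \<in> K" "l \<in> K"
  shows "Q k l s = Q k l t"
proof -
  note vs = arc_verts[OF st]
  have orth: "Q k l s \<otimes> Q k m t = \<zero>" if "l \<in> K" "m \<in> K" "l \<noteq> m" for l m
  proof -
    have "Q k l s \<otimes> Q k m t = (\<Oplus>i\<in>V. \<Oplus>j\<in>V. Y (k, s) (l, i) \<otimes> Y (k, t) (m, j))"
      unfolding Q_def using kl that vs fin by (intro finsum_mult) (simp_all add: Pi_iff)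
    also have "\<dots> = \<zero>"
      using that kl by (intro add.finprod_one_eqI) (simp add: Y_nonarc[OF st])
    finally show ?thesis .
  qed
  have one: "(\<Oplus>m\<in>K. Q k m i) = \<one>" if "i \<in> V" for i
    using Yrowsum[OF kl(1) that] by (simp add: Q_def)
  have "Q k l s = Q k l s \<otimes> (\<Oplus>m\<in>K. Q k m t)" using kl vs by (simp add: one)
  also have "\<dots> = (\<Oplus>m\<in>K. Q k l s \<otimes> Q k m t)"
    using kl vs finK by (intro finsum_rdistr) (simp_all add: Pi_iff)
  also have "\<dots> = Q k l s \<otimes> Q k l t"
    using kl vs finK by (intro finsum_only) (simp_all add: orth)
  also have "\<dots> = (\<Oplus>m\<in>K. Q k m s \<otimes> Q k l t)"
    using kl vs finK by (intro finsum_only[symmetric]) (simp_all add: orth)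
  also have "\<dots> = (\<Oplus>m\<in>K. Q k m s) \<otimes> Q k l t"
    using kl vs finK by (intro finsum_ldistr[symmetric]) (simp_all add: Pi_iff)
  also have "\<dots> = Q k l t" using kl vs by (simp add: one)
  finally show ?thesis .
qed

lemma Q_const: "k \<in> K \<Longrightarrow> l \<in> K \<Longrightarrow> i \<in> V \<Longrightarrow> j \<in> V \<Longrightarrow> Q k l i = Q k l j"
  using edge_connected_const[OF conn, of "Q k l"] Q_arc by blast

definition vtx where "vtx = (SOME i. i \<in> V)"

lemma vtx [simp]: "vtx \<in> V" unfolding vtx_def using nonempty by (simp add: some_in_eq)

definition x where "x k l = Q k l vtx"

lemma x_closed [simp]: "k \<in> K \<Longrightarrow> l \<in> K \<Longrightarrow> x k l \<in> carrier S" by (simp add: x_def)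

lemma x_row: "k \<in> K \<Longrightarrow> l \<in> K \<Longrightarrow> i \<in> V \<Longrightarrow> (\<Oplus>j\<in>V. Y (k, i) (l, j)) = x k l"
  using Q_const[of k l i vtx] by (simp add: x_def Q_def)

lemma card_V: "of_nat (card V) \<noteq> (0::complex)"
  using fin nonempty by simp

text \<open>
  Both constants equal \<open>\<Oplus>i j. Y (k, i) (l, j)\<close> after multiplication by the number of vertices.
\<close>

lemma x_col:
  assumes "k \<in> K" "l \<in> K" "j \<in> V"
  shows "(\<Oplus>i\<in>V. Y (k, i) (l, j)) = x k l"
proof -
  interpret t: copies S G K n "\<lambda>u v. Y v u" by (rule transposed)
  have row: "(\<Oplus>i\<in>V. Y (k, i) (l, j)) = t.x l k" if "j \<in> V" for j using assms that by (intro t.x_row)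
  have "of_nat (card V) \<odot> t.x l k = (\<Oplus>j\<in>V. \<Oplus>i\<in>V. Y (k, i) (l, j))"
    using assms fin by (simp add: finsum_const_smult[symmetric] row cong: finsum_cong)
  also have "\<dots> = (\<Oplus>i\<in>V. \<Oplus>j\<in>V. Y (k, i) (l, j))"
    using assms fin by (intro finsum_swap) simp_all
  also have "\<dots> = of_nat (card V) \<odot> x k l"
    using assms fin by (simp add: finsum_const_smult[symmetric] x_row cong: finsum_cong)
  finally have eq: "of_nat (card V) \<odot> t.x l k = of_nat (card V) \<odot> x k l" .
  have "t.x l k = x k l" using assms by (intro smult_cancel[OF _ _ eq card_V] t.x_closed x_closed)
  then show ?thesis using row[OF assms(3)] by simp
qed

text \<open>\<open>x k m\<close> may be written as the block sum through the very row
  \<open>(k, i)\<close> that contains \<open>Y (k, i) (l, j)\<close>, and the entries of one row are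
  mutually orthogonal.\<close>

lemma Y_x:
  assumes "k \<in> K" "l \<in> K" "m \<in> K" "i \<in> V" "j \<in> V"
  shows "Y (k, i) (l, j) \<otimes> x k m = (if l = m then Y (k, i) (l, j) else \<zero>)"
    and "x k m \<otimes> Y (k, i) (l, j) = (if l = m then Y (k, i) (l, j) else \<zero>)"
proof -
  have "Y (k, i) (l, j) \<otimes> x k m = (\<Oplus>j'\<in>V. Y (k, i) (l, j) \<otimes> Y (k, i) (m, j'))"
    unfolding x_row[OF assms(1,3,4), symmetric]
    using assms fin by (intro finsum_rdistr) (simp_all add: Pi_iff)
  also have "\<dots> = Y (k, i) (l, j) \<otimes> Y (k, i) (m, j)"
    using assms fin by (intro finsum_only) (simp_all add: Yrow)
  finally show "Y (k, i) (l, j) \<otimes> x k m = (if l = m then Y (k, i) (l, j) else \<zero>)"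
    using assms by (simp add: Yrow)
  have "x k m \<otimes> Y (k, i) (l, j) = (\<Oplus>j'\<in>V. Y (k, i) (m, j') \<otimes> Y (k, i) (l, j))"
    unfolding x_row[OF assms(1,3,4), symmetric]
    using assms fin by (intro finsum_ldistr) (simp_all add: Pi_iff)
  also have "\<dots> = Y (k, i) (m, j) \<otimes> Y (k, i) (l, j)"
    using assms fin by (intro finsum_only) (auto simp: Yrow)
  finally show "x k m \<otimes> Y (k, i) (l, j) = (if l = m then Y (k, i) (l, j) else \<zero>)"
    using assms by (auto simp: Yrow)
qed

lemma x_transposed: "k \<in> K \<Longrightarrow> l \<in> K \<Longrightarrow> copies.x S G (\<lambda>u v. Y v u) l k = x k l"
proof -
  interpret t: copies S G K n "\<lambda>u v. Y v u" by (rule transposed)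
  assume "k \<in> K" "l \<in> K"
  then show "t.x l k = x k l" using t.x_row[of l k vtx] x_col[of k l vtx] by simp
qed

text \<open>The half of the magic relations that concerns rows, together with self-adjointness;
  \<open>magic_x\<close> takes the other half from the transposed matrix.\<close>

lemma x_half:
  assumes "k \<in> K"
  shows "l \<in> K \<Longrightarrow> invol S (x k l) = x k l"
    and "l \<in> K \<Longrightarrow> m \<in> K \<Longrightarrow> x k l \<otimes> x k m = (if l = m then x k l else \<zero>)"
    and "(\<Oplus>l\<in>K. x k l) = \<one>"
proof -
  assume l: "l \<in> K"
  have "invol S (x k l) = (\<Oplus>j\<in>V. invol S (Y (k, vtx) (l, j)))"
    unfolding x_row[OF assms l vtx, symmetric] using assms l by (intro finsum_invol) (simp add: Pi_iff)
  also have "\<dots> = x k l"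
    unfolding x_row[OF assms l vtx, symmetric]
    using assms l by (intro finsum_cong') (simp_all add: Pi_iff Yi)
  finally show "invol S (x k l) = x k l" .
  assume m: "m \<in> K"
  have "x k l \<otimes> x k m = (\<Oplus>j\<in>V. Y (k, vtx) (l, j)) \<otimes> x k m"
    using assms l m by (simp add: x_row)
  also have "\<dots> = (\<Oplus>j\<in>V. Y (k, vtx) (l, j) \<otimes> x k m)"
    using assms l m fin by (intro finsum_ldistr) (simp_all add: Pi_iff)
  also have "\<dots> = (if l = m then x k l else \<zero>)"
    using assms l m by (simp add: Y_x x_row cong: finsum_cong)
  finally show "x k l \<otimes> x k m = (if l = m then x k l else \<zero>)" .
next
  show "(\<Oplus>l\<in>K. x k l) = \<one>" using Yrowsum[OF assms vtx] assms by (simp add: x_row cong: finsum_cong)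
qed

lemma magic_x: "magic K S x"
proof (rule magicI)
  interpret t: copies S G K n "\<lambda>u v. Y v u" by (rule transposed)
  fix i j k assume *: "i \<in> K" "j \<in> K" "k \<in> K"
  show "x j i \<otimes> x k i = (if j = k then x j i else \<zero>)"
    using t.x_half(2)[OF *] * by (simp add: x_transposed)
next
  interpret t: copies S G K n "\<lambda>u v. Y v u" by (rule transposed)
  fix i assume *: "i \<in> K"
  show "(\<Oplus>l\<in>K. x l i) = \<one>" using t.x_half(3)[OF *] * by (simp add: x_transposed cong: finsum_cong)
qed (simp_all add: x_half)

text \<open>Insert \<open>x k l\<close> between the factors: it fixes the first and kills the
  second, whatever the rows \<open>i\<close> and \<open>i'\<close> are.\<close>

lemma Y_orth:
  assumes "k \<in> K" "l \<in> K" "m \<in> K" "i \<in> V" "j \<in> V" "i' \<in> V" "j' \<in> V" "l \<noteq> m"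
  shows "Y (k, i) (l, j) \<otimes> Y (k, i') (m, j') = \<zero>"
proof -
  have "Y (k, i) (l, j) \<otimes> Y (k, i') (m, j') = (Y (k, i) (l, j) \<otimes> x k l) \<otimes> Y (k, i') (m, j')"
    using assms by (simp add: Y_x)
  also have "\<dots> = Y (k, i) (l, j) \<otimes> (x k l \<otimes> Y (k, i') (m, j'))"
    using assms by (intro m_assoc) simp_all
  also have "\<dots> = \<zero>" using assms by (simp add: Y_x)
  finally show ?thesis .
qed

definition N where "N k i j = (\<Oplus>l\<in>K. Y (k, i) (l, j))"

lemma N_closed [simp]: "k \<in> K \<Longrightarrow> i \<in> V \<Longrightarrow> j \<in> V \<Longrightarrow> N k i j \<in> carrier S"
  by (simp add: N_def Pi_iff)

text \<open>Recovers \<open>Y\<close> from \<open>N\<close> and \<open>x\<close> in either order, so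
  it also shows that they commute.\<close>

lemma N_x:
  assumes "k \<in> K" "l \<in> K" "i \<in> V" "j \<in> V"
  shows "N k i j \<otimes> x k l = Y (k, i) (l, j)" and "x k l \<otimes> N k i j = Y (k, i) (l, j)"
proof -
  have "N k i j \<otimes> x k l = (\<Oplus>m\<in>K. Y (k, i) (m, j) \<otimes> x k l)"
    unfolding N_def using assms finK by (intro finsum_ldistr) (simp_all add: Pi_iff)
  also have "\<dots> = Y (k, i) (l, j) \<otimes> x k l"
    using assms finK by (intro finsum_only) (simp_all add: Y_x)
  finally show "N k i j \<otimes> x k l = Y (k, i) (l, j)" using assms by (simp add: Y_x)
  have "x k l \<otimes> N k i j = (\<Oplus>m\<in>K. x k l \<otimes> Y (k, i) (m, j))"
    unfolding N_def using assms finK by (intro finsum_rdistr) (simp_all add: Pi_iff)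
  also have "\<dots> = x k l \<otimes> Y (k, i) (l, j)"
    using assms finK by (intro finsum_only) (simp_all add: Y_x)
  finally show "x k l \<otimes> N k i j = Y (k, i) (l, j)" using assms by (simp add: Y_x)
qed

lemma N_N:
  assumes "k \<in> K" "i \<in> V" "j \<in> V" "i' \<in> V" "j' \<in> V"
  shows "N k i j \<otimes> N k i' j' = (\<Oplus>l\<in>K. Y (k, i) (l, j) \<otimes> Y (k, i') (l, j'))"
proof -
  have "N k i j \<otimes> N k i' j' = (\<Oplus>l\<in>K. \<Oplus>m\<in>K. Y (k, i) (l, j) \<otimes> Y (k, i') (m, j'))"
    unfolding N_def using assms finK by (intro finsum_mult) (simp_all add: Pi_iff)
  also have "\<dots> = (\<Oplus>l\<in>K. Y (k, i) (l, j) \<otimes> Y (k, i') (l, j'))"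
    using assms finK by (intro finsum_diag) (simp_all add: Y_orth)
  finally show ?thesis .
qed

text \<open>(R4) only gives the sum over all copies \<open>l\<close>; multiplying by
  \<open>x k l\<close> cuts out a single one. Its transposed version is what
  \<open>graph_rep_N\<close> needs for the column sums, where the row block \<open>k\<close> is
  fixed although (R4) sums over it.\<close>

lemma Y_arcs_sum_x:
  assumes st: "(s, t) \<in> E" and k: "k \<in> K" "l \<in> K"
  shows "(\<Oplus>e\<in>E. Y (k, s) (l, fst e) \<otimes> Y (k, t) (l, snd e)) = x k l"
proof -
  note vs = arc_verts[OF st]
  let ?y = "\<lambda>m. \<Oplus>e\<in>E. Y (k, s) (m, fst e) \<otimes> Y (k, t) (m, snd e)"
  have "x k l = x k l \<otimes> (\<Oplus>m\<in>K. ?y m)" using k by (simp add: Y_arcs_sum[OF st])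
  also have "\<dots> = (\<Oplus>m\<in>K. x k l \<otimes> ?y m)"
    using k vs finK by (intro finsum_rdistr) (simp_all add: Pi_iff arc_ends)
  also have "\<dots> = (\<Oplus>m\<in>K. if l = m then ?y m else \<zero>)"
  proof (intro finsum_cong' refl)
    fix m assume m: "m \<in> K"
    have "x k l \<otimes> ?y m = (\<Oplus>e\<in>E. x k l \<otimes> (Y (k, s) (m, fst e) \<otimes> Y (k, t) (m, snd e)))"
      using k m vs finE by (intro finsum_rdistr) (simp_all add: Pi_iff arc_ends)
    also have "\<dots> = (\<Oplus>e\<in>E. if l = m then Y (k, s) (m, fst e) \<otimes> Y (k, t) (m, snd e) else \<zero>)"
      using k m vs by (intro finsum_cong') (simp_all add: Pi_iff arc_ends m_assoc[symmetric] Y_x)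
    finally show "x k l \<otimes> ?y m = (if l = m then ?y m else \<zero>)" by simp
  qed (use k vs in \<open>simp add: Pi_iff arc_ends\<close>)
  also have "\<dots> = ?y l"
    using k vs finK by (subst finsum_only[where j = l]) (simp_all add: Pi_iff arc_ends)
  finally show ?thesis by simp
qed

lemma graph_rep_N:
  assumes k: "k \<in> K"
  shows "graph_rep G S (N k)"
proof (rule graph_repI[OF star_algebra_axioms wf])
  interpret t: copies S G K n "\<lambda>u v. Y v u" by (rule transposed)
  show "magic V S (N k)"
  proof (rule magicI)
    fix i j assume *: "i \<in> V" "j \<in> V"
    show "N k i j \<in> carrier S" using k * by simp
    have "invol S (N k i j) = (\<Oplus>l\<in>K. invol S (Y (k, i) (l, j)))"
      unfolding N_def using k * by (intro finsum_invol) (simp add: Pi_iff)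
    also have "\<dots> = N k i j"
      unfolding N_def using k * by (intro finsum_cong') (simp_all add: Pi_iff Yi)
    finally show "invol S (N k i j) = N k i j" .
  next
    fix i j j' assume *: "i \<in> V" "j \<in> V" "j' \<in> V"
    show "N k i j \<otimes> N k i j' = (if j = j' then N k i j else \<zero>)"
      using k * by (simp add: N_N Yrow cong: finsum_cong) (simp add: N_def)
    show "N k j i \<otimes> N k j' i = (if j = j' then N k j i else \<zero>)"
      using k * by (simp add: N_N Ycol cong: finsum_cong) (simp add: N_def)
  next
    fix i assume i: "i \<in> V"
    have "(\<Oplus>j\<in>V. N k i j) = (\<Oplus>l\<in>K. \<Oplus>j\<in>V. Y (k, i) (l, j))"
      unfolding N_def using k i fin finK by (intro finsum_swap) simp_all
    then show "(\<Oplus>j\<in>V. N k i j) = \<one>" using k i by (simp add: Yrowsum)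
    have "(\<Oplus>j\<in>V. N k j i) = (\<Oplus>l\<in>K. \<Oplus>j\<in>V. Y (k, j) (l, i))"
      unfolding N_def using k i fin finK by (intro finsum_swap) simp_all
    also have "\<dots> = (\<Oplus>l\<in>K. x k l)" using k i by (simp add: x_col cong: finsum_cong)
    finally show "(\<Oplus>j\<in>V. N k j i) = \<one>" using k by (simp add: x_half)
  qed
  fix s t assume st: "(s, t) \<in> E"
  note vs = arc_verts[OF st]
  have "(\<Oplus>e\<in>E. N k (fst e) s \<otimes> N k (snd e) t)
      = (\<Oplus>e\<in>E. \<Oplus>l\<in>K. Y (k, fst e) (l, s) \<otimes> Y (k, snd e) (l, t))"
    using k vs by (intro finsum_cong') (simp_all add: Pi_iff N_N arc_ends)
  also have "\<dots> = (\<Oplus>l\<in>K. \<Oplus>e\<in>E. Y (k, fst e) (l, s) \<otimes> Y (k, snd e) (l, t))"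
    using k vs finE finK by (intro finsum_swap) (simp_all add: arc_ends)
  also have "\<dots> = (\<Oplus>l\<in>K. x k l)"
    using k vs by (intro finsum_cong') (simp_all add: Pi_iff t.Y_arcs_sum_x[OF st] x_transposed)
  finally show "(\<Oplus>e\<in>E. N k (fst e) s \<otimes> N k (snd e) t) = \<one>" using k by (simp add: x_half)
  have "(\<Oplus>e\<in>E. N k s (fst e) \<otimes> N k t (snd e))
      = (\<Oplus>e\<in>E. \<Oplus>l\<in>K. Y (k, s) (l, fst e) \<otimes> Y (k, t) (l, snd e))"
    using k vs by (intro finsum_cong') (simp_all add: Pi_iff N_N arc_ends)
  also have "\<dots> = (\<Oplus>l\<in>K. \<Oplus>e\<in>E. Y (k, s) (l, fst e) \<otimes> Y (k, t) (l, snd e))"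
    using k vs finE finK by (intro finsum_swap) (simp_all add: arc_ends)
  finally show "(\<Oplus>e\<in>E. N k s (fst e) \<otimes> N k t (snd e)) = \<one>" using k by (simp add: Y_arcs_sum[OF st])
  fix s' t' assume st': "(s', t') \<in> E"
  have "N k s s' \<otimes> N k t t' = (\<Oplus>l\<in>K. Y (k, s) (l, s') \<otimes> Y (k, t) (l, t'))"
    using k vs arc_verts[OF st'] by (simp add: N_N)
  also have "\<dots> = (\<Oplus>l\<in>K. Y (k, t) (l, t') \<otimes> Y (k, s) (l, s'))"
    using k vs arc_verts[OF st'] by (intro finsum_cong') (simp_all add: Pi_iff Y_arcs_commute[OF st st'])
  also have "\<dots> = N k t t' \<otimes> N k s s'" using k vs arc_verts[OF st'] by (simp add: N_N)
  finally show "N k s s' \<otimes> N k t t' = N k t t' \<otimes> N k s s'" .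
next
  interpret t: copies S G K n "\<lambda>u v. Y v u" by (rule transposed)
  fix s t i j assume st: "(s, t) \<in> E" and ij: "i \<in> V" "j \<in> V" "(i, j) \<notin> E"
  show "N k s i \<otimes> N k t j = \<zero> \<and> N k i s \<otimes> N k j t = \<zero>"
    using k arc_verts[OF st] ij
    by (simp add: N_N Y_nonarc[OF st] t.Y_nonarc[OF st] cong: finsum_cong)
qed

end

section \<open>Homomorphisms commuting with projections\<close>

context star_algebra
begin

definition projection where
  "projection e \<longleftrightarrow> e \<in> carrier S \<and> invol S e = e \<and> e \<otimes> e = e"

text \<open>Commuting with \<open>e\<close> means being fixed by conjugation with the symmetry \<open>1 - 2e\<close>.\<close>

lemma commute_projection_iff:
  assumes e: "projection e"
  defines "u \<equiv> \<one> \<oplus> (-2) \<odot> e"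
  shows "star_hom S S (\<lambda>a. u \<otimes> a \<otimes> u)"
    and "a \<in> carrier S \<Longrightarrow> u \<otimes> a \<otimes> u = a \<longleftrightarrow> e \<otimes> a = a \<otimes> e"
proof -
  have ec: "e \<in> carrier S" "invol S e = e" "e \<otimes> e = e" using e by (simp_all add: projection_def)
  have uc: "u \<in> carrier S" using ec by (simp add: u_def)
  have ui: "invol S u = u" using ec by (simp add: u_def)
  \<comment> \<open>The coefficient on the right is zero: this is the computation
    \<open>(1 - 2 e)^2 = 1\<close>.\<close>
  have "(-2) \<odot> e \<oplus> ((-2) \<odot> e \<oplus> 4 \<odot> e) = (-2 + (-2 + 4)) \<odot> e"
    using ec by (simp only: smult_add_left smult_closed)
  then have "u \<otimes> u = \<one>" using ec by (simp add: u_def l_distr r_distr smult_add_right a_assoc)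
  note uu = this
  have uu': "u \<otimes> (u \<otimes> x) = x" if "x \<in> carrier S" for x
    using that uc uu by (simp add: m_assoc[symmetric])
  show "star_hom S S (\<lambda>a. u \<otimes> a \<otimes> u)"
    using uc by (intro star_homI) (simp_all add: l_distr r_distr m_assoc uu' uu ui)
  assume a: "a \<in> carrier S"
  show "u \<otimes> a \<otimes> u = a \<longleftrightarrow> e \<otimes> a = a \<otimes> e"
  proof
    assume "u \<otimes> a \<otimes> u = a"
    then have "u \<otimes> a \<otimes> u \<otimes> u = a \<otimes> u" by simp
    then have "u \<otimes> a = a \<otimes> u" using a uc uu by (simp add: m_assoc)
    then have "a \<oplus> (-2) \<odot> (e \<otimes> a) = a \<oplus> (-2) \<odot> (a \<otimes> e)"
      using a ec by (simp add: u_def l_distr r_distr)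
    then have "(-2) \<odot> (e \<otimes> a) = (-2) \<odot> (a \<otimes> e)"
      using a ec by (simp add: add.left_cancel)
    from smult_cancel[OF _ _ this] show "e \<otimes> a = a \<otimes> e" using a ec by simp
  next
    assume "e \<otimes> a = a \<otimes> e"
    then have "u \<otimes> a = a \<otimes> u" using a ec by (simp add: u_def l_distr r_distr)
    then show "u \<otimes> a \<otimes> u = a" using a uc uu by (simp add: m_assoc)
  qed
qed

text \<open>\<open>f\<close> and its conjugate by the symmetry agree on \<open>T\<close>, so the
  uniqueness principle of \<open>A\<close> identifies them. This replaces the argument that the
  commutant of \<open>e\<close> is a closed subalgebra.\<close>

lemma hom_commute_projection:
  assumes f: "star_hom A S f" and e: "projection e"
    and unique: "\<And>g. star_hom A S g \<Longrightarrow> (\<And>b. b \<in> T \<Longrightarrow> g b = f b) \<Longrightarrow> g a = f a"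
    and T: "\<And>b. b \<in> T \<Longrightarrow> b \<in> carrier A \<and> f b \<otimes> e = e \<otimes> f b" and a: "a \<in> carrier A"
  shows "f a \<otimes> e = e \<otimes> f a"
proof -
  let ?u = "\<one> \<oplus> (-2) \<odot> e"
  have "?u \<otimes> f a \<otimes> ?u = f a"
  proof (rule unique[OF star_hom_comp[OF f commute_projection_iff(1)[OF e]]])
    fix b assume "b \<in> T"
    then show "?u \<otimes> f b \<otimes> ?u = f b"
      using T[of b] commute_projection_iff(2)[OF e, of "f b"] star_hom_closed[OF f] by simp
  qed
  then show ?thesis using commute_projection_iff(2)[OF e, of "f a"] star_hom_closed[OF f a] by simp
qed

text \<open>Each \<open>h i\<close> is cut down to the corner of \<open>e i\<close>. Commutation
  makes the cut multiplicative, orthogonality removes the cross terms, and the sum of the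
  projections gives the unit. This is the shape of the coproduct at \<open>\<nu> i\<close>.\<close>

lemma star_hom_orthogonal_sum:
  assumes A: "star_algebra A" and I: "finite I" and h: "\<And>i. i \<in> I \<Longrightarrow> star_hom A S (h i)"
    and e: "\<And>i. i \<in> I \<Longrightarrow> projection (e i)" and one: "(\<Oplus>i\<in>I. e i) = \<one>"
    and orth: "\<And>i j. i \<in> I \<Longrightarrow> j \<in> I \<Longrightarrow> i \<noteq> j \<Longrightarrow> e i \<otimes> e j = \<zero>"
    and comm: "\<And>i a. i \<in> I \<Longrightarrow> a \<in> carrier A \<Longrightarrow> h i a \<otimes> e i = e i \<otimes> h i a"
  shows "star_hom A S (\<lambda>a. \<Oplus>i\<in>I. h i a \<otimes> e i)"
proof -
  interpret A: star_algebra A by fact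
  note hs = star_hom_simps[OF h]
  have ec: "e i \<in> carrier S" "invol S (e i) = e i" "e i \<otimes> e i = e i" if "i \<in> I" for i
    using e[OF that] by (simp_all add: projection_def)
  show ?thesis
  proof (rule star_homI)
    fix a assume a: "a \<in> carrier A"
    show "(\<Oplus>i\<in>I. h i a \<otimes> e i) \<in> carrier S" using a by (simp add: Pi_iff hs ec)
    have inv: "invol S (h i a) \<otimes> e i = e i \<otimes> invol S (h i a)" if "i \<in> I" for i
      using comm[of i "invol A a"] that a by (simp add: hs)
    have "(\<Oplus>i\<in>I. h i (invol A a) \<otimes> e i) = (\<Oplus>i\<in>I. invol S (h i a \<otimes> e i))"
      using a by (intro finsum_cong') (simp_all add: Pi_iff hs ec inv)
    also have "\<dots> = invol S (\<Oplus>i\<in>I. h i a \<otimes> e i)"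
      using a by (intro finsum_invol[symmetric]) (simp add: Pi_iff hs ec)
    finally show "(\<Oplus>i\<in>I. h i (invol A a) \<otimes> e i) = invol S (\<Oplus>i\<in>I. h i a \<otimes> e i)" .
    show "(\<Oplus>i\<in>I. h i (c \<odot>\<^bsub>A\<^esub> a) \<otimes> e i) = c \<odot> (\<Oplus>i\<in>I. h i a \<otimes> e i)" for c
      using a by (subst finsum_smult) (simp_all add: Pi_iff hs ec cong: finsum_cong)
    fix b assume b: "b \<in> carrier A"
    have "(\<Oplus>i\<in>I. h i (a \<oplus>\<^bsub>A\<^esub> b) \<otimes> e i) = (\<Oplus>i\<in>I. h i a \<otimes> e i \<oplus> h i b \<otimes> e i)"
      using a b by (intro finsum_cong') (simp_all add: Pi_iff hs ec l_distr)
    also have "\<dots> = (\<Oplus>i\<in>I. h i a \<otimes> e i) \<oplus> (\<Oplus>i\<in>I. h i b \<otimes> e i)"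
      using a b by (intro finsum_addf) (simp_all add: Pi_iff hs ec)
    finally show "(\<Oplus>i\<in>I. h i (a \<oplus>\<^bsub>A\<^esub> b) \<otimes> e i) = (\<Oplus>i\<in>I. h i a \<otimes> e i) \<oplus> (\<Oplus>i\<in>I. h i b \<otimes> e i)" .
    have m: "(h i a \<otimes> e i) \<otimes> (h j b \<otimes> e j) = h i a \<otimes> (e i \<otimes> e j) \<otimes> h j b" if "i \<in> I" "j \<in> I" for i j
      using that a b comm[OF that(2) b] by (simp add: hs ec m_assoc)
    have "(\<Oplus>i\<in>I. h i a \<otimes> e i) \<otimes> (\<Oplus>i\<in>I. h i b \<otimes> e i)
        = (\<Oplus>i\<in>I. \<Oplus>j\<in>I. (h i a \<otimes> e i) \<otimes> (h j b \<otimes> e j))"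
      using a b I by (intro finsum_mult) (simp_all add: Pi_iff hs ec)
    also have "\<dots> = (\<Oplus>i\<in>I. (h i a \<otimes> e i) \<otimes> (h i b \<otimes> e i))"
      using a b I by (intro finsum_diag) (simp_all add: hs ec m orth)
    also have "\<dots> = (\<Oplus>i\<in>I. h i (a \<otimes>\<^bsub>A\<^esub> b) \<otimes> e i)"
    proof (intro finsum_cong' refl)
      fix i assume i: "i \<in> I"
      show "(h i a \<otimes> e i) \<otimes> (h i b \<otimes> e i) = h i (a \<otimes>\<^bsub>A\<^esub> b) \<otimes> e i"
        using m[OF i i] a b i comm[OF i b] by (simp add: hs ec m_assoc)
    qed (use a b in \<open>simp add: Pi_iff hs ec\<close>)
    finally show "(\<Oplus>i\<in>I. h i (a \<otimes>\<^bsub>A\<^esub> b) \<otimes> e i)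
      = (\<Oplus>i\<in>I. h i a \<otimes> e i) \<otimes> (\<Oplus>i\<in>I. h i b \<otimes> e i)" by (rule sym)
  next
    show "(\<Oplus>i\<in>I. h i \<one>\<^bsub>A\<^esub> \<otimes> e i) = \<one>" by (simp add: hs ec one cong: finsum_cong)
  qed
qed

end


section \<open>Woronowicz algebras and their underlying C*-algebras\<close>

lemma add_comult_sel [simp]:
  "carrier (add_comult A \<Delta>) = carrier A" "monoid.mult (add_comult A \<Delta>) = monoid.mult A"
  "one (add_comult A \<Delta>) = one A" "zero (add_comult A \<Delta>) = zero A" "add (add_comult A \<Delta>) = add A"
  "smult (add_comult A \<Delta>) = smult A" "invol (add_comult A \<Delta>) = invol A"
  "cnorm (add_comult A \<Delta>) = cnorm A" "comult (add_comult A \<Delta>) = \<Delta>"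
  by (simp_all add: add_comult_def cstar_alg.extend_def woronowicz.fields_def)

text \<open>The extended record has a different type, so facts about \<open>A\<close> are not
  literally facts about it; they are transferred by unfolding down to the record selectors. The
  lemmas that follow do the same for the other notions.\<close>

lemma cstar_add_comult [simp]: "cstar (add_comult A \<Delta>) \<longleftrightarrow> cstar A"
  unfolding cstar_def cstar_axioms_def star_algebra_def star_algebra_axioms_def ring_def
    ring_axioms_def abelian_group_def abelian_group_axioms_def abelian_monoid_def monoid_def
    cstar_seminorm_def a_minus_def a_inv_def m_inv_def comm_group_def comm_monoid_def
    comm_monoid_axioms_def group_def group_axioms_def Units_def
    add_comult_sel partial_object.select_convs monoid.select_convs ..

lemma star_hom_add_comult [simp]:
  "star_hom (add_comult A \<Delta>) B h \<longleftrightarrow> star_hom A B h"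
  "star_hom C (add_comult A \<Delta>) h' \<longleftrightarrow> star_hom C A h'"
  unfolding star_hom_def ring_hom_def add_comult_sel by (rule refl)+

lemma formal_tensor_add_comult:
  "formal_tensor (add_comult A \<Delta>) (add_comult B \<Delta>') = formal_tensor A B"
  unfolding formal_tensor_def DirProd_def monoid_star_alg_def add_comult_sel ..

lemma state_add_comult: "state (add_comult A \<Delta>) = state A"
  unfolding state_def[abs_def] add_comult_sel ..

lemma min_tensor_add_comult [simp]:
  "min_tensor (add_comult A \<Delta>) (add_comult B \<Delta>') = min_tensor A B"
  "elem_tensor (add_comult A \<Delta>) (add_comult B \<Delta>') = elem_tensor A B"
proof -
  have m: "min_seminorm (add_comult A \<Delta>) (add_comult B \<Delta>') = min_seminorm A B"
    unfolding min_seminorm_def[abs_def] formal_tensor_add_comult state_add_comult ..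
  show "min_tensor (add_comult A \<Delta>) (add_comult B \<Delta>') = min_tensor A B"
    unfolding min_tensor_def m formal_tensor_add_comult ..
  show "elem_tensor (add_comult A \<Delta>) (add_comult B \<Delta>') = elem_tensor A B"
    unfolding elem_tensor_def[abs_def] m formal_tensor_add_comult ..
qed

lemma tensor_map_add_comult:
  "tensor_map (add_comult A \<Delta>1) (add_comult B \<Delta>2) (add_comult C \<Delta>3) (add_comult D \<Delta>4) = tensor_map A B C D"
  "tensor_map (add_comult A \<Delta>1) (add_comult B \<Delta>2) C' D' = tensor_map A B C' D'"
  by (simp_all only: tensor_map_def[abs_def] the_star_hom_def min_tensor_add_comult add_comult_sel)


section \<open>The coproduct on generators\<close>

lemma (in tensor_product) star_hom_E:
  "star_hom A TT (\<lambda>a. E a \<one>\<^bsub>B\<^esub>)" "star_hom B TT (\<lambda>b. E \<one>\<^bsub>A\<^esub> b)"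
proof -
  show "star_hom A TT (\<lambda>a. E a \<one>\<^bsub>B\<^esub>)"
    by (rule star_homI) (simp_all add: E_bilinear(1,3)[of _ _ _ "\<one>\<^bsub>B\<^esub>"] E_mult E_invol E_one)
  show "star_hom B TT (\<lambda>b. E \<one>\<^bsub>A\<^esub> b)"
    by (rule star_homI) (simp_all add: E_bilinear(2,4)[of _ "\<one>\<^bsub>A\<^esub>"] E_mult E_invol E_one)
qed

context graph_algebra
begin

text \<open>Placing the generating matrix in the first leg and in the second leg gives two commuting
  representations. Their matrix product is a representation by \<open>graph_rep_product\<close>, and
  the universal property turns it into the coproduct.\<close>

lemma comult_A_aut:
  assumes fin: "finite (pverts G)"
  defines "A \<equiv> graph_cstar G"
  shows "star_hom A (min_tensor A A) (comult (A_aut G))"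
    and "i \<in> pverts G \<Longrightarrow> j \<in> pverts G \<Longrightarrow> comult (A_aut G) (graph_gen G i j)
      = (\<Oplus>\<^bsub>min_tensor A A\<^esub>k\<in>pverts G. elem_tensor A A (graph_gen G i k) (graph_gen G k j))"
proof -
  let ?X = "graph_gen G" and ?V = "pverts G"
  interpret A: cstar A unfolding A_def by (rule cstar_graph_cstar)
  interpret T: tensor_product A A by unfold_locales
  have X: "graph_rep G A ?X" unfolding A_def by (rule graph_rep_graph_gen)
  note Xc = magicD(1)[OF graph_repD(1)[OF X]]
  note hom = graph_rep_hom[OF A.star_algebra_axioms T.TT.star_algebra_axioms _ wf X]
  have "graph_rep G T.TT (\<lambda>i j. \<Oplus>\<^bsub>T.TT\<^esub>k\<in>?V. T.E (?X i k) \<one>\<^bsub>A\<^esub> \<otimes>\<^bsub>T.TT\<^esub> T.E \<one>\<^bsub>A\<^esub> (?X k j))"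
    by (rule T.TT.graph_rep_product[OF wf fin hom[OF T.star_hom_E(1)] hom[OF T.star_hom_E(2)]])
       (simp add: T.E_mult Xc)
  note ex = graph_cstar_extend[OF T.cstar_TT this, folded A_def]
  define h where "h = (SOME h. star_hom A T.TT h \<and> (\<forall>i\<in>?V. \<forall>j\<in>?V. h (?X i j)
      = (\<Oplus>\<^bsub>T.TT\<^esub>k\<in>?V. T.E (?X i k) \<one>\<^bsub>A\<^esub> \<otimes>\<^bsub>T.TT\<^esub> T.E \<one>\<^bsub>A\<^esub> (?X k j))))"
  note hh = someI_ex[OF ex, folded h_def]
  note h = hh[THEN conjunct1] hh[THEN conjunct2, rule_format]
  have h2: "h (?X i j) = (\<Oplus>\<^bsub>T.TT\<^esub>k\<in>?V. T.E (?X i k) (?X k j))" if ij: "i \<in> ?V" "j \<in> ?V" for i j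
    unfolding h(2)[OF ij] using ij by (intro T.TT.finsum_cong') (simp_all add: Pi_iff T.E_mult Xc)
  have "comult (A_aut G) = the_star_hom A T.TT (\<lambda>\<Delta>. \<forall>i\<in>?V. \<forall>j\<in>?V.
      \<Delta> (?X i j) = (\<Oplus>\<^bsub>T.TT\<^esub>k\<in>?V. T.E (?X i k) (?X k j)))"
    by (simp add: A_aut_def Let_def A_def)
  also have "\<dots> = restrict h (carrier A)"
  proof (rule the_star_hom_eq[OF A.star_algebra_axioms h(1)])
    show "\<forall>i\<in>?V. \<forall>j\<in>?V. restrict h (carrier A) (?X i j) = (\<Oplus>\<^bsub>T.TT\<^esub>k\<in>?V. T.E (?X i k) (?X k j))"
      by (simp add: Xc h2)
    fix h1 h2 z
    assume h: "star_hom A T.TT h1" "star_hom A T.TT h2"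
      and e: "\<forall>i\<in>?V. \<forall>j\<in>?V. h1 (?X i j) = (\<Oplus>\<^bsub>T.TT\<^esub>k\<in>?V. T.E (?X i k) (?X k j))"
        "\<forall>i\<in>?V. \<forall>j\<in>?V. h2 (?X i j) = (\<Oplus>\<^bsub>T.TT\<^esub>k\<in>?V. T.E (?X i k) (?X k j))"
      and z: "z \<in> carrier A"
    show "h1 z = h2 z"
      by (rule graph_cstar_unique[folded A_def, OF T.cstar_TT h _ z]) (simp add: e)
  qed
  finally have c: "comult (A_aut G) = restrict h (carrier A)" .
  show "star_hom A T.TT (comult (A_aut G))"
    unfolding c by (rule star_hom_restrict[OF A.star_algebra_axioms h(1)])
  show "comult (A_aut G) (?X i j) = (\<Oplus>\<^bsub>T.TT\<^esub>k\<in>?V. T.E (?X i k) (?X k j))"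
    if "i \<in> ?V" "j \<in> ?V" using that by (simp add: c Xc h2)
qed

end

locale cstar_copies = copies S G K n Y + cstar S
  for S :: "('a, 'x) cstar_alg_scheme" (structure)
    and G :: "'v pair_pre_digraph" and K n and Y :: "nat \<times> 'v \<Rightarrow> nat \<times> 'v \<Rightarrow> 'a"
begin

text \<open>Both \<open>x\<close> and \<open>N\<close> are sums over part of a row of
  \<open>Y\<close>, over the vertex for \<open>x\<close> and over the copy for \<open>N\<close>. In
  either case the coproduct leaves the partial sum in the second leg.\<close>

lemma comult_sum:
  assumes d: "star_hom S (min_tensor S S) d"
    and dY: "\<And>u v. u \<in> K \<times> V \<Longrightarrow> v \<in> K \<times> V
      \<Longrightarrow> d (Y u v) = (\<Oplus>\<^bsub>min_tensor S S\<^esub>w\<in>K \<times> V. elem_tensor S S (Y u w) (Y w v))"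
    and J: "finite J" "\<And>j. j \<in> J \<Longrightarrow> w j \<in> K \<times> V" and u: "u \<in> K \<times> V"
  shows "d (\<Oplus>j\<in>J. Y u (w j)) = (\<Oplus>\<^bsub>min_tensor S S\<^esub>m\<in>K. \<Oplus>\<^bsub>min_tensor S S\<^esub>r\<in>V.
      elem_tensor S S (Y u (m, r)) (\<Oplus>j\<in>J. Y (m, r) (w j)))"
proof -
  interpret T: tensor_product S S by unfold_locales
  note Yc = magicY(1)
  have "d (\<Oplus>j\<in>J. Y u (w j)) = (\<Oplus>\<^bsub>T.TT\<^esub>j\<in>J. d (Y u (w j)))"
    using J(2) u by (intro star_hom_finsum[OF d star_algebra_axioms T.TT.star_algebra_axioms]) (simp add: Pi_iff Yc)
  also have "\<dots> = (\<Oplus>\<^bsub>T.TT\<^esub>j\<in>J. \<Oplus>\<^bsub>T.TT\<^esub>v\<in>K \<times> V. T.E (Y u v) (Y v (w j)))"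
    by (intro T.TT.finsum_cong' refl Pi_I dY T.TT.finsum_closed T.E_closed Yc u J(2)) assumption+
  also have "\<dots> = (\<Oplus>\<^bsub>T.TT\<^esub>v\<in>K \<times> V. \<Oplus>\<^bsub>T.TT\<^esub>j\<in>J. T.E (Y u v) (Y v (w j)))"
    using J finK fin u by (intro T.TT.finsum_swap finite_cartesian_product T.E_closed Yc)
  also have "\<dots> = (\<Oplus>\<^bsub>T.TT\<^esub>v\<in>K \<times> V. T.E (Y u v) (\<Oplus>j\<in>J. Y v (w j)))"
    by (intro T.TT.finsum_cong' refl Pi_I T.E_finsum_right[symmetric] T.E_closed finsum_closed Yc u J) assumption+
  also have "\<dots> = (\<Oplus>\<^bsub>T.TT\<^esub>m\<in>K. \<Oplus>\<^bsub>T.TT\<^esub>r\<in>V. T.E (Y u (m, r)) (\<Oplus>j\<in>J. Y (m, r) (w j)))"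
    using finK fin by (intro T.TT.finsum_Sigma T.E_closed finsum_closed Pi_I Yc SigmaI u J(2)) assumption+
  finally show ?thesis .
qed

end

section \<open>The isomorphism\<close>

locale copies_wreath =
  fixes G :: "'v pair_pre_digraph" and n :: nat
  assumes graph: "finite_graph G" and conn: "edge_connected G"
begin

lemma wf: "parcs G \<subseteq> pverts G \<times> pverts G" and fin: "finite (pverts G)" and nonempty: "pverts G \<noteq> {}"
proof -
  interpret pair_fin_digraph G using graph by (simp add: finite_graph_def)
  show "parcs G \<subseteq> pverts G \<times> pverts G" by (auto dest: arc_fst_in_verts arc_snd_in_verts)
  show "finite (pverts G)" by (rule pair_finite_verts)
  show "pverts G \<noteq> {}" using graph by (simp add: finite_graph_def)
qed

definition K where "K = {1..n}"

sublocale g: graph_algebra G using wf by unfold_locales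
sublocale c: graph_algebra "disjoint_copies n G" using wf_copies[OF wf] by unfold_locales

abbreviation "A \<equiv> A_aut G"
abbreviation "A0 \<equiv> graph_cstar G"
abbreviation "B \<equiv> A_aut (disjoint_copies n G)"
abbreviation "B0 \<equiv> graph_cstar (disjoint_copies n G)"
abbreviation "X \<equiv> graph_gen G"
abbreviation "Y \<equiv> graph_gen (disjoint_copies n G)"

text \<open>\<open>free_wreath\<close> takes the Woronowicz algebra \<open>A\<close>, while
  universal properties are stated for the C*-algebra \<open>A0\<close>; the two differ only by the
  coproduct, and the transfer lemmas that follow pass between them. The same holds for
  \<open>B\<close> and \<open>B0\<close>.\<close>

lemma A_eq: "A = add_comult A0 (comult A)" and B_eq: "B = add_comult B0 (comult B)"
  unfolding A_aut_def Let_def add_comult_sel by (rule refl)+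

lemma cstar_A: "cstar A"
  using cstar_add_comult[of A0 "comult A"] g.cstar_graph_cstar unfolding A_eq[symmetric] by simp

lemma carrier_A: "carrier A = carrier A0"
  using add_comult_sel(1)[of A0 "comult A"] unfolding A_eq[symmetric] .

lemma carrier_B: "carrier B = carrier B0"
  using add_comult_sel(1)[of B0 "comult B"] unfolding B_eq[symmetric] .

lemma star_hom_A: "star_hom A S h \<longleftrightarrow> star_hom A0 S h"
  using star_hom_add_comult(1)[of A0 "comult A" S h] unfolding A_eq[symmetric] .

lemma star_hom_B: "star_hom B S h \<longleftrightarrow> star_hom B0 S h"
  using star_hom_add_comult(1)[of B0 "comult B" S h] unfolding B_eq[symmetric] .

lemma tensor_map_A: "tensor_map A A C D = tensor_map A0 A0 C D"
  using tensor_map_add_comult(2)[of A0 "comult A" A0 "comult A" C D] unfolding A_eq[symmetric] .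

sublocale w: wreath A n using cstar_A by (rule wreath.intro)

abbreviation "W \<equiv> wreath_cstar A n"
abbreviation "\<nu> \<equiv> wreath_nu A n"
abbreviation "x \<equiv> wreath_x A n"

sublocale A0: cstar A0 by (rule g.cstar_graph_cstar)
sublocale B0: cstar B0 by (rule c.cstar_graph_cstar)
sublocale W: cstar W by (rule w.cstar_W)

sublocale C: cstar_copies B0 G K n Y
  by unfold_locales (fact K_def fin nonempty wf conn c.graph_rep_graph_gen)+

lemmas Xc = magicD(1)[OF graph_repD(1)[OF g.graph_rep_graph_gen]]
lemmas mx = magicD[OF w.magic_wreath_x[folded K_def]]

lemma star_hom_nu: "k \<in> K \<Longrightarrow> star_hom A0 W (\<nu> k)"
  using w.star_hom_wreath_nu[of k] by (simp only: star_hom_A K_def)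

lemma nu_closed: "k \<in> K \<Longrightarrow> a \<in> carrier A0 \<Longrightarrow> \<nu> k a \<in> carrier W"
  using star_hom_closed[OF star_hom_nu] .

lemma nu_x: "k \<in> K \<Longrightarrow> l \<in> K \<Longrightarrow> a \<in> carrier A0 \<Longrightarrow> \<nu> k a \<otimes>\<^bsub>W\<^esub> x k l = x k l \<otimes>\<^bsub>W\<^esub> \<nu> k a"
  using w.wreath_commute[of k l a] by (simp only: carrier_A K_def)

lemma ex_Phi: "\<exists>h. star_hom B0 W h \<and> (\<forall>u\<in>K \<times> pverts G. \<forall>v\<in>K \<times> pverts G.
    h (Y u v) = \<nu> (fst u) (X (snd u) (snd v)) \<otimes>\<^bsub>W\<^esub> x (fst u) (fst v))"
  unfolding K_def pverts_copies[symmetric]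
proof (rule c.graph_cstar_extend[OF w.cstar_W W.graph_rep_copies[OF wf fin w.magic_wreath_x]])
  fix k assume "k \<in> {1..n}"
  then show "graph_rep G W (\<lambda>i j. \<nu> k (X i j))"
    by (intro graph_rep_hom[OF A0.star_algebra_axioms W.star_algebra_axioms star_hom_nu wf g.graph_rep_graph_gen])
       (simp only: K_def)
qed (rule nu_x[unfolded K_def], assumption+, rule Xc)

definition \<Phi> where "\<Phi> = (SOME h. star_hom B0 W h \<and> (\<forall>u\<in>K \<times> pverts G. \<forall>v\<in>K \<times> pverts G.
    h (Y u v) = \<nu> (fst u) (X (snd u) (snd v)) \<otimes>\<^bsub>W\<^esub> x (fst u) (fst v)))"

lemmas star_hom_Phi = someI_ex[OF ex_Phi, folded \<Phi>_def, THEN conjunct1]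

lemma Phi_Y: "k \<in> K \<Longrightarrow> i \<in> pverts G \<Longrightarrow> l \<in> K \<Longrightarrow> j \<in> pverts G
    \<Longrightarrow> \<Phi> (Y (k, i) (l, j)) = \<nu> k (X i j) \<otimes>\<^bsub>W\<^esub> x k l"
  using someI_ex[OF ex_Phi, folded \<Phi>_def, THEN conjunct2, rule_format, of "(k, i)" "(l, j)"] by simp

definition f where
  "f k = (SOME h. star_hom A0 B0 h \<and> (\<forall>i\<in>pverts G. \<forall>j\<in>pverts G. h (X i j) = C.N k i j))"

lemma f: "k \<in> K \<Longrightarrow> star_hom A0 B0 (f k)"
    "k \<in> K \<Longrightarrow> i \<in> pverts G \<Longrightarrow> j \<in> pverts G \<Longrightarrow> f k (X i j) = C.N k i j"
proof -
  have *: "star_hom A0 B0 (f k) \<and> (\<forall>i\<in>pverts G. \<forall>j\<in>pverts G. f k (X i j) = C.N k i j)" if "k \<in> K" for k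
    by (rule someI_ex[OF g.graph_cstar_extend[OF c.cstar_graph_cstar C.graph_rep_N[OF that]], folded f_def])
  show "k \<in> K \<Longrightarrow> star_hom A0 B0 (f k)"
    "k \<in> K \<Longrightarrow> i \<in> pverts G \<Longrightarrow> j \<in> pverts G \<Longrightarrow> f k (X i j) = C.N k i j"
    using * by simp_all
qed

lemma projection_x: "k \<in> K \<Longrightarrow> l \<in> K \<Longrightarrow> B0.projection (C.x k l)"
  by (simp add: B0.projection_def C.x_half)

text \<open>On the generators both products are \<open>Y (k, i) (l, j)\<close> by
  \<open>C.N_x\<close>. The commutation extends to all of \<open>A0\<close> because
  \<open>C.x k l\<close> is a projection.\<close>

lemma f_x:
  assumes kl: "k \<in> K" "l \<in> K" and a: "a \<in> carrier A0"
  shows "f k a \<otimes>\<^bsub>B0\<^esub> C.x k l = C.x k l \<otimes>\<^bsub>B0\<^esub> f k a"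
proof (rule B0.hom_commute_projection[OF f(1)[OF kl(1)] projection_x[OF kl]
      _ _ a, where T = "{X i j | i j. i \<in> pverts G \<and> j \<in> pverts G}"])
  fix h assume h: "star_hom A0 B0 h"
    and e: "\<And>b. b \<in> {X i j | i j. i \<in> pverts G \<and> j \<in> pverts G} \<Longrightarrow> h b = f k b"
  show "h a = f k a"
    by (rule g.graph_cstar_unique[OF c.cstar_graph_cstar h f(1)[OF kl(1)] _ a]) (rule e, blast)
next
  fix b assume "b \<in> {X i j | i j. i \<in> pverts G \<and> j \<in> pverts G}"
  then obtain i j where b: "b = X i j" "i \<in> pverts G" "j \<in> pverts G" by blast
  show "b \<in> carrier A0 \<and> f k b \<otimes>\<^bsub>B0\<^esub> C.x k l = C.x k l \<otimes>\<^bsub>B0\<^esub> f k b"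
    unfolding b(1) using kl b(2,3) by (simp add: f(2) C.N_x Xc)
qed

lemma ex_Psi: "\<exists>h. star_hom W B0 h \<and> (\<forall>k\<in>K. \<forall>a\<in>carrier A0. h (\<nu> k a) = f k a)
    \<and> (\<forall>k\<in>K. \<forall>l\<in>K. h (x k l) = C.x k l)"
  unfolding K_def carrier_A[symmetric]
  by (rule w.wreath_extend[OF c.cstar_graph_cstar _ C.magic_x[unfolded K_def]])
     (simp_all only: star_hom_A f(1)[unfolded K_def] carrier_A f_x[unfolded K_def])

definition \<Psi> where "\<Psi> = (SOME h. star_hom W B0 h \<and> (\<forall>k\<in>K. \<forall>a\<in>carrier A0. h (\<nu> k a) = f k a)
    \<and> (\<forall>k\<in>K. \<forall>l\<in>K. h (x k l) = C.x k l))"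

lemmas star_hom_Psi = someI_ex[OF ex_Psi, folded \<Psi>_def, THEN conjunct1]

lemma Psi_nu: "k \<in> K \<Longrightarrow> a \<in> carrier A0 \<Longrightarrow> \<Psi> (\<nu> k a) = f k a"
  and Psi_x: "k \<in> K \<Longrightarrow> l \<in> K \<Longrightarrow> \<Psi> (x k l) = C.x k l"
  using someI_ex[OF ex_Psi, folded \<Psi>_def] by simp_all

text \<open>Applying \<open>\<Phi>\<close> to a block sum of \<open>Y\<close> leaves the factor
  \<open>x k l\<close> times \<open>\<nu> k\<close> of a full row sum over \<open>A0\<close>, which
  is the unit.\<close>

lemma Phi_C_x:
  assumes "k \<in> K" "l \<in> K"
  shows "\<Phi> (C.x k l) = x k l"
proof -
  have "\<Phi> (C.x k l) = \<Phi> (\<Oplus>\<^bsub>B0\<^esub>j\<in>pverts G. Y (k, C.vtx) (l, j))"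
    using assms by (simp add: C.x_row)
  also have "\<dots> = (\<Oplus>\<^bsub>W\<^esub>j\<in>pverts G. \<Phi> (Y (k, C.vtx) (l, j)))"
    using assms by (intro star_hom_finsum[OF star_hom_Phi B0.star_algebra_axioms W.star_algebra_axioms]) (simp add: Pi_iff)
  also have "\<dots> = (\<Oplus>\<^bsub>W\<^esub>j\<in>pverts G. \<nu> k (X C.vtx j) \<otimes>\<^bsub>W\<^esub> x k l)"
    using assms by (intro W.finsum_cong') (simp_all add: Pi_iff Phi_Y nu_closed Xc mx)
  also have "\<dots> = (\<Oplus>\<^bsub>W\<^esub>j\<in>pverts G. \<nu> k (X C.vtx j)) \<otimes>\<^bsub>W\<^esub> x k l"
    using assms fin by (intro W.finsum_ldistr[symmetric]) (simp_all add: Pi_iff nu_closed Xc mx)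
  also have "(\<Oplus>\<^bsub>W\<^esub>j\<in>pverts G. \<nu> k (X C.vtx j)) = \<nu> k (\<Oplus>\<^bsub>A0\<^esub>j\<in>pverts G. X C.vtx j)"
    using assms by (intro star_hom_finsum[OF star_hom_nu A0.star_algebra_axioms W.star_algebra_axioms, symmetric])
      (simp_all add: Pi_iff Xc)
  also have "\<dots> = \<one>\<^bsub>W\<^esub>"
    using magicD(5)[OF graph_repD(1)[OF g.graph_rep_graph_gen] C.vtx] star_hom_simps(4)[OF star_hom_nu] assms by simp
  finally show ?thesis using assms by (simp add: mx)
qed

lemma Phi_C_N:
  assumes "k \<in> K" "i \<in> pverts G" "j \<in> pverts G"
  shows "\<Phi> (C.N k i j) = \<nu> k (X i j)"
proof -
  have "\<Phi> (C.N k i j) = (\<Oplus>\<^bsub>W\<^esub>l\<in>K. \<Phi> (Y (k, i) (l, j)))"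
    unfolding C.N_def using assms
    by (intro star_hom_finsum[OF star_hom_Phi B0.star_algebra_axioms W.star_algebra_axioms]) (simp add: Pi_iff)
  also have "\<dots> = (\<Oplus>\<^bsub>W\<^esub>l\<in>K. \<nu> k (X i j) \<otimes>\<^bsub>W\<^esub> x k l)"
    using assms by (intro W.finsum_cong') (simp_all add: Pi_iff Phi_Y nu_closed Xc mx)
  also have "\<dots> = \<nu> k (X i j) \<otimes>\<^bsub>W\<^esub> (\<Oplus>\<^bsub>W\<^esub>l\<in>K. x k l)"
    using assms C.finK by (intro W.finsum_rdistr[symmetric]) (simp_all add: Pi_iff nu_closed Xc mx)
  finally show ?thesis using assms by (simp add: mx nu_closed Xc)
qed

text \<open>On generators this is the factorisation of \<open>Y\<close> in
  \<open>C.N_x\<close>.\<close>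

lemma Psi_Phi: "b \<in> carrier B0 \<Longrightarrow> \<Psi> (\<Phi> b) = b"
proof (rule c.graph_cstar_unique[OF c.cstar_graph_cstar star_hom_comp[OF star_hom_Phi star_hom_Psi] B0.star_hom_id])
  fix u v assume "u \<in> pverts (disjoint_copies n G)" "v \<in> pverts (disjoint_copies n G)"
  then obtain k i l j where u: "u = (k, i)" "v = (l, j)" "k \<in> K" "i \<in> pverts G" "l \<in> K" "j \<in> pverts G"
    unfolding C.V' by blast
  show "\<Psi> (\<Phi> (Y u v)) = Y u v"
    using u(3-6) unfolding u(1,2)
    by (simp add: Phi_Y star_hom_simps[OF star_hom_Psi] nu_closed Xc mx Psi_nu Psi_x f(2) C.N_x)
qed

lemma Phi_Psi: "z \<in> carrier W \<Longrightarrow> \<Phi> (\<Psi> z) = z"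
proof (rule w.wreath_unique[OF w.cstar_W star_hom_comp[OF star_hom_Psi star_hom_Phi] W.star_hom_id, folded K_def])
  fix k a assume k: "k \<in> K" and a: "a \<in> carrier A"
  have "\<Phi> (f k a) = \<nu> k a"
    by (rule g.graph_cstar_unique[OF w.cstar_W star_hom_comp[OF f(1)[OF k] star_hom_Phi] star_hom_nu[OF k] _ a[unfolded carrier_A]])
       (simp add: f(2) k Phi_C_N)
  then show "\<Phi> (\<Psi> (\<nu> k a)) = \<nu> k a" using k a by (simp only: Psi_nu carrier_A)
next
  fix k l assume "k \<in> K" "l \<in> K"
  then show "\<Phi> (\<Psi> (x k l)) = x k l" by (simp add: Psi_x Phi_C_x)
qed

end

section \<open>Transport of the coproduct and compatibility\<close>

context copies_wreath
begin

sublocale AT: tensor_product A0 A0 by unfold_locales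
sublocale BT: tensor_product B0 B0 by unfold_locales
sublocale WT: tensor_product W W by unfold_locales

definition T where "T = tensor_map B0 B0 W W \<Phi> \<Phi>"

lemmas star_hom_T = tensor_map_hom(1)[OF c.cstar_graph_cstar c.cstar_graph_cstar w.cstar_W w.cstar_W star_hom_Phi star_hom_Phi, folded T_def]
lemmas T_E = tensor_map_hom(2)[OF c.cstar_graph_cstar c.cstar_graph_cstar w.cstar_W w.cstar_W star_hom_Phi star_hom_Phi, folded T_def]
lemmas T_finsum = star_hom_finsum[OF star_hom_T BT.TT.star_algebra_axioms WT.TT.star_algebra_axioms]

lemma finite_copies: "finite (pverts (disjoint_copies n G))"
  by (simp add: pverts_copies fin)

lemmas comult_A = g.comult_A_aut[OF fin]
lemmas comult_B = c.comult_A_aut[OF finite_copies, unfolded C.V']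
lemmas comult_sum_B = C.comult_sum[OF comult_B]

text \<open>The coproduct of \<open>B\<close> transported to \<open>W\<close> along the isomorphism.
  It is a homomorphism by construction, so only the two identities that characterise the coproduct
  of the free wreath product remain to be checked.\<close>

definition D where "D z = T (comult B (\<Psi> z))"

lemma star_hom_D: "star_hom W WT.TT D"
  unfolding D_def[abs_def] by (rule star_hom_comp[OF star_hom_comp[OF star_hom_Psi comult_B(1)] star_hom_T])

text \<open>By \<open>C.x_row\<close> the second leg of \<open>comult_sum\<close> does not depend on
  the vertex \<open>r\<close>, so the sum over \<open>r\<close> can be taken inside the first leg,
  where it is again an entry of \<open>x\<close>.\<close>

lemma D_x:
  assumes kl: "k \<in> K" "l \<in> K"
  shows "D (x k l) = (\<Oplus>\<^bsub>WT.TT\<^esub>m\<in>K. WT.E (x k m) (x m l))"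
proof -
  have "comult B (C.x k l) = comult B (\<Oplus>\<^bsub>B0\<^esub>j\<in>pverts G. Y (k, C.vtx) (l, j))"
    using kl by (simp only: C.x_row C.vtx)
  also have "\<dots> = (\<Oplus>\<^bsub>BT.TT\<^esub>m\<in>K. \<Oplus>\<^bsub>BT.TT\<^esub>r\<in>pverts G.
      BT.E (Y (k, C.vtx) (m, r)) (\<Oplus>\<^bsub>B0\<^esub>j\<in>pverts G. Y (m, r) (l, j)))"
    using kl by (intro comult_sum_B fin SigmaI C.vtx)
  also have "\<dots> = (\<Oplus>\<^bsub>BT.TT\<^esub>m\<in>K. BT.E (C.x k m) (C.x m l))"
  proof (intro BT.TT.finsum_cong' refl Pi_I)
    fix m assume m: "m \<in> K"
    have "(\<Oplus>\<^bsub>BT.TT\<^esub>r\<in>pverts G. BT.E (Y (k, C.vtx) (m, r)) (\<Oplus>\<^bsub>B0\<^esub>j\<in>pverts G. Y (m, r) (l, j)))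
        = (\<Oplus>\<^bsub>BT.TT\<^esub>r\<in>pverts G. BT.E (Y (k, C.vtx) (m, r)) (C.x m l))"
      using kl m by (intro BT.TT.finsum_cong') (simp_all add: Pi_iff C.x_row)
    also have "\<dots> = BT.E (\<Oplus>\<^bsub>B0\<^esub>r\<in>pverts G. Y (k, C.vtx) (m, r)) (C.x m l)"
      using kl m fin by (intro BT.E_finsum_left[symmetric]) (simp_all add: Pi_iff)
    finally show "(\<Oplus>\<^bsub>BT.TT\<^esub>r\<in>pverts G. BT.E (Y (k, C.vtx) (m, r)) (\<Oplus>\<^bsub>B0\<^esub>j\<in>pverts G. Y (m, r) (l, j)))
        = BT.E (C.x k m) (C.x m l)"
      using kl m by (simp add: C.x_row)
  qed (use kl in simp)
  finally have "comult B (C.x k l) = (\<Oplus>\<^bsub>BT.TT\<^esub>m\<in>K. BT.E (C.x k m) (C.x m l))" .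
  then have "D (x k l) = T (\<Oplus>\<^bsub>BT.TT\<^esub>m\<in>K. BT.E (C.x k m) (C.x m l))"
    using kl by (simp only: D_def Psi_x)
  also have "\<dots> = (\<Oplus>\<^bsub>WT.TT\<^esub>m\<in>K. T (BT.E (C.x k m) (C.x m l)))"
    using kl by (intro T_finsum) (simp add: Pi_iff)
  also have "\<dots> = (\<Oplus>\<^bsub>WT.TT\<^esub>m\<in>K. WT.E (x k m) (x m l))"
    using kl by (intro WT.TT.finsum_cong') (simp_all add: Pi_iff T_E Phi_C_x mx)
  finally show ?thesis .
qed

text \<open>Under \<open>\<Phi>\<close> the entry \<open>Y (k, i) (m, r)\<close> splits into a value
  of \<open>\<nu> k\<close> and \<open>x k m\<close>, while the partial sum in the second leg is
  \<open>C.N m r j\<close> and becomes \<open>\<nu> m (X r j)\<close>.\<close>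

lemma D_nu_X:
  assumes *: "k \<in> K" "i \<in> pverts G" "j \<in> pverts G"
  shows "D (\<nu> k (X i j)) = (\<Oplus>\<^bsub>WT.TT\<^esub>m\<in>K. \<Oplus>\<^bsub>WT.TT\<^esub>r\<in>pverts G.
      WT.E (\<nu> k (X i r) \<otimes>\<^bsub>W\<^esub> x k m) (\<nu> m (X r j)))"
proof -
  have "D (\<nu> k (X i j)) = T (comult B (\<Oplus>\<^bsub>B0\<^esub>l\<in>K. Y (k, i) (l, j)))"
    using * by (simp only: D_def Psi_nu Xc f(2) C.N_def)
  also have "comult B (\<Oplus>\<^bsub>B0\<^esub>l\<in>K. Y (k, i) (l, j)) = (\<Oplus>\<^bsub>BT.TT\<^esub>m\<in>K. \<Oplus>\<^bsub>BT.TT\<^esub>r\<in>pverts G.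
      BT.E (Y (k, i) (m, r)) (\<Oplus>\<^bsub>B0\<^esub>l\<in>K. Y (m, r) (l, j)))"
    using * by (intro comult_sum_B C.finK SigmaI)
  also have "T \<dots> = (\<Oplus>\<^bsub>WT.TT\<^esub>m\<in>K. T (\<Oplus>\<^bsub>BT.TT\<^esub>r\<in>pverts G.
      BT.E (Y (k, i) (m, r)) (C.N m r j)))"
    unfolding C.N_def[symmetric] using * by (intro T_finsum) (simp add: Pi_iff)
  also have "\<dots> = (\<Oplus>\<^bsub>WT.TT\<^esub>m\<in>K. \<Oplus>\<^bsub>WT.TT\<^esub>r\<in>pverts G.
      WT.E (\<nu> k (X i r) \<otimes>\<^bsub>W\<^esub> x k m) (\<nu> m (X r j)))"
  proof (intro WT.TT.finsum_cong' refl Pi_I)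
    fix m assume m: "m \<in> K"
    have "T (\<Oplus>\<^bsub>BT.TT\<^esub>r\<in>pverts G. BT.E (Y (k, i) (m, r)) (C.N m r j))
        = (\<Oplus>\<^bsub>WT.TT\<^esub>r\<in>pverts G. T (BT.E (Y (k, i) (m, r)) (C.N m r j)))"
      using * m by (intro T_finsum) (simp add: Pi_iff)
    also have "\<dots> = (\<Oplus>\<^bsub>WT.TT\<^esub>r\<in>pverts G. WT.E (\<nu> k (X i r) \<otimes>\<^bsub>W\<^esub> x k m) (\<nu> m (X r j)))"
      using * m by (intro WT.TT.finsum_cong') (simp_all add: Pi_iff T_E Phi_Y Phi_C_N nu_closed Xc mx)
    finally show "T (\<Oplus>\<^bsub>BT.TT\<^esub>r\<in>pverts G. BT.E (Y (k, i) (m, r)) (C.N m r j))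
        = (\<Oplus>\<^bsub>WT.TT\<^esub>r\<in>pverts G. WT.E (\<nu> k (X i r) \<otimes>\<^bsub>W\<^esub> x k m) (\<nu> m (X r j)))" .
    show "(\<Oplus>\<^bsub>WT.TT\<^esub>r\<in>pverts G. WT.E (\<nu> k (X i r) \<otimes>\<^bsub>W\<^esub> x k m) (\<nu> m (X r j))) \<in> carrier WT.TT"
      using * m by (simp add: Pi_iff nu_closed Xc mx)
  qed
  finally show ?thesis .
qed

abbreviation "\<nu>\<nu> k m \<equiv> tensor_map A0 A0 W W (\<nu> k) (\<nu> m)"

lemma star_hom_nunu: "k \<in> K \<Longrightarrow> m \<in> K \<Longrightarrow> star_hom AT.TT WT.TT (\<nu>\<nu> k m)"
  using tensor_map_hom(1)[OF g.cstar_graph_cstar g.cstar_graph_cstar w.cstar_W w.cstar_W star_hom_nu star_hom_nu] .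

lemma nunu_E: "k \<in> K \<Longrightarrow> m \<in> K \<Longrightarrow> a \<in> carrier A0 \<Longrightarrow> b \<in> carrier A0
    \<Longrightarrow> \<nu>\<nu> k m (AT.E a b) = WT.E (\<nu> k a) (\<nu> m b)"
  using tensor_map_hom(2)[OF g.cstar_graph_cstar g.cstar_graph_cstar w.cstar_W w.cstar_W star_hom_nu star_hom_nu] .

lemma projection_E: "k \<in> K \<Longrightarrow> m \<in> K \<Longrightarrow> WT.TT.projection (WT.E (x k m) \<one>\<^bsub>W\<^esub>)"
  by (simp add: WT.TT.projection_def WT.E_invol WT.E_mult mx)

text \<open>On elementary tensors the projection meets only the first leg, where \<open>nu_x\<close>
  applies; being a projection, it then commutes with the whole image.\<close>

lemma nunu_commute:
  assumes km: "k \<in> K" "m \<in> K" and z: "z \<in> carrier AT.TT"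
  shows "\<nu>\<nu> k m z \<otimes>\<^bsub>WT.TT\<^esub> WT.E (x k m) \<one>\<^bsub>W\<^esub> = WT.E (x k m) \<one>\<^bsub>W\<^esub> \<otimes>\<^bsub>WT.TT\<^esub> \<nu>\<nu> k m z"
proof (rule WT.TT.hom_commute_projection[OF star_hom_nunu[OF km] projection_E[OF km]
      _ _ z, where T = "{AT.E a b | a b. a \<in> carrier A0 \<and> b \<in> carrier A0}"])
  fix h assume h: "star_hom AT.TT WT.TT h"
    and e: "\<And>b. b \<in> {AT.E a b | a b. a \<in> carrier A0 \<and> b \<in> carrier A0} \<Longrightarrow> h b = \<nu>\<nu> k m b"
  show "h z = \<nu>\<nu> k m z"
    by (rule AT.tensor_hom_unique[OF WT.cstar_TT h star_hom_nunu[OF km] _ z]) (rule e, blast)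
next
  fix b assume "b \<in> {AT.E a b | a b. a \<in> carrier A0 \<and> b \<in> carrier A0}"
  then obtain a a' where b: "b = AT.E a a'" "a \<in> carrier A0" "a' \<in> carrier A0" by blast
  show "b \<in> carrier AT.TT \<and> \<nu>\<nu> k m b \<otimes>\<^bsub>WT.TT\<^esub> WT.E (x k m) \<one>\<^bsub>W\<^esub>
      = WT.E (x k m) \<one>\<^bsub>W\<^esub> \<otimes>\<^bsub>WT.TT\<^esub> \<nu>\<nu> k m b"
    unfolding b(1) using km b(2,3) by (simp add: nunu_E nu_closed WT.E_mult mx nu_x)
qed

text \<open>Both sides are homomorphisms in \<open>a\<close>, the right one by
  \<open>star_hom_orthogonal_sum\<close>, so the generators of \<open>A0\<close> decide; for them
  the left side is computed by \<open>D_nu_X\<close>.\<close>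

lemma D_nu:
  assumes k: "k \<in> K" and a: "a \<in> carrier A0"
  shows "D (\<nu> k a)
    = (\<Oplus>\<^bsub>WT.TT\<^esub>m\<in>K. \<nu>\<nu> k m (comult A a) \<otimes>\<^bsub>WT.TT\<^esub> WT.E (x k m) \<one>\<^bsub>W\<^esub>)"
proof (rule g.graph_cstar_unique[OF WT.cstar_TT star_hom_comp[OF star_hom_nu[OF k] star_hom_D] _ _ a])
  show "star_hom A0 WT.TT
      (\<lambda>a. \<Oplus>\<^bsub>WT.TT\<^esub>m\<in>K. \<nu>\<nu> k m (comult A a) \<otimes>\<^bsub>WT.TT\<^esub> WT.E (x k m) \<one>\<^bsub>W\<^esub>)"
  proof (rule WT.TT.star_hom_orthogonal_sum[OF A0.star_algebra_axioms C.finK])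
    have "(\<Oplus>\<^bsub>WT.TT\<^esub>m\<in>K. WT.E (x k m) \<one>\<^bsub>W\<^esub>) = WT.E (\<Oplus>\<^bsub>W\<^esub>m\<in>K. x k m) \<one>\<^bsub>W\<^esub>"
      using k C.finK by (intro WT.E_finsum_left[symmetric]) (simp_all add: Pi_iff mx)
    then show "(\<Oplus>\<^bsub>WT.TT\<^esub>m\<in>K. WT.E (x k m) \<one>\<^bsub>W\<^esub>) = \<one>\<^bsub>WT.TT\<^esub>"
      using k by (simp add: mx WT.E_one)
    fix m assume m: "m \<in> K"
    show "star_hom A0 WT.TT (\<lambda>a. \<nu>\<nu> k m (comult A a))"
      by (rule star_hom_comp[OF comult_A(1) star_hom_nunu[OF k m]])
    show "WT.TT.projection (WT.E (x k m) \<one>\<^bsub>W\<^esub>)" by (rule projection_E[OF k m])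
    show "\<nu>\<nu> k m (comult A a) \<otimes>\<^bsub>WT.TT\<^esub> WT.E (x k m) \<one>\<^bsub>W\<^esub>
        = WT.E (x k m) \<one>\<^bsub>W\<^esub> \<otimes>\<^bsub>WT.TT\<^esub> \<nu>\<nu> k m (comult A a)" if "a \<in> carrier A0" for a
      by (rule nunu_commute[OF k m star_hom_closed[OF comult_A(1) that]])
    fix l assume l: "l \<in> K" "m \<noteq> l"
    show "WT.E (x k m) \<one>\<^bsub>W\<^esub> \<otimes>\<^bsub>WT.TT\<^esub> WT.E (x k l) \<one>\<^bsub>W\<^esub> = \<zero>\<^bsub>WT.TT\<^esub>"
      using k m l by (simp add: WT.E_mult mx WT.E_zero)
  qed
  fix i j assume ij: "i \<in> pverts G" "j \<in> pverts G"
  show "D (\<nu> k (X i j))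
      = (\<Oplus>\<^bsub>WT.TT\<^esub>m\<in>K. \<nu>\<nu> k m (comult A (X i j)) \<otimes>\<^bsub>WT.TT\<^esub> WT.E (x k m) \<one>\<^bsub>W\<^esub>)"
    unfolding D_nu_X[OF k ij]
  proof (intro WT.TT.finsum_cong' refl Pi_I)
    fix m assume m: "m \<in> K"
    have "\<nu>\<nu> k m (comult A (X i j)) = (\<Oplus>\<^bsub>WT.TT\<^esub>r\<in>pverts G. \<nu>\<nu> k m (AT.E (X i r) (X r j)))"
      unfolding comult_A(2)[OF ij] using ij
      by (intro star_hom_finsum[OF star_hom_nunu[OF k m] AT.TT.star_algebra_axioms WT.TT.star_algebra_axioms])
         (simp add: Pi_iff Xc)
    also have "\<dots> = (\<Oplus>\<^bsub>WT.TT\<^esub>r\<in>pverts G. WT.E (\<nu> k (X i r)) (\<nu> m (X r j)))"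
      using ij k m by (intro WT.TT.finsum_cong') (simp_all add: Pi_iff nunu_E nu_closed Xc)
    finally have "\<nu>\<nu> k m (comult A (X i j)) \<otimes>\<^bsub>WT.TT\<^esub> WT.E (x k m) \<one>\<^bsub>W\<^esub>
        = (\<Oplus>\<^bsub>WT.TT\<^esub>r\<in>pverts G. WT.E (\<nu> k (X i r)) (\<nu> m (X r j))) \<otimes>\<^bsub>WT.TT\<^esub> WT.E (x k m) \<one>\<^bsub>W\<^esub>"
      by (rule arg_cong)
    also have "\<dots> = (\<Oplus>\<^bsub>WT.TT\<^esub>r\<in>pverts G. WT.E (\<nu> k (X i r)) (\<nu> m (X r j)) \<otimes>\<^bsub>WT.TT\<^esub> WT.E (x k m) \<one>\<^bsub>W\<^esub>)"
      using ij k m fin by (intro WT.TT.finsum_ldistr) (simp_all add: Pi_iff nu_closed Xc mx)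
    also have "\<dots> = (\<Oplus>\<^bsub>WT.TT\<^esub>r\<in>pverts G. WT.E (\<nu> k (X i r) \<otimes>\<^bsub>W\<^esub> x k m) (\<nu> m (X r j)))"
    proof (intro WT.TT.finsum_cong' refl Pi_I)
      fix r assume r: "r \<in> pverts G"
      note cl = nu_closed[OF k Xc[OF ij(1) r]] nu_closed[OF m Xc[OF r ij(2)]] mx(1)[OF k m]
      show "WT.E (\<nu> k (X i r)) (\<nu> m (X r j)) \<otimes>\<^bsub>WT.TT\<^esub> WT.E (x k m) \<one>\<^bsub>W\<^esub>
          = WT.E (\<nu> k (X i r) \<otimes>\<^bsub>W\<^esub> x k m) (\<nu> m (X r j))"
        unfolding WT.E_mult[OF cl(1,2,3) W.one_closed] W.r_one[OF cl(2)] ..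
      show "WT.E (\<nu> k (X i r) \<otimes>\<^bsub>W\<^esub> x k m) (\<nu> m (X r j)) \<in> carrier WT.TT"
        by (intro WT.E_closed W.m_closed cl)
    qed
    finally show "(\<Oplus>\<^bsub>WT.TT\<^esub>r\<in>pverts G. WT.E (\<nu> k (X i r) \<otimes>\<^bsub>W\<^esub> x k m) (\<nu> m (X r j)))
        = \<nu>\<nu> k m (comult A (X i j)) \<otimes>\<^bsub>WT.TT\<^esub> WT.E (x k m) \<one>\<^bsub>W\<^esub>" by (rule sym)
    show "\<nu>\<nu> k m (comult A (X i j)) \<otimes>\<^bsub>WT.TT\<^esub> WT.E (x k m) \<one>\<^bsub>W\<^esub> \<in> carrier WT.TT"
      using k m ij star_hom_closed[OF star_hom_comp[OF comult_A(1) star_hom_nunu[OF k m]]] by (simp add: Xc mx)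
  qed
qed

abbreviation "F \<equiv> free_wreath A n"

lemma F_eq: "F = add_comult W (comult F)"
  unfolding free_wreath_def Let_def add_comult_sel ..

text \<open>\<open>D\<close> satisfies the identities that single out the coproduct of the free
  wreath product, and \<open>wreath_unique\<close> leaves no other solution.\<close>

lemma comult_F: "comult F = restrict D (carrier W)"
proof -
  let ?P = "\<lambda>\<Delta>. (\<forall>i\<in>K. \<forall>j\<in>K. \<Delta> (x i j) = (\<Oplus>\<^bsub>WT.TT\<^esub>k\<in>K. WT.E (x i k) (x k j)))
    \<and> (\<forall>i\<in>K. \<forall>a\<in>carrier A0. \<Delta> (\<nu> i a)
        = (\<Oplus>\<^bsub>WT.TT\<^esub>k\<in>K. \<nu>\<nu> i k (comult A a) \<otimes>\<^bsub>WT.TT\<^esub> WT.E (x i k) \<one>\<^bsub>W\<^esub>))"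
  have "comult F = the_star_hom W WT.TT ?P"
    unfolding free_wreath_def Let_def add_comult_sel tensor_map_A carrier_A K_def ..
  also have "\<dots> = restrict D (carrier W)"
  proof (rule the_star_hom_eq[OF W.star_algebra_axioms star_hom_D])
    show "?P (restrict D (carrier W))"
      by (simp add: D_x D_nu nu_closed mx)
    fix h1 h2 z
    assume h: "star_hom W WT.TT h1" and p: "?P h1" and h': "star_hom W WT.TT h2" and p': "?P h2"
      and z: "z \<in> carrier W"
    show "h1 z = h2 z"
    proof (rule w.wreath_unique[folded K_def, OF WT.cstar_TT h h' _ _ z])
      fix k a assume "k \<in> K" "a \<in> carrier A"
      then show "h1 (\<nu> k a) = h2 (\<nu> k a)"
        using p[THEN conjunct2, rule_format, of k a] p'[THEN conjunct2, rule_format, of k a]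
        by (simp only: carrier_A)
    next
      fix i j assume "i \<in> K" "j \<in> K"
      then show "h1 (x i j) = h2 (x i j)"
        using p[THEN conjunct1, rule_format, of i j] p'[THEN conjunct1, rule_format, of i j] by simp
    qed
  qed
  finally show ?thesis .
qed

theorem woronowicz_iso_Phi: "woronowicz_iso B F \<Phi>"
proof -
  have carrier_F: "carrier F = carrier W"
    using add_comult_sel(1)[of W "comult F"] unfolding F_eq[symmetric] .
  have "star_hom B F \<Phi>"
    using star_hom_add_comult(2)[of B W "comult F" \<Phi>] star_hom_Phi
    unfolding F_eq[symmetric] star_hom_B by simp
  moreover have "bij_betw \<Phi> (carrier B) (carrier F)"
    unfolding carrier_B carrier_F
    by (rule bij_betw_byWitness[where f' = \<Psi>])
       (simp_all add: Psi_Phi Phi_Psi star_hom_closed[OF star_hom_Phi] star_hom_closed[OF star_hom_Psi] image_subset_iff)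
  moreover have "comult F (\<Phi> b) = tensor_map B B F F \<Phi> \<Phi> (comult B b)" if "b \<in> carrier B" for b
  proof -
    have b: "b \<in> carrier B0" using that by (simp only: carrier_B)
    have "tensor_map B B F F = tensor_map B0 B0 W W"
      using tensor_map_add_comult(1)[of B0 "comult B" B0 "comult B" W "comult F" W "comult F"]
      unfolding B_eq[symmetric] F_eq[symmetric] .
    \<comment> \<open>\<open>\<Psi>\<close> inverts \<open>\<Phi>\<close>, so the transported
      coproduct at \<open>\<Phi> b\<close> is the original one at \<open>b\<close>, carried over by
      \<open>T\<close>.\<close>
    moreover have "comult F (\<Phi> b) = T (comult B b)"
      by (simp add: comult_F star_hom_closed[OF star_hom_Phi b] D_def Psi_Phi[OF b])
    ultimately show ?thesis by (simp only: T_def)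
  qed
  ultimately show ?thesis unfolding woronowicz_iso_def by (intro conjI ballI)
qed

end

theorem theorem4p2:
  fixes G :: "'v pair_pre_digraph" and n :: nat
  assumes "finite_graph G" and "edge_connected G" and "n \<ge> 1"
  shows "\<exists>\<Phi>. woronowicz_iso (A_aut (disjoint_copies n G)) (free_wreath (A_aut G) n) \<Phi>"
proof -
  interpret copies_wreath G n using assms(1,2) by (rule copies_wreath.intro)
  show ?thesis by (intro exI) (rule woronowicz_iso_Phi)
qed

end
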